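(* Let $\mathbf{X}_i=(X_{ij})_{j=1}^{r(i)}$, $1\le i\le n$, be finite tuples of self-adjoint elements with $\|X_{ij}\|_\infty\le R$ in a tracial $W^*$-probability space $(\mathcal{M},\tau)$. Then (without any further assumption on the $\mathbf{X}_i$) \begin{align*} &\chi_{\mathrm{orb}}(\mathbf{X}_1,\dots,\mathbf{X}_n)\\ &\quad=\inf\bigl\{(\tau_{\mathbf{X}}^{(R)}\otimes\tau_{\mathbf{X}}^{(R)})(h)+\pi_{\mathrm{orb},R}^{(2)}(h:(\tau_{\mathbf{X}_i}^{(R)})_{i=1}^n)\ \big|\ h=h^*\in\mathcal{C}_R(\mathbf{x})\otimes_{\min}\mathcal{C}_R(\mathbf{x})\bigr\}\\ &\quad=\inf\bigl\{(\tau_{\mathbf{X}}^{(R)}\otimes\tau_{\mathbf{X}}^{(R)})(p)+\pi_{\mathrm{orb},R}^{(2)}(p:(\tau_{\mathbf{X}_i}^{(R)})_{i=1}^n)\ \big|\ p=p^*\in\mathbb{C}\langle\mathbf{x}\rangle\otimes\mathbb{C}\langle\mathbf{x}\rangle\bigr\}. \end{align*} In particular, the infimum expressions above are independent of the choice of $R\ge\max_{i,j}\|X_{ij}\|_\infty$.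
   Context: A tracial $W^*$-probability space $(\mathcal{M},\tau)$ is a finite von Neumann algebra with a faithful normal tracial state; $\|\cdot\|_\infty$ is the operator norm. Universal algebras. $\mathbf{x}_i=(x_{ij})_{j=1}^{r(i)}$, $1\le i\le n$, are tuples of indeterminates, $\mathbf{x}=\mathbf{x}_1\sqcup\cdots\sqcup\mathbf{x}_n$, $R>0$. $\mathcal{C}_R(\mathbf{x}_i)$ is the universal (unital, full) $C^*$-free product of $r(i)$ copies of $C[-R,R]$, where $x_{ij}$ is the coordinate function $t$ in the $j$th copy; $\mathcal{C}_R(\mathbf{x})=\bigstar_{i=1}^n\mathcal{C}_R(\mathbf{x}_i)$. $\mathbb{C}\langle\mathbf{x}\rangle\subset\mathcal{C}_R(\mathbf{x})$ is the $*$-algebra of non-commutative polynomials in the self-adjoint $x_{ij}$, and $\mathbb{C}\langle\mathbf{x}\rangle\otimes\mathbb{C}\langle\mathbf{x}\rangle$ is the algebraic tensor product, regarded inside the minimal $C^*$-tensor product $\mathcal{C}_R(\mathbf{x})\otimes_{\min}\mathcal{C}_R(\mathbf{x})$. For self-adjoint elements $\mathbf{a}=(a_{ij})$ of norm $\le R$ in a unital $C^*$-algebra, $f\mapsto f(\mathbf{a})$ is the unital $*$-homomorphism on $\mathcal{C}_R(\mathbf{x})$ determined by $x_{ij}\mapsto a_{ij}$. For $\mathbf{A}=(\mathbf{A}_i)_{i=1}^n$ with $\mathbf{A}_i\in(M_N(\mathbb{C})_R^{sa})^{r(i)}$, $h\in\mathcal{C}_R(\mathbf{x})\otimes_{\min}\mathcal{C}_R(\mathbf{x})\mapsto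 h(\mathbf{A})\in M_N(\mathbb{C})\otimes M_N(\mathbb{C})$ is the $*$-homomorphism with $(f\otimes g)(\mathbf{A})=f(\mathbf{A})\otimes g(\mathbf{A})$. $TS(\mathcal{A})$ is the set of tracial states on $\mathcal{A}$. $\tau_{\mathbf{X}}^{(R)}\in TS(\mathcal{C}_R(\mathbf{x}))$ is $f\mapsto\tau(f(\mathbf{X}))$, $\mathbf{X}=\mathbf{X}_1\sqcup\cdots\sqcup\mathbf{X}_n$, and $\tau_{\mathbf{X}_i}^{(R)}$ is its restriction to $\mathcal{C}_R(\mathbf{x}_i)$. Matrices. $\mathrm{tr}_N$ is the normalized trace on $M_N(\mathbb{C})$, $M_N(\mathbb{C})_R^{sa}$ the set of self-adjoint $N\times N$ matrices of operator norm $\le R$, $\gamma_{\mathrm{U}(N)}$ the Haar probability measure on $\mathrm{U}(N)$. $V_i\mathbf{A}_iV_i^*$ means entrywise conjugation. For $\tau_i\in TS(\mathcal{C}_R(\mathbf{x}_i))$, $\Gamma_R(\tau_i;N,m,\delta)$ is the set of $(A_j)_{j=1}^{r(i)}\in(M_N(\mathbb{C})_R^{sa})^{r(i)}$ with $|\mathrm{tr}_N(A_{j_1}\cdots A_{j_l})-\tau_i(x_{ij_1}\cdots x_{ij_l})|<\delta$ for all $1\le l\le m$, $1\le j_k\le r(i)$. Double orbital free pressure. For $h=h^*\in\mathcal{C}_R(\mathbf{x})\otimes_{\min}\mathcal{C}_R(\mathbf{x})$ and $\tau_i\in TS(\mathcal{C}_R(\mathbf{x}_i))$, $$\pi_{\mathrm{orb},R}^{(2)}(h:(\tau_i)_{i=1}^n;N,m,\delta)=\sup_{\mathbf{A}_i\in\Gamma_R(\tau_i;N,m,\delta),\,1\le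 i\le n}\log\int_{\mathrm{U}(N)^n}\exp\bigl(-N^2(\mathrm{tr}_N\otimes\mathrm{tr}_N)(h((V_i\mathbf{A}_iV_i^* )_{i=1}^n))\bigr)\,d\gamma_{\mathrm{U}(N)}^{\otimes n}(V_i)$$ ($-\infty$ if some $\Gamma_R(\tau_i;N,m,\delta)=\emptyset$), and $\pi_{\mathrm{orb},R}^{(2)}(h:(\tau_i)_{i=1}^n)=\inf_{m\in\mathbb{N},\delta>0}\limsup_{N\to\infty}\frac1{N^2}\pi_{\mathrm{orb},R}^{(2)}(h:(\tau_i)_{i=1}^n;N,m,\delta)$. Orbital free entropy. For $\mathbf{A}_i\in(M_N(\mathbb{C})^{sa})^{r(i)}$, $\Gamma_{\mathrm{orb}}(\mathbf{X}_1,\dots,\mathbf{X}_n:(\mathbf{A}_i)_{i=1}^n;N,m,\delta)$ is the set of $(V_i)_{i=1}^n\in\mathrm{U}(N)^n$ with $|\mathrm{tr}_N(q((V_i\mathbf{A}_iV_i^* )_{i=1}^n))-\tau(q(\mathbf{X}))|<\delta$ for all non-commutative monomials $q$ in $\mathbf{x}$ of degree between $1$ and $m$. With $R\ge\max_{i,j}\|X_{ij}\|_\infty$, $$\chi_{\mathrm{orb}}(\mathbf{X}_1,\dots,\mathbf{X}_n)=\lim_{m\to\infty,\,\delta\searrow0}\ \limsup_{N\to\infty}\frac1{N^2}\ \sup_{\mathbf{A}_i\in(M_N(\mathbb{C})_R^{sa})^{r(i)}}\log\gamma_{\mathrm{U}(N)}^{\otimes n}\bigl(\Gamma_{\mathrm{orb}}(\mathbf{X}_1,\dots,\mathbf{X}_n:(\mathbf{A}_i)_{i=1}^n;N,m,\delta)\bigr)$$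 ($\log0=-\infty$), which is known to be independent of the choice of such $R$. *)

theory Defs
  imports
    "HOL-Probability.Probability"
    "HOL-Library.Poly_Mapping"
    "HOL-Algebra.Module"
    "Jordan_Normal_Form.Schur_Decomposition"
begin

section \<open>Star algebras and C*-algebras as records\<close>

text \<open>The first component of \<open>module\<close> is the scalar field.  A \<open>star_alg\<close> carries no norm;
  it is used for the dense algebras that are completed below.\<close>

record 'a star_alg = "(complex, 'a) module" +
  star :: "'a \<Rightarrow> 'a"

record 'a cstar_alg = "'a star_alg" +
  nrm :: "'a \<Rightarrow> real"

text \<open>Unital *-homomorphisms between unital C*-algebras.  Contractivity is automatic for such maps;
  it is part of the definition only so that it need not be rederived.\<close>

definition star_hom :: "'a cstar_alg \<Rightarrow> 'b cstar_alg \<Rightarrow> ('a \<Rightarrow> 'b) \<Rightarrow> bool" where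
  "star_hom A B \<phi> \<longleftrightarrow>
     \<phi> \<in> carrier A \<rightarrow> carrier B \<and>
     \<phi> \<one>\<^bsub>A\<^esub> = \<one>\<^bsub>B\<^esub> \<and>
     (\<forall>a\<in>carrier A. \<forall>b\<in>carrier A. \<phi> (a \<oplus>\<^bsub>A\<^esub> b) = \<phi> a \<oplus>\<^bsub>B\<^esub> \<phi> b) \<and>
     (\<forall>c. \<forall>a\<in>carrier A. \<phi> (c \<odot>\<^bsub>A\<^esub> a) = c \<odot>\<^bsub>B\<^esub> \<phi> a) \<and>
     (\<forall>a\<in>carrier A. \<forall>b\<in>carrier A. \<phi> (a \<otimes>\<^bsub>A\<^esub> b) = \<phi> a \<otimes>\<^bsub>B\<^esub> \<phi> b) \<and>
     (\<forall>a\<in>carrier A. \<phi> (star A a) = star B (\<phi> a)) \<and>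
     (\<forall>a\<in>carrier A. nrm B (\<phi> a) \<le> nrm A a)"

text \<open>A state is a positive linear functional of norm one.\<close>

definition is_state :: "'a cstar_alg \<Rightarrow> ('a \<Rightarrow> complex) \<Rightarrow> bool" where
  "is_state A \<phi> \<longleftrightarrow>
     (\<forall>a\<in>carrier A. \<forall>b\<in>carrier A. \<phi> (a \<oplus>\<^bsub>A\<^esub> b) = \<phi> a + \<phi> b) \<and>
     (\<forall>c. \<forall>a\<in>carrier A. \<phi> (c \<odot>\<^bsub>A\<^esub> a) = c * \<phi> a) \<and>
     (\<forall>a\<in>carrier A. \<phi> (star A a \<otimes>\<^bsub>A\<^esub> a) \<in> \<real>\<^sub>\<ge>\<^sub>0) \<and>
     \<phi> \<one>\<^bsub>A\<^esub> = 1 \<and>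
     (\<forall>a\<in>carrier A. cmod (\<phi> a) \<le> nrm A a)"

text \<open>The product \<open>a(w\<^sub>1) a(w\<^sub>2) \<dots> a(w\<^sub>l)\<close>, i.e. the monomial \<open>w\<close> evaluated at \<open>a\<close>.\<close>

definition word_prod :: "('a, 'm) monoid_scheme \<Rightarrow> ('k \<Rightarrow> 'a) \<Rightarrow> 'k list \<Rightarrow> 'a" where
  "word_prod A a w = foldr (\<lambda>k y. a k \<otimes>\<^bsub>A\<^esub> y) w \<one>\<^bsub>A\<^esub>"

inductive_set lin_span :: "'a cstar_alg \<Rightarrow> 'a set \<Rightarrow> 'a set"
  for A :: "'a cstar_alg" and S :: "'a set" where
  zero: "\<zero>\<^bsub>A\<^esub> \<in> lin_span A S"
| incl: "a \<in> S \<Longrightarrow> a \<in> lin_span A S"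
| add: "a \<in> lin_span A S \<Longrightarrow> b \<in> lin_span A S \<Longrightarrow> a \<oplus>\<^bsub>A\<^esub> b \<in> lin_span A S"
| smult: "a \<in> lin_span A S \<Longrightarrow> c \<odot>\<^bsub>A\<^esub> a \<in> lin_span A S"


section \<open>Completion of a star algebra with respect to a seminorm\<close>

text \<open>Elements are classes of Cauchy sequences modulo null sequences, so elements of seminorm zero are
  divided out at the same time.\<close>

definition cauchy_seqs :: "'a star_alg \<Rightarrow> ('a \<Rightarrow> real) \<Rightarrow> (nat \<Rightarrow> 'a) set" where
  "cauchy_seqs B N = {s. (\<forall>k. s k \<in> carrier B) \<and>
     (\<forall>e>0. \<exists>K. \<forall>k\<ge>K. \<forall>l\<ge>K. N (s k \<oplus>\<^bsub>B\<^esub> (-1) \<odot>\<^bsub>B\<^esub> s l) < e)}"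

definition cauchy_class :: "'a star_alg \<Rightarrow> ('a \<Rightarrow> real) \<Rightarrow> (nat \<Rightarrow> 'a) \<Rightarrow> (nat \<Rightarrow> 'a) set" where
  "cauchy_class B N s = {t \<in> cauchy_seqs B N. (\<lambda>k. N (t k \<oplus>\<^bsub>B\<^esub> (-1) \<odot>\<^bsub>B\<^esub> s k)) \<longlonglongrightarrow> 0}"

definition repr :: "(nat \<Rightarrow> 'a) set \<Rightarrow> nat \<Rightarrow> 'a" where
  "repr P = (SOME s. s \<in> P)"

definition completion :: "'a star_alg \<Rightarrow> ('a \<Rightarrow> real) \<Rightarrow> (nat \<Rightarrow> 'a) set cstar_alg" where
  "completion B N = \<lparr>
     carrier = cauchy_class B N ` cauchy_seqs B N,
     mult = (\<lambda>P Q. cauchy_class B N (\<lambda>k. repr P k \<otimes>\<^bsub>B\<^esub> repr Q k)),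
     one = cauchy_class B N (\<lambda>k. \<one>\<^bsub>B\<^esub>),
     zero = cauchy_class B N (\<lambda>k. \<zero>\<^bsub>B\<^esub>),
     add = (\<lambda>P Q. cauchy_class B N (\<lambda>k. repr P k \<oplus>\<^bsub>B\<^esub> repr Q k)),
     smult = (\<lambda>c P. cauchy_class B N (\<lambda>k. c \<odot>\<^bsub>B\<^esub> repr P k)),
     star = (\<lambda>P. cauchy_class B N (\<lambda>k. star B (repr P k))),
     nrm = (\<lambda>P. lim (\<lambda>k. N (repr P k))) \<rparr>"

definition completion_embed :: "'a star_alg \<Rightarrow> ('a \<Rightarrow> real) \<Rightarrow> 'a \<Rightarrow> (nat \<Rightarrow> 'a) set" where
  "completion_embed B N a = cauchy_class B N (\<lambda>k. a)"


section \<open>Algebras of formal linear combinations\<close>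

text \<open>The *-algebra with linear basis \<open>W\<close>, where basis elements are multiplied by \<open>m\<close>, with unit \<open>e\<close>
  and (antimultiplicative) involution \<open>s\<close>.\<close>

definition formal_alg ::
  "'w set \<Rightarrow> ('w \<Rightarrow> 'w \<Rightarrow> 'w) \<Rightarrow> 'w \<Rightarrow> ('w \<Rightarrow> 'w) \<Rightarrow> ('w \<Rightarrow>\<^sub>0 complex) star_alg" where
  "formal_alg W m e s = \<lparr>
     carrier = {p. Poly_Mapping.keys p \<subseteq> W},
     mult = (\<lambda>p q. \<Sum>u\<in>Poly_Mapping.keys p. \<Sum>v\<in>Poly_Mapping.keys q.
        Poly_Mapping.single (m u v) (Poly_Mapping.lookup p u * Poly_Mapping.lookup q v)),
     one = Poly_Mapping.single e 1,
     zero = 0,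
     add = (+),
     smult = (\<lambda>c. Poly_Mapping.map ((*) c)),
     star = (\<lambda>p. \<Sum>u\<in>Poly_Mapping.keys p. Poly_Mapping.single (s u) (cnj (Poly_Mapping.lookup p u))) \<rparr>"


section \<open>Universal free products of unital C*-algebras\<close>

text \<open>The free *-algebra on the disjoint union of the \<open>A k\<close>, \<open>k \<in> K\<close>.\<close>

definition free_star_alg ::
  "'k set \<Rightarrow> ('k \<Rightarrow> 'a cstar_alg) \<Rightarrow> (('k \<times> 'a) list \<Rightarrow>\<^sub>0 complex) star_alg" where
  "free_star_alg K A =
     formal_alg (lists (SIGMA k:K. carrier (A k))) (@) []
       (\<lambda>w. rev (map (\<lambda>(k, a). (k, star (A k) a)) w))"

definition letter :: "'k \<Rightarrow> 'a \<Rightarrow> (('k \<times> 'a) list \<Rightarrow>\<^sub>0 complex)" where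
  "letter k a = Poly_Mapping.single [(k, a)] 1"

definition cstar_seminorm :: "'a star_alg \<Rightarrow> ('a \<Rightarrow> real) \<Rightarrow> bool" where
  "cstar_seminorm B N \<longleftrightarrow>
     (\<forall>p\<in>carrier B. 0 \<le> N p) \<and>
     (\<forall>p\<in>carrier B. \<forall>q\<in>carrier B. N (p \<oplus>\<^bsub>B\<^esub> q) \<le> N p + N q) \<and>
     (\<forall>c. \<forall>p\<in>carrier B. N (c \<odot>\<^bsub>B\<^esub> p) = cmod c * N p) \<and>
     (\<forall>p\<in>carrier B. \<forall>q\<in>carrier B. N (p \<otimes>\<^bsub>B\<^esub> q) \<le> N p * N q) \<and>
     (\<forall>p\<in>carrier B. N (star B p \<otimes>\<^bsub>B\<^esub> p) = N p ^ 2)"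

text \<open>C*-seminorms on the free *-algebra modulo which each \<open>a \<mapsto> letter k a\<close> is a unital
  *-homomorphism on \<open>A k\<close>; compatibility with the involution holds already in the free *-algebra.
  Equivalently, these are the C*-seminorms on the algebraic free product, amalgamated over the unit.
  The last condition is automatic (*-homomorphisms are contractive) and makes visible that the
  supremum in \<open>free_norm\<close> is finite.\<close>

definition free_seminorm ::
  "'k set \<Rightarrow> ('k \<Rightarrow> 'a cstar_alg) \<Rightarrow> ((('k \<times> 'a) list \<Rightarrow>\<^sub>0 complex) \<Rightarrow> real) \<Rightarrow> bool" where
  "free_seminorm K A N \<longleftrightarrow>
     cstar_seminorm (free_star_alg K A) N \<and>
     (\<forall>k\<in>K. N (letter k \<one>\<^bsub>A k\<^esub> - Poly_Mapping.single [] 1) = 0) \<and>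
     (\<forall>k\<in>K. \<forall>a\<in>carrier (A k). \<forall>b\<in>carrier (A k).
        N (letter k (a \<oplus>\<^bsub>A k\<^esub> b) - (letter k a + letter k b)) = 0) \<and>
     (\<forall>k\<in>K. \<forall>c. \<forall>a\<in>carrier (A k).
        N (letter k (c \<odot>\<^bsub>A k\<^esub> a) - Poly_Mapping.single [(k, a)] c) = 0) \<and>
     (\<forall>k\<in>K. \<forall>a\<in>carrier (A k). \<forall>b\<in>carrier (A k).
        N (letter k (a \<otimes>\<^bsub>A k\<^esub> b) - Poly_Mapping.single [(k, a), (k, b)] 1) = 0) \<and>
     (\<forall>k\<in>K. \<forall>a\<in>carrier (A k). N (letter k a) \<le> nrm (A k) a)"

definition free_norm ::
  "'k set \<Rightarrow> ('k \<Rightarrow> 'a cstar_alg) \<Rightarrow> (('k \<times> 'a) list \<Rightarrow>\<^sub>0 complex) \<Rightarrow> real" where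
  "free_norm K A p = Sup {N p | N. free_seminorm K A N}"

type_synonym ('k, 'a) free = "(nat \<Rightarrow> (('k \<times> 'a) list \<Rightarrow>\<^sub>0 complex)) set"

definition free_product :: "'k set \<Rightarrow> ('k \<Rightarrow> 'a cstar_alg) \<Rightarrow> ('k, 'a) free cstar_alg" where
  "free_product K A = completion (free_star_alg K A) (free_norm K A)"

definition free_incl :: "'k set \<Rightarrow> ('k \<Rightarrow> 'a cstar_alg) \<Rightarrow> 'k \<Rightarrow> 'a \<Rightarrow> ('k, 'a) free" where
  "free_incl K A k a = completion_embed (free_star_alg K A) (free_norm K A) (letter k a)"


section \<open>Minimal tensor products of unital C*-algebras\<close>

text \<open>Formal linear combinations of pairs \<open>(a, b)\<close>.  The bilinearity relations of the algebraic tensor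
  product need not be imposed: by linearity of states they hold modulo elements of \<open>min_norm\<close> zero.\<close>

definition pre_tensor :: "'a cstar_alg \<Rightarrow> 'b cstar_alg \<Rightarrow> ('a \<times> 'b \<Rightarrow>\<^sub>0 complex) star_alg" where
  "pre_tensor A B =
     formal_alg (carrier A \<times> carrier B)
       (\<lambda>(a, b) (a', b'). (a \<otimes>\<^bsub>A\<^esub> a', b \<otimes>\<^bsub>B\<^esub> b')) (\<one>\<^bsub>A\<^esub>, \<one>\<^bsub>B\<^esub>)
       (\<lambda>(a, b). (star A a, star B b))"

definition pre_functional ::
  "('a \<Rightarrow> complex) \<Rightarrow> ('b \<Rightarrow> complex) \<Rightarrow> ('a \<times> 'b \<Rightarrow>\<^sub>0 complex) \<Rightarrow> complex" where
  "pre_functional \<phi> \<psi> t = (\<Sum>(a, b)\<in>Poly_Mapping.keys t. Poly_Mapping.lookup t (a, b) * (\<phi> a * \<psi> b))"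

text \<open>The spatial norm, for the universal representations of \<open>A\<close> and \<open>B\<close>, which are the direct sums of
  the GNS representations of all states \<open>\<phi>\<close>, \<open>\<psi>\<close>.  A dense subspace of the Hilbert space of
  \<open>\<pi>\<^sub>\<phi> \<otimes> \<pi>\<^sub>\<psi>\<close> is the image of the algebraic tensor product with
  \<open>\<langle>s, s'\<rangle> = (\<phi> \<otimes> \<psi>)(s\<^sup>* s')\<close>, on which \<open>t\<close> acts by left multiplication;
  so the inner supremum over \<open>s\<close> is the operator norm of \<open>(\<pi>\<^sub>\<phi> \<otimes> \<pi>\<^sub>\<psi>)(t)\<close>.\<close>

definition min_norm :: "'a cstar_alg \<Rightarrow> 'b cstar_alg \<Rightarrow> ('a \<times> 'b \<Rightarrow>\<^sub>0 complex) \<Rightarrow> real" where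
  "min_norm A B t = (let T = pre_tensor A B in
     Sup {sqrt (Re (pre_functional \<phi> \<psi> (star T (t \<otimes>\<^bsub>T\<^esub> s) \<otimes>\<^bsub>T\<^esub> (t \<otimes>\<^bsub>T\<^esub> s)))) | \<phi> \<psi> s.
       is_state A \<phi> \<and> is_state B \<psi> \<and> s \<in> carrier T \<and>
       Re (pre_functional \<phi> \<psi> (star T s \<otimes>\<^bsub>T\<^esub> s)) \<le> 1})"

type_synonym ('a, 'b) tensor = "(nat \<Rightarrow> ('a \<times> 'b \<Rightarrow>\<^sub>0 complex)) set"

definition min_tensor :: "'a cstar_alg \<Rightarrow> 'b cstar_alg \<Rightarrow> ('a, 'b) tensor cstar_alg" where
  "min_tensor A B = completion (pre_tensor A B) (min_norm A B)"

definition tensor_elem :: "'a cstar_alg \<Rightarrow> 'b cstar_alg \<Rightarrow> 'a \<Rightarrow> 'b \<Rightarrow> ('a, 'b) tensor" where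
  "tensor_elem A B a b =
     completion_embed (pre_tensor A B) (min_norm A B) (Poly_Mapping.single (a, b) 1)"

text \<open>The product state \<open>\<phi> \<otimes> \<psi>\<close>; it is uniquely determined on the carrier.\<close>

definition tensor_state ::
  "'a cstar_alg \<Rightarrow> 'b cstar_alg \<Rightarrow> ('a \<Rightarrow> complex) \<Rightarrow> ('b \<Rightarrow> complex) \<Rightarrow> ('a, 'b) tensor \<Rightarrow> complex" where
  "tensor_state A B \<phi> \<psi> = (SOME \<omega>. is_state (min_tensor A B) \<omega> \<and>
     (\<forall>a\<in>carrier A. \<forall>b\<in>carrier B. \<omega> (tensor_elem A B a b) = \<phi> a * \<psi> b))"


section \<open>The universal algebras \<open>C\<^sub>R(x\<^sub>i)\<close> and \<open>C\<^sub>R(x)\<close>\<close>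

text \<open>The indeterminates are \<open>x\<^sub>i\<^sub>j\<close> with \<open>i < n\<close> and \<open>j < r i\<close>.\<close>

definition C_interval :: "real \<Rightarrow> (real \<Rightarrow> complex) cstar_alg" where
  "C_interval R = \<lparr>
     carrier = {f \<in> extensional {-R..R}. continuous_on {-R..R} f},
     mult = (\<lambda>f g. restrict (\<lambda>t. f t * g t) {-R..R}),
     one = restrict (\<lambda>t. 1) {-R..R},
     zero = restrict (\<lambda>t. 0) {-R..R},
     add = (\<lambda>f g. restrict (\<lambda>t. f t + g t) {-R..R}),
     smult = (\<lambda>c f. restrict (\<lambda>t. c * f t) {-R..R}),
     star = (\<lambda>f. restrict (\<lambda>t. cnj (f t)) {-R..R}),
     nrm = (\<lambda>f. SUP t\<in>{-R..R}. cmod (f t)) \<rparr>"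

type_synonym C_tuple_elem = "(nat, real \<Rightarrow> complex) free"
type_synonym C_all_elem = "(nat, C_tuple_elem) free"

definition C_tuple :: "real \<Rightarrow> nat \<Rightarrow> C_tuple_elem cstar_alg" where
  "C_tuple R k = free_product {..<k} (\<lambda>j. C_interval R)"

definition x_tuple :: "real \<Rightarrow> nat \<Rightarrow> nat \<Rightarrow> C_tuple_elem" where
  "x_tuple R k j = free_incl {..<k} (\<lambda>j. C_interval R) j (restrict complex_of_real {-R..R})"

definition C_all :: "real \<Rightarrow> nat \<Rightarrow> (nat \<Rightarrow> nat) \<Rightarrow> C_all_elem cstar_alg" where
  "C_all R n r = free_product {..<n} (\<lambda>i. C_tuple R (r i))"

definition tuple_incl :: "real \<Rightarrow> nat \<Rightarrow> (nat \<Rightarrow> nat) \<Rightarrow> nat \<Rightarrow> C_tuple_elem \<Rightarrow> C_all_elem" where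
  "tuple_incl R n r i = free_incl {..<n} (\<lambda>i. C_tuple R (r i)) i"

definition x_all :: "real \<Rightarrow> nat \<Rightarrow> (nat \<Rightarrow> nat) \<Rightarrow> nat \<Rightarrow> nat \<Rightarrow> C_all_elem" where
  "x_all R n r i j = tuple_incl R n r i (x_tuple R (r i) j)"

definition C_all2 :: "real \<Rightarrow> nat \<Rightarrow> (nat \<Rightarrow> nat) \<Rightarrow> (C_all_elem, C_all_elem) tensor cstar_alg" where
  "C_all2 R n r = min_tensor (C_all R n r) (C_all R n r)"

definition var_set :: "nat \<Rightarrow> (nat \<Rightarrow> nat) \<Rightarrow> (nat \<times> nat) set" where
  "var_set n r = (SIGMA i:{..<n}. {..<r i})"

text \<open>\<open>\<complex>\<langle>x\<rangle>\<close> inside \<open>C\<^sub>R(x)\<close>, and the algebraic tensor square inside the minimal one.\<close>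

definition nc_polys :: "real \<Rightarrow> nat \<Rightarrow> (nat \<Rightarrow> nat) \<Rightarrow> C_all_elem set" where
  "nc_polys R n r = lin_span (C_all R n r)
     {word_prod (C_all R n r) (\<lambda>(i, j). x_all R n r i j) w | w. w \<in> lists (var_set n r)}"

definition nc_polys2 :: "real \<Rightarrow> nat \<Rightarrow> (nat \<Rightarrow> nat) \<Rightarrow> (C_all_elem, C_all_elem) tensor set" where
  "nc_polys2 R n r = lin_span (C_all2 R n r)
     {tensor_elem (C_all R n r) (C_all R n r) f g | f g. f \<in> nc_polys R n r \<and> g \<in> nc_polys R n r}"

text \<open>The *-homomorphism \<open>f \<mapsto> f(a)\<close> determined by \<open>x\<^sub>i\<^sub>j \<mapsto> a i j\<close>, for selfadjoint \<open>a i j\<close> of norm at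
  most \<open>R\<close> in \<open>B\<close>; it is uniquely determined on the carrier.\<close>

definition eval_at ::
  "real \<Rightarrow> nat \<Rightarrow> (nat \<Rightarrow> nat) \<Rightarrow> 'b cstar_alg \<Rightarrow> (nat \<Rightarrow> nat \<Rightarrow> 'b) \<Rightarrow> C_all_elem \<Rightarrow> 'b" where
  "eval_at R n r B a = (SOME \<phi>. star_hom (C_all R n r) B \<phi> \<and>
     (\<forall>i<n. \<forall>j<r i. \<phi> (x_all R n r i j) = a i j))"


section \<open>Matrices\<close>

definition trN :: "nat \<Rightarrow> complex mat \<Rightarrow> complex" where
  "trN N A = (\<Sum>i<N. A $$ (i, i)) / of_nat N"

definition euclid_norm :: "complex vec \<Rightarrow> real" where
  "euclid_norm v = sqrt (\<Sum>i<dim_vec v. (cmod (v $ i))\<^sup>2)"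

definition mat_norm :: "complex mat \<Rightarrow> real" where
  "mat_norm A = Sup {euclid_norm (A *\<^sub>v v) | v. v \<in> carrier_vec (dim_col A) \<and> euclid_norm v \<le> 1}"

definition mat_alg :: "nat \<Rightarrow> complex mat cstar_alg" where
  "mat_alg N = ring_mat TYPE(complex) N
     \<lparr> smult = (\<cdot>\<^sub>m), star = mat_adjoint, nrm = mat_norm \<rparr>"

definition Msa :: "nat \<Rightarrow> real \<Rightarrow> complex mat set" where
  "Msa N R = {A \<in> carrier_mat N N. mat_adjoint A = A \<and> mat_norm A \<le> R}"

text \<open>The identification of \<open>M\<^sub>N(\<complex>) \<otimes> M\<^sub>N(\<complex>)\<close> with the matrices of size \<open>N * N\<close>, under which
  \<open>tr\<^sub>N \<otimes> tr\<^sub>N\<close> is the normalized trace \<open>trN (N * N)\<close>.\<close>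

definition kron :: "nat \<Rightarrow> complex mat \<Rightarrow> complex mat \<Rightarrow> complex mat" where
  "kron N A B = mat (N * N) (N * N)
     (\<lambda>(k, l). A $$ (k div N, l div N) * B $$ (k mod N, l mod N))"

definition eval2_at ::
  "real \<Rightarrow> nat \<Rightarrow> (nat \<Rightarrow> nat) \<Rightarrow> nat \<Rightarrow> (nat \<Rightarrow> nat \<Rightarrow> complex mat) \<Rightarrow> (C_all_elem, C_all_elem) tensor \<Rightarrow> complex mat" where
  "eval2_at R n r N A = (SOME \<Phi>. star_hom (C_all2 R n r) (mat_alg (N * N)) \<Phi> \<and>
     (\<forall>f\<in>carrier (C_all R n r). \<forall>g\<in>carrier (C_all R n r).
        \<Phi> (tensor_elem (C_all R n r) (C_all R n r) f g) =
        kron N (eval_at R n r (mat_alg N) A f) (eval_at R n r (mat_alg N) A g)))"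

definition unitary_group :: "nat \<Rightarrow> complex mat set" where
  "unitary_group N = {U \<in> carrier_mat N N. U * mat_adjoint U = 1\<^sub>m N \<and> mat_adjoint U * U = 1\<^sub>m N}"

text \<open>The Borel structure of \<open>U(N)\<close> as a subspace of \<open>\<complex>\<^sup>N\<^sup>\<times>\<^sup>N\<close>.\<close>

definition unitary_borel :: "nat \<Rightarrow> complex mat measure" where
  "unitary_borel N = vimage_algebra (unitary_group N)
     (\<lambda>U. \<lambda>(k, l)\<in>{..<N} \<times> {..<N}. U $$ (k, l))
     (\<Pi>\<^sub>M kl\<in>{..<N} \<times> {..<N}. (borel :: complex measure))"

definition is_haar_prob :: "nat \<Rightarrow> complex mat measure \<Rightarrow> bool" where
  "is_haar_prob N \<mu> \<longleftrightarrow> prob_space \<mu> \<and> sets \<mu> = sets (unitary_borel N) \<and>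
     (\<forall>U\<in>unitary_group N. \<forall>B\<in>sets \<mu>. emeasure \<mu> ((\<lambda>V. U * V) ` B) = emeasure \<mu> B)"

definition conj_tuple :: "(nat \<Rightarrow> complex mat) \<Rightarrow> (nat \<Rightarrow> nat \<Rightarrow> complex mat) \<Rightarrow> nat \<Rightarrow> nat \<Rightarrow> complex mat" where
  "conj_tuple V A i j = V i * A i j * mat_adjoint (V i)"

definition log_ereal :: "real \<Rightarrow> ereal" where
  "log_ereal x = (if x = 0 then -\<infinity> else ereal (ln x))"


section \<open>Tracial W*-probability spaces\<close>

text \<open>Complex Hilbert spaces.  Norm and topology come from the real inner product
  \<open>Re \<langle>x, y\<rangle>\<close>; \<open>cinner\<close> is linear in the second argument.\<close>

class chilbert_space = real_inner + complete_space +
  fixes scaleC :: "complex \<Rightarrow> 'a \<Rightarrow> 'a"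
    and cinner :: "'a \<Rightarrow> 'a \<Rightarrow> complex"
  assumes scaleC_add_right: "scaleC c (x + y) = scaleC c x + scaleC c y"
    and scaleC_add_left: "scaleC (c + d) x = scaleC c x + scaleC d x"
    and scaleC_scaleC: "scaleC c (scaleC d x) = scaleC (c * d) x"
    and scaleC_of_real: "scaleC (complex_of_real a) x = scaleR a x"
    and cinner_commute: "cinner x y = cnj (cinner y x)"
    and cinner_add_right: "cinner x (y + z) = cinner x y + cinner x z"
    and cinner_scaleC_right: "cinner x (scaleC c y) = c * cinner x y"
    and Re_cinner: "Re (cinner x y) = inner x y"

definition bounded_ops :: "('h::chilbert_space \<Rightarrow> 'h) set" where
  "bounded_ops = {T. bounded_linear T \<and> (\<forall>c x. T (scaleC c x) = scaleC c (T x))}"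

definition is_adjoint :: "('h::chilbert_space \<Rightarrow> 'h) \<Rightarrow> ('h \<Rightarrow> 'h) \<Rightarrow> bool" where
  "is_adjoint T S \<longleftrightarrow> (\<forall>x y. cinner (T x) y = cinner x (S y))"

definition op_adjoint :: "('h::chilbert_space \<Rightarrow> 'h) \<Rightarrow> ('h \<Rightarrow> 'h)" where
  "op_adjoint T = (THE S. is_adjoint T S)"

definition op_sa :: "('h::chilbert_space \<Rightarrow> 'h) \<Rightarrow> bool" where
  "op_sa T \<longleftrightarrow> is_adjoint T T"

definition op_le :: "('h::chilbert_space \<Rightarrow> 'h) \<Rightarrow> ('h \<Rightarrow> 'h) \<Rightarrow> bool" where
  "op_le S T \<longleftrightarrow> (\<forall>x. Re (cinner x (S x)) \<le> Re (cinner x (T x)))"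

definition commutant :: "('h::chilbert_space \<Rightarrow> 'h) set \<Rightarrow> ('h \<Rightarrow> 'h) set" where
  "commutant M = {S \<in> bounded_ops. \<forall>T\<in>M. S \<circ> T = T \<circ> S}"

definition von_neumann_algebra :: "('h::chilbert_space \<Rightarrow> 'h) set \<Rightarrow> bool" where
  "von_neumann_algebra M \<longleftrightarrow> M \<subseteq> bounded_ops \<and>
     (\<forall>T\<in>M. \<exists>S\<in>M. is_adjoint T S) \<and> commutant (commutant M) = M"

definition op_alg :: "('h::chilbert_space \<Rightarrow> 'h) set \<Rightarrow> ('h \<Rightarrow> 'h) cstar_alg" where
  "op_alg M = \<lparr>
     carrier = M,
     mult = (\<circ>),
     one = id,
     zero = (\<lambda>x. 0),
     add = (\<lambda>S T x. S x + T x),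
     smult = (\<lambda>c T x. scaleC c (T x)),
     star = op_adjoint,
     nrm = onorm \<rparr>"

text \<open>Normality: preservation of least upper bounds of bounded increasing nets of selfadjoint elements.\<close>

definition normal_functional ::
  "('h::chilbert_space \<Rightarrow> 'h) set \<Rightarrow> (('h \<Rightarrow> 'h) \<Rightarrow> complex) \<Rightarrow> bool" where
  "normal_functional M \<tau> \<longleftrightarrow> (let Ms = {T \<in> M. op_sa T} in
     \<forall>D T. D \<subseteq> Ms \<and> D \<noteq> {} \<and> (\<forall>S\<in>D. \<forall>S'\<in>D. \<exists>S''\<in>D. op_le S S'' \<and> op_le S' S'') \<and>
       T \<in> Ms \<and> (\<forall>U\<in>Ms. op_le T U \<longleftrightarrow> (\<forall>S\<in>D. op_le S U)) \<longrightarrow>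
       Re (\<tau> T) = (SUP S\<in>D. Re (\<tau> S)))"

text \<open>Finiteness of the von Neumann algebra is implied by the existence of a faithful tracial state.\<close>

definition tracial_Wstar_prob_space ::
  "('h::chilbert_space \<Rightarrow> 'h) set \<Rightarrow> (('h \<Rightarrow> 'h) \<Rightarrow> complex) \<Rightarrow> bool" where
  "tracial_Wstar_prob_space M \<tau> \<longleftrightarrow>
     von_neumann_algebra M \<and>
     is_state (op_alg M) \<tau> \<and>
     (\<forall>S\<in>M. \<forall>T\<in>M. \<tau> (S \<circ> T) = \<tau> (T \<circ> S)) \<and>
     (\<forall>T\<in>M. \<tau> (op_adjoint T \<circ> T) = 0 \<longrightarrow> T = (\<lambda>x. 0)) \<and>
     normal_functional M \<tau>"

text \<open>The tracial states \<open>\<tau>\<^sub>X\<close> on \<open>C\<^sub>R(x)\<close> and \<open>\<tau>\<^sub>X\<^sub>i\<close> on \<open>C\<^sub>R(x\<^sub>i)\<close>.\<close>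

definition tau_all ::
  "('h::chilbert_space \<Rightarrow> 'h) set \<Rightarrow> (('h \<Rightarrow> 'h) \<Rightarrow> complex) \<Rightarrow> real \<Rightarrow> nat \<Rightarrow> (nat \<Rightarrow> nat) \<Rightarrow>
   (nat \<Rightarrow> nat \<Rightarrow> 'h \<Rightarrow> 'h) \<Rightarrow> C_all_elem \<Rightarrow> complex" where
  "tau_all M \<tau> R n r X f = \<tau> (eval_at R n r (op_alg M) X f)"

definition tau_tuple ::
  "('h::chilbert_space \<Rightarrow> 'h) set \<Rightarrow> (('h \<Rightarrow> 'h) \<Rightarrow> complex) \<Rightarrow> real \<Rightarrow> nat \<Rightarrow> (nat \<Rightarrow> nat) \<Rightarrow>
   (nat \<Rightarrow> nat \<Rightarrow> 'h \<Rightarrow> 'h) \<Rightarrow> nat \<Rightarrow> C_tuple_elem \<Rightarrow> complex" where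
  "tau_tuple M \<tau> R n r X i f = tau_all M \<tau> R n r X (tuple_incl R n r i f)"


section \<open>Double orbital free pressure and orbital free entropy\<close>

text \<open>Throughout, \<open>\<gamma> N\<close> stands for the Haar probability measure of \<open>U(N)\<close>.\<close>

definition Gamma_R ::
  "real \<Rightarrow> nat \<Rightarrow> (C_tuple_elem \<Rightarrow> complex) \<Rightarrow> nat \<Rightarrow> nat \<Rightarrow> real \<Rightarrow> (nat \<Rightarrow> complex mat) set" where
  "Gamma_R R k \<sigma> N m \<delta> = {A. (\<forall>j<k. A j \<in> Msa N R) \<and>
     (\<forall>w\<in>lists {..<k}. 1 \<le> length w \<and> length w \<le> m \<longrightarrow>
        cmod (trN N (word_prod (mat_alg N) A w) - \<sigma> (word_prod (C_tuple R k) (x_tuple R k) w)) < \<delta>)}"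

definition pressure_fin ::
  "(nat \<Rightarrow> complex mat measure) \<Rightarrow> real \<Rightarrow> nat \<Rightarrow> (nat \<Rightarrow> nat) \<Rightarrow> (C_all_elem, C_all_elem) tensor \<Rightarrow>
   (nat \<Rightarrow> C_tuple_elem \<Rightarrow> complex) \<Rightarrow> nat \<Rightarrow> nat \<Rightarrow> real \<Rightarrow> ereal" where
  "pressure_fin \<gamma> R n r h \<sigma> N m \<delta> =
     (SUP A\<in>{A. \<forall>i<n. A i \<in> Gamma_R R (r i) (\<sigma> i) N m \<delta>}.
        log_ereal (\<integral>V. exp (- (real N ^ 2) *
            Re (trN (N * N) (eval2_at R n r N (conj_tuple V A) h))) \<partial>(\<Pi>\<^sub>M i\<in>{..<n}. \<gamma> N)))"

definition pressure ::
  "(nat \<Rightarrow> complex mat measure) \<Rightarrow> real \<Rightarrow> nat \<Rightarrow> (nat \<Rightarrow> nat) \<Rightarrow> (C_all_elem, C_all_elem) tensor \<Rightarrow>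
   (nat \<Rightarrow> C_tuple_elem \<Rightarrow> complex) \<Rightarrow> ereal" where
  "pressure \<gamma> R n r h \<sigma> =
     (INF (m, \<delta>)\<in>UNIV \<times> {0<..}.
        limsup (\<lambda>N. ereal (1 / real N ^ 2) * pressure_fin \<gamma> R n r h \<sigma> N m \<delta>))"

definition Gamma_orb ::
  "('h::chilbert_space \<Rightarrow> 'h) set \<Rightarrow> (('h \<Rightarrow> 'h) \<Rightarrow> complex) \<Rightarrow> nat \<Rightarrow> (nat \<Rightarrow> nat) \<Rightarrow>
   (nat \<Rightarrow> nat \<Rightarrow> 'h \<Rightarrow> 'h) \<Rightarrow> (nat \<Rightarrow> nat \<Rightarrow> complex mat) \<Rightarrow> nat \<Rightarrow> nat \<Rightarrow> real \<Rightarrow> (nat \<Rightarrow> complex mat) set" where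
  "Gamma_orb M \<tau> n r X A N m \<delta> = {V \<in> {..<n} \<rightarrow>\<^sub>E unitary_group N.
     \<forall>w\<in>lists (var_set n r). 1 \<le> length w \<and> length w \<le> m \<longrightarrow>
       cmod (trN N (word_prod (mat_alg N) (\<lambda>(i, j). conj_tuple V A i j) w)
             - \<tau> (word_prod (op_alg M) (\<lambda>(i, j). X i j) w)) < \<delta>}"

text \<open>The parameter \<open>S\<close> is the cut-off constant for the norms of the matrices.\<close>

definition chi_orb ::
  "(nat \<Rightarrow> complex mat measure) \<Rightarrow> real \<Rightarrow> ('h::chilbert_space \<Rightarrow> 'h) set \<Rightarrow> (('h \<Rightarrow> 'h) \<Rightarrow> complex) \<Rightarrow>
   nat \<Rightarrow> (nat \<Rightarrow> nat) \<Rightarrow> (nat \<Rightarrow> nat \<Rightarrow> 'h \<Rightarrow> 'h) \<Rightarrow> ereal" where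
  "chi_orb \<gamma> S M \<tau> n r X =
     Lim (sequentially \<times>\<^sub>F at_right 0) (\<lambda>(m, \<delta>).
       limsup (\<lambda>N. ereal (1 / real N ^ 2) *
         (SUP A\<in>{A. \<forall>i<n. \<forall>j<r i. A i j \<in> Msa N S}.
            log_ereal (measure (\<Pi>\<^sub>M i\<in>{..<n}. \<gamma> N) (Gamma_orb M \<tau> n r X A N m \<delta>)))))"

text \<open>The quantities \<open>(\<tau>\<^sub>X \<otimes> \<tau>\<^sub>X)(h) + \<pi>(h)\<close> over which the infima are taken.\<close>

definition shifted_pressure ::
  "(nat \<Rightarrow> complex mat measure) \<Rightarrow> ('h::chilbert_space \<Rightarrow> 'h) set \<Rightarrow> (('h \<Rightarrow> 'h) \<Rightarrow> complex) \<Rightarrow>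
   real \<Rightarrow> nat \<Rightarrow> (nat \<Rightarrow> nat) \<Rightarrow> (nat \<Rightarrow> nat \<Rightarrow> 'h \<Rightarrow> 'h) \<Rightarrow> (C_all_elem, C_all_elem) tensor \<Rightarrow> ereal" where
  "shifted_pressure \<gamma> M \<tau> R n r X h =
     ereal (Re (tensor_state (C_all R n r) (C_all R n r)
                  (tau_all M \<tau> R n r X) (tau_all M \<tau> R n r X) h))
     + pressure \<gamma> R n r h (tau_tuple M \<tau> R n r X)"

definition inf_all ::
  "(nat \<Rightarrow> complex mat measure) \<Rightarrow> ('h::chilbert_space \<Rightarrow> 'h) set \<Rightarrow> (('h \<Rightarrow> 'h) \<Rightarrow> complex) \<Rightarrow>
   real \<Rightarrow> nat \<Rightarrow> (nat \<Rightarrow> nat) \<Rightarrow> (nat \<Rightarrow> nat \<Rightarrow> 'h \<Rightarrow> 'h) \<Rightarrow> ereal" where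
  "inf_all \<gamma> M \<tau> R n r X =
     (INF h\<in>{h \<in> carrier (C_all2 R n r). star (C_all2 R n r) h = h}. shifted_pressure \<gamma> M \<tau> R n r X h)"

definition inf_poly ::
  "(nat \<Rightarrow> complex mat measure) \<Rightarrow> ('h::chilbert_space \<Rightarrow> 'h) set \<Rightarrow> (('h \<Rightarrow> 'h) \<Rightarrow> complex) \<Rightarrow>
   real \<Rightarrow> nat \<Rightarrow> (nat \<Rightarrow> nat) \<Rightarrow> (nat \<Rightarrow> nat \<Rightarrow> 'h \<Rightarrow> 'h) \<Rightarrow> ereal" where
  "inf_poly \<gamma> M \<tau> R n r X =
     (INF p\<in>{p \<in> nc_polys2 R n r. star (C_all2 R n r) p = p}. shifted_pressure \<gamma> M \<tau> R n r X p)"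

end

theory Submission
  imports Defs "HOL-Computational_Algebra.Fundamental_Theorem_Algebra"
begin

text \<open>The theorem is a variational principle of Varadhan type for the Haar measure of \<open>U(N)\<^sup>n\<close> at speed
  \<open>N\<^sup>2\<close>, and it is proved by the chain
  \<open>\<chi>\<^sub>o\<^sub>r\<^sub>b \<le> inf over all h \<le> inf over polynomials p \<le> \<chi>\<^sub>o\<^sub>r\<^sub>b\<close> with the cut-off constant \<open>R\<close>.

  First inequality (\<open>chi_orb_le_pressure\<close>).  On an orbital microstate the traces of words are close to the
  moments of \<open>X\<close>.  Polynomials are dense and all evaluations are contractive, so
  \<open>(tr \<otimes> tr)(h)\<close> is close to \<open>(\<tau>\<^sub>X \<otimes> \<tau>\<^sub>X)(h)\<close>, uniformly over all microstates with large \<open>m\<close> and small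
  \<open>\<delta>\<close> (\<open>tr2_close\<close>).  Restricting the integral in the pressure to orbital microstates therefore costs only
  the factor \<open>exp (- N\<^sup>2 ((\<tau>\<^sub>X \<otimes> \<tau>\<^sub>X)(h) + \<epsilon>))\<close>.  The tuples over which the pressure takes its supremum are
  no obstacle: the moments of a single tuple are not changed by conjugation, so a tuple of matrices with at
  least one orbital microstate has the right moments by itself (\<open>Gamma_R_of_Gam\<close>).

  Last inequality (\<open>inf_poly_le_rate\<close>).  This is where the tensor square matters: for a word \<open>w\<close> and
  \<open>u = w - \<tau>(w)\<close>, the value of a product state \<open>\<sigma> \<otimes> \<sigma>\<close> at \<open>u\<^sup>* \<otimes> u\<close> is
  \<open>|\<sigma>(w) - \<tau>(w)|\<^sup>2\<close>.  Summing over the words of length at most \<open>m\<close> and multiplying by \<open>\<beta>\<close> gives a polynomial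
  that vanishes at \<open>\<tau>\<^sub>X \<otimes> \<tau>\<^sub>X\<close>, is nonnegative at every microstate, and is at least \<open>\<beta> \<delta>\<^sup>2\<close> off the orbital
  microstate space (\<open>square_penalty\<close>).  So the integral is at most \<open>\<gamma>(\<Gamma>\<^sub>o\<^sub>r\<^sub>b) + exp (- N\<^sup>2 \<beta> \<delta>\<^sup>2)\<close>, and the
  second term disappears as \<open>\<beta> \<rightarrow> \<infinity>\<close>.

  The entropy does not depend on the cut-off constant (\<open>chi_orb_cut_off_le\<close>): cutting the spectrum of the
  matrices off at a smaller constant that still bounds the norms of the \<open>X i j\<close> moves them by little in the
  normalized Hilbert--Schmidt norm as soon as one high even moment is right, and this changes the traces of
  words by little, uniformly in the unitaries.

  The larger part of the text provides the algebras.  Free products and minimal tensor products are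
  completions of formal algebras, and the evaluations \<open>f(A)\<close>, \<open>h(A)\<close> and the product state are chosen among
  the maps with the required properties, so such maps have to be constructed.  Operator norms
  and the minimal tensor norm are given by the suprema of \<open>\<omega>(a\<^sup>* a)\<close> over
  families of positive functionals, normalized at \<open>1\<close>, that are stable under \<open>a \<mapsto> b\<^sup>* a b\<close> (locale
  \<open>positive_family\<close>).  From this alone follow the C*-identity and, for selfadjoint \<open>a\<close> of norm at most \<open>R\<close>,
  the estimate of \<open>\<parallel>p(a)\<parallel>\<close> by the maximum of \<open>|p|\<close> on \<open>[-R, R]\<close> behind the continuous functional
  calculus (\<open>poly_ev_norm_le\<close>).  With the
  universal property of the free product it yields the evaluations at selfadjoint elements
  (\<open>eval_at_star_hom\<close>).  On the tensor square, matrix evaluation is continuous for the minimal norm because the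
  trace of \<open>M\<^sub>N \<otimes> M\<^sub>N\<close> pulls back to a product of states and is faithful (\<open>tensor_universal\<close>).
  Of the chosen maps the arguments use only that they are contractive and which values they take on words and
  elementary tensors, which determines them by density.\<close>

section \<open>Star algebras with a C*-seminorm\<close>

locale star_algebra =
  fixes A :: "('a, 'm) star_alg_scheme" (structure)
  assumes zero_in [simp, intro]: "\<zero> \<in> carrier A"
    and one_in [simp, intro]: "\<one> \<in> carrier A"
    and add_in [simp, intro]: "x \<in> carrier A \<Longrightarrow> y \<in> carrier A \<Longrightarrow> x \<oplus> y \<in> carrier A"
    and mult_in [simp, intro]: "x \<in> carrier A \<Longrightarrow> y \<in> carrier A \<Longrightarrow> x \<otimes> y \<in> carrier A"
    and smult_in [simp, intro]: "x \<in> carrier A \<Longrightarrow> c \<odot> x \<in> carrier A"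
    and star_in [simp, intro]: "x \<in> carrier A \<Longrightarrow> star A x \<in> carrier A"
    and add_assoc: "x \<in> carrier A \<Longrightarrow> y \<in> carrier A \<Longrightarrow> z \<in> carrier A \<Longrightarrow>
      (x \<oplus> y) \<oplus> z = x \<oplus> (y \<oplus> z)"
    and add_comm: "x \<in> carrier A \<Longrightarrow> y \<in> carrier A \<Longrightarrow> x \<oplus> y = y \<oplus> x"
    and add_zero_left [simp]: "x \<in> carrier A \<Longrightarrow> \<zero> \<oplus> x = x"
    and smult_zero_left [simp]: "x \<in> carrier A \<Longrightarrow> 0 \<odot> x = \<zero>"
    and smult_one [simp]: "x \<in> carrier A \<Longrightarrow> 1 \<odot> x = x"
    and smult_smult [simp]: "x \<in> carrier A \<Longrightarrow> a \<odot> (b \<odot> x) = (a * b) \<odot> x"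
    and smult_add_left: "x \<in> carrier A \<Longrightarrow> (a + b) \<odot> x = a \<odot> x \<oplus> b \<odot> x"
    and smult_add_right: "x \<in> carrier A \<Longrightarrow> y \<in> carrier A \<Longrightarrow> a \<odot> (x \<oplus> y) = a \<odot> x \<oplus> a \<odot> y"
    and mult_assoc: "x \<in> carrier A \<Longrightarrow> y \<in> carrier A \<Longrightarrow> z \<in> carrier A \<Longrightarrow>
      (x \<otimes> y) \<otimes> z = x \<otimes> (y \<otimes> z)"
    and one_left [simp]: "x \<in> carrier A \<Longrightarrow> \<one> \<otimes> x = x"
    and one_right [simp]: "x \<in> carrier A \<Longrightarrow> x \<otimes> \<one> = x"
    and distrib_right: "x \<in> carrier A \<Longrightarrow> y \<in> carrier A \<Longrightarrow> z \<in> carrier A \<Longrightarrow>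
      (x \<oplus> y) \<otimes> z = x \<otimes> z \<oplus> y \<otimes> z"
    and distrib_left: "x \<in> carrier A \<Longrightarrow> y \<in> carrier A \<Longrightarrow> z \<in> carrier A \<Longrightarrow>
      z \<otimes> (x \<oplus> y) = z \<otimes> x \<oplus> z \<otimes> y"
    and smult_mult_left [simp]: "x \<in> carrier A \<Longrightarrow> y \<in> carrier A \<Longrightarrow> (c \<odot> x) \<otimes> y = c \<odot> (x \<otimes> y)"
    and smult_mult_right [simp]: "x \<in> carrier A \<Longrightarrow> y \<in> carrier A \<Longrightarrow> x \<otimes> (c \<odot> y) = c \<odot> (x \<otimes> y)"
    and star_star [simp]: "x \<in> carrier A \<Longrightarrow> star A (star A x) = x"
    and star_add [simp]: "x \<in> carrier A \<Longrightarrow> y \<in> carrier A \<Longrightarrow> star A (x \<oplus> y) = star A x \<oplus> star A y"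
    and star_smult [simp]: "x \<in> carrier A \<Longrightarrow> star A (c \<odot> x) = cnj c \<odot> star A x"
    and star_mult [simp]: "x \<in> carrier A \<Longrightarrow> y \<in> carrier A \<Longrightarrow> star A (x \<otimes> y) = star A y \<otimes> star A x"
begin

lemma add_left_comm: "x \<in> carrier A \<Longrightarrow> y \<in> carrier A \<Longrightarrow> z \<in> carrier A \<Longrightarrow>
    x \<oplus> (y \<oplus> z) = y \<oplus> (x \<oplus> z)"
proof -
  assume "x \<in> carrier A" "y \<in> carrier A" "z \<in> carrier A"
  then have "(x \<oplus> y) \<oplus> z = (y \<oplus> x) \<oplus> z" by (simp only: add_comm)
  then show ?thesis using \<open>x \<in> _\<close> \<open>y \<in> _\<close> \<open>z \<in> _\<close> by (simp only: add_assoc)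
qed

lemmas add_ac = add_assoc add_comm add_left_comm

lemma add_zero_right [simp]: "x \<in> carrier A \<Longrightarrow> x \<oplus> \<zero> = x"
  by (simp add: add_comm[of x])

lemma smult_zero_right [simp]: "c \<odot> \<zero> = \<zero>"
  using smult_smult[of \<zero> c 0] by simp

lemma add_neg [simp]: "x \<in> carrier A \<Longrightarrow> x \<oplus> (-1) \<odot> x = \<zero>"
  using smult_add_left[of x 1 "-1"] by simp

lemma neg_add_cancel [simp]: "x \<in> carrier A \<Longrightarrow> y \<in> carrier A \<Longrightarrow> (-1) \<odot> x \<oplus> (x \<oplus> y) = y"
  by (subst add_assoc[symmetric]) (simp_all add: add_comm[of _ x])

lemma mult_zero_left [simp]: "x \<in> carrier A \<Longrightarrow> \<zero> \<otimes> x = \<zero>"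
  using smult_mult_left[of \<zero> x 0] by simp

lemma mult_zero_right [simp]: "x \<in> carrier A \<Longrightarrow> x \<otimes> \<zero> = \<zero>"
  using smult_mult_right[of x \<zero> 0] by simp

lemma star_zero [simp]: "star A \<zero> = \<zero>"
  using star_smult[of \<zero> 0] by simp

lemma star_one [simp]: "star A \<one> = \<one>"
  using star_mult[of "star A \<one>" \<one>] by simp

lemma eq_of_diff_zero: "x \<in> carrier A \<Longrightarrow> y \<in> carrier A \<Longrightarrow> x \<oplus> (-1) \<odot> y = \<zero> \<Longrightarrow> x = y"
proof -
  assume x: "x \<in> carrier A" and y: "y \<in> carrier A" and *: "x \<oplus> (-1) \<odot> y = \<zero>"
  have "x = (x \<oplus> (-1) \<odot> y) \<oplus> y" using x y by (simp add: add_assoc add_comm[of "(-1) \<odot> y" y])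
  then show ?thesis using y * by simp
qed

lemma word_prod_in [simp]: "(\<And>k. k \<in> set w \<Longrightarrow> a k \<in> carrier A) \<Longrightarrow> word_prod A a w \<in> carrier A"
  by (induction w) (auto simp: word_prod_def)

lemma word_prod_Nil [simp]: "word_prod A a [] = \<one>"
  and word_prod_Cons [simp]: "word_prod A a (k # w) = a k \<otimes> word_prod A a w"
  by (auto simp: word_prod_def)

lemma word_prod_append: "(\<And>k. k \<in> set v \<union> set w \<Longrightarrow> a k \<in> carrier A) \<Longrightarrow>
    word_prod A a (v @ w) = word_prod A a v \<otimes> word_prod A a w"
proof (induction v)
  case (Cons k v)
  then have "word_prod A a v \<in> carrier A" "word_prod A a w \<in> carrier A" "a k \<in> carrier A" by simp_all
  with Cons show ?case by (simp add: mult_assoc)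
qed simp

lemma star_word_prod: "(\<And>k. k \<in> set w \<Longrightarrow> a k \<in> carrier A \<and> star A (a k) = a k) \<Longrightarrow>
    star A (word_prod A a w) = word_prod A a (rev w)"
proof (induction w)
  case (Cons k w)
  then have "\<And>j. j \<in> set (rev w) \<union> set [k] \<Longrightarrow> a j \<in> carrier A" by auto
  from word_prod_append[of "rev w" "[k]" a, OF this]
  have "word_prod A a (rev w @ [k]) = word_prod A a (rev w) \<otimes> word_prod A a [k]" by blast
  then show ?case using Cons by simp
qed simp

end

definition dst :: "('a, 'm) star_alg_scheme \<Rightarrow> ('a \<Rightarrow> real) \<Rightarrow> 'a \<Rightarrow> 'a \<Rightarrow> real" where
  "dst A N x y = N (x \<oplus>\<^bsub>A\<^esub> (-1) \<odot>\<^bsub>A\<^esub> y)"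

locale seminormed_star_algebra = star_algebra A for A :: "('a, 'm) star_alg_scheme" (structure) +
  fixes N :: "'a \<Rightarrow> real"
  assumes N_ge0 [simp]: "x \<in> carrier A \<Longrightarrow> 0 \<le> N x"
    and N_add: "x \<in> carrier A \<Longrightarrow> y \<in> carrier A \<Longrightarrow> N (x \<oplus> y) \<le> N x + N y"
    and N_smult [simp]: "x \<in> carrier A \<Longrightarrow> N (c \<odot> x) = cmod c * N x"
    and N_mult: "x \<in> carrier A \<Longrightarrow> y \<in> carrier A \<Longrightarrow> N (x \<otimes> y) \<le> N x * N y"
    and N_star_mult: "x \<in> carrier A \<Longrightarrow> N (star A x \<otimes> x) = (N x)\<^sup>2"
begin

lemma N_zero [simp]: "N \<zero> = 0"
  using N_smult[of \<zero> 0] by simp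

lemma N_star [simp]: assumes "x \<in> carrier A" shows "N (star A x) = N x"
proof -
  have "N x \<le> N (star A x)" if "x \<in> carrier A" for x
  proof (cases "N x = 0")
    case False
    have "N x * N x \<le> N (star A x) * N x"
      using N_star_mult[OF that] N_mult[of "star A x" x] that by (simp add: power2_eq_square)
    moreover have "N x > 0" using False N_ge0[OF that] by linarith
    ultimately show ?thesis by simp
  qed (use that in simp)
  from this[OF assms] this[of "star A x"] assms show ?thesis by simp
qed

lemma dst_ge0 [simp]: "x \<in> carrier A \<Longrightarrow> y \<in> carrier A \<Longrightarrow> 0 \<le> dst A N x y"
  by (simp add: dst_def)

lemma dst_refl [simp]: "x \<in> carrier A \<Longrightarrow> dst A N x x = 0"
  by (simp add: dst_def)

lemma dst_smult: "x \<in> carrier A \<Longrightarrow> y \<in> carrier A \<Longrightarrow> dst A N (c \<odot> x) (c \<odot> y) = cmod c * dst A N x y"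
proof -
  assume xy: "x \<in> carrier A" "y \<in> carrier A"
  have "c \<odot> x \<oplus> (-1) \<odot> (c \<odot> y) = c \<odot> (x \<oplus> (-1) \<odot> y)"
    using xy by (simp add: smult_add_right)
  then show ?thesis unfolding dst_def using xy by (simp only: N_smult add_in smult_in)
qed

lemma dst_sym: "x \<in> carrier A \<Longrightarrow> y \<in> carrier A \<Longrightarrow> dst A N x y = dst A N y x"
proof -
  assume xy: "x \<in> carrier A" "y \<in> carrier A"
  have "y \<oplus> (-1) \<odot> x = (-1) \<odot> (x \<oplus> (-1) \<odot> y)"
    using xy by (simp add: smult_add_right add_comm)
  then show ?thesis unfolding dst_def using xy N_smult[of "x \<oplus> (-1) \<odot> y" "-1"] by simp
qed

lemma dst_triangle: "x \<in> carrier A \<Longrightarrow> y \<in> carrier A \<Longrightarrow> z \<in> carrier A \<Longrightarrow>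
    dst A N x z \<le> dst A N x y + dst A N y z"
proof -
  assume xy: "x \<in> carrier A" "y \<in> carrier A" "z \<in> carrier A"
  have "x \<oplus> (-1) \<odot> z = (x \<oplus> (-1) \<odot> y) \<oplus> (y \<oplus> (-1) \<odot> z)"
    using xy by (simp add: add_assoc)
  then show ?thesis unfolding dst_def using xy by (simp only: N_add add_in smult_in)
qed

lemma dst_add: "x \<in> carrier A \<Longrightarrow> y \<in> carrier A \<Longrightarrow> x' \<in> carrier A \<Longrightarrow> y' \<in> carrier A \<Longrightarrow>
    dst A N (x \<oplus> y) (x' \<oplus> y') \<le> dst A N x x' + dst A N y y'"
proof -
  assume xy: "x \<in> carrier A" "y \<in> carrier A" "x' \<in> carrier A" "y' \<in> carrier A"
  have "(x \<oplus> y) \<oplus> (-1) \<odot> (x' \<oplus> y') = (x \<oplus> (-1) \<odot> x') \<oplus> (y \<oplus> (-1) \<odot> y')"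
    using xy by (simp add: smult_add_right add_ac)
  then show ?thesis unfolding dst_def using xy by (simp only: N_add add_in smult_in)
qed

lemma dst_mult: "x \<in> carrier A \<Longrightarrow> y \<in> carrier A \<Longrightarrow> x' \<in> carrier A \<Longrightarrow> y' \<in> carrier A \<Longrightarrow>
    dst A N (x \<otimes> y) (x' \<otimes> y') \<le> N x * dst A N y y' + dst A N x x' * N y'"
proof -
  assume xy: "x \<in> carrier A" "y \<in> carrier A" "x' \<in> carrier A" "y' \<in> carrier A"
  have "(x \<otimes> y) \<oplus> (-1) \<odot> (x' \<otimes> y') = x \<otimes> (y \<oplus> (-1) \<odot> y') \<oplus> (x \<oplus> (-1) \<odot> x') \<otimes> y'"
    using xy by (simp add: distrib_left distrib_right add_assoc)
  then have "dst A N (x \<otimes> y) (x' \<otimes> y') \<le> N (x \<otimes> (y \<oplus> (-1) \<odot> y')) + N ((x \<oplus> (-1) \<odot> x') \<otimes> y')"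
    unfolding dst_def using xy by (simp only: N_add add_in smult_in mult_in)
  also have "\<dots> \<le> N x * dst A N y y' + dst A N x x' * N y'"
    unfolding dst_def using xy by (intro add_mono N_mult) auto
  finally show ?thesis .
qed

lemma dst_star [simp]: "x \<in> carrier A \<Longrightarrow> y \<in> carrier A \<Longrightarrow> dst A N (star A x) (star A y) = dst A N x y"
proof -
  assume xy: "x \<in> carrier A" "y \<in> carrier A"
  have "star A x \<oplus> (-1) \<odot> star A y = star A (x \<oplus> (-1) \<odot> y)"
    using xy by simp
  then show ?thesis unfolding dst_def using xy by (simp only: N_star add_in smult_in)
qed

lemma N_dst: "x \<in> carrier A \<Longrightarrow> y \<in> carrier A \<Longrightarrow> N x \<le> N y + dst A N x y"
proof -
  assume xy: "x \<in> carrier A" "y \<in> carrier A"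
  have "x = y \<oplus> (x \<oplus> (-1) \<odot> y)"
    using xy by (subst add_left_comm) auto
  then show ?thesis unfolding dst_def using xy N_add[of y "x \<oplus> (-1) \<odot> y"] by simp
qed

lemma abs_N_diff: "x \<in> carrier A \<Longrightarrow> y \<in> carrier A \<Longrightarrow> \<bar>N x - N y\<bar> \<le> dst A N x y"
  using N_dst[of x y] N_dst[of y x] dst_sym[of x y] by linarith

end

lemma seminormed_star_algebraI:
  assumes "star_algebra B" "cstar_seminorm B N"
  shows "seminormed_star_algebra B N"
proof -
  interpret star_algebra B by fact
  show ?thesis
    by unfold_locales (use assms(2) in \<open>simp_all add: cstar_seminorm_def\<close>)
qed

locale cstar_algebra = seminormed_star_algebra A "nrm A" for A :: "'a cstar_alg" (structure) +
  assumes nrm_definite: "x \<in> carrier A \<Longrightarrow> nrm A x = 0 \<Longrightarrow> x = \<zero>"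
begin

lemma dst_eq_zero: "x \<in> carrier A \<Longrightarrow> y \<in> carrier A \<Longrightarrow> dst A (nrm A) x y = 0 \<Longrightarrow> x = y"
  unfolding dst_def by (rule eq_of_diff_zero, assumption, assumption, rule nrm_definite) auto

lemma dst_small_eq: assumes "x \<in> carrier A" "y \<in> carrier A" "\<And>e. e > 0 \<Longrightarrow> dst A (nrm A) x y \<le> e"
  shows "x = y"
proof (rule dst_eq_zero)
  have "dst A (nrm A) x y \<le> 0" by (rule field_le_epsilon) (use assms in auto)
  then show "dst A (nrm A) x y = 0" using dst_ge0[OF assms(1,2)] by linarith
qed (use assms in auto)

end

locale complete_cstar_algebra = cstar_algebra +
  assumes complete: "\<And>s. (\<And>k. s k \<in> carrier A) \<Longrightarrow>
      (\<And>e. e > 0 \<Longrightarrow> \<exists>K. \<forall>k\<ge>K. \<forall>l\<ge>K. dst A (nrm A) (s k) (s l) < e) \<Longrightarrow>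
      \<exists>x\<in>carrier A. (\<lambda>k. dst A (nrm A) (s k) x) \<longlonglongrightarrow> 0"

section \<open>Completions\<close>

lemma completion_sel:
  "carrier (completion B N) = cauchy_class B N ` cauchy_seqs B N"
  "mult (completion B N) P Q = cauchy_class B N (\<lambda>k. repr P k \<otimes>\<^bsub>B\<^esub> repr Q k)"
  "one (completion B N) = cauchy_class B N (\<lambda>k. \<one>\<^bsub>B\<^esub>)"
  "zero (completion B N) = cauchy_class B N (\<lambda>k. \<zero>\<^bsub>B\<^esub>)"
  "add (completion B N) P Q = cauchy_class B N (\<lambda>k. repr P k \<oplus>\<^bsub>B\<^esub> repr Q k)"
  "smult (completion B N) c P = cauchy_class B N (\<lambda>k. c \<odot>\<^bsub>B\<^esub> repr P k)"
  "star (completion B N) P = cauchy_class B N (\<lambda>k. star B (repr P k))"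
  "nrm (completion B N) P = lim (\<lambda>k. N (repr P k))"
  by (simp_all add: completion_def)

text \<open>The chosen representatives in \<open>completion\<close> are harmless because all operations are compatible with
  the equivalence of Cauchy sequences; products need in addition that Cauchy sequences are bounded.\<close>

locale pre_cstar_algebra = seminormed_star_algebra B N for B :: "'a star_alg" (structure) and N
begin

abbreviation "S \<equiv> cauchy_seqs B N"
abbreviation "cls \<equiv> cauchy_class B N"
abbreviation "C \<equiv> completion B N"
abbreviation "d \<equiv> dst B N"

lemma cauchy_seqs_iff: "s \<in> S \<longleftrightarrow> (\<forall>k. s k \<in> carrier B) \<and>
    (\<forall>e>0. \<exists>K. \<forall>k\<ge>K. \<forall>l\<ge>K. d (s k) (s l) < e)"
  by (simp add: cauchy_seqs_def dst_def)

lemma cauchy_seqs_carrier [simp]: "s \<in> S \<Longrightarrow> s k \<in> carrier B"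
  by (simp add: cauchy_seqs_iff)

lemma cauchy_seqsD: "s \<in> S \<Longrightarrow> e > 0 \<Longrightarrow> \<exists>K. \<forall>k\<ge>K. \<forall>l\<ge>K. d (s k) (s l) < e"
  by (simp add: cauchy_seqs_iff)

lemma cauchy_seqsI:
  assumes "s \<in> S" "t \<in> S" "\<And>k. f k \<in> carrier B"
    and "\<And>k l. d (f k) (f l) \<le> M * (d (s k) (s l) + d (t k) (t l))"
  shows "f \<in> S"
  unfolding cauchy_seqs_iff
proof (intro conjI allI impI)
  fix e :: real assume "e > 0"
  define e' where "e' = e / (2 * (\<bar>M\<bar> + 1))"
  have M1: "\<bar>M\<bar> + 1 \<noteq> 0" by linarith
  have "e' > 0" using \<open>e > 0\<close> by (simp add: e'_def)
  then obtain K L where K: "\<And>k l. k \<ge> K \<Longrightarrow> l \<ge> K \<Longrightarrow> d (s k) (s l) < e'"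
    and L: "\<And>k l. k \<ge> L \<Longrightarrow> l \<ge> L \<Longrightarrow> d (t k) (t l) < e'"
    using cauchy_seqsD[OF assms(1)] cauchy_seqsD[OF assms(2)] by metis
  show "\<exists>K. \<forall>k\<ge>K. \<forall>l\<ge>K. d (f k) (f l) < e"
  proof (intro exI[of _ "max K L"] allI impI)
    fix k l assume kl: "k \<ge> max K L" "l \<ge> max K L"
    have ge: "0 \<le> d (s k) (s l)" "0 \<le> d (t k) (t l)" using assms by auto
    have "d (f k) (f l) \<le> M * (d (s k) (s l) + d (t k) (t l))" by fact
    also have "\<dots> \<le> (\<bar>M\<bar> + 1) * (d (s k) (s l) + d (t k) (t l))"
      using ge by (intro mult_right_mono) auto
    also have "\<dots> < (\<bar>M\<bar> + 1) * (e' + e')"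
      using K[of k l] L[of k l] kl by (intro mult_strict_left_mono add_strict_mono) auto
    also have "\<dots> = e" using M1 by (simp add: e'_def divide_simps)
    finally show "d (f k) (f l) < e" .
  qed
qed (use assms in auto)

lemma cls_eq_iff: assumes "s \<in> S" "t \<in> S" shows "cls s = cls t \<longleftrightarrow> (\<lambda>k. d (s k) (t k)) \<longlonglongrightarrow> 0"
proof
  assume "cls s = cls t"
  moreover have "s \<in> cls s" using assms by (simp add: cauchy_class_def flip: dst_def)
  ultimately show "(\<lambda>k. d (s k) (t k)) \<longlonglongrightarrow> 0" by (auto simp: cauchy_class_def simp flip: dst_def)
next
  assume lim: "(\<lambda>k. d (s k) (t k)) \<longlonglongrightarrow> 0"
  have "d (t k) (s k) = d (s k) (t k)" for k using assms by (intro dst_sym) auto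
  with lim have lim': "(\<lambda>k. d (t k) (s k)) \<longlonglongrightarrow> 0" by simp
  have "(\<lambda>k. d (u k) (t k)) \<longlonglongrightarrow> 0 \<longleftrightarrow> (\<lambda>k. d (u k) (s k)) \<longlonglongrightarrow> 0" if u: "u \<in> S" for u
  proof
    assume *: "(\<lambda>k. d (u k) (s k)) \<longlonglongrightarrow> 0"
    show "(\<lambda>k. d (u k) (t k)) \<longlonglongrightarrow> 0"
      by (rule tendsto_sandwich[OF _ _ tendsto_const tendsto_add_zero[OF * lim]])
         (use assms u dst_triangle in auto)
  next
    assume *: "(\<lambda>k. d (u k) (t k)) \<longlonglongrightarrow> 0"
    show "(\<lambda>k. d (u k) (s k)) \<longlonglongrightarrow> 0"
      by (rule tendsto_sandwich[OF _ _ tendsto_const tendsto_add_zero[OF * lim']])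
         (use assms u dst_triangle in auto)
  qed
  then show "cls s = cls t" by (auto simp: cauchy_class_def simp flip: dst_def)
qed

lemma cls_eqI:
  assumes "s \<in> S" "s' \<in> S" "t \<in> S" "t' \<in> S" "f \<in> S" "g \<in> S" "cls s = cls s'" "cls t = cls t'"
    and "\<And>k. d (f k) (g k) \<le> M * (d (s k) (s' k) + d (t k) (t' k))"
  shows "cls f = cls g"
proof -
  have "(\<lambda>k. d (s k) (s' k)) \<longlonglongrightarrow> 0" "(\<lambda>k. d (t k) (t' k)) \<longlonglongrightarrow> 0"
    using assms cls_eq_iff by auto
  then have *: "(\<lambda>k. M * (d (s k) (s' k) + d (t k) (t' k))) \<longlonglongrightarrow> 0"
    by (intro tendsto_mult_right_zero tendsto_add_zero)
  have "(\<lambda>k. d (f k) (g k)) \<longlonglongrightarrow> 0"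
    by (rule tendsto_sandwich[OF _ _ tendsto_const *]) (use assms in auto)
  then show ?thesis using assms cls_eq_iff by auto
qed

lemma cauchy_bounded: assumes "s \<in> S" obtains M where "M \<ge> 0" "\<And>k. N (s k) \<le> M"
proof -
  obtain K where K: "\<And>k l. k \<ge> K \<Longrightarrow> l \<ge> K \<Longrightarrow> d (s k) (s l) < 1"
    using cauchy_seqsD[OF assms, of 1] by auto
  define M where "M = (\<Sum>k\<le>K. N (s k)) + 1"
  have le: "N (s k) \<le> (\<Sum>k\<le>K. N (s k))" if "k \<le> K" for k
    using that assms by (intro member_le_sum) auto
  have "N (s k) \<le> M" for k
  proof (cases "k \<le> K")
    case False
    have "N (s k) \<le> N (s K) + d (s k) (s K)" using assms by (intro N_dst) auto
    then show ?thesis using K[of k K] le[of K] False by (simp add: M_def)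
  qed (use le in \<open>auto simp: M_def add_increasing2\<close>)
  moreover have "M \<ge> 0" using assms by (auto simp: M_def intro!: add_nonneg_nonneg sum_nonneg)
  ultimately show ?thesis using that by blast
qed

lemma cauchy_const [simp]: "a \<in> carrier B \<Longrightarrow> (\<lambda>k. a) \<in> S"
  by (auto simp: cauchy_seqs_iff)

lemma cauchy_add [simp]: "s \<in> S \<Longrightarrow> t \<in> S \<Longrightarrow> (\<lambda>k. s k \<oplus> t k) \<in> S"
  by (rule cauchy_seqsI[of s t _ 1]) (auto simp: dst_add)

lemma cauchy_smult [simp]: "s \<in> S \<Longrightarrow> (\<lambda>k. c \<odot> s k) \<in> S"
  by (rule cauchy_seqsI[of s s _ "cmod c"]) (auto simp: dst_smult distrib_left mult_nonneg_nonneg)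

lemma cauchy_star [simp]: "s \<in> S \<Longrightarrow> (\<lambda>k. star B (s k)) \<in> S"
  by (rule cauchy_seqsI[of s s _ 1]) auto

lemma dst_mult_bounded:
  assumes "x \<in> carrier B" "y \<in> carrier B" "x' \<in> carrier B" "y' \<in> carrier B"
    and "N x \<le> M" "N y' \<le> M"
  shows "d (x \<otimes> y) (x' \<otimes> y') \<le> M * (d x x' + d y y')"
proof -
  have "d (x \<otimes> y) (x' \<otimes> y') \<le> N x * d y y' + d x x' * N y'" using assms by (intro dst_mult)
  also have "\<dots> \<le> M * d y y' + d x x' * M"
    using assms by (intro add_mono mult_right_mono mult_left_mono) auto
  finally show ?thesis by (simp add: algebra_simps)
qed

lemma cauchy_mult [simp]: assumes "s \<in> S" "t \<in> S" shows "(\<lambda>k. s k \<otimes> t k) \<in> S"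
proof -
  obtain M1 M2 where "\<And>k. N (s k) \<le> M1" "\<And>k. N (t k) \<le> M2" using assms cauchy_bounded by metis
  then have "N (s k) \<le> max M1 M2" "N (t k) \<le> max M1 M2" for k by (simp_all add: le_max_iff_disj)
  then show ?thesis
    using assms by (intro cauchy_seqsI[OF assms, of _ "max M1 M2"] dst_mult_bounded) auto
qed

lemma completion_carrierE: assumes "P \<in> carrier C" obtains s where "s \<in> S" "P = cls s"
  using assms by (auto simp: completion_sel)

lemma cls_in [simp]: "s \<in> S \<Longrightarrow> cls s \<in> carrier C"
  by (auto simp: completion_sel)

lemma repr_cls: assumes "s \<in> S" shows "repr (cls s) \<in> S" "cls (repr (cls s)) = cls s"
proof -
  have "s \<in> cls s" using assms by (simp add: cauchy_class_def flip: dst_def)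
  then have r: "repr (cls s) \<in> cls s" unfolding repr_def by (rule someI[of "\<lambda>u. u \<in> cls s"])
  then show "repr (cls s) \<in> S" by (simp add: cauchy_class_def)
  with r assms show "cls (repr (cls s)) = cls s"
    by (simp add: cls_eq_iff) (simp add: cauchy_class_def flip: dst_def)
qed

lemma completion_add [simp]: "s \<in> S \<Longrightarrow> t \<in> S \<Longrightarrow> cls s \<oplus>\<^bsub>C\<^esub> cls t = cls (\<lambda>k. s k \<oplus> t k)"
  unfolding completion_sel
  by (rule cls_eqI[of "repr (cls s)" s "repr (cls t)" t _ _ 1]) (auto simp: repr_cls dst_add)

lemma completion_smult [simp]: "s \<in> S \<Longrightarrow> c \<odot>\<^bsub>C\<^esub> cls s = cls (\<lambda>k. c \<odot> s k)"
  unfolding completion_sel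
  by (rule cls_eqI[of "repr (cls s)" s s s _ _ "cmod c"]) (auto simp: repr_cls dst_smult)

lemma completion_star [simp]: "s \<in> S \<Longrightarrow> star C (cls s) = cls (\<lambda>k. star B (s k))"
  unfolding completion_sel
  by (rule cls_eqI[of "repr (cls s)" s s s _ _ 1]) (auto simp: repr_cls)

lemma completion_mult [simp]: assumes "s \<in> S" "t \<in> S" shows "cls s \<otimes>\<^bsub>C\<^esub> cls t = cls (\<lambda>k. s k \<otimes> t k)"
proof -
  have r: "repr (cls s) \<in> S" using assms repr_cls by auto
  obtain M1 M2 where "\<And>k. N (repr (cls s) k) \<le> M1" "\<And>k. N (t k) \<le> M2"
    using assms r cauchy_bounded by metis
  then have "N (repr (cls s) k) \<le> max M1 M2" "N (t k) \<le> max M1 M2" for k by (simp_all add: le_max_iff_disj)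
  then show ?thesis unfolding completion_sel
    using assms r by (rule_tac cls_eqI[of "repr (cls s)" s "repr (cls t)" t _ _ "max M1 M2"])
      (auto simp: repr_cls intro!: dst_mult_bounded)
qed

lemma completion_one: "\<one>\<^bsub>C\<^esub> = cls (\<lambda>k. \<one>)" and completion_zero: "\<zero>\<^bsub>C\<^esub> = cls (\<lambda>k. \<zero>)"
  by (simp_all add: completion_sel)

lemma star_algebra_completion: "star_algebra C"
proof -
  have comm: "x \<oplus>\<^bsub>C\<^esub> y = y \<oplus>\<^bsub>C\<^esub> x" if xy: "x \<in> carrier C" "y \<in> carrier C" for x y
  proof -
    obtain s t where st: "s \<in> S" "x = cls s" "t \<in> S" "y = cls t"
      using xy by (meson completion_carrierE)
    then have "s k \<oplus> t k = t k \<oplus> s k" for k by (intro add_comm) auto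
    with st show ?thesis by simp
  qed
  show ?thesis
    by unfold_locales
       (erule (1) comm | (elim completion_carrierE, simp add: completion_one completion_zero add_assoc
        mult_assoc smult_add_left smult_add_right distrib_left distrib_right; fail) |
        (simp add: completion_one completion_zero; fail))+
qed

lemma completion_nrm: assumes "s \<in> S" shows "(\<lambda>k. N (s k)) \<longlonglongrightarrow> nrm C (cls s)"
proof -
  define r where "r = repr (cls s)"
  have r: "r \<in> S" "cls r = cls s" using assms repr_cls by (auto simp: r_def)
  have "Cauchy (\<lambda>k. N (r k))"
    unfolding Cauchy_def
  proof (intro allI impI)
    fix e :: real assume "e > 0"
    then obtain K where K: "\<And>k l. k \<ge> K \<Longrightarrow> l \<ge> K \<Longrightarrow> d (r k) (r l) < e"
      using cauchy_seqsD[OF r(1)] by metis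
    show "\<exists>M. \<forall>m\<ge>M. \<forall>n\<ge>M. dist (N (r m)) (N (r n)) < e"
      unfolding dist_real_def
      by (intro exI[of _ K] allI impI, rule order.strict_trans1[OF abs_N_diff K]) (use r in auto)
  qed
  then have conv: "(\<lambda>k. N (r k)) \<longlonglongrightarrow> nrm C (cls s)"
    by (simp add: completion_sel r_def convergent_LIMSEQ_iff[symmetric] Cauchy_convergent)
  have "(\<lambda>k. d (s k) (r k)) \<longlonglongrightarrow> 0" using cls_eq_iff[OF assms r(1)] r(2) by simp
  then have "(\<lambda>k. N (s k) - N (r k)) \<longlonglongrightarrow> 0"
    by (rule Lim_null_comparison[rotated]) (use r assms abs_N_diff in auto)
  from tendsto_add[OF this conv] show ?thesis by simp
qed

lemma nrm_leI: "s \<in> S \<Longrightarrow> (\<And>k. k \<ge> K \<Longrightarrow> N (s k) \<le> M) \<Longrightarrow> nrm C (cls s) \<le> M"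
  by (rule LIMSEQ_le_const2[OF completion_nrm]) auto

lemma cstar_algebra_completion: "cstar_algebra C"
proof -
  interpret C: star_algebra C by (rule star_algebra_completion)
  show ?thesis
  proof
    fix x assume "x \<in> carrier C"
    then obtain s where s: "s \<in> S" "x = cls s" by (rule completion_carrierE)
    note lim_s = completion_nrm[OF s(1)]
    show "0 \<le> nrm C x" unfolding s(2) by (rule LIMSEQ_le_const[OF lim_s]) (use s in auto)
    show "nrm C (star C x \<otimes>\<^bsub>C\<^esub> x) = (nrm C x)\<^sup>2"
    proof (rule LIMSEQ_unique)
      show "(\<lambda>k. (N (s k))\<^sup>2) \<longlonglongrightarrow> (nrm C x)\<^sup>2" unfolding s(2) by (intro tendsto_power lim_s)
      show "(\<lambda>k. (N (s k))\<^sup>2) \<longlonglongrightarrow> nrm C (star C x \<otimes>\<^bsub>C\<^esub> x)"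
        using completion_nrm[of "\<lambda>k. star B (s k) \<otimes> s k"] s by (simp add: N_star_mult)
    qed
    show "nrm C (c \<odot>\<^bsub>C\<^esub> x) = cmod c * nrm C x" for c
    proof (rule LIMSEQ_unique)
      show "(\<lambda>k. cmod c * N (s k)) \<longlonglongrightarrow> cmod c * nrm C x" unfolding s(2) by (intro tendsto_intros lim_s)
      show "(\<lambda>k. cmod c * N (s k)) \<longlonglongrightarrow> nrm C (c \<odot>\<^bsub>C\<^esub> x)"
        using completion_nrm[of "\<lambda>k. c \<odot> s k"] s by simp
    qed
    show "x = \<zero>\<^bsub>C\<^esub>" if "nrm C x = 0"
    proof -
      have "N (s k) = d (s k) \<zero>" for k using s by (simp add: dst_def)
      then show ?thesis using lim_s that s by (simp add: completion_zero cls_eq_iff)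
    qed
    fix y assume "y \<in> carrier C"
    then obtain t where t: "t \<in> S" "y = cls t" by (rule completion_carrierE)
    note lim_t = completion_nrm[OF t(1)]
    show "nrm C (x \<oplus>\<^bsub>C\<^esub> y) \<le> nrm C x + nrm C y" unfolding s(2) t(2)
      using s t by (simp, intro LIMSEQ_le[OF completion_nrm tendsto_add[OF lim_s lim_t]]) (auto simp: N_add)
    show "nrm C (x \<otimes>\<^bsub>C\<^esub> y) \<le> nrm C x * nrm C y" unfolding s(2) t(2)
      using s t by (simp, intro LIMSEQ_le[OF completion_nrm tendsto_mult[OF lim_s lim_t]]) (auto simp: N_mult)
  qed
qed

lemma embed_cls: "completion_embed B N a = cls (\<lambda>k. a)"
  by (simp add: completion_embed_def)

lemma embed_hom [simp]:
  "a \<in> carrier B \<Longrightarrow> completion_embed B N a \<in> carrier C"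
  "completion_embed B N \<one> = \<one>\<^bsub>C\<^esub>"
  "a \<in> carrier B \<Longrightarrow> b \<in> carrier B \<Longrightarrow>
     completion_embed B N (a \<oplus> b) = completion_embed B N a \<oplus>\<^bsub>C\<^esub> completion_embed B N b"
  "a \<in> carrier B \<Longrightarrow> completion_embed B N (c \<odot> a) = c \<odot>\<^bsub>C\<^esub> completion_embed B N a"
  "a \<in> carrier B \<Longrightarrow> b \<in> carrier B \<Longrightarrow>
     completion_embed B N (a \<otimes> b) = completion_embed B N a \<otimes>\<^bsub>C\<^esub> completion_embed B N b"
  "a \<in> carrier B \<Longrightarrow> completion_embed B N (star B a) = star C (completion_embed B N a)"
  by (auto simp: embed_cls completion_one)

lemma embed_nrm [simp]: "a \<in> carrier B \<Longrightarrow> nrm C (completion_embed B N a) = N a"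
  using completion_nrm[of "\<lambda>k. a"] by (simp add: embed_cls LIMSEQ_const_iff)

lemma embed_dst: "a \<in> carrier B \<Longrightarrow> b \<in> carrier B \<Longrightarrow>
    dst C (nrm C) (completion_embed B N a) (completion_embed B N b) = d a b"
  unfolding dst_def by (simp flip: embed_hom(3,4))

lemma embed_dense: assumes "P \<in> carrier C" "e > 0"
  shows "\<exists>a\<in>carrier B. dst C (nrm C) P (completion_embed B N a) < e"
proof -
  obtain s where s: "s \<in> S" "P = cls s" using assms by (auto elim: completion_carrierE)
  obtain K where K: "\<And>k l. k \<ge> K \<Longrightarrow> l \<ge> K \<Longrightarrow> d (s k) (s l) < e/2"
    using cauchy_seqsD[OF s(1), of "e/2"] assms(2) by auto
  have "dst C (nrm C) P (completion_embed B N (s K)) = nrm C (cls (\<lambda>k. s k \<oplus> (-1) \<odot> s K))"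
    using s by (simp add: dst_def embed_cls)
  also have "\<dots> \<le> e/2"
    using s K by (intro nrm_leI[of _ K]) (auto simp: dst_def less_imp_le)
  also have "\<dots> < e" using assms by simp
  finally show ?thesis using s by (intro bexI[of _ "s K"]) auto
qed

end

section \<open>Extending maps from dense subsets\<close>

text \<open>Extension of a contractive map by continuity.  The dense set is given by a parametrization \<open>i\<close> and the map by
  its values \<open>f\<close> on the parameters, because formal expressions with the same image are not equal;
  contractivity makes \<open>f\<close> well defined modulo such identifications.\<close>

locale dense_extension = A: cstar_algebra A + D: complete_cstar_algebra D
  for A :: "'a cstar_alg" and D :: "'b cstar_alg" +
  fixes G :: "'g set" and i :: "'g \<Rightarrow> 'a" and f :: "'g \<Rightarrow> 'b"
  assumes i_in [simp]: "g \<in> G \<Longrightarrow> i g \<in> carrier A"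
    and f_in [simp]: "g \<in> G \<Longrightarrow> f g \<in> carrier D"
    and dense: "x \<in> carrier A \<Longrightarrow> e > 0 \<Longrightarrow> \<exists>g\<in>G. dst A (nrm A) x (i g) < e"
    and contractive: "g \<in> G \<Longrightarrow> h \<in> G \<Longrightarrow> dst D (nrm D) (f g) (f h) \<le> dst A (nrm A) (i g) (i h)"
    and G_add: "g \<in> G \<Longrightarrow> h \<in> G \<Longrightarrow> \<exists>k\<in>G. i k = i g \<oplus>\<^bsub>A\<^esub> i h \<and> f k = f g \<oplus>\<^bsub>D\<^esub> f h"
    and G_smult: "g \<in> G \<Longrightarrow> \<exists>k\<in>G. i k = c \<odot>\<^bsub>A\<^esub> i g \<and> f k = c \<odot>\<^bsub>D\<^esub> f g"
begin

abbreviation "dA \<equiv> dst A (nrm A)"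
abbreviation "dD \<equiv> dst D (nrm D)"

text \<open>The condition says that \<open>y\<close> is within the right distance of every value of \<open>f\<close>; by density at most one
  \<open>y\<close> does this.\<close>

definition ext :: "'a \<Rightarrow> 'b" where
  "ext x = (SOME y. y \<in> carrier D \<and> (\<forall>g\<in>G. dD y (f g) \<le> dA x (i g)))"

lemma ext_exists: assumes x: "x \<in> carrier A"
  shows "\<exists>y. y \<in> carrier D \<and> (\<forall>g\<in>G. dD y (f g) \<le> dA x (i g))"
proof -
  have "\<forall>n. \<exists>g\<in>G. dA x (i g) < 1 / real (Suc n)" using dense[OF x] by simp
  then obtain g where g: "\<And>n. g n \<in> G" "\<And>n. dA x (i (g n)) < 1 / real (Suc n)" by metis
  have "\<exists>K. \<forall>k\<ge>K. \<forall>l\<ge>K. dD (f (g k)) (f (g l)) < e" if "e > 0" for e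
  proof -
    have "e / 2 > 0" using that by simp
    then obtain K where K: "1 / real (Suc K) < e / 2" by (rule nat_approx_posE)
    have small: "dA x (i (g k)) < e / 2" if "k \<ge> K" for k
    proof -
      have "1 / real (Suc k) \<le> 1 / real (Suc K)" using that by (intro divide_left_mono) auto
      with K g(2)[of k] show ?thesis by linarith
    qed
    show ?thesis
    proof (intro exI[of _ K] allI impI)
      fix k l assume "k \<ge> K" "l \<ge> K"
      then show "dD (f (g k)) (f (g l)) < e"
        using contractive[OF g(1)[of k] g(1)[of l]] A.dst_triangle[of "i (g k)" x "i (g l)"]
          A.dst_sym[of x "i (g k)"] small[of k] small[of l] x g(1) by auto
    qed
  qed
  then obtain y where y: "y \<in> carrier D" "(\<lambda>k. dD (f (g k)) y) \<longlonglongrightarrow> 0"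
    using D.complete[of "\<lambda>k. f (g k)"] g(1) by auto
  have "dD y (f h) \<le> dA x (i h)" if h: "h \<in> G" for h
  proof -
    have "(\<lambda>k. dD (f (g k)) y + 1 / real (Suc k) + dA x (i h)) \<longlonglongrightarrow> 0 + 0 + dA x (i h)"
      using y(2) lim_1_over_n[THEN LIMSEQ_Suc] by (intro tendsto_intros) auto
    moreover have "dD y (f h) \<le> dD (f (g k)) y + 1 / real (Suc k) + dA x (i h)" for k
      using D.dst_triangle[of y "f (g k)" "f h"] contractive[OF g(1)[of k] h]
        A.dst_triangle[of "i (g k)" x "i h"] A.dst_sym[of x "i (g k)"] D.dst_sym[of y "f (g k)"]
        g(1)[of k] g(2)[of k] h x y(1) f_in i_in by auto
    ultimately show ?thesis by (intro LIMSEQ_le_const) auto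
  qed
  with y show ?thesis by blast
qed

lemma ext_in [simp]: "x \<in> carrier A \<Longrightarrow> ext x \<in> carrier D"
  and ext_dst: "x \<in> carrier A \<Longrightarrow> g \<in> G \<Longrightarrow> dD (ext x) (f g) \<le> dA x (i g)"
  unfolding ext_def using someI_ex[OF ext_exists] by auto

lemma ext_i [simp]: assumes "g \<in> G" shows "ext (i g) = f g"
proof (rule D.dst_eq_zero)
  show "dD (ext (i g)) (f g) = 0"
    by (rule antisym) (use ext_dst[of "i g" g] assms in auto)
qed (use assms in auto)

lemma ext_eqI:
  assumes "x \<in> carrier A" "y \<in> carrier D"
    and "\<And>e. e > 0 \<Longrightarrow> \<exists>k\<in>G. dA x (i k) \<le> e \<and> dD y (f k) \<le> e"
  shows "ext x = y"
proof (rule D.dst_small_eq)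
  fix e :: real assume "e > 0"
  then obtain k where "k \<in> G" "dA x (i k) \<le> e / 2" "dD y (f k) \<le> e / 2" using assms(3)[of "e/2"] by auto
  then show "dD (ext x) y \<le> e"
    using D.dst_triangle[of "ext x" "f k" y] ext_dst[of x k] D.dst_sym[of y "f k"] assms by simp
qed (use assms in auto)

lemma ext_add: assumes xy: "x \<in> carrier A" "y \<in> carrier A"
  shows "ext (x \<oplus>\<^bsub>A\<^esub> y) = ext x \<oplus>\<^bsub>D\<^esub> ext y"
proof (rule ext_eqI)
  fix e :: real assume e: "e > 0"
  obtain g h where gh: "g \<in> G" "h \<in> G" "dA x (i g) < e/2" "dA y (i h) < e/2"
    using dense[OF xy(1), of "e/2"] dense[OF xy(2), of "e/2"] e by auto
  obtain k where k: "k \<in> G" "i k = i g \<oplus>\<^bsub>A\<^esub> i h" "f k = f g \<oplus>\<^bsub>D\<^esub> f h" using G_add gh by blast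
  have "dA (x \<oplus>\<^bsub>A\<^esub> y) (i k) \<le> e" using A.dst_add[of x y "i g" "i h"] gh k xy by simp
  moreover have "dD (ext x \<oplus>\<^bsub>D\<^esub> ext y) (f k) \<le> e"
    using D.dst_add[of "ext x" "ext y" "f g" "f h"] gh k xy ext_dst[of x g] ext_dst[of y h] by simp
  ultimately show "\<exists>k\<in>G. dA (x \<oplus>\<^bsub>A\<^esub> y) (i k) \<le> e \<and> dD (ext x \<oplus>\<^bsub>D\<^esub> ext y) (f k) \<le> e" using k by blast
qed (use xy in auto)

lemma ext_smult: assumes x: "x \<in> carrier A" shows "ext (c \<odot>\<^bsub>A\<^esub> x) = c \<odot>\<^bsub>D\<^esub> ext x"
proof (rule ext_eqI)
  fix e :: real assume e: "e > 0"
  then obtain g where g: "g \<in> G" "dA x (i g) < e / (cmod c + 1)"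
    using dense[OF x, of "e / (cmod c + 1)"] by (auto simp: add_nonneg_pos)
  have pos: "cmod c + 1 > 0" by (simp add: add_nonneg_pos)
  have "cmod c * dA x (i g) \<le> (cmod c + 1) * dA x (i g)" using x g by (intro mult_right_mono) auto
  also have "\<dots> \<le> e" using g pos by (simp add: field_simps)
  finally have *: "cmod c * dA x (i g) \<le> e" .
  obtain k where k: "k \<in> G" "i k = c \<odot>\<^bsub>A\<^esub> i g" "f k = c \<odot>\<^bsub>D\<^esub> f g" using G_smult g by blast
  have "cmod c * dD (ext x) (f g) \<le> cmod c * dA x (i g)" using ext_dst x g by (intro mult_left_mono) auto
  with * have "dA (c \<odot>\<^bsub>A\<^esub> x) (i k) \<le> e \<and> dD (c \<odot>\<^bsub>D\<^esub> ext x) (f k) \<le> e"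
    using x g by (simp add: k A.dst_smult D.dst_smult)
  with k show "\<exists>k\<in>G. dA (c \<odot>\<^bsub>A\<^esub> x) (i k) \<le> e \<and> dD (c \<odot>\<^bsub>D\<^esub> ext x) (f k) \<le> e" by blast
qed (use x in auto)

lemma ext_nrm: assumes x: "x \<in> carrier A" shows "nrm D (ext x) \<le> nrm A x"
proof -
  obtain g where "g \<in> G" using dense[OF x, of 1] by auto
  then obtain k where k: "k \<in> G" "i k = \<zero>\<^bsub>A\<^esub>" "f k = \<zero>\<^bsub>D\<^esub>" using G_smult[of g 0] by auto
  then show ?thesis using ext_dst[OF x k(1)] x by (simp add: dst_def)
qed

lemma ext_star:
  assumes "\<And>g. g \<in> G \<Longrightarrow> \<exists>k\<in>G. i k = star A (i g) \<and> f k = star D (f g)" and x: "x \<in> carrier A"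
  shows "ext (star A x) = star D (ext x)"
proof (rule ext_eqI)
  fix e :: real assume e: "e > 0"
  then obtain g where g: "g \<in> G" "dA x (i g) < e" using dense[OF x] by auto
  obtain k where k: "k \<in> G" "i k = star A (i g)" "f k = star D (f g)" using assms(1)[OF g(1)] by blast
  then show "\<exists>k\<in>G. dA (star A x) (i k) \<le> e \<and> dD (star D (ext x)) (f k) \<le> e"
    using x g ext_dst[OF x g(1)] by (intro bexI[of _ k]) auto
qed (use x in auto)

lemma ext_mult:
  assumes "\<And>g h. g \<in> G \<Longrightarrow> h \<in> G \<Longrightarrow> \<exists>k\<in>G. i k = i g \<otimes>\<^bsub>A\<^esub> i h \<and> f k = f g \<otimes>\<^bsub>D\<^esub> f h"
    and x: "x \<in> carrier A" and y: "y \<in> carrier A"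
  shows "ext (x \<otimes>\<^bsub>A\<^esub> y) = ext x \<otimes>\<^bsub>D\<^esub> ext y"
proof (rule ext_eqI)
  fix e :: real assume e: "e > 0"
  define M where "M = nrm A x + nrm A y + 1"
  have M: "M \<ge> 1" using x y by (simp add: M_def)
  define e' where "e' = min 1 (e / M)"
  have e': "e' > 0" "e' \<le> 1" "M * e' \<le> e" using e M by (auto simp: e'_def min_def field_simps)
  obtain g h where gh: "g \<in> G" "h \<in> G" "dA x (i g) < e'" "dA y (i h) < e'"
    using dense[OF x e'(1)] dense[OF y e'(1)] by auto
  obtain k where k: "k \<in> G" "i k = i g \<otimes>\<^bsub>A\<^esub> i h" "f k = f g \<otimes>\<^bsub>D\<^esub> f h" using assms(1)[OF gh(1,2)] by blast
  have ih: "nrm A (i h) \<le> nrm A y + 1" using A.N_dst[of "i h" y] A.dst_sym[of y "i h"] gh y e' by auto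
  have fh: "nrm D (f h) \<le> nrm A y + 1" using ext_nrm[of "i h"] ih gh by auto
  have comb: "a * b + c * b' \<le> e" if "0 \<le> b" "0 \<le> c" "a \<le> nrm A x" "b' \<le> nrm A y + 1" "b \<le> e'" "c \<le> e'" for a b c b'
  proof -
    have "a * b \<le> nrm A x * e'" using that x by (intro mult_mono) auto
    moreover have "c * b' \<le> c * (nrm A y + 1)" using that by (intro mult_left_mono) auto
    moreover have "c * (nrm A y + 1) \<le> e' * (nrm A y + 1)" using that y by (intro mult_right_mono) auto
    ultimately have "a * b + c * b' \<le> M * e'" by (simp add: M_def algebra_simps)
    with e' show ?thesis by simp
  qed
  have "dA (x \<otimes>\<^bsub>A\<^esub> y) (i k) \<le> e"
    using A.dst_mult[of x y "i g" "i h"] comb[of "dA y (i h)" "dA x (i g)" "nrm A x" "nrm A (i h)"] gh ih x y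
    by (simp add: k)
  moreover have "dD (ext x \<otimes>\<^bsub>D\<^esub> ext y) (f k) \<le> e"
    using D.dst_mult[of "ext x" "ext y" "f g" "f h"] gh fh x y ext_nrm[OF x] ext_dst[of x g] ext_dst[of y h]
      comb[of "dD (ext y) (f h)" "dD (ext x) (f g)" "nrm D (ext x)" "nrm D (f h)"]
    by (simp add: k)
  ultimately show "\<exists>k\<in>G. dA (x \<otimes>\<^bsub>A\<^esub> y) (i k) \<le> e \<and> dD (ext x \<otimes>\<^bsub>D\<^esub> ext y) (f k) \<le> e" using k by blast
qed (use x y in auto)

lemma ext_star_hom:
  assumes "\<And>g. g \<in> G \<Longrightarrow> \<exists>k\<in>G. i k = star A (i g) \<and> f k = star D (f g)"
    and "\<And>g h. g \<in> G \<Longrightarrow> h \<in> G \<Longrightarrow> \<exists>k\<in>G. i k = i g \<otimes>\<^bsub>A\<^esub> i h \<and> f k = f g \<otimes>\<^bsub>D\<^esub> f h"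
    and "\<exists>k\<in>G. i k = \<one>\<^bsub>A\<^esub> \<and> f k = \<one>\<^bsub>D\<^esub>"
  shows "star_hom A D ext"
proof -
  obtain k where "k \<in> G" "i k = \<one>\<^bsub>A\<^esub>" "f k = \<one>\<^bsub>D\<^esub>" using assms(3) by blast
  then have "ext \<one>\<^bsub>A\<^esub> = \<one>\<^bsub>D\<^esub>" using ext_i[of k] by simp
  then show ?thesis
    unfolding star_hom_def
    by (intro conjI ballI allI Pi_I ext_mult[OF assms(2)] ext_star[OF assms(1)] ext_add ext_smult ext_nrm) auto
qed

end

section \<open>Generated subalgebras and closures\<close>

definition gen_span :: "'a cstar_alg \<Rightarrow> ('k \<Rightarrow> 'a) \<Rightarrow> 'k set \<Rightarrow> 'a set" where
  "gen_span A a V = lin_span A {word_prod A a w | w. w \<in> lists V}"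

definition nclosure :: "'a cstar_alg \<Rightarrow> 'a set \<Rightarrow> 'a set" where
  "nclosure A Q = {x \<in> carrier A. \<forall>e>0. \<exists>y\<in>Q. dst A (nrm A) x y < e}"

context cstar_algebra
begin

lemma lin_span_in: assumes "T \<subseteq> carrier A" "x \<in> lin_span A T" shows "x \<in> carrier A"
  using assms(2) by induction (use assms(1) in auto)

lemma gen_span_in: assumes "\<And>k. k \<in> V \<Longrightarrow> a k \<in> carrier A" "x \<in> gen_span A a V" shows "x \<in> carrier A"
  using assms(2) unfolding gen_span_def by (rule lin_span_in[rotated]) (use assms(1) in auto)

lemma gen_span_mult: assumes a: "\<And>k. k \<in> V \<Longrightarrow> a k \<in> carrier A"
    and x: "x \<in> gen_span A a V" and y: "y \<in> gen_span A a V"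
  shows "x \<otimes> y \<in> gen_span A a V"
proof -
  let ?T = "{word_prod A a w | w. w \<in> lists V}"
  have T: "?T \<subseteq> carrier A" using a by auto
  show ?thesis using x unfolding gen_span_def
  proof induction
    case zero
    then show ?case using y gen_span_in[OF a y] by (simp add: lin_span.zero)
  next
    case (incl x)
    then obtain v where v: "v \<in> lists V" "x = word_prod A a v" by auto
    show ?case using y unfolding gen_span_def
    proof induction
      case (incl y)
      then obtain w where w: "w \<in> lists V" "y = word_prod A a w" by auto
      have "x \<otimes> y = word_prod A a (v @ w)" using v w a by (subst word_prod_append) auto
      then show ?case using v w by (intro lin_span.incl CollectI exI[of _ "v @ w"]) auto
    qed (use v a lin_span_in[OF T] in \<open>auto simp: distrib_left intro: lin_span.intros\<close>)
  qed (use gen_span_in[OF a y] lin_span_in[OF T] in \<open>auto simp: distrib_right intro: lin_span.intros\<close>)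
qed

lemma gen_span_one: "\<one> \<in> gen_span A a V"
  unfolding gen_span_def by (rule lin_span.incl) (auto intro!: exI[of _ "[]"])

lemma gen_span_gen: "k \<in> V \<Longrightarrow> a k \<in> carrier A \<Longrightarrow> a k \<in> gen_span A a V"
  unfolding gen_span_def by (rule lin_span.incl) (auto intro!: exI[of _ "[k]"])

lemma nclosure_in: "x \<in> nclosure A Q \<Longrightarrow> x \<in> carrier A"
  by (simp add: nclosure_def)

lemma nclosure_incl: "Q \<subseteq> carrier A \<Longrightarrow> Q \<subseteq> nclosure A Q"
  by (force simp: nclosure_def)

lemma nclosure_nclosure: assumes "Q \<subseteq> carrier A" "x \<in> nclosure A (nclosure A Q)" shows "x \<in> nclosure A Q"
  unfolding nclosure_def
proof (intro CollectI conjI allI impI)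
  fix e :: real assume "e > 0"
  then obtain y where y: "y \<in> nclosure A Q" "dst A (nrm A) x y < e/2"
    using assms(2) unfolding nclosure_def[of _ "nclosure A Q"] by (auto dest: spec[of _ "e/2"])
  then obtain z where z: "z \<in> Q" "dst A (nrm A) y z < e/2"
    using \<open>e > 0\<close> unfolding nclosure_def[of _ Q] by (auto dest: spec[of _ "e/2"])
  then show "\<exists>y\<in>Q. dst A (nrm A) x y < e"
    using dst_triangle[of x y z] nclosure_in y assms by (intro bexI[of _ z]) auto
qed (use assms nclosure_in in auto)

lemma nclosure_add: assumes Q: "Q \<subseteq> carrier A" "\<And>x y. x \<in> Q \<Longrightarrow> y \<in> Q \<Longrightarrow> x \<oplus> y \<in> Q"
    and xy: "x \<in> nclosure A Q" "y \<in> nclosure A Q"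
  shows "x \<oplus> y \<in> nclosure A Q"
  unfolding nclosure_def
proof (intro CollectI conjI allI impI)
  fix e :: real assume "e > 0"
  then have "e / 2 > 0" by simp
  then obtain x' y' where *: "x' \<in> Q" "dst A (nrm A) x x' < e/2" "y' \<in> Q" "dst A (nrm A) y y' < e/2"
    using xy unfolding nclosure_def by blast
  then have "x' \<in> carrier A" "y' \<in> carrier A" using Q(1) by auto
  with * show "\<exists>z\<in>Q. dst A (nrm A) (x \<oplus> y) z < e"
    using dst_add[of x y x' y'] Q xy nclosure_in by (intro bexI[of _ "x' \<oplus> y'"]) auto
qed (use xy nclosure_in in auto)

lemma nclosure_smult: assumes Q: "Q \<subseteq> carrier A" "\<And>x. x \<in> Q \<Longrightarrow> c \<odot> x \<in> Q" and x: "x \<in> nclosure A Q"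
  shows "c \<odot> x \<in> nclosure A Q"
  unfolding nclosure_def
proof (intro CollectI conjI allI impI)
  fix e :: real assume e: "e > 0"
  have pos: "cmod c + 1 > 0" by (simp add: add_nonneg_pos)
  with e have "e / (cmod c + 1) > 0" by simp
  then obtain y where y: "y \<in> Q" "dst A (nrm A) x y < e / (cmod c + 1)"
    using x unfolding nclosure_def by blast
  have xc: "x \<in> carrier A" "y \<in> carrier A" using x y Q nclosure_in by auto
  have "cmod c * dst A (nrm A) x y \<le> (cmod c + 1) * dst A (nrm A) x y" using xc by (intro mult_right_mono) auto
  also have "\<dots> < e" using y pos by (simp add: field_simps)
  finally show "\<exists>y\<in>Q. dst A (nrm A) (c \<odot> x) y < e"
    using y Q xc by (intro bexI[of _ "c \<odot> y"]) (auto simp: dst_smult)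
qed (use x nclosure_in in auto)

lemma nclosure_mult: assumes Q: "Q \<subseteq> carrier A" "\<And>x y. x \<in> Q \<Longrightarrow> y \<in> Q \<Longrightarrow> x \<otimes> y \<in> Q"
    and xy: "x \<in> nclosure A Q" "y \<in> nclosure A Q"
  shows "x \<otimes> y \<in> nclosure A Q"
  unfolding nclosure_def
proof (intro CollectI conjI allI impI)
  fix e :: real assume e: "e > 0"
  have xyc: "x \<in> carrier A" "y \<in> carrier A" using xy nclosure_in by auto
  define M where "M = nrm A x + nrm A y + 1"
  have M: "M \<ge> 1" using xyc by (simp add: M_def)
  define e' where "e' = min 1 (e / M / 2)"
  have e': "e' > 0" "e' \<le> 1" "M * e' \<le> e / 2" using e M by (auto simp: e'_def min_def field_simps)
  obtain x' y' where *: "x' \<in> Q" "dst A (nrm A) x x' < e'" "y' \<in> Q" "dst A (nrm A) y y' < e'"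
    using xy e'(1) unfolding nclosure_def by blast
  have c': "x' \<in> carrier A" "y' \<in> carrier A" using * Q by auto
  have y': "nrm A y' \<le> nrm A y + 1" using N_dst[of y' y] dst_sym[of y y'] * c' xyc e' by auto
  have "nrm A x * dst A (nrm A) y y' + dst A (nrm A) x x' * nrm A y' \<le> nrm A x * e' + e' * (nrm A y + 1)"
    using * y' c' xyc e' by (intro add_mono mult_mono) auto
  also have "\<dots> = M * e'" by (simp add: M_def algebra_simps)
  also have "\<dots> < e" using e' e by simp
  finally have "dst A (nrm A) (x \<otimes> y) (x' \<otimes> y') < e" using dst_mult[of x y x' y'] c' xyc by simp
  then show "\<exists>z\<in>Q. dst A (nrm A) (x \<otimes> y) z < e" using Q * by blast
qed (use xy nclosure_in in auto)

end

lemma star_homD: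
  assumes "star_hom A B \<phi>"
  shows "a \<in> carrier A \<Longrightarrow> \<phi> a \<in> carrier B" "\<phi> \<one>\<^bsub>A\<^esub> = \<one>\<^bsub>B\<^esub>"
    "a \<in> carrier A \<Longrightarrow> b \<in> carrier A \<Longrightarrow> \<phi> (a \<oplus>\<^bsub>A\<^esub> b) = \<phi> a \<oplus>\<^bsub>B\<^esub> \<phi> b"
    "a \<in> carrier A \<Longrightarrow> \<phi> (c \<odot>\<^bsub>A\<^esub> a) = c \<odot>\<^bsub>B\<^esub> \<phi> a"
    "a \<in> carrier A \<Longrightarrow> b \<in> carrier A \<Longrightarrow> \<phi> (a \<otimes>\<^bsub>A\<^esub> b) = \<phi> a \<otimes>\<^bsub>B\<^esub> \<phi> b"
    "a \<in> carrier A \<Longrightarrow> \<phi> (star A a) = star B (\<phi> a)"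
    "a \<in> carrier A \<Longrightarrow> nrm B (\<phi> a) \<le> nrm A a"
  using assms unfolding star_hom_def by auto

lemma star_hom_dst: assumes "star_hom A B \<phi>" "star_algebra A" "star_algebra B" "x \<in> carrier A" "y \<in> carrier A"
  shows "dst B (nrm B) (\<phi> x) (\<phi> y) \<le> dst A (nrm A) x y"
proof -
  interpret star_algebra A by fact
  have "\<phi> x \<oplus>\<^bsub>B\<^esub> (-1) \<odot>\<^bsub>B\<^esub> \<phi> y = \<phi> (x \<oplus>\<^bsub>A\<^esub> (-1) \<odot>\<^bsub>A\<^esub> y)"
    using assms star_homD[OF assms(1)] by simp
  then show ?thesis using assms star_homD(7)[OF assms(1)] by (simp add: dst_def)
qed

lemma star_hom_word_prod: assumes "star_hom A B \<phi>" "star_algebra A" "\<And>k. k \<in> set w \<Longrightarrow> a k \<in> carrier A"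
  shows "\<phi> (word_prod A a w) = word_prod B (\<lambda>k. \<phi> (a k)) w"
  using assms(3)
proof (induction w)
  case (Cons k w)
  interpret star_algebra A by fact
  have "word_prod A a w \<in> carrier A" using Cons by auto
  then show ?case using Cons star_homD[OF assms(1)] by (simp add: word_prod_def)
qed (simp add: word_prod_def star_homD[OF assms(1)])

lemma star_hom_gen_span:
  assumes h: "star_hom A B \<phi>" and "cstar_algebra A" "cstar_algebra B"
    and a: "\<And>k. k \<in> V \<Longrightarrow> a k \<in> carrier A" and x: "x \<in> gen_span A a V"
  shows "\<phi> x \<in> gen_span B (\<lambda>k. \<phi> (a k)) V"
proof -
  interpret A: cstar_algebra A by fact
  interpret B: cstar_algebra B by fact
  let ?T = "{word_prod A a w | w. w \<in> lists V}"
  have T: "?T \<subseteq> carrier A" using a by auto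
  have z: "\<phi> \<zero>\<^bsub>A\<^esub> = \<zero>\<^bsub>B\<^esub>"
    using star_homD(4)[OF h, of "\<zero>\<^bsub>A\<^esub>" 0] star_homD(1)[OF h, of "\<zero>\<^bsub>A\<^esub>"] by simp
  show ?thesis using x unfolding gen_span_def
  proof induction
    case (incl x)
    then obtain w where w: "w \<in> lists V" "x = word_prod A a w" by auto
    then have "\<phi> x = word_prod B (\<lambda>k. \<phi> (a k)) w"
      using a by (auto intro!: star_hom_word_prod[OF h A.star_algebra_axioms])
    with w show ?case by (intro lin_span.incl) auto
  qed (use A.lin_span_in[OF T] in \<open>auto simp: z star_homD[OF h] intro: lin_span.intros\<close>)
qed

section \<open>Formal linear combinations\<close>

lemma formal_alg_sel:
  "carrier (formal_alg W m e s) = {p. Poly_Mapping.keys p \<subseteq> W}"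
  "mult (formal_alg W m e s) p q = (\<Sum>u\<in>Poly_Mapping.keys p. \<Sum>v\<in>Poly_Mapping.keys q.
        Poly_Mapping.single (m u v) (Poly_Mapping.lookup p u * Poly_Mapping.lookup q v))"
  "one (formal_alg W m e s) = Poly_Mapping.single e 1"
  "zero (formal_alg W m e s) = 0"
  "add (formal_alg W m e s) = (+)"
  "module.smult (formal_alg W m e s) c = Poly_Mapping.map ((*) c)"
  "star (formal_alg W m e s) p =
     (\<Sum>u\<in>Poly_Mapping.keys p. Poly_Mapping.single (s u) (cnj (Poly_Mapping.lookup p u)))"
  by (simp_all add: formal_alg_def)

text \<open>All maps on formal linear combinations are treated as additive extensions of maps on basis elements, where
  the coefficient enters as an argument so that antilinear maps are covered.\<close>

definition lin_ext :: "('w \<Rightarrow> complex \<Rightarrow> 'x::comm_monoid_add) \<Rightarrow> ('w \<Rightarrow>\<^sub>0 complex) \<Rightarrow> 'x" where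
  "lin_ext g p = (\<Sum>u\<in>Poly_Mapping.keys p. g u (Poly_Mapping.lookup p u))"

definition additive_family :: "('w \<Rightarrow> complex \<Rightarrow> 'x::comm_monoid_add) \<Rightarrow> bool" where
  "additive_family g \<longleftrightarrow> (\<forall>u. g u 0 = 0) \<and> (\<forall>u a b. g u (a + b) = g u a + g u b)"

lemma lin_ext_superset:
  assumes "additive_family g" "finite K" "Poly_Mapping.keys p \<subseteq> K"
  shows "lin_ext g p = (\<Sum>u\<in>K. g u (Poly_Mapping.lookup p u))"
  unfolding lin_ext_def using assms
  by (intro sum.mono_neutral_left) (auto simp: additive_family_def in_keys_iff)

lemma lin_ext_add [simp]:
  assumes "additive_family g" shows "lin_ext g (p + q) = lin_ext g p + lin_ext g q"
proof -
  let ?K = "Poly_Mapping.keys p \<union> Poly_Mapping.keys q"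
  have "lin_ext g (p + q) = (\<Sum>u\<in>?K. g u (Poly_Mapping.lookup (p + q) u))"
    by (rule lin_ext_superset[OF assms]) (use Poly_Mapping.keys_add[of p q] in auto)
  also have "\<dots> = (\<Sum>u\<in>?K. g u (Poly_Mapping.lookup p u)) + (\<Sum>u\<in>?K. g u (Poly_Mapping.lookup q u))"
    using assms by (simp add: lookup_add additive_family_def sum.distrib)
  also have "\<dots> = lin_ext g p + lin_ext g q"
    by (subst (1 2) lin_ext_superset[OF assms, of ?K]) auto
  finally show ?thesis .
qed

lemma lin_ext_zero [simp]: "lin_ext g 0 = 0"
  by (simp add: lin_ext_def)

lemma lin_ext_single [simp]: "additive_family g \<Longrightarrow> lin_ext g (Poly_Mapping.single w a) = g w a"
  by (simp add: lin_ext_def additive_family_def)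

lemma lookup_map_mult [simp]: "Poly_Mapping.lookup (Poly_Mapping.map ((*) (c::complex)) p) u = c * Poly_Mapping.lookup p u"
  by transfer (simp add: when_def)

lemma map_mult_add [simp]: "Poly_Mapping.map ((*) (c::complex)) (p + q) = Poly_Mapping.map ((*) c) p + Poly_Mapping.map ((*) c) q"
  by (rule poly_mapping_eqI) (simp add: lookup_add algebra_simps)

lemma map_mult_zero [simp]: "Poly_Mapping.map ((*) (c::complex)) 0 = 0"
  by (rule poly_mapping_eqI) simp

lemma map_mult_single [simp]: "Poly_Mapping.map ((*) (c::complex)) (Poly_Mapping.single w a) = Poly_Mapping.single w (c * a)"
  by (rule poly_mapping_eqI) (simp add: lookup_single when_def)

lemma formal_induct [consumes 1, case_names zero single add]:
  fixes p :: "'w \<Rightarrow>\<^sub>0 complex"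
  assumes "Poly_Mapping.keys p \<subseteq> W" and "P 0" and "\<And>w a. w \<in> W \<Longrightarrow> P (Poly_Mapping.single w a)"
    and "\<And>p q. Poly_Mapping.keys p \<subseteq> W \<Longrightarrow> Poly_Mapping.keys q \<subseteq> W \<Longrightarrow> P p \<Longrightarrow> P q \<Longrightarrow> P (p + q)"
  shows "P p"
proof -
  have "P p" if "finite K" "K \<subseteq> W" "Poly_Mapping.keys p \<subseteq> K" for K p
    using that
  proof (induction K arbitrary: p)
    case (insert k K)
    let ?s = "Poly_Mapping.single k (Poly_Mapping.lookup p k)"
    have k: "Poly_Mapping.keys (p - ?s) \<subseteq> K"
      using insert.prems(2) by (auto simp: in_keys_iff lookup_minus lookup_single when_def split: if_splits)
    then have "P (?s + (p - ?s))"
      using insert by (intro assms(4) insert.IH assms(3)) (auto split: if_splits)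
    then show ?case by simp
  qed (use assms in simp)
  from this[OF finite_keys assms(1)] show ?thesis by auto
qed

text \<open>The structure on the basis that makes \<open>formal_alg\<close> a *-algebra; words and pairs are the two instances.\<close>

locale star_monoid =
  fixes W :: "'w set" and m :: "'w \<Rightarrow> 'w \<Rightarrow> 'w" and e :: 'w and s :: "'w \<Rightarrow> 'w"
  assumes e_in [simp]: "e \<in> W" and m_in [simp]: "u \<in> W \<Longrightarrow> v \<in> W \<Longrightarrow> m u v \<in> W"
    and s_in [simp]: "u \<in> W \<Longrightarrow> s u \<in> W"
    and m_assoc: "u \<in> W \<Longrightarrow> v \<in> W \<Longrightarrow> w \<in> W \<Longrightarrow> m (m u v) w = m u (m v w)"
    and e_left [simp]: "u \<in> W \<Longrightarrow> m e u = u" and e_right [simp]: "u \<in> W \<Longrightarrow> m u e = u"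
    and s_s [simp]: "u \<in> W \<Longrightarrow> s (s u) = u"
    and s_m [simp]: "u \<in> W \<Longrightarrow> v \<in> W \<Longrightarrow> s (m u v) = m (s v) (s u)"
begin

abbreviation "F \<equiv> formal_alg W m e s"

lemma additive_mult_inner: "additive_family (\<lambda>v b. Poly_Mapping.single (m u v) (a * b))"
  by (auto simp: additive_family_def distrib_left single_add)

lemma formal_mult_lin_ext:
  "mult F p q = lin_ext (\<lambda>u a. lin_ext (\<lambda>v b. Poly_Mapping.single (m u v) (a * b)) q) p"
  by (simp add: formal_alg_sel lin_ext_def)

lemma additive_mult_outer: "additive_family (\<lambda>u a. lin_ext (\<lambda>v b. Poly_Mapping.single (m u v) (a * b)) q)"
  by (auto simp: additive_family_def lin_ext_def distrib_right single_add sum.distrib)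

lemma formal_mult_add_left [simp]: "mult F (p + p') q = mult F p q + mult F p' q"
  by (simp add: formal_mult_lin_ext additive_mult_outer)

lemma formal_mult_add_right [simp]: "mult F p (q + q') = mult F p q + mult F p q'"
  unfolding formal_mult_lin_ext
  by (simp only: lin_ext_add[OF additive_mult_inner]) (simp add: lin_ext_def sum.distrib)

lemma formal_mult_zero [simp]: "mult F 0 q = 0" "mult F p 0 = 0"
  by (simp_all add: formal_alg_sel)

lemma formal_mult_single [simp]:
  "mult F (Poly_Mapping.single u a) (Poly_Mapping.single v b) = Poly_Mapping.single (m u v) (a * b)"
  unfolding formal_mult_lin_ext
  by (simp add: lin_ext_single[OF additive_mult_inner] additive_family_def distrib_right single_add)

lemma additive_star: "additive_family (\<lambda>u a. Poly_Mapping.single (s u) (cnj a))"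
  by (auto simp: additive_family_def single_add)

lemma formal_star_lin_ext: "star F p = lin_ext (\<lambda>u a. Poly_Mapping.single (s u) (cnj a)) p"
  by (simp add: formal_alg_sel lin_ext_def)

lemma formal_star_add [simp]: "star F (p + q) = star F p + star F q"
  and formal_star_single [simp]: "star F (Poly_Mapping.single u a) = Poly_Mapping.single (s u) (cnj a)"
  and formal_star_zero [simp]: "star F 0 = 0"
  by (simp_all add: formal_star_lin_ext additive_star)

lemma keys_add_sub: "Poly_Mapping.keys p \<subseteq> W \<Longrightarrow> Poly_Mapping.keys q \<subseteq> W \<Longrightarrow> Poly_Mapping.keys (p + q) \<subseteq> W"
  using Poly_Mapping.keys_add[of p q] by auto

lemma keys_mult: "Poly_Mapping.keys p \<subseteq> W \<Longrightarrow> Poly_Mapping.keys q \<subseteq> W \<Longrightarrow> Poly_Mapping.keys (mult F p q) \<subseteq> W"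
proof (induction p rule: formal_induct)
  case (single u a)
  from single(2) show ?case
    by (induction q rule: formal_induct) (use single(1) in \<open>simp_all add: keys_add_sub\<close>)
qed (simp_all add: keys_add_sub)

lemma keys_star: "Poly_Mapping.keys p \<subseteq> W \<Longrightarrow> Poly_Mapping.keys (star F p) \<subseteq> W"
  by (induction p rule: formal_induct) (simp_all add: keys_add_sub)

lemma formal_mult_assoc:
  assumes "Poly_Mapping.keys p \<subseteq> W" "Poly_Mapping.keys q \<subseteq> W" "Poly_Mapping.keys r \<subseteq> W"
  shows "mult F (mult F p q) r = mult F p (mult F q r)"
  using assms
proof (induction p rule: formal_induct)
  case (single u a)
  note u = single(1)
  from single(2,3) show ?case
  proof (induction q rule: formal_induct)
    case (single v b)
    note v = single(1)
    from single(2) show ?case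
      by (induction r rule: formal_induct) (use u v in \<open>auto simp: m_assoc mult.assoc\<close>)
  qed auto
qed auto

lemma formal_smult_left: "mult F (Poly_Mapping.map ((*) c) p) q = Poly_Mapping.map ((*) c) (mult F p q)"
  and formal_smult_right: "mult F p (Poly_Mapping.map ((*) c) q) = Poly_Mapping.map ((*) c) (mult F p q)"
proof -
  have 1: "mult F (Poly_Mapping.map ((*) c) p) q = Poly_Mapping.map ((*) c) (mult F p q) \<and>
           mult F p (Poly_Mapping.map ((*) c) q) = Poly_Mapping.map ((*) c) (mult F p q)"
    if "Poly_Mapping.keys p \<subseteq> UNIV"
    using that
  proof (induction p rule: formal_induct)
    case (single u a)
    have "Poly_Mapping.keys q \<subseteq> UNIV" by simp
    then show ?case by (induction q rule: formal_induct) (auto simp: mult.assoc mult.left_commute)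
  qed auto
  then show "mult F (Poly_Mapping.map ((*) c) p) q = Poly_Mapping.map ((*) c) (mult F p q)"
    "mult F p (Poly_Mapping.map ((*) c) q) = Poly_Mapping.map ((*) c) (mult F p q)" by auto
qed

lemma formal_one: "Poly_Mapping.keys p \<subseteq> W \<Longrightarrow> mult F (Poly_Mapping.single e 1) p = p"
  "Poly_Mapping.keys p \<subseteq> W \<Longrightarrow> mult F p (Poly_Mapping.single e 1) = p"
  by (induction p rule: formal_induct; simp)+

lemma formal_star_star: "Poly_Mapping.keys p \<subseteq> W \<Longrightarrow> star F (star F p) = p"
  by (induction p rule: formal_induct) auto

lemma formal_star_smult: "star F (Poly_Mapping.map ((*) c) p) = Poly_Mapping.map ((*) (cnj c)) (star F p)"
proof -
  have "Poly_Mapping.keys p \<subseteq> UNIV" by simp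
  then show ?thesis by (induction p rule: formal_induct) auto
qed

lemma formal_star_mult:
  assumes "Poly_Mapping.keys p \<subseteq> W" "Poly_Mapping.keys q \<subseteq> W"
  shows "star F (mult F p q) = mult F (star F q) (star F p)"
  using assms
proof (induction p rule: formal_induct)
  case (single u a)
  from single(2) show ?case
    by (induction q rule: formal_induct) (use single(1) in \<open>auto simp: mult.commute\<close>)
qed auto

lemma star_algebra_formal: "star_algebra F"
proof
  fix x y a b
  show "(a + b) \<odot>\<^bsub>F\<^esub> x = a \<odot>\<^bsub>F\<^esub> x \<oplus>\<^bsub>F\<^esub> b \<odot>\<^bsub>F\<^esub> x"
    by (rule poly_mapping_eqI) (simp add: formal_alg_sel(4-6) lookup_add algebra_simps)
  show "a \<odot>\<^bsub>F\<^esub> (b \<odot>\<^bsub>F\<^esub> x) = (a * b) \<odot>\<^bsub>F\<^esub> x"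
    by (rule poly_mapping_eqI) (simp add: formal_alg_sel(4-6) algebra_simps)
  show "0 \<odot>\<^bsub>F\<^esub> x = \<zero>\<^bsub>F\<^esub>" "1 \<odot>\<^bsub>F\<^esub> x = x"
    by (rule poly_mapping_eqI, simp add: formal_alg_sel(4-6))+
qed (auto simp only: formal_alg_sel(1,3-6) mem_Collect_eq keys_add_sub keys_mult keys_star formal_mult_assoc
       formal_smult_left formal_smult_right formal_one formal_star_star formal_star_smult formal_star_mult
       formal_mult_add_left formal_mult_add_right formal_star_add map_mult_add add.assoc add.commute add_0_left
       keys_zero empty_subsetI, auto simp: in_keys_iff)

lemma formal_diff: "p \<oplus>\<^bsub>F\<^esub> (-1) \<odot>\<^bsub>F\<^esub> q = p - q"
  by (rule poly_mapping_eqI) (simp add: formal_alg_sel lookup_add lookup_minus)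

end

definition formal_ev :: "('a, 'm) star_alg_scheme \<Rightarrow> ('w \<Rightarrow> 'a) \<Rightarrow> ('w \<Rightarrow>\<^sub>0 complex) \<Rightarrow> 'a" where
  "formal_ev D g p = finsum D (\<lambda>u. Poly_Mapping.lookup p u \<odot>\<^bsub>D\<^esub> g u) (Poly_Mapping.keys p)"

locale formal_evaluation = star_monoid W m e s + D: star_algebra D
  for W :: "'w set" and m e s and D :: "('a, 'm) star_alg_scheme" +
  fixes g :: "'w \<Rightarrow> 'a"
  assumes g_in [simp]: "u \<in> W \<Longrightarrow> g u \<in> carrier D"
begin

sublocale DM: abelian_monoid D
  by (rule abelian_monoidI) (auto simp: D.add_assoc D.add_comm D.add_left_comm)

abbreviation "evl \<equiv> formal_ev D g"

lemma ev_superset: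
  assumes "finite K" "Poly_Mapping.keys p \<subseteq> K" "K \<subseteq> W"
  shows "evl p = finsum D (\<lambda>u. Poly_Mapping.lookup p u \<odot>\<^bsub>D\<^esub> g u) K"
  unfolding formal_ev_def using assms
  by (intro DM.add.finprod_mono_neutral_cong_left) (auto simp: in_keys_iff)

lemma ev_in [simp]: "Poly_Mapping.keys p \<subseteq> W \<Longrightarrow> evl p \<in> carrier D"
  unfolding formal_ev_def by (intro DM.finsum_closed) auto

lemma ev_zero [simp]: "evl 0 = \<zero>\<^bsub>D\<^esub>"
  by (simp add: formal_ev_def)

lemma ev_single [simp]: "w \<in> W \<Longrightarrow> evl (Poly_Mapping.single w a) = a \<odot>\<^bsub>D\<^esub> g w"
  by (subst ev_superset[of "{w}"]) auto

lemma ev_add [simp]: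
  assumes "Poly_Mapping.keys p \<subseteq> W" "Poly_Mapping.keys q \<subseteq> W"
  shows "evl (p + q) = evl p \<oplus>\<^bsub>D\<^esub> evl q"
proof -
  let ?K = "Poly_Mapping.keys p \<union> Poly_Mapping.keys q"
  have K: "finite ?K" "?K \<subseteq> W" using assms by auto
  have "evl (p + q) = finsum D (\<lambda>u. Poly_Mapping.lookup (p + q) u \<odot>\<^bsub>D\<^esub> g u) ?K"
    using K Poly_Mapping.keys_add[of p q] by (intro ev_superset) auto
  also have "\<dots> = finsum D (\<lambda>u. Poly_Mapping.lookup p u \<odot>\<^bsub>D\<^esub> g u \<oplus>\<^bsub>D\<^esub> Poly_Mapping.lookup q u \<odot>\<^bsub>D\<^esub> g u) ?K"
    using K by (intro DM.finsum_cong') (auto simp: lookup_add D.smult_add_left subset_iff)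
  also have "\<dots> = evl p \<oplus>\<^bsub>D\<^esub> evl q"
    using K by (subst (1 2) ev_superset[of ?K]) (auto intro!: DM.finsum_addf simp: subset_iff)
  finally show ?thesis .
qed

lemma ev_smult [simp]:
  assumes "Poly_Mapping.keys p \<subseteq> W" shows "evl (Poly_Mapping.map ((*) c) p) = c \<odot>\<^bsub>D\<^esub> evl p"
proof -
  have k: "Poly_Mapping.keys (Poly_Mapping.map ((*) c) p) \<subseteq> W" if "Poly_Mapping.keys p \<subseteq> W" for p
    using that by (auto simp: in_keys_iff subset_iff)
  from assms show ?thesis
    by (induction p rule: formal_induct) (auto simp: k D.smult_add_right)
qed

lemma ev_mult:
  assumes "\<And>u v. u \<in> W \<Longrightarrow> v \<in> W \<Longrightarrow> g (m u v) = g u \<otimes>\<^bsub>D\<^esub> g v"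
    and "Poly_Mapping.keys p \<subseteq> W" "Poly_Mapping.keys q \<subseteq> W"
  shows "evl (mult F p q) = evl p \<otimes>\<^bsub>D\<^esub> evl q"
  using assms(2,3)
proof (induction p rule: formal_induct)
  case (single u a)
  from single(2) show ?case
    by (induction q rule: formal_induct)
       (use single(1) assms(1) in \<open>auto simp: keys_mult D.distrib_left mult.commute split: if_splits\<close>)
qed (auto simp: keys_mult D.distrib_right)

lemma ev_star:
  assumes "\<And>u. u \<in> W \<Longrightarrow> g (s u) = star D (g u)" and "Poly_Mapping.keys p \<subseteq> W"
  shows "evl (star F p) = star D (evl p)"
  using assms(2)
  by (induction p rule: formal_induct) (auto simp: keys_star assms(1))

end

section \<open>Universal property of the free product\<close>

locale free_family =
  fixes K :: "'k set" and A :: "'k \<Rightarrow> 'a cstar_alg"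
  assumes A_cstar: "k \<in> K \<Longrightarrow> cstar_algebra (A k)"
begin

definition "W = lists (SIGMA k:K. carrier (A k))"
definition "s w = rev (map (\<lambda>(k, a). (k, star (A k) a)) w)"
abbreviation "B \<equiv> free_star_alg K A"
abbreviation "FN \<equiv> free_norm K A"
abbreviation "C \<equiv> free_product K A"

lemma B_eq: "B = formal_alg W (@) [] s"
  unfolding free_star_alg_def W_def s_def ..

lemma A_alg: "k \<in> K \<Longrightarrow> star_algebra (A k)"
  using A_cstar by (simp add: cstar_algebra_def seminormed_star_algebra_def)

sublocale star_monoid W "(@)" "[]" s
proof
  fix u assume u: "u \<in> W"
  show "s u \<in> W" using u unfolding W_def s_def by (auto intro!: star_algebra.star_in A_alg)
  have "map ((\<lambda>(k, a). (k, star (A k) a)) \<circ> (\<lambda>(k, a). (k, star (A k) a))) u = u"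
    by (rule map_idI) (use u in \<open>auto simp: W_def intro!: star_algebra.star_star A_alg\<close>)
  then show "s (s u) = u" by (simp add: s_def rev_map)
qed (auto simp: W_def s_def)

sublocale B: star_algebra B
  unfolding B_eq by (rule star_algebra_formal)

lemma B_carrier: "p \<in> carrier B \<longleftrightarrow> Poly_Mapping.keys p \<subseteq> W"
  by (simp add: B_eq formal_alg_sel)

lemma B_diff: "p \<oplus>\<^bsub>B\<^esub> (-1) \<odot>\<^bsub>B\<^esub> q = p - q"
  unfolding B_eq by (rule formal_diff)

lemma free_seminormD:
  assumes "free_seminorm K A N" shows "seminormed_star_algebra B N"
  using assms unfolding free_seminorm_def by (intro seminormed_star_algebraI B.star_algebra_axioms) auto

lemma letter_in: "k \<in> K \<Longrightarrow> a \<in> carrier (A k) \<Longrightarrow> letter k a \<in> carrier B"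
  by (auto simp: letter_def B_carrier W_def)

text \<open>A free seminorm of a word is at most the product of the norms of its letters.  This makes the supremum
  that defines the free norm finite.\<close>

lemma free_seminorm_bounded:
  assumes "p \<in> carrier B" shows "\<exists>M. \<forall>N. free_seminorm K A N \<longrightarrow> N p \<le> M"
  using assms unfolding B_carrier
proof (induction p rule: formal_induct)
  case zero
  have "N 0 = 0" if "free_seminorm K A N" for N
  proof -
    interpret N: seminormed_star_algebra B N by (rule free_seminormD[OF that])
    show ?thesis using N.N_zero by (simp add: B_eq formal_alg_sel)
  qed
  then show ?case by (metis order_refl)
next
  case (single w c)
  then show ?case
  proof (induction w)
    case Nil
    have "N (Poly_Mapping.single [] c) \<le> cmod c" if "free_seminorm K A N" for N
    proof -
      interpret N: seminormed_star_algebra B N by (rule free_seminormD[OF that])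
      have "Poly_Mapping.single [] c = c \<odot>\<^bsub>B\<^esub> \<one>\<^bsub>B\<^esub>" by (simp add: B_eq formal_alg_sel)
      moreover have "N \<one>\<^bsub>B\<^esub> = (N \<one>\<^bsub>B\<^esub>)\<^sup>2" using N.N_star_mult[of "\<one>\<^bsub>B\<^esub>"] by simp
      then have "N \<one>\<^bsub>B\<^esub> \<le> 1" by (auto simp: power2_eq_square)
      ultimately show ?thesis using mult_left_mono[of "N \<one>\<^bsub>B\<^esub>" 1 "cmod c"] by simp
    qed
    then show ?case by blast
  next
    case (Cons x w)
    obtain k a where x: "x = (k, a)" "k \<in> K" "a \<in> carrier (A k)" using Cons.prems by (auto simp: W_def)
    have w: "w \<in> W" using Cons.prems by (auto simp: W_def)
    then obtain M where M: "\<And>N. free_seminorm K A N \<Longrightarrow> N (Poly_Mapping.single w c) \<le> M" using Cons.IH by auto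
    have "N (Poly_Mapping.single (x # w) c) \<le> nrm (A k) a * \<bar>M\<bar>" if N: "free_seminorm K A N" for N
    proof -
      interpret N: seminormed_star_algebra B N by (rule free_seminormD[OF N])
      have "Poly_Mapping.single (x # w) c = letter k a \<otimes>\<^bsub>B\<^esub> Poly_Mapping.single w c"
        unfolding letter_def by (simp add: B_eq x)
      then have "N (Poly_Mapping.single (x # w) c) \<le> N (letter k a) * N (Poly_Mapping.single w c)"
        using N.N_mult[OF letter_in[OF x(2,3)], of "Poly_Mapping.single w c"] w by (simp add: B_carrier)
      moreover have n0: "0 \<le> nrm (A k) a"
      proof -
        interpret Ak: cstar_algebra "A k" using x(2) by (rule A_cstar)
        show ?thesis using x(3) by simp
      qed
      have "N (letter k a) * N (Poly_Mapping.single w c) \<le> nrm (A k) a * \<bar>M\<bar>"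
        using n0
        using M[OF N] N x w N.N_ge0[of "Poly_Mapping.single w c"] N.N_ge0[OF letter_in[OF x(2,3)]]
        unfolding free_seminorm_def by (intro mult_mono) (auto simp: B_carrier)
      ultimately show ?thesis by linarith
    qed
    then show ?case by blast
  qed
next
  case (add p q)
  then obtain M1 M2 where M: "\<And>N. free_seminorm K A N \<Longrightarrow> N p \<le> M1" "\<And>N. free_seminorm K A N \<Longrightarrow> N q \<le> M2" by auto
  have "N (p + q) \<le> M1 + M2" if N: "free_seminorm K A N" for N
  proof -
    interpret N: seminormed_star_algebra B N by (rule free_seminormD[OF N])
    have "N (p \<oplus>\<^bsub>B\<^esub> q) \<le> N p + N q" using add by (intro N.N_add) (auto simp: B_carrier)
    then show ?thesis using M[OF N] by (simp add: B_eq formal_alg_sel)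
  qed
  then show ?case by blast
qed

lemma zero_free_seminorm: "free_seminorm K A (\<lambda>p. 0)"
proof -
  have "0 \<le> nrm (A k) a" if "k \<in> K" "a \<in> carrier (A k)" for k a
  proof -
    interpret cstar_algebra "A k" using that A_cstar by simp
    show ?thesis using that by simp
  qed
  then show ?thesis by (simp add: free_seminorm_def cstar_seminorm_def)
qed

lemma free_norm_upper: "p \<in> carrier B \<Longrightarrow> free_seminorm K A N \<Longrightarrow> N p \<le> FN p"
  unfolding free_norm_def using free_seminorm_bounded[of p]
  by (intro cSup_upper) (auto simp: bdd_above_def)

lemma free_norm_least: "(\<And>N. free_seminorm K A N \<Longrightarrow> N p \<le> M) \<Longrightarrow> FN p \<le> M"
  unfolding free_norm_def by (rule cSup_least) (use zero_free_seminorm in auto)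

lemma free_norm_ge0: "p \<in> carrier B \<Longrightarrow> 0 \<le> FN p"
  using free_norm_upper[OF _ zero_free_seminorm] by simp

lemma free_norm_smult_le: assumes "p \<in> carrier B" shows "FN (c \<odot>\<^bsub>B\<^esub> p) \<le> cmod c * FN p"
proof (rule free_norm_least)
  fix N assume N: "free_seminorm K A N"
  interpret N: seminormed_star_algebra B N by (rule free_seminormD[OF N])
  show "N (c \<odot>\<^bsub>B\<^esub> p) \<le> cmod c * FN p"
    using assms free_norm_upper[OF assms N] by (simp add: mult_left_mono)
qed

sublocale PC: pre_cstar_algebra B FN
proof (unfold_locales)
  fix p q c assume p: "p \<in> carrier B"
  show "0 \<le> FN p" using p by (rule free_norm_ge0)
  show "FN (c \<odot>\<^bsub>B\<^esub> p) = cmod c * FN p"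
  proof (cases "c = 0")
    case True
    have "FN (0 \<odot>\<^bsub>B\<^esub> p) \<le> 0" using free_norm_smult_le[OF p, of 0] by simp
    moreover have "0 \<le> FN (0 \<odot>\<^bsub>B\<^esub> p)" using p by (intro free_norm_ge0) (rule B.smult_in)
    ultimately show ?thesis using True by simp
  next
    case False
    have "FN p \<le> cmod (1 / c) * FN (c \<odot>\<^bsub>B\<^esub> p)"
      using free_norm_smult_le[of "c \<odot>\<^bsub>B\<^esub> p" "1 / c"] p False by simp
    then have "cmod c * FN p \<le> FN (c \<odot>\<^bsub>B\<^esub> p)" using False by (simp add: norm_divide field_simps)
    with free_norm_smult_le[OF p, of c] show ?thesis by simp
  qed
  show "FN (star B p \<otimes>\<^bsub>B\<^esub> p) = (FN p)\<^sup>2"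
  proof (rule antisym)
    show "FN (star B p \<otimes>\<^bsub>B\<^esub> p) \<le> (FN p)\<^sup>2"
    proof (rule free_norm_least)
      fix N assume N: "free_seminorm K A N"
      interpret N: seminormed_star_algebra B N by (rule free_seminormD[OF N])
      show "N (star B p \<otimes>\<^bsub>B\<^esub> p) \<le> (FN p)\<^sup>2"
        using p free_norm_upper[OF p N] by (simp add: N.N_star_mult power_mono)
    qed
    have pp: "star B p \<otimes>\<^bsub>B\<^esub> p \<in> carrier B" using p by simp
    have "FN p \<le> sqrt (FN (star B p \<otimes>\<^bsub>B\<^esub> p))"
    proof (rule free_norm_least)
      fix N assume N: "free_seminorm K A N"
      interpret N: seminormed_star_algebra B N by (rule free_seminormD[OF N])
      show "N p \<le> sqrt (FN (star B p \<otimes>\<^bsub>B\<^esub> p))"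
        using free_norm_upper[OF pp N] p by (simp add: N.N_star_mult real_le_rsqrt)
    qed
    then have "(FN p)\<^sup>2 \<le> (sqrt (FN (star B p \<otimes>\<^bsub>B\<^esub> p)))\<^sup>2"
      using free_norm_ge0[OF p] by (intro power_mono)
    then show "(FN p)\<^sup>2 \<le> FN (star B p \<otimes>\<^bsub>B\<^esub> p)" using free_norm_ge0[OF pp] by simp
  qed
  assume q: "q \<in> carrier B"
  show "FN (p \<oplus>\<^bsub>B\<^esub> q) \<le> FN p + FN q"
  proof (rule free_norm_least)
    fix N assume N: "free_seminorm K A N"
    interpret N: seminormed_star_algebra B N by (rule free_seminormD[OF N])
    show "N (p \<oplus>\<^bsub>B\<^esub> q) \<le> FN p + FN q"
      using N.N_add[OF p q] free_norm_upper[OF p N] free_norm_upper[OF q N] by simp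
  qed
  show "FN (p \<otimes>\<^bsub>B\<^esub> q) \<le> FN p * FN q"
  proof (rule free_norm_least)
    fix N assume N: "free_seminorm K A N"
    interpret N: seminormed_star_algebra B N by (rule free_seminormD[OF N])
    have "N (p \<otimes>\<^bsub>B\<^esub> q) \<le> N p * N q" by (rule N.N_mult[OF p q])
    also have "\<dots> \<le> FN p * FN q"
      using free_norm_upper[OF p N] free_norm_upper[OF q N] p q free_norm_ge0 by (intro mult_mono) auto
    finally show "N (p \<otimes>\<^bsub>B\<^esub> q) \<le> FN p * FN q" .
  qed
qed

lemma cstar_algebra_free: "cstar_algebra C"
  unfolding free_product_def by (rule PC.cstar_algebra_completion)

text \<open>This is how the relations of the factors enter the free product: each of them holds modulo every free
  seminorm, hence in the completion.\<close>

lemma free_norm_zeroI: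
  assumes "p \<in> carrier B" "q \<in> carrier B" "\<And>N. free_seminorm K A N \<Longrightarrow> N (p - q) = 0"
  shows "completion_embed B FN p = completion_embed B FN q"
proof -
  have "p - q \<in> carrier B" using assms(1,2) B_diff[of p q, symmetric] by (simp add: B.add_in B.smult_in)
  moreover have "FN (p - q) \<le> 0" by (rule free_norm_least, rule eq_refl, rule assms(3))
  ultimately have "FN (p - q) = 0" using free_norm_ge0 by (intro antisym) auto
  then have "dst C (nrm C) (completion_embed B FN p) (completion_embed B FN q) = 0"
    unfolding free_product_def using PC.embed_dst[OF assms(1,2)] by (simp add: dst_def[of B] B_diff)
  then show ?thesis
    using cstar_algebra.dst_eq_zero[OF cstar_algebra_free] assms PC.embed_hom(1) unfolding free_product_def by blast
qed

lemma free_incl_hom: assumes k: "k \<in> K" shows "star_hom (A k) C (free_incl K A k)"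
proof -
  interpret Ak: cstar_algebra "A k" using k by (rule A_cstar)
  let ?e = "completion_embed B FN"
  have *: "?e (letter k \<one>\<^bsub>A k\<^esub>) = ?e (Poly_Mapping.single [] 1)"
    by (rule free_norm_zeroI) (use k letter_in[OF k] in \<open>auto simp: free_seminorm_def B_carrier\<close>)
  have add: "?e (letter k (a \<oplus>\<^bsub>A k\<^esub> b)) = ?e (letter k a \<oplus>\<^bsub>B\<^esub> letter k b)"
    if "a \<in> carrier (A k)" "b \<in> carrier (A k)" for a b
    using k that by (intro free_norm_zeroI B.add_in letter_in Ak.add_in)
      (auto simp: free_seminorm_def B_eq formal_alg_sel(5))
  have smult: "?e (letter k (c \<odot>\<^bsub>A k\<^esub> a)) = ?e (c \<odot>\<^bsub>B\<^esub> letter k a)"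
    if "a \<in> carrier (A k)" for a c
    using k that by (intro free_norm_zeroI B.smult_in letter_in Ak.smult_in)
      (auto simp: free_seminorm_def B_eq formal_alg_sel(6) letter_def)
  have mult: "?e (letter k (a \<otimes>\<^bsub>A k\<^esub> b)) = ?e (letter k a \<otimes>\<^bsub>B\<^esub> letter k b)"
    if "a \<in> carrier (A k)" "b \<in> carrier (A k)" for a b
  proof -
    have "letter k a \<otimes>\<^bsub>B\<^esub> letter k b = Poly_Mapping.single [(k, a), (k, b)] 1"
      unfolding letter_def B_eq by simp
    then show ?thesis
      by (intro free_norm_zeroI) (use k letter_in[OF k] that in \<open>auto simp: free_seminorm_def B_carrier W_def\<close>)
  qed
  have star: "letter k (star (A k) a) = star B (letter k a)" if "a \<in> carrier (A k)" for a
    unfolding B_eq letter_def by (simp add: s_def)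
  have nrm: "FN (letter k a) \<le> nrm (A k) a" if "a \<in> carrier (A k)" for a
    by (rule free_norm_least) (use k that in \<open>auto simp: free_seminorm_def\<close>)
  have one: "Poly_Mapping.single [] 1 = \<one>\<^bsub>B\<^esub>" by (simp add: B_eq formal_alg_sel)
  show ?thesis
    unfolding star_hom_def free_incl_def free_product_def
    by (auto simp: letter_in[OF k] * one add smult mult star nrm)
qed

lemma embed_word:
  assumes "w \<in> W"
  shows "completion_embed B FN (Poly_Mapping.single w 1) = word_prod C (\<lambda>(k, a). free_incl K A k a) w"
  using assms
proof (induction w)
  case Nil
  have "Poly_Mapping.single [] 1 = \<one>\<^bsub>B\<^esub>" by (simp add: B_eq formal_alg_sel)
  then show ?case by (simp add: word_prod_def free_product_def)
next
  case (Cons x w)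
  obtain k a where x: "x = (k, a)" "k \<in> K" "a \<in> carrier (A k)" using Cons.prems by (auto simp: W_def)
  have w: "w \<in> W" using Cons.prems by (auto simp: W_def)
  have "Poly_Mapping.single (x # w) 1 = letter k a \<otimes>\<^bsub>B\<^esub> Poly_Mapping.single w 1"
    unfolding letter_def by (simp add: B_eq x)
  then show ?case using Cons.IH[OF w] x w letter_in[OF x(2,3)]
    by (simp add: word_prod_def free_incl_def B_carrier) (simp add: free_product_def)
qed

text \<open>Words in elements of the factors span a dense subspace, and the closure of a subalgebra is multiplicative,
  so it contains the words as soon as it contains the letters.\<close>

lemma free_dense:
  assumes Q: "Q \<subseteq> carrier C" "\<And>x y. x \<in> Q \<Longrightarrow> y \<in> Q \<Longrightarrow> x \<oplus>\<^bsub>C\<^esub> y \<in> Q"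
    "\<And>x c. x \<in> Q \<Longrightarrow> c \<odot>\<^bsub>C\<^esub> x \<in> Q" "\<And>x y. x \<in> Q \<Longrightarrow> y \<in> Q \<Longrightarrow> x \<otimes>\<^bsub>C\<^esub> y \<in> Q" "\<one>\<^bsub>C\<^esub> \<in> Q"
    and inc: "\<And>k a. k \<in> K \<Longrightarrow> a \<in> carrier (A k) \<Longrightarrow> free_incl K A k a \<in> nclosure C Q"
  shows "nclosure C Q = carrier C"
proof
  interpret C: cstar_algebra C by (rule cstar_algebra_free)
  let ?e = "completion_embed B FN"
  have sub: "Q \<subseteq> nclosure C Q" by (rule C.nclosure_incl[OF Q(1)])
  have word: "word_prod C (\<lambda>(k, a). free_incl K A k a) w \<in> nclosure C Q" if "w \<in> W" for w
    using that
  proof (induction w)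
    case Nil
    then show ?case using sub Q(5) by (auto simp: word_prod_def)
  next
    case (Cons x w)
    obtain k a where x: "x = (k, a)" "k \<in> K" "a \<in> carrier (A k)" using Cons.prems by (auto simp: W_def)
    have w: "w \<in> W" using Cons.prems by (auto simp: W_def)
    show ?case using C.nclosure_mult[OF Q(1,4) inc[OF x(2,3)] Cons.IH[OF w]] x by simp
  qed
  have e: "?e p \<in> nclosure C Q" if "Poly_Mapping.keys p \<subseteq> W" for p
    using that
  proof (induction p rule: formal_induct)
    case zero
    have "?e 0 = 0 \<odot>\<^bsub>C\<^esub> \<one>\<^bsub>C\<^esub>"
      using PC.embed_hom(4)[of "\<one>\<^bsub>B\<^esub>" 0] PC.embed_hom(2)
      by (simp add: free_product_def del: PC.embed_hom) (simp add: B_eq formal_alg_sel)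
    then show ?case using sub Q(3)[OF Q(5), of 0] by auto
  next
    case (single w a)
    have "?e (Poly_Mapping.single w a) = a \<odot>\<^bsub>C\<^esub> ?e (Poly_Mapping.single w 1)"
      unfolding free_product_def using single
      by (subst PC.embed_hom(4)[symmetric]) (simp_all add: B_eq formal_alg_sel)
    then show ?case using C.nclosure_smult[OF Q(1,3) word[OF single]] embed_word[OF single] by simp
  next
    case (add p q)
    have "?e (p + q) = ?e p \<oplus>\<^bsub>C\<^esub> ?e q"
      unfolding free_product_def using add
      by (subst PC.embed_hom(3)[symmetric]) (simp_all add: B_eq formal_alg_sel)
    then show ?case using C.nclosure_add[OF Q(1,2)] add by simp
  qed
  show "carrier C \<subseteq> nclosure C Q"
  proof
    fix x assume x: "x \<in> carrier C"
    have "\<exists>y\<in>nclosure C Q. dst C (nrm C) x y < \<epsilon>" if "\<epsilon> > 0" for \<epsilon>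
    proof -
      from PC.embed_dense[OF x[unfolded free_product_def] that]
      obtain p where p: "p \<in> carrier B" "dst C (nrm C) x (?e p) < \<epsilon>"
        unfolding free_product_def by (rule bexE)
      have "?e p \<in> nclosure C Q" by (rule e) (use p in \<open>simp add: B_carrier\<close>)
      with p(2) show ?thesis by (rule bexI)
    qed
    then have "x \<in> nclosure C (nclosure C Q)"
      unfolding nclosure_def[of C "nclosure C Q"] using x by simp
    then show "x \<in> nclosure C Q" by (rule C.nclosure_nclosure[OF Q(1)])
  qed
qed (auto simp: nclosure_def)

text \<open>The universal property: evaluating formal combinations in a target gives a C*-seminorm that is
  dominated by the free norm by definition, so the evaluation extends to the completion.\<close>

lemma free_product_universal:
  fixes D :: "'d cstar_alg"
  assumes D: "complete_cstar_algebra D" and \<phi>: "\<And>k. k \<in> K \<Longrightarrow> star_hom (A k) D (\<phi> k)"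
  obtains \<Phi> where "star_hom C D \<Phi>" "\<And>k a. k \<in> K \<Longrightarrow> a \<in> carrier (A k) \<Longrightarrow> \<Phi> (free_incl K A k a) = \<phi> k a"
proof -
  interpret D: complete_cstar_algebra D by (rule D)
  define g where "g = word_prod D (\<lambda>(k, a). \<phi> k a)"
  have \<phi>_in: "\<phi> k a \<in> carrier D" if "k \<in> K" "a \<in> carrier (A k)" for k a
    using star_homD(1)[OF \<phi>] that by auto
  have g_in: "g u \<in> carrier D" if "u \<in> W" for u
    unfolding g_def using that by (intro D.word_prod_in) (auto simp: W_def \<phi>_in)
  interpret E: formal_evaluation W "(@)" "[]" s D g
    by unfold_locales (rule g_in)
  have g_app: "g (u @ v) = g u \<otimes>\<^bsub>D\<^esub> g v" if "u \<in> W" "v \<in> W" for u v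
    unfolding g_def using that by (intro D.word_prod_append) (auto simp: W_def \<phi>_in)
  have g_star: "g (s u) = star D (g u)" if "u \<in> W" for u
    using that
  proof (induction u)
    case (Cons x u)
    obtain k a where x: "x = (k, a)" "k \<in> K" "a \<in> carrier (A k)" using Cons.prems by (auto simp: W_def)
    have u: "u \<in> W" "[x] \<in> W" using Cons.prems by (auto simp: W_def)
    have "s (x # u) = s u @ s [x]" by (simp add: s_def)
    then have "g (s (x # u)) = g (s u) \<otimes>\<^bsub>D\<^esub> g (s [x])" using u by (simp add: g_app)
    also have "g (s [x]) = star D (\<phi> k a)"
      using x star_homD(6)[OF \<phi>] \<phi>_in[OF x(2) star_algebra.star_in[OF A_alg[OF x(2)] x(3)]] by (simp add: g_def s_def)
    also have "g (s u) \<otimes>\<^bsub>D\<^esub> star D (\<phi> k a) = star D (g (x # u))"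
      using Cons.IH[OF u(1)] g_in[OF u(1)] x \<phi>_in by (simp add: g_def)
    finally show ?case .
  qed (simp add: g_def s_def)
  have ev: "E.evl p \<in> carrier D" if "p \<in> carrier B" for p using that by (simp add: B_carrier)
  have ev_mult: "E.evl (p \<otimes>\<^bsub>B\<^esub> q) = E.evl p \<otimes>\<^bsub>D\<^esub> E.evl q" if "p \<in> carrier B" "q \<in> carrier B" for p q
    unfolding B_eq using that by (intro E.ev_mult g_app) (auto simp: B_carrier)
  have ev_star: "E.evl (star B p) = star D (E.evl p)" if "p \<in> carrier B" for p
    unfolding B_eq using that by (intro E.ev_star g_star) (auto simp: B_carrier)
  have ev_add: "E.evl (p \<oplus>\<^bsub>B\<^esub> q) = E.evl p \<oplus>\<^bsub>D\<^esub> E.evl q" if "p \<in> carrier B" "q \<in> carrier B" for p q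
    using that by (simp add: B_carrier) (simp add: B_eq formal_alg_sel)
  have ev_smult: "E.evl (c \<odot>\<^bsub>B\<^esub> p) = c \<odot>\<^bsub>D\<^esub> E.evl p" if "p \<in> carrier B" for p c
    using that by (simp add: B_carrier) (simp add: B_eq formal_alg_sel)
  have ev_letter: "E.evl (letter k a) = \<phi> k a" if "k \<in> K" "a \<in> carrier (A k)" for k a
  proof -
    have "[(k, a)] \<in> W" using that by (auto simp: W_def)
    then show ?thesis using \<phi>_in[OF that] unfolding letter_def by (subst E.ev_single) (simp_all add: g_def)
  qed
  have ev_one: "E.evl \<one>\<^bsub>B\<^esub> = \<one>\<^bsub>D\<^esub>" 
    using E.ev_single[of "[]" 1] D.one_in by (simp add: B_eq formal_alg_sel(3)) (simp add: g_def)
  let ?N = "\<lambda>p. nrm D (E.evl p)"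
  have diff: "nrm D (E.evl (p - q)) = 0" if "p \<in> carrier B" "q \<in> carrier B" "E.evl p = E.evl q" for p q
    using that ev by (simp flip: B_diff add: ev_add ev_smult)
  have "free_seminorm K A ?N"
    unfolding free_seminorm_def
  proof (intro conjI ballI allI)
    show "cstar_seminorm B ?N"
      using D.N_add D.N_mult D.N_star_mult
      by (auto simp: cstar_seminorm_def ev ev_mult ev_star ev_add ev_smult)
  next
    fix k assume k: "k \<in> K"
    interpret Ak: cstar_algebra "A k" using k by (rule A_cstar)
    have one: "Poly_Mapping.single [] 1 = \<one>\<^bsub>B\<^esub>" by (simp add: B_eq formal_alg_sel)
    note hom = star_homD[OF \<phi>[OF k]]
    show "?N (letter k \<one>\<^bsub>A k\<^esub> - Poly_Mapping.single [] 1) = 0"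
      unfolding one using k by (intro diff) (auto simp: letter_in ev_letter ev_one hom)
    fix a assume a: "a \<in> carrier (A k)"
    show "?N (letter k a) \<le> nrm (A k) a" using k a by (simp add: ev_letter hom)
    show "?N (letter k (c \<odot>\<^bsub>A k\<^esub> a) - Poly_Mapping.single [(k, a)] c) = 0" for c
    proof -
      have "Poly_Mapping.single [(k, a)] c = c \<odot>\<^bsub>B\<^esub> letter k a" by (simp add: B_eq formal_alg_sel letter_def)
      then show ?thesis using k a diff[of "letter k (c \<odot>\<^bsub>A k\<^esub> a)" "c \<odot>\<^bsub>B\<^esub> letter k a"]
        by (simp add: letter_in ev_letter ev_smult hom)
    qed
    fix b assume b: "b \<in> carrier (A k)"
    show "?N (letter k (a \<oplus>\<^bsub>A k\<^esub> b) - (letter k a + letter k b)) = 0"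
    proof -
      have "letter k a + letter k b = letter k a \<oplus>\<^bsub>B\<^esub> letter k b" by (simp add: B_eq formal_alg_sel)
      then show ?thesis using k a b diff[of "letter k (a \<oplus>\<^bsub>A k\<^esub> b)" "letter k a \<oplus>\<^bsub>B\<^esub> letter k b"]
        by (simp add: letter_in ev_letter ev_add hom)
    qed
    show "?N (letter k (a \<otimes>\<^bsub>A k\<^esub> b) - Poly_Mapping.single [(k, a), (k, b)] 1) = 0"
    proof -
      have "Poly_Mapping.single [(k, a), (k, b)] 1 = letter k a \<otimes>\<^bsub>B\<^esub> letter k b"
        unfolding letter_def B_eq by simp
      then show ?thesis using k a b diff[of "letter k (a \<otimes>\<^bsub>A k\<^esub> b)" "letter k a \<otimes>\<^bsub>B\<^esub> letter k b"]
        by (simp add: letter_in ev_letter ev_mult hom)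
    qed
  qed
  note le = free_norm_upper[OF _ this]
  interpret C: cstar_algebra C by (rule cstar_algebra_free)
  let ?e = "completion_embed B FN"
  interpret X: dense_extension C D "carrier B" ?e E.evl
  proof
    fix p q assume pq: "p \<in> carrier B" "q \<in> carrier B"
    have "dst D (nrm D) (E.evl p) (E.evl q) = nrm D (E.evl (p - q))"
      using pq by (simp flip: B_diff add: ev_add ev_smult dst_def)
    also have "\<dots> \<le> FN (p - q)" using le[of "p - q"] pq by (simp flip: B_diff)
    also have "\<dots> = dst C (nrm C) (?e p) (?e q)"
      unfolding free_product_def using PC.embed_dst[OF pq] by (simp add: dst_def[of B] B_diff)
    finally show "dst D (nrm D) (E.evl p) (E.evl q) \<le> dst C (nrm C) (?e p) (?e q)" .
    show "\<exists>k\<in>carrier B. ?e k = ?e p \<oplus>\<^bsub>C\<^esub> ?e q \<and> E.evl k = E.evl p \<oplus>\<^bsub>D\<^esub> E.evl q"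
      using pq by (intro bexI[of _ "p \<oplus>\<^bsub>B\<^esub> q"]) (auto simp: ev_add free_product_def)
  next
    fix p c assume p: "p \<in> carrier B"
    show "\<exists>k\<in>carrier B. ?e k = c \<odot>\<^bsub>C\<^esub> ?e p \<and> E.evl k = c \<odot>\<^bsub>D\<^esub> E.evl p"
      using p by (intro bexI[of _ "c \<odot>\<^bsub>B\<^esub> p"]) (auto simp: ev_smult free_product_def)
  qed (auto simp: ev free_product_def PC.embed_dense)
  have "star_hom C D X.ext"
  proof (rule X.ext_star_hom)
    fix p q assume pq: "p \<in> carrier B" "q \<in> carrier B"
    show "\<exists>k\<in>carrier B. ?e k = ?e p \<otimes>\<^bsub>C\<^esub> ?e q \<and> E.evl k = E.evl p \<otimes>\<^bsub>D\<^esub> E.evl q"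
      using pq by (intro bexI[of _ "p \<otimes>\<^bsub>B\<^esub> q"]) (auto simp: ev_mult free_product_def)
  next
    fix p assume p: "p \<in> carrier B"
    show "\<exists>k\<in>carrier B. ?e k = star C (?e p) \<and> E.evl k = star D (E.evl p)"
      using p by (intro bexI[of _ "star B p"]) (auto simp: ev_star free_product_def)
  qed (auto intro!: bexI[of _ "\<one>\<^bsub>B\<^esub>"] simp: ev_one free_product_def)
  moreover have "X.ext (free_incl K A k a) = \<phi> k a" if "k \<in> K" "a \<in> carrier (A k)" for k a
    unfolding free_incl_def using that by (simp add: letter_in ev_letter)
  ultimately show ?thesis using that by blast
qed

end

section \<open>Norms defined by families of positive functionals\<close>

locale positive_functional = star_algebra B for B :: "('a, 'm) star_alg_scheme" (structure) +
  fixes \<omega> :: "'a \<Rightarrow> complex"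
  assumes fun_add: "a \<in> carrier B \<Longrightarrow> b \<in> carrier B \<Longrightarrow> \<omega> (a \<oplus> b) = \<omega> a + \<omega> b"
    and fun_smult: "a \<in> carrier B \<Longrightarrow> \<omega> (c \<odot> a) = c * \<omega> a"
    and fun_pos: "a \<in> carrier B \<Longrightarrow> \<omega> (star B a \<otimes> a) \<in> \<real>\<^sub>\<ge>\<^sub>0"
begin

definition "q a = Re (\<omega> (star B a \<otimes> a))"

lemma q_ge0 [simp]: "a \<in> carrier B \<Longrightarrow> 0 \<le> q a"
  using fun_pos[of a] by (simp add: q_def complex_nonneg_Reals_iff)

lemma fun_star_self: "a \<in> carrier B \<Longrightarrow> \<omega> (star B a \<otimes> a) = of_real (q a)"
  using fun_pos[of a] by (simp add: q_def complex_nonneg_Reals_iff complex_eq_iff)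

lemma expand:
  assumes "a \<in> carrier B" "b \<in> carrier B"
  shows "of_real (q (a \<oplus> c \<odot> b)) = of_real (q a) + c * \<omega> (star B a \<otimes> b) + cnj c * \<omega> (star B b \<otimes> a)
    + cnj c * c * of_real (q b)"
proof -
  have "of_real (q (a \<oplus> c \<odot> b)) = \<omega> (star B (a \<oplus> c \<odot> b) \<otimes> (a \<oplus> c \<odot> b))"
    using assms by (simp only: fun_star_self add_in smult_in)
  also have "\<dots> = \<omega> (star B a \<otimes> a) + c * \<omega> (star B a \<otimes> b) + (cnj c * \<omega> (star B b \<otimes> a) + cnj c * c * \<omega> (star B b \<otimes> b))"
    using assms by (simp add: distrib_left distrib_right fun_add fun_smult algebra_simps)
  finally show ?thesis using assms by (simp add: fun_star_self)
qed

lemma hermitian: assumes ab: "a \<in> carrier B" "b \<in> carrier B"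
  shows "\<omega> (star B b \<otimes> a) = cnj (\<omega> (star B a \<otimes> b))"
proof -
  have "Im (of_real (q (a \<oplus> c \<odot> b)) :: complex) = 0" for c by simp
  from this[of 1] this[of \<i>] show ?thesis unfolding expand[OF ab] by (auto simp: complex_eq_iff)
qed

lemma cauchy_schwarz: assumes ab: "a \<in> carrier B" "b \<in> carrier B"
  shows "(cmod (\<omega> (star B a \<otimes> b)))\<^sup>2 \<le> q a * q b"
proof -
  define z where "z = \<omega> (star B a \<otimes> b)"
  have zz: "(complex_of_real (cmod z))\<^sup>2 = z * cnj z" using complex_norm_square[of z] by simp
  have main: "0 \<le> q a - 2 * t * (cmod z)\<^sup>2 + t\<^sup>2 * (cmod z)\<^sup>2 * q b" for t
  proof -
    have "complex_of_real (q (a \<oplus> (- of_real t * cnj z) \<odot> b)) =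
        of_real (q a - 2 * t * (cmod z)\<^sup>2 + t\<^sup>2 * (cmod z)\<^sup>2 * q b)"
      unfolding expand[OF ab] hermitian[OF ab] z_def[symmetric]
      by (simp add: zz) (simp add: algebra_simps power2_eq_square)
    then have "q (a \<oplus> (- of_real t * cnj z) \<odot> b) = q a - 2 * t * (cmod z)\<^sup>2 + t\<^sup>2 * (cmod z)\<^sup>2 * q b"
      by (simp only: of_real_eq_iff)
    then show ?thesis using q_ge0[of "a \<oplus> (- of_real t * cnj z) \<odot> b"] ab by (simp del: q_ge0)
  qed
  show ?thesis
  proof (cases "q b = 0")
    case True
    have "z = 0"
    proof (rule ccontr)
      assume "z \<noteq> 0"
      then show False using main[of "(q a + 1) / (2 * (cmod z)\<^sup>2)"] True by simp
    qed
    then show ?thesis using True by (simp add: z_def)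
  next
    case False
    then have qb: "q b > 0" using q_ge0[OF ab(2)] by linarith
    have "0 \<le> q a - 2 * (1 / q b) * (cmod z)\<^sup>2 + (1 / q b)\<^sup>2 * (cmod z)\<^sup>2 * q b" by (rule main)
    also have "\<dots> = q a - (cmod z)\<^sup>2 / q b" using qb by (simp add: power2_eq_square field_simps)
    finally show ?thesis using qb by (simp add: z_def field_simps)
  qed
qed

lemma q_one: "q \<one> = Re (\<omega> \<one>)"
  by (simp add: q_def)

lemma fun_bound: "a \<in> carrier B \<Longrightarrow> (cmod (\<omega> a))\<^sup>2 \<le> q \<one> * q a"
  using cauchy_schwarz[of \<one> a] by simp

lemma positive_conj: "b \<in> carrier B \<Longrightarrow> positive_functional B (\<lambda>a. \<omega> (star B b \<otimes> (a \<otimes> b)))"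
proof
  fix a assume b: "b \<in> carrier B" and a: "a \<in> carrier B"
  have "star B b \<otimes> ((star B a \<otimes> a) \<otimes> b) = star B (a \<otimes> b) \<otimes> (a \<otimes> b)"
    using a b by (simp add: mult_assoc)
  then show "\<omega> (star B b \<otimes> (star B a \<otimes> a \<otimes> b)) \<in> \<real>\<^sub>\<ge>\<^sub>0" using a b by (simp only: fun_pos mult_in)
qed (auto simp: distrib_left distrib_right fun_add fun_smult)

text \<open>Iterating the Cauchy--Schwarz inequality turns any submultiplicative bound on \<open>\<omega>\<close> into the
  bound that is needed for left multiplication to act boundedly.\<close>

lemma bounded_action:
  assumes h: "h \<in> carrier B" "star B h = h" and s: "s \<in> carrier B"
    and L: "\<And>x. x \<in> carrier B \<Longrightarrow> cmod (\<omega> x) \<le> L x" "\<And>x. x \<in> carrier B \<Longrightarrow> 0 \<le> L x"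
      "\<And>x y. x \<in> carrier B \<Longrightarrow> y \<in> carrier B \<Longrightarrow> L (x \<otimes> y) \<le> L x * L y"
  shows "Re (\<omega> (star B s \<otimes> (h \<otimes> s))) \<le> L h * q s"
proof -
  interpret S: positive_functional B "\<lambda>a. \<omega> (star B s \<otimes> (a \<otimes> s))" by (rule positive_conj[OF s])
  define f where "f a = Re (\<omega> (star B s \<otimes> (a \<otimes> s)))" for a
  have S1: "S.q \<one> = q s" using s by (simp add: S.q_def q_def)
  have step: "(f a)\<^sup>2 \<le> q s * f (a \<otimes> a)" if "a \<in> carrier B" "star B a = a" for a
  proof -
    have "(f a)\<^sup>2 \<le> (cmod (\<omega> (star B s \<otimes> (a \<otimes> s))))\<^sup>2"
      unfolding f_def by (rule power2_le_iff_abs_le[THEN iffD2]) (simp_all add: abs_Re_le_cmod)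
    also have "\<dots> \<le> q s * f (a \<otimes> a)" using S.fun_bound[OF that(1)] S1 that by (simp add: S.q_def f_def)
    finally show ?thesis .
  qed
  define pw where "pw k = ((\<lambda>a. a \<otimes> a) ^^ k) h" for k :: nat
  have pw: "pw k \<in> carrier B \<and> star B (pw k) = pw k" for k
    by (induction k) (auto simp: pw_def h)
  have pwS: "pw (Suc k) = pw k \<otimes> pw k" for k by (simp add: pw_def)
  define K where "K = L (star B s) * L s"
  have K: "K \<ge> 0" using s L by (simp add: K_def)
  have Lpw: "L (pw k) \<le> (L h) ^ (2 ^ k)" for k
  proof (induction k)
    case (Suc k)
    have "L (pw (Suc k)) \<le> L (pw k) * L (pw k)" unfolding pwS by (rule L) (use pw in auto)
    also have "\<dots> \<le> (L h) ^ (2 ^ k) * (L h) ^ (2 ^ k)" using Suc L(2) pw h by (intro mult_mono zero_le_power) auto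
    finally show ?case by (simp add: power_add[symmetric] mult_2)
  qed (simp add: pw_def)
  have fpw: "f (pw k) \<le> K * (L h) ^ (2 ^ k)" for k
  proof -
    have "f (pw k) \<le> cmod (\<omega> (star B s \<otimes> (pw k \<otimes> s)))" unfolding f_def by (rule complex_Re_le_cmod)
    also have "\<dots> \<le> L (star B s \<otimes> (pw k \<otimes> s))" using pw s by (intro L) auto
    also have "\<dots> \<le> L (star B s) * (L (pw k) * L s)"
      using pw[of k] s L(2) by (intro order_trans[OF L(3) mult_left_mono[OF L(3)]]) auto
    also have "\<dots> = K * L (pw k)" by (simp add: K_def)
    also have "\<dots> \<le> K * (L h) ^ (2 ^ k)" using Lpw K by (intro mult_left_mono) auto
    finally show ?thesis .
  qed
  show ?thesis
  proof (cases "f h \<le> 0")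
    case True
    have "0 \<le> L h * q s" using L(2)[OF h(1)] s by simp
    with True show ?thesis by (simp add: f_def)
  next
    case False
    have "f h * f h \<le> q s * f (h \<otimes> h)" using step[OF h] by (simp add: power2_eq_square)
    then have "q s \<noteq> 0" using False by (auto simp: mult_le_0_iff)
    then have qs: "q s > 0" using q_ge0[OF s] by linarith
    have pos: "f h / q s > 0" using False qs by simp
    have iter: "q s * (f h / q s) ^ (2 ^ k) \<le> f (pw k)" for k
    proof (induction k)
      case 0 then show ?case using qs by (simp add: pw_def)
    next
      case (Suc k)
      have "(q s * (f h / q s) ^ (2 ^ k))\<^sup>2 \<le> (f (pw k))\<^sup>2" using Suc pos qs by (intro power_mono) auto
      also have "\<dots> \<le> q s * f (pw (Suc k))" using step[of "pw k"] pw by (simp add: pwS)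
      finally show ?case using qs by (simp add: power2_eq_square power_add mult_2 mult_ac)
    qed
    have "f h / q s \<le> L h"
    proof (rule ccontr)
      assume *: "\<not> f h / q s \<le> L h"
      have le: "q s * (f h / q s) ^ (2 ^ k) \<le> K * (L h) ^ (2 ^ k)" for k using iter[of k] fpw[of k] by simp
      define y where "y = f h / q s"
      have y: "0 < y" "L h < y" using * pos by (auto simp: y_def)
      define \<rho> where "\<rho> = L h / y"
      have \<rho>: "0 \<le> \<rho>" "\<rho> < 1" using y L(2)[OF h(1)] by (auto simp: \<rho>_def)
      have "q s \<le> K * \<rho> ^ (2 ^ k)" for k
        using le[of k, folded y_def] y by (simp add: \<rho>_def power_divide pos_le_divide_eq)
      moreover have "(\<lambda>k. K * \<rho> ^ (2 ^ k)) \<longlonglongrightarrow> K * 0"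
        using \<rho> by (intro tendsto_mult tendsto_const filterlim_compose[OF LIMSEQ_power_zero]
            filterlim_subseq) (auto simp: strict_mono_def)
      ultimately have "q s \<le> K * 0" by (intro LIMSEQ_le_const) auto
      with qs show False by simp
    qed
    then show ?thesis using qs by (simp add: f_def field_simps)
  qed
qed

end

text \<open>The norm \<open>N\<close> is the least one with \<open>\<omega>(a\<^sup>* a) \<le> N(a)\<^sup>2 \<omega>(1)\<close> for all \<open>\<omega>\<close>.  As the family contains
  \<open>a \<mapsto> \<omega>(b\<^sup>* a b)\<close> with each \<open>\<omega>\<close>, this is the operator norm in the direct sum of the GNS
  representations, expressed without representations.  Operator norms and the minimal tensor norm both have
  this form.\<close>

locale positive_family = star_algebra B for B :: "('a, 'm) star_alg_scheme" (structure) +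
  fixes \<Omega> :: "('a \<Rightarrow> complex) set" and N :: "'a \<Rightarrow> real"
  assumes Omega_positive: "\<omega> \<in> \<Omega> \<Longrightarrow> positive_functional B \<omega>"
    and Omega_conj: "\<omega> \<in> \<Omega> \<Longrightarrow> b \<in> carrier B \<Longrightarrow>
      \<exists>\<omega>'\<in>\<Omega>. \<forall>a\<in>carrier B. \<omega>' a = \<omega> (star B b \<otimes> (a \<otimes> b))"
    and Omega_ge0: "a \<in> carrier B \<Longrightarrow> 0 \<le> N a"
    and Omega_upper: "\<omega> \<in> \<Omega> \<Longrightarrow> a \<in> carrier B \<Longrightarrow> Re (\<omega> (star B a \<otimes> a)) \<le> (N a)\<^sup>2 * Re (\<omega> \<one>)"
    and Omega_least: "a \<in> carrier B \<Longrightarrow> 0 \<le> c \<Longrightarrow>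
      (\<And>\<omega>. \<omega> \<in> \<Omega> \<Longrightarrow> Re (\<omega> (star B a \<otimes> a)) \<le> c\<^sup>2 * Re (\<omega> \<one>)) \<Longrightarrow> N a \<le> c"
begin

lemma Omega_one_ge0: assumes "\<omega> \<in> \<Omega>" shows "0 \<le> Re (\<omega> \<one>)"
proof -
  interpret positive_functional B \<omega> using assms by (rule Omega_positive)
  show ?thesis using q_ge0[of \<one>] by (simp add: q_one)
qed

lemma Omega_le_norm: assumes w: "\<omega> \<in> \<Omega>" and a: "a \<in> carrier B" shows "cmod (\<omega> a) \<le> N a * Re (\<omega> \<one>)"
proof -
  interpret positive_functional B \<omega> using w by (rule Omega_positive)
  have "(cmod (\<omega> a))\<^sup>2 \<le> Re (\<omega> \<one>) * q a" using fun_bound[OF a] by (simp add: q_one)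
  also have "\<dots> \<le> Re (\<omega> \<one>) * ((N a)\<^sup>2 * Re (\<omega> \<one>))"
    using Omega_upper[OF w a] Omega_one_ge0[OF w] by (intro mult_left_mono) (auto simp: q_def)
  also have "\<dots> = (N a * Re (\<omega> \<one>))\<^sup>2" by (simp add: power2_eq_square)
  finally show ?thesis using Omega_ge0[OF a] Omega_one_ge0[OF w] by (simp add: power2_le_iff_abs_le)
qed

lemma Omega_conj_upper: assumes w: "\<omega> \<in> \<Omega>" and ab: "a \<in> carrier B" "b \<in> carrier B"
  shows "Re (\<omega> (star B (a \<otimes> b) \<otimes> (a \<otimes> b))) \<le> (N a)\<^sup>2 * Re (\<omega> (star B b \<otimes> b))"
proof -
  obtain \<omega>' where w': "\<omega>' \<in> \<Omega>" "\<And>a. a \<in> carrier B \<Longrightarrow> \<omega>' a = \<omega> (star B b \<otimes> (a \<otimes> b))"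
    using Omega_conj[OF w ab(2)] by blast
  have "star B (a \<otimes> b) \<otimes> (a \<otimes> b) = star B b \<otimes> ((star B a \<otimes> a) \<otimes> b)" using ab by (simp add: mult_assoc)
  then show ?thesis using Omega_upper[OF w'(1) ab(1)] w'(2)[of "star B a \<otimes> a"] w'(2)[of \<one>] ab by simp
qed

lemma N_submult: assumes ab: "a \<in> carrier B" "b \<in> carrier B" shows "N (a \<otimes> b) \<le> N a * N b"
proof (rule Omega_least)
  fix \<omega> assume w: "\<omega> \<in> \<Omega>"
  have "Re (\<omega> (star B (a \<otimes> b) \<otimes> (a \<otimes> b))) \<le> (N a)\<^sup>2 * Re (\<omega> (star B b \<otimes> b))" by (rule Omega_conj_upper[OF w ab])
  also have "\<dots> \<le> (N a)\<^sup>2 * ((N b)\<^sup>2 * Re (\<omega> \<one>))" using Omega_upper[OF w ab(2)] by (intro mult_left_mono) auto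
  finally show "Re (\<omega> (star B (a \<otimes> b) \<otimes> (a \<otimes> b))) \<le> (N a * N b)\<^sup>2 * Re (\<omega> \<one>)" by (simp add: power_mult_distrib)
qed (use ab Omega_ge0 in auto)

text \<open>The nontrivial half of the C*-identity is the Cauchy--Schwarz inequality for
  \<open>\<omega>(a\<^sup>* a) = \<omega>(1\<^sup>* (a\<^sup>* a))\<close>.\<close>

lemma N_sq_le: assumes a: "a \<in> carrier B" shows "(N a)\<^sup>2 \<le> N (star B a \<otimes> a)"
proof -
  have "N a \<le> sqrt (N (star B a \<otimes> a))"
  proof (rule Omega_least[OF a])
    fix \<omega> assume w: "\<omega> \<in> \<Omega>"
    have "Re (\<omega> (star B a \<otimes> a)) \<le> cmod (\<omega> (star B a \<otimes> a))" by (rule complex_Re_le_cmod)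
    also have "\<dots> \<le> N (star B a \<otimes> a) * Re (\<omega> \<one>)" using a by (intro Omega_le_norm[OF w]) auto
    finally show "Re (\<omega> (star B a \<otimes> a)) \<le> (sqrt (N (star B a \<otimes> a)))\<^sup>2 * Re (\<omega> \<one>)"
      using Omega_ge0[of "star B a \<otimes> a"] a by simp
  qed (use Omega_ge0 a in auto)
  then have "(N a)\<^sup>2 \<le> (sqrt (N (star B a \<otimes> a)))\<^sup>2" using Omega_ge0[OF a] by (intro power_mono)
  then show ?thesis using Omega_ge0[of "star B a \<otimes> a"] a by simp
qed

lemma N_star_eq: assumes a: "a \<in> carrier B" shows "N (star B a) = N a"
proof -
  have "N a \<le> N (star B a)" if a: "a \<in> carrier B" for a
  proof (cases "N a = 0")
    case False
    then have pos: "N a > 0" using Omega_ge0[OF a] by linarith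
    have "N a * N a \<le> N (star B a) * N a"
      using N_sq_le[OF a] N_submult[of "star B a" a] a by (simp add: power2_eq_square)
    with pos show ?thesis by simp
  qed (use Omega_ge0 a in auto)
  from this[OF a] this[of "star B a"] a show ?thesis by simp
qed

lemma N_cstar: assumes a: "a \<in> carrier B" shows "N (star B a \<otimes> a) = (N a)\<^sup>2"
  using N_sq_le[OF a] N_submult[of "star B a" a] N_star_eq[OF a] a by (auto simp: power2_eq_square intro: antisym)

lemma N_triangle: assumes ab: "a \<in> carrier B" "b \<in> carrier B" shows "N (a \<oplus> b) \<le> N a + N b"
proof (rule Omega_least)
  fix \<omega> assume w: "\<omega> \<in> \<Omega>"
  interpret positive_functional B \<omega> using w by (rule Omega_positive)
  let ?u = "Re (\<omega> \<one>)"
  have u: "?u \<ge> 0" by (rule Omega_one_ge0[OF w])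
  have qa: "q a \<le> (N a)\<^sup>2 * ?u" and qb: "q b \<le> (N b)\<^sup>2 * ?u"
    using Omega_upper[OF w] ab by (auto simp: q_def)
  have "(cmod (\<omega> (star B a \<otimes> b)))\<^sup>2 \<le> q a * q b" by (rule cauchy_schwarz[OF ab])
  also have "\<dots> \<le> ((N a)\<^sup>2 * ?u) * ((N b)\<^sup>2 * ?u)" using qa qb ab u by (intro mult_mono) auto
  also have "\<dots> = (N a * N b * ?u)\<^sup>2" by (simp add: power2_eq_square)
  finally have cs: "cmod (\<omega> (star B a \<otimes> b)) \<le> N a * N b * ?u"
    using Omega_ge0 ab u by (simp add: power2_le_iff_abs_le)
  have "complex_of_real (q (a \<oplus> b)) = of_real (q a) + \<omega> (star B a \<otimes> b) + cnj (\<omega> (star B a \<otimes> b)) + of_real (q b)"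
    using expand[OF ab, of 1] hermitian[OF ab] ab by simp
  then have "Re (complex_of_real (q (a \<oplus> b))) = q a + 2 * Re (\<omega> (star B a \<otimes> b)) + q b" by simp
  then have "q (a \<oplus> b) \<le> q a + 2 * cmod (\<omega> (star B a \<otimes> b)) + q b"
    using complex_Re_le_cmod[of "\<omega> (star B a \<otimes> b)"] by simp
  also have "\<dots> \<le> (N a + N b)\<^sup>2 * ?u" using qa qb cs by (simp add: power2_eq_square algebra_simps)
  finally show "Re (\<omega> (star B (a \<oplus> b) \<otimes> (a \<oplus> b))) \<le> (N a + N b)\<^sup>2 * ?u" by (simp add: q_def)
qed (use ab Omega_ge0 in auto)

lemma N_smult_le: assumes a: "a \<in> carrier B" shows "N (c \<odot> a) \<le> cmod c * N a"
proof (rule Omega_least)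
  fix \<omega> assume w: "\<omega> \<in> \<Omega>"
  interpret positive_functional B \<omega> using w by (rule Omega_positive)
  have "\<omega> (star B (c \<odot> a) \<otimes> (c \<odot> a)) = c * cnj c * \<omega> (star B a \<otimes> a)"
    using a by (simp add: fun_smult)
  also have "c * cnj c = of_real ((cmod c)\<^sup>2)" by (rule complex_norm_square[symmetric])
  finally have "Re (\<omega> (star B (c \<odot> a) \<otimes> (c \<odot> a))) = (cmod c)\<^sup>2 * Re (\<omega> (star B a \<otimes> a))"
    by (simp del: of_real_power)
  also have "\<dots> \<le> (cmod c)\<^sup>2 * ((N a)\<^sup>2 * Re (\<omega> \<one>))" using Omega_upper[OF w a] by (intro mult_left_mono) auto
  finally show "Re (\<omega> (star B (c \<odot> a) \<otimes> (c \<odot> a))) \<le> (cmod c * N a)\<^sup>2 * Re (\<omega> \<one>)"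
    by (simp add: power_mult_distrib)
qed (use a Omega_ge0 in auto)

sublocale seminormed_star_algebra B N
proof
  fix c x assume x: "x \<in> carrier B"
  show "N (c \<odot> x) = cmod c * N x"
  proof (cases "c = 0")
    case True
    then show ?thesis using N_smult_le[OF x, of 0] Omega_ge0[of \<zero>] x by simp
  next
    case False
    have "N x \<le> cmod (1 / c) * N (c \<odot> x)" using N_smult_le[of "c \<odot> x" "1 / c"] x False by simp
    then have "cmod c * N x \<le> N (c \<odot> x)" using False by (simp add: norm_divide field_simps)
    with N_smult_le[OF x, of c] show ?thesis by simp
  qed
qed (auto simp: Omega_ge0 N_triangle N_submult N_cstar)

end

section \<open>Polynomial functional calculus\<close>

definition poly_ev :: "('a, 'm) star_alg_scheme \<Rightarrow> 'a \<Rightarrow> complex poly \<Rightarrow> 'a" where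
  "poly_ev B x p = fold_coeffs (\<lambda>c y. c \<odot>\<^bsub>B\<^esub> \<one>\<^bsub>B\<^esub> \<oplus>\<^bsub>B\<^esub> x \<otimes>\<^bsub>B\<^esub> y) p \<zero>\<^bsub>B\<^esub>"

context star_algebra
begin

lemma poly_ev_0 [simp]: "poly_ev A x 0 = \<zero>"
  by (simp add: poly_ev_def)

lemma poly_ev_pCons [simp]: "x \<in> carrier A \<Longrightarrow> poly_ev A x (pCons c p) = c \<odot> \<one> \<oplus> x \<otimes> poly_ev A x p"
  unfolding poly_ev_def by (cases "p = 0 \<and> c = 0") auto

lemma poly_ev_in [simp]: "x \<in> carrier A \<Longrightarrow> poly_ev A x p \<in> carrier A"
  by (induction p) auto

lemma poly_ev_add: "x \<in> carrier A \<Longrightarrow> poly_ev A x (p + q) = poly_ev A x p \<oplus> poly_ev A x q"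
  by (induction p q rule: poly_induct2) (auto simp: smult_add_left distrib_left add_ac)

lemma poly_ev_smult: "x \<in> carrier A \<Longrightarrow> poly_ev A x (Polynomial.smult c p) = c \<odot> poly_ev A x p"
  by (induction p) (auto simp: smult_add_right)

lemma poly_ev_mult: "x \<in> carrier A \<Longrightarrow> poly_ev A x (p * q) = poly_ev A x p \<otimes> poly_ev A x q"
  by (induction p) (auto simp: poly_ev_add poly_ev_smult distrib_right mult_assoc)

lemma poly_ev_commute: "x \<in> carrier A \<Longrightarrow> x \<otimes> poly_ev A x p = poly_ev A x p \<otimes> x"
  using poly_ev_mult[of x "[:0, 1:]" p] poly_ev_mult[of x p "[:0, 1:]"] by (simp add: mult.commute)

lemma poly_ev_cnj: "x \<in> carrier A \<Longrightarrow> star A x = x \<Longrightarrow> poly_ev A x (map_poly cnj p) = star A (poly_ev A x p)"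
  by (induction p) (auto simp: map_poly_pCons poly_ev_commute)

end

context positive_family
begin

text \<open>In the GNS picture this says that \<open>c\<close> is bounded below as an operator, i.e. that \<open>0\<close> is not in its
  approximate point spectrum.  It takes the place of invertibility, which would require inverses to exist in the
  algebra.\<close>

definition bounded_below :: "'a \<Rightarrow> bool" where
  "bounded_below c \<longleftrightarrow> (\<exists>\<kappa>>0. \<forall>\<omega>\<in>\<Omega>. \<kappa> * Re (\<omega> \<one>) \<le> Re (\<omega> (star B c \<otimes> c)))"

lemma bounded_below_mult:
  assumes cd: "c \<in> carrier B" "d \<in> carrier B" and bc: "bounded_below c" and bd: "bounded_below d"
  shows "bounded_below (c \<otimes> d)"
proof -
  obtain \<kappa> where \<kappa>: "\<kappa> > 0" "\<And>\<omega>. \<omega> \<in> \<Omega> \<Longrightarrow> \<kappa> * Re (\<omega> \<one>) \<le> Re (\<omega> (star B c \<otimes> c))"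
    using bc unfolding bounded_below_def by blast
  obtain \<mu> where \<mu>: "\<mu> > 0" "\<And>\<omega>. \<omega> \<in> \<Omega> \<Longrightarrow> \<mu> * Re (\<omega> \<one>) \<le> Re (\<omega> (star B d \<otimes> d))"
    using bd unfolding bounded_below_def by blast
  have "\<kappa> * \<mu> * Re (\<omega> \<one>) \<le> Re (\<omega> (star B (c \<otimes> d) \<otimes> (c \<otimes> d)))" if w: "\<omega> \<in> \<Omega>" for \<omega>
  proof -
    obtain \<omega>' where w': "\<omega>' \<in> \<Omega>" "\<And>a. a \<in> carrier B \<Longrightarrow> \<omega>' a = \<omega> (star B d \<otimes> (a \<otimes> d))"
      using Omega_conj[OF w cd(2)] by blast
    have "\<kappa> * (\<mu> * Re (\<omega> \<one>)) \<le> \<kappa> * Re (\<omega> (star B d \<otimes> d))" using \<mu>(2)[OF w] \<kappa>(1) by (intro mult_left_mono) auto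
    also have "\<dots> = \<kappa> * Re (\<omega>' \<one>)" using w'(2)[of \<one>] cd by simp
    also have "\<dots> \<le> Re (\<omega>' (star B c \<otimes> c))" by (rule \<kappa>(2)[OF w'(1)])
    also have "\<dots> = Re (\<omega> (star B (c \<otimes> d) \<otimes> (c \<otimes> d)))"
      using w'(2)[of "star B c \<otimes> c"] cd by (simp add: mult_assoc)
    finally show ?thesis by simp
  qed
  then show ?thesis unfolding bounded_below_def using \<kappa>(1) \<mu>(1) by (intro exI[of _ "\<kappa> * \<mu>"]) auto
qed

text \<open>For \<open>z\<close> off the real axis \<open>|x - z|\<^sup>2 \<ge> (Im z)\<^sup>2\<close>; for real \<open>z\<close> with \<open>|z| > R\<close>
  the Cauchy--Schwarz inequality against \<open>1\<close> gives the constant \<open>(|z| - R)\<^sup>2\<close>, because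
  \<open>|\<omega>(x)| \<le> R \<omega>(1)\<close>.\<close>

lemma bounded_below_linear:
  assumes x: "x \<in> carrier B" "star B x = x" "N x \<le> R" and z: "\<not> (Im z = 0 \<and> \<bar>Re z\<bar> \<le> R)"
  shows "bounded_below (x \<oplus> (- z) \<odot> \<one>)"
proof -
  have R: "0 \<le> R" using x Omega_ge0[of x] by linarith
  have key: "Re (\<omega> (star B (x \<oplus> (- z) \<odot> \<one>) \<otimes> (x \<oplus> (- z) \<odot> \<one>))) \<ge> (Im z)\<^sup>2 * Re (\<omega> \<one>) \<and>
      (\<bar>Re z\<bar> > R \<longrightarrow> Re (\<omega> (star B (x \<oplus> (- z) \<odot> \<one>) \<otimes> (x \<oplus> (- z) \<odot> \<one>))) \<ge> (\<bar>Re z\<bar> - R)\<^sup>2 * Re (\<omega> \<one>))"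
    if w: "\<omega> \<in> \<Omega>" for \<omega>
  proof -
    interpret positive_functional B \<omega> using w by (rule Omega_positive)
    define u where "u = Re (\<omega> \<one>)"
    define r where "r = Re (\<omega> x)"
    have u0: "0 \<le> u" unfolding u_def by (rule Omega_one_ge0[OF w])
    have u1: "\<omega> \<one> = of_real u" using fun_star_self[of \<one>] by (simp add: u_def q_one)
    have rx: "\<omega> x = of_real r" using hermitian[of x \<one>] x by (auto simp: r_def complex_eq_iff)
    have E: "q (x \<oplus> c \<odot> \<one>) = q x + 2 * Re c * r + (cmod c)\<^sup>2 * u" for c
    proof -
      have "complex_of_real (q (x \<oplus> c \<odot> \<one>)) = of_real (q x) + c * of_real r + cnj c * of_real r + cnj c * c * of_real u"
        using expand[OF x(1) one_in, of c] x rx by (simp add: q_one u_def)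
      then have "Re (complex_of_real (q (x \<oplus> c \<odot> \<one>))) = q x + Re (c * of_real r + cnj c * of_real r) + Re (cnj c * c * of_real u)"
        by simp
      also have "cnj c * c = of_real ((cmod c)\<^sup>2)" by (metis complex_norm_square mult.commute)
      finally show ?thesis by (simp del: of_real_power)
    qed
    have pos: "0 \<le> q x + 2 * c * r + c\<^sup>2 * u" for c :: real
      using E[of "of_real c"] q_ge0[of "x \<oplus> of_real c \<odot> \<one>"] x by simp
    have cz: "(cmod z)\<^sup>2 = (Re z)\<^sup>2 + (Im z)\<^sup>2" by (simp add: cmod_power2)
    have 1: "(Im z)\<^sup>2 * u \<le> q (x \<oplus> (- z) \<odot> \<one>)"
      using pos[of "- Re z"] by (simp add: E cz algebra_simps)
    have 2: "(\<bar>Re z\<bar> - R)\<^sup>2 * u \<le> q (x \<oplus> (- z) \<odot> \<one>)" if gt: "\<bar>Re z\<bar> > R"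
    proof (cases "u = 0")
      case True
      then show ?thesis using 1 x by simp
    next
      case False
      with u0 have up: "u > 0" by simp
      have ru: "\<bar>r\<bar> \<le> R * u"
      proof -
        have "\<bar>r\<bar> \<le> N x * u" using Omega_le_norm[OF w x(1)] rx by (simp add: u_def)
        also have "\<dots> \<le> R * u" using x u0 by (intro mult_right_mono) auto
        finally show ?thesis .
      qed
      have "r\<^sup>2 \<le> q x * u" using cauchy_schwarz[of \<one> x] x rx by (simp add: q_one u_def mult.commute)
      then have "(r - Re z * u)\<^sup>2 \<le> (q x - 2 * Re z * r + (Re z)\<^sup>2 * u) * u"
        by (simp add: power2_eq_square algebra_simps)
      also have "\<dots> \<le> q (x \<oplus> (- z) \<odot> \<one>) * u"
        using u0 by (intro mult_right_mono) (auto simp: E cz algebra_simps)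
      finally have A: "(r - Re z * u)\<^sup>2 \<le> q (x \<oplus> (- z) \<odot> \<one>) * u" .
      have "(\<bar>Re z\<bar> - R) * u \<le> \<bar>r - Re z * u\<bar>"
        using ru abs_triangle_ineq2[of "Re z * u" r] up by (simp add: abs_mult left_diff_distrib abs_minus_commute)
      then have "((\<bar>Re z\<bar> - R) * u)\<^sup>2 \<le> (r - Re z * u)\<^sup>2"
        using gt up by (subst abs_le_square_iff[symmetric]) auto
      with A have "((\<bar>Re z\<bar> - R)\<^sup>2 * u) * u \<le> q (x \<oplus> (- z) \<odot> \<one>) * u"
        by (simp add: power2_eq_square algebra_simps)
      then show ?thesis using up by simp
    qed
    show ?thesis using 1 2 by (simp add: q_def u_def)
  qed
  show ?thesis
  proof (cases "Im z = 0")
    case True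
    then have gt: "\<bar>Re z\<bar> > R" using z by auto
    then show ?thesis unfolding bounded_below_def using key by (intro exI[of _ "(\<bar>Re z\<bar> - R)\<^sup>2"]) auto
  next
    case False
    then show ?thesis unfolding bounded_below_def using key by (intro exI[of _ "(Im z)\<^sup>2"]) auto
  qed
qed

text \<open>The fundamental theorem of algebra splits off one linear factor at a time.\<close>

lemma bounded_below_poly:
  assumes x: "x \<in> carrier B" "star B x = x" "N x \<le> R"
  shows "g \<noteq> 0 \<Longrightarrow> (\<And>t. \<bar>t\<bar> \<le> R \<Longrightarrow> poly g (complex_of_real t) \<noteq> 0) \<Longrightarrow> bounded_below (poly_ev B x g)"
proof (induction "degree g" arbitrary: g)
  case 0
  then obtain c where g: "g = [:c:]" "c \<noteq> 0" by (metis degree_eq_zeroE pCons_0_0)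
  have "Re (\<omega> (star B (c \<odot> \<one>) \<otimes> (c \<odot> \<one>))) = (cmod c)\<^sup>2 * Re (\<omega> \<one>)" if w: "\<omega> \<in> \<Omega>" for \<omega>
  proof -
    interpret positive_functional B \<omega> using w by (rule Omega_positive)
    have "\<omega> (star B (c \<odot> \<one>) \<otimes> (c \<odot> \<one>)) = (c * cnj c) * \<omega> \<one>" by (simp add: fun_smult)
    also have "c * cnj c = of_real ((cmod c)\<^sup>2)" by (rule complex_norm_square[symmetric])
    finally show ?thesis by (simp del: of_real_power)
  qed
  then show ?case using g x unfolding bounded_below_def by (intro exI[of _ "(cmod c)\<^sup>2"]) auto
next
  case (Suc n)
  then have "\<not> constant (poly g)" by (simp add: constant_degree)
  then obtain z where z: "poly g z = 0" using fundamental_theorem_of_algebra by blast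
  then obtain h where h: "g = [:- z, 1:] * h" by (metis dvdE poly_eq_0_iff_dvd)
  have h0: "h \<noteq> 0" using Suc.prems(1) h by auto
  have "degree g = 1 + degree h" unfolding h using h0 by (subst degree_mult_eq) auto
  then have "degree h = n" using Suc.hyps(2) by simp
  moreover have "poly h (of_real t) \<noteq> 0" if "\<bar>t\<bar> \<le> R" for t
    using Suc.prems(2)[OF that] h by auto
  ultimately have bh: "bounded_below (poly_ev B x h)" using Suc.hyps(1) h0 by auto
  have "\<not> (Im z = 0 \<and> \<bar>Re z\<bar> \<le> R)"
  proof
    assume *: "Im z = 0 \<and> \<bar>Re z\<bar> \<le> R"
    then have "z = of_real (Re z)" by (simp add: complex_eq_iff)
    then show False using Suc.prems(2)[of "Re z"] * z by simp
  qed
  then have "bounded_below (x \<oplus> (- z) \<odot> \<one>)" by (rule bounded_below_linear[OF x])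
  moreover have "poly_ev B x [:- z, 1:] = x \<oplus> (- z) \<odot> \<one>" using x by (simp add: add_comm)
  ultimately show ?case unfolding h using x bh by (simp only: poly_ev_mult) (intro bounded_below_mult, auto)
qed

text \<open>The spectrum of a selfadjoint element is found by hand: at a norming sequence of functionals,
  \<open>N (p(x))\<^sup>2 - p(x)\<^sup>* p(x)\<close> is not bounded below, so this polynomial has a root in \<open>[-R, R]\<close>.\<close>

lemma poly_ev_norm_le:
  assumes x: "x \<in> carrier B" "star B x = x" "N x \<le> R" and M: "0 \<le> M"
    and p: "\<And>t. \<bar>t\<bar> \<le> R \<Longrightarrow> cmod (poly p (of_real t)) \<le> M"
  shows "N (poly_ev B x p) \<le> M"
proof (rule ccontr)
  define P where "P = poly_ev B x p"
  have P: "P \<in> carrier B" using x by (simp add: P_def)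
  assume "\<not> N (poly_ev B x p) \<le> M"
  then have gt: "N P > M" by (simp add: P_def)
  define m where "m = (N P)\<^sup>2"
  have mM: "m > M\<^sup>2" using gt M unfolding m_def by (intro power_strict_mono) auto
  then have m: "m > 0" using zero_le_power2[of M] by linarith
  define g where "g = [:of_real m:] - map_poly cnj p * p"
  have g_ne: "poly g (of_real t) \<noteq> 0" if "\<bar>t\<bar> \<le> R" for t
  proof
    assume "poly g (of_real t) = 0"
    then have "of_real m = cnj (poly p (of_real t)) * poly p (of_real t)" by (simp add: g_def)
    also have "\<dots> = of_real ((cmod (poly p (of_real t)))\<^sup>2)" by (metis complex_norm_square mult.commute)
    finally have "m = (cmod (poly p (of_real t)))\<^sup>2" by (simp only: of_real_eq_iff)
    also have "\<dots> \<le> M\<^sup>2" using p[OF that] by (intro power_mono) auto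
    finally show False using mM by simp
  qed
  have "0 \<le> R" using x Omega_ge0[of x] by linarith
  then have "g \<noteq> 0" using g_ne[of 0] by auto
  then have bb: "bounded_below (poly_ev B x g)" using g_ne by (rule bounded_below_poly[OF x])
  define H where "H = star B P \<otimes> P"
  have H: "H \<in> carrier B" "star B H = H" "N H = m" using P by (auto simp: H_def m_def N_cstar)
  have "g = [:of_real m:] + Polynomial.smult (-1) (map_poly cnj p * p)" by (simp add: g_def)
  then have ev: "poly_ev B x g = of_real m \<odot> \<one> \<oplus> (-1) \<odot> H"
    using x by (simp only: poly_ev_add poly_ev_smult poly_ev_mult poly_ev_cnj P_def H_def) simp
  obtain \<kappa> where \<kappa>: "\<kappa> > 0"
    "\<And>\<omega>. \<omega> \<in> \<Omega> \<Longrightarrow> \<kappa> * Re (\<omega> \<one>) \<le> Re (\<omega> (star B (poly_ev B x g) \<otimes> poly_ev B x g))"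
    using bb unfolding bounded_below_def by blast
  define c where "c = sqrt (max 0 (m - \<kappa> / (2 * m)))"
  have "N P \<le> c"
  proof (rule Omega_least[OF P])
    fix \<omega> assume w: "\<omega> \<in> \<Omega>"
    interpret positive_functional B \<omega> using w by (rule Omega_positive)
    define u where "u = Re (\<omega> \<one>)"
    have u0: "0 \<le> u" unfolding u_def by (rule Omega_one_ge0[OF w])
    have HP: "\<omega> H = of_real (q P)" unfolding H_def using P by (rule fun_star_self)
    have "\<omega> \<one> = of_real u" using fun_star_self[of \<one>] by (simp add: u_def q_one)
    then have "\<omega> (star B (poly_ev B x g) \<otimes> poly_ev B x g) = of_real (m * m * u - 2 * m * q P) + \<omega> (star B H \<otimes> H)"
      unfolding ev using H
      by (simp add: distrib_left distrib_right fun_add fun_smult HP algebra_simps)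
    then have "\<kappa> * u \<le> m * m * u - 2 * m * q P + q H" using \<kappa>(2)[OF w] by (simp add: u_def q_def)
    moreover have "q H \<le> m\<^sup>2 * u" using Omega_upper[OF w H(1)] H by (simp add: q_def u_def)
    ultimately have "2 * m * q P \<le> 2 * m * m * u - \<kappa> * u" by (simp add: power2_eq_square)
    moreover have "2 * m * ((m - \<kappa> / (2 * m)) * u) = 2 * m * m * u - \<kappa> * u" using m by (simp add: field_simps)
    ultimately have "2 * m * q P \<le> 2 * m * ((m - \<kappa> / (2 * m)) * u)" by simp
    then have "q P \<le> (m - \<kappa> / (2 * m)) * u" using m by simp
    also have "\<dots> \<le> c\<^sup>2 * u" unfolding c_def using u0 by (intro mult_right_mono) auto
    finally show "Re (\<omega> (star B P \<otimes> P)) \<le> c\<^sup>2 * Re (\<omega> \<one>)" by (simp add: q_def u_def)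
  qed (simp add: c_def)
  then have "m \<le> c\<^sup>2" unfolding m_def using P by (intro power_mono) auto
  also have "\<dots> = max 0 (m - \<kappa> / (2 * m))" by (simp add: c_def)
  also have "\<dots> < m" using m \<kappa>(1) by simp
  finally show False by simp
qed

end

section \<open>Continuous functions on an interval and their functional calculus\<close>

lemma C_interval_sel:
  "carrier (C_interval R) = {f \<in> extensional {-R..R}. continuous_on {-R..R} f}"
  "mult (C_interval R) f g = restrict (\<lambda>t. f t * g t) {-R..R}"
  "one (C_interval R) = restrict (\<lambda>t. 1) {-R..R}"
  "zero (C_interval R) = restrict (\<lambda>t. 0) {-R..R}"
  "add (C_interval R) f g = restrict (\<lambda>t. f t + g t) {-R..R}"
  "module.smult (C_interval R) c f = restrict (\<lambda>t. c * f t) {-R..R}"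
  "star (C_interval R) f = restrict (\<lambda>t. cnj (f t)) {-R..R}"
  "nrm (C_interval R) f = (SUP t\<in>{-R..R}. cmod (f t))"
  by (simp_all add: C_interval_def)

lemma restrict_in_C_interval: "continuous_on {-R..R} f \<Longrightarrow> restrict f {-R..R} \<in> carrier (C_interval R)"
  by (auto simp: C_interval_sel cong: continuous_on_cong_simp)

lemma star_algebra_C_interval: "star_algebra (C_interval R)"
proof
  fix f assume f: "f \<in> carrier (C_interval R)"
  then have "f = restrict f {-R..R}" by (auto simp: C_interval_sel extensional_restrict)
  then have *: "f t = restrict f {-R..R} t" for t by simp
  show "1 \<odot>\<^bsub>C_interval R\<^esub> f = f" "\<zero>\<^bsub>C_interval R\<^esub> \<oplus>\<^bsub>C_interval R\<^esub> f = f"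
    "\<one>\<^bsub>C_interval R\<^esub> \<otimes>\<^bsub>C_interval R\<^esub> f = f" "f \<otimes>\<^bsub>C_interval R\<^esub> \<one>\<^bsub>C_interval R\<^esub> = f"
    "star (C_interval R) (star (C_interval R) f) = f"
    by (rule ext, subst *, simp add: C_interval_sel restrict_def)+
qed (auto simp: C_interval_sel algebra_simps fun_eq_iff
       intro!: continuous_intros cong: continuous_on_cong_simp)

context
  fixes R :: real assumes R: "0 \<le> R"
begin

abbreviation "CI \<equiv> C_interval R"

lemma C_interval_bdd: "f \<in> carrier CI \<Longrightarrow> bdd_above ((\<lambda>t. cmod (f t)) ` {-R..R})"
  by (intro compact_imp_bounded[THEN bounded_imp_bdd_above] compact_continuous_image continuous_on_norm)
     (auto simp: C_interval_sel)

lemma C_interval_nrm_upper: "f \<in> carrier CI \<Longrightarrow> t \<in> {-R..R} \<Longrightarrow> cmod (f t) \<le> nrm CI f"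
  unfolding C_interval_sel(8) by (rule cSUP_upper[OF _ C_interval_bdd])

lemma C_interval_nrm_least: "(\<And>t. t \<in> {-R..R} \<Longrightarrow> cmod (f t) \<le> M) \<Longrightarrow> nrm CI f \<le> M"
  unfolding C_interval_sel(8) using R by (intro cSUP_least) auto

lemma C_interval_nrm_ge0: "f \<in> carrier CI \<Longrightarrow> 0 \<le> nrm CI f"
  using C_interval_nrm_upper[of f 0] R by (intro order_trans[OF norm_ge_zero, of "f 0"]) auto

lemma cstar_algebra_C_interval: "cstar_algebra CI"
proof -
  interpret star_algebra CI by (rule star_algebra_C_interval)
  have smult_le: "nrm CI (c \<odot>\<^bsub>CI\<^esub> f) \<le> cmod c * nrm CI f" if f: "f \<in> carrier CI" for c f
    by (rule C_interval_nrm_least)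
       (use C_interval_nrm_upper[OF f] in \<open>auto simp: C_interval_sel(6) norm_mult intro!: mult_left_mono\<close>)
  show ?thesis
  proof
    fix f assume f: "f \<in> carrier CI"
    show "0 \<le> nrm CI f" by (rule C_interval_nrm_ge0[OF f])
    show "nrm CI (c \<odot>\<^bsub>CI\<^esub> f) = cmod c * nrm CI f" for c
    proof (cases "c = 0")
      case True
      then show ?thesis using smult_le[OF f, of c] C_interval_nrm_ge0[OF smult_in[OF f, of c]] by simp
    next
      case False
      have "nrm CI f \<le> cmod (1 / c) * nrm CI (c \<odot>\<^bsub>CI\<^esub> f)"
        using smult_le[of "c \<odot>\<^bsub>CI\<^esub> f" "1 / c"] f False by simp
      then have "cmod c * nrm CI f \<le> nrm CI (c \<odot>\<^bsub>CI\<^esub> f)" using False by (simp add: norm_divide field_simps)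
      with smult_le[OF f, of c] show ?thesis by simp
    qed
    show "nrm CI (star CI f \<otimes>\<^bsub>CI\<^esub> f) = (nrm CI f)\<^sup>2"
    proof (rule antisym)
      show "nrm CI (star CI f \<otimes>\<^bsub>CI\<^esub> f) \<le> (nrm CI f)\<^sup>2"
        by (rule C_interval_nrm_least)
           (use C_interval_nrm_upper[OF f] in \<open>auto simp: C_interval_sel(2,7) norm_mult power2_eq_square intro!: mult_mono
              order_trans[OF norm_ge_zero]\<close>)
      have sf: "star CI f \<otimes>\<^bsub>CI\<^esub> f \<in> carrier CI" using f by simp
      have "nrm CI f \<le> sqrt (nrm CI (star CI f \<otimes>\<^bsub>CI\<^esub> f))"
      proof (rule C_interval_nrm_least)
        fix t assume t: "t \<in> {-R..R}"
        have "(cmod (f t))\<^sup>2 = cmod ((star CI f \<otimes>\<^bsub>CI\<^esub> f) t)"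
          using t by (simp add: C_interval_sel(2,7) norm_mult power2_eq_square)
        also have "\<dots> \<le> nrm CI (star CI f \<otimes>\<^bsub>CI\<^esub> f)" by (rule C_interval_nrm_upper[OF sf t])
        finally show "cmod (f t) \<le> sqrt (nrm CI (star CI f \<otimes>\<^bsub>CI\<^esub> f))" by (rule real_le_rsqrt)
      qed
      then have "(nrm CI f)\<^sup>2 \<le> (sqrt (nrm CI (star CI f \<otimes>\<^bsub>CI\<^esub> f)))\<^sup>2"
        using C_interval_nrm_ge0[OF f] by (intro power_mono)
      then show "(nrm CI f)\<^sup>2 \<le> nrm CI (star CI f \<otimes>\<^bsub>CI\<^esub> f)"
        using C_interval_nrm_ge0[OF sf] by simp
    qed
    show "f = \<zero>\<^bsub>CI\<^esub>" if "nrm CI f = 0"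
    proof
      fix t show "f t = \<zero>\<^bsub>CI\<^esub> t"
      proof (cases "t \<in> {-R..R}")
        case True
        then show ?thesis using C_interval_nrm_upper[OF f True] that by (simp add: C_interval_sel(4))
      next
        case False
        then show ?thesis using f by (auto simp: C_interval_sel(1,4) extensional_def)
      qed
    qed
    fix g assume g: "g \<in> carrier CI"
    show "nrm CI (f \<oplus>\<^bsub>CI\<^esub> g) \<le> nrm CI f + nrm CI g"
      by (rule C_interval_nrm_least)
         (use C_interval_nrm_upper[OF f] C_interval_nrm_upper[OF g] in
           \<open>auto simp: C_interval_sel(5) intro!: order_trans[OF norm_triangle_ineq] add_mono\<close>)
    show "nrm CI (f \<otimes>\<^bsub>CI\<^esub> g) \<le> nrm CI f * nrm CI g"
      by (rule C_interval_nrm_least)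
         (use C_interval_nrm_upper[OF f] C_interval_nrm_upper[OF g] C_interval_nrm_ge0[OF f] in
           \<open>auto simp: C_interval_sel(2) norm_mult intro!: mult_mono\<close>)
  qed
qed

abbreviation "cid \<equiv> restrict complex_of_real {-R..R}"

lemma cid_in: "cid \<in> carrier CI"
  by (intro restrict_in_C_interval continuous_intros)

lemma poly_ev_C_interval: "poly_ev CI cid p = restrict (\<lambda>t. poly p (of_real t)) {-R..R}"
proof -
  interpret star_algebra CI by (rule star_algebra_C_interval)
  show ?thesis
  proof (induction p)
    case (pCons c p)
    show ?case by (simp only: poly_ev_pCons[OF cid_in] pCons(2)) (auto simp: C_interval_sel(2,3,5,6) fun_eq_iff)
  qed (simp add: C_interval_sel(4))
qed

lemma C_interval_poly_dense:
  assumes f: "f \<in> carrier CI" and e: "e > 0"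
  shows "\<exists>p. dst CI (nrm CI) f (poly_ev CI cid p) < e"
proof -
  have "continuous_on {-R..R} f" using f by (simp add: C_interval_sel)
  then obtain g where g: "polynomial_function g" "\<And>t. t \<in> {-R..R} \<Longrightarrow> cmod (f t - g t) < e / 2"
    using Stone_Weierstrass_polynomial_function[of "{-R..R}" f "e/2"] e by auto
  have "real_polynomial_function (\<lambda>t. Re (g t))" "real_polynomial_function (\<lambda>t. Im (g t))"
    using g(1) bounded_linear_Re bounded_linear_Im unfolding polynomial_function_def o_def by auto
  then obtain a n b m where re: "(\<lambda>t. Re (g t)) = (\<lambda>t. \<Sum>i\<le>n. a i * t ^ i)"
    and im: "(\<lambda>t. Im (g t)) = (\<lambda>t. \<Sum>i\<le>m. b i * t ^ i)"
    unfolding real_polynomial_function_iff_sum by blast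
  define p where "p = (\<Sum>i\<le>n. monom (complex_of_real (a i)) i) + (\<Sum>i\<le>m. monom (\<i> * of_real (b i)) i)"
  have pg: "poly p (of_real t) = g t" for t
    using fun_cong[OF re, of t] fun_cong[OF im, of t]
    by (simp add: p_def poly_sum poly_monom complex_eq_iff flip: of_real_power)
  interpret cstar_algebra CI by (rule cstar_algebra_C_interval)
  have "dst CI (nrm CI) f (poly_ev CI cid p) \<le> e / 2"
    unfolding dst_def poly_ev_C_interval
    by (rule C_interval_nrm_least) (use g(2) pg in \<open>auto simp: C_interval_sel(5,6) less_imp_le\<close>)
  also have "\<dots> < e" using e by simp
  finally show ?thesis by blast
qed

text \<open>Polynomials are dense in \<open>C[-R, R]\<close>, and \<open>p \<mapsto> p(a)\<close> is contractive by \<open>poly_ev_norm_le\<close>.\<close>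

theorem functional_calculus:
  fixes D :: "'d cstar_alg"
  assumes D: "complete_cstar_algebra D" and Om: "positive_family D \<Omega> (nrm D)"
    and a: "a \<in> carrier D" "star D a = a" "nrm D a \<le> R"
  obtains \<phi> where "star_hom CI D \<phi>" "\<phi> cid = a"
proof -
  interpret D: complete_cstar_algebra D by (rule D)
  interpret P: positive_family D \<Omega> "nrm D" by (rule Om)
  interpret C: cstar_algebra CI by (rule cstar_algebra_C_interval)
  have cid_star: "star CI cid = cid" by (auto simp: C_interval_sel)
  interpret X: dense_extension CI D UNIV "poly_ev CI cid" "poly_ev D a"
  proof
    fix p q :: "complex poly"
    have sub: "p - q = p + Polynomial.smult (-1) q" by simp
    have "dst D (nrm D) (poly_ev D a p) (poly_ev D a q) = nrm D (poly_ev D a (p - q))"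
      unfolding sub dst_def using a by (simp only: D.poly_ev_add D.poly_ev_smult)
    also have "\<dots> \<le> nrm CI (poly_ev CI cid (p - q))"
    proof (rule P.poly_ev_norm_le[OF a])
      have pin: "poly_ev CI cid (p - q) \<in> carrier CI" using cid_in by simp
      show "0 \<le> nrm CI (poly_ev CI cid (p - q))" using pin by simp
      show "cmod (poly (p - q) (of_real t)) \<le> nrm CI (poly_ev CI cid (p - q))" if "\<bar>t\<bar> \<le> R" for t
        using C_interval_nrm_upper[OF pin, of t] that by (simp add: poly_ev_C_interval abs_le_iff minus_le_iff)
    qed
    also have "\<dots> = dst CI (nrm CI) (poly_ev CI cid p) (poly_ev CI cid q)"
      unfolding sub dst_def using cid_in by (simp only: C.poly_ev_add C.poly_ev_smult)
    finally show "dst D (nrm D) (poly_ev D a p) (poly_ev D a q) \<le>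
      dst CI (nrm CI) (poly_ev CI cid p) (poly_ev CI cid q)" .
    show "\<exists>k\<in>UNIV. poly_ev CI cid k = poly_ev CI cid p \<oplus>\<^bsub>CI\<^esub> poly_ev CI cid q \<and>
        poly_ev D a k = poly_ev D a p \<oplus>\<^bsub>D\<^esub> poly_ev D a q"
      using cid_in a by (intro bexI[of _ "p + q"]) (auto simp: C.poly_ev_add D.poly_ev_add)
    show "\<exists>k\<in>UNIV. poly_ev CI cid k = c \<odot>\<^bsub>CI\<^esub> poly_ev CI cid p \<and>
        poly_ev D a k = c \<odot>\<^bsub>D\<^esub> poly_ev D a p" for c
      using cid_in a by (intro bexI[of _ "Polynomial.smult c p"]) (auto simp: C.poly_ev_smult D.poly_ev_smult)
  next
    fix x :: "real \<Rightarrow> complex" and e :: real assume "x \<in> carrier CI" "0 < e"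
    then show "\<exists>g\<in>UNIV. dst CI (nrm CI) x (poly_ev CI cid g) < e" using C_interval_poly_dense by auto
  qed (use cid_in a in auto)
  have "star_hom CI D X.ext"
  proof (rule X.ext_star_hom)
    fix p q :: "complex poly"
    show "\<exists>k\<in>UNIV. poly_ev CI cid k = poly_ev CI cid p \<otimes>\<^bsub>CI\<^esub> poly_ev CI cid q \<and>
        poly_ev D a k = poly_ev D a p \<otimes>\<^bsub>D\<^esub> poly_ev D a q"
      using cid_in a by (intro bexI[of _ "p * q"]) (auto simp: C.poly_ev_mult D.poly_ev_mult)
    show "\<exists>k\<in>UNIV. poly_ev CI cid k = star CI (poly_ev CI cid p) \<and> poly_ev D a k = star D (poly_ev D a p)"
      using cid_in cid_star a by (intro bexI[of _ "map_poly cnj p"]) (auto simp: C.poly_ev_cnj D.poly_ev_cnj)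
    show "\<exists>k\<in>UNIV. poly_ev CI cid k = \<one>\<^bsub>CI\<^esub> \<and> poly_ev D a k = \<one>\<^bsub>D\<^esub>"
      using cid_in a by (intro bexI[of _ "[:1:]"]) auto
  qed
  moreover have "X.ext cid = a"
    using X.ext_i[of "[:0, 1:]"] cid_in a by simp
  ultimately show ?thesis using that by blast
qed

lemma gen_span_poly:
  assumes "cstar_algebra A" "k \<in> V" "x k \<in> carrier A" "\<And>k. k \<in> V \<Longrightarrow> x k \<in> carrier A"
  shows "poly_ev A (x k) p \<in> gen_span A x V"
proof -
  interpret cstar_algebra A by fact
  show ?thesis
  proof (induction p)
    case 0 then show ?case by (simp add: gen_span_def lin_span.zero)
  next
    case (pCons c p)
    have "x k \<otimes>\<^bsub>A\<^esub> poly_ev A (x k) p \<in> gen_span A x V"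
      using assms pCons by (intro gen_span_mult gen_span_gen) auto
    moreover have "c \<odot>\<^bsub>A\<^esub> \<one>\<^bsub>A\<^esub> \<in> gen_span A x V"
      using gen_span_one[of x V] unfolding gen_span_def by (rule lin_span.smult)
    ultimately show ?case using assms by (simp add: gen_span_def lin_span.add)
  qed
qed

end

section \<open>The universal algebras and evaluation at selfadjoint elements\<close>

lemma star_hom_poly_ev:
  assumes h: "star_hom A D \<phi>" and "star_algebra A" "star_algebra D" "x \<in> carrier A"
  shows "\<phi> (poly_ev A x p) = poly_ev D (\<phi> x) p"
proof -
  interpret A: star_algebra A by fact
  interpret D: star_algebra D by fact
  have z: "\<phi> \<zero>\<^bsub>A\<^esub> = \<zero>\<^bsub>D\<^esub>"
    using star_homD(4)[OF h, of "\<zero>\<^bsub>A\<^esub>" 0] star_homD(1)[OF h, of "\<zero>\<^bsub>A\<^esub>"] by simp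
  show ?thesis by (induction p) (use assms in \<open>auto simp: z star_homD[OF h]\<close>)
qed

lemma star_hom_nclosure:
  assumes h: "star_hom A D \<phi>" and A: "star_algebra A" and D: "star_algebra D"
    and Q: "Q \<subseteq> carrier A" and im: "\<And>y. y \<in> Q \<Longrightarrow> \<phi> y \<in> Q'" and x: "x \<in> nclosure A Q"
  shows "\<phi> x \<in> nclosure D Q'"
  unfolding nclosure_def
proof (intro CollectI conjI allI impI)
  have xA: "x \<in> carrier A" using x by (simp add: nclosure_def)
  then show "\<phi> x \<in> carrier D" by (rule star_homD(1)[OF h])
  fix e :: real assume "e > 0"
  then obtain y where y: "y \<in> Q" "dst A (nrm A) x y < e" using x by (auto simp: nclosure_def)
  then show "\<exists>y\<in>Q'. dst D (nrm D) (\<phi> x) y < e"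
    using star_hom_dst[OF h A D xA, of y] Q im by (intro bexI[of _ "\<phi> y"]) auto
qed

context
  fixes R :: real assumes R: "0 \<le> R"
begin

lemma free_family_interval: "free_family {..<k::nat} (\<lambda>j. C_interval R)"
  by (rule free_family.intro) (rule cstar_algebra_C_interval[OF R])

lemma cstar_algebra_C_tuple: "cstar_algebra (C_tuple R k)"
  unfolding C_tuple_def by (rule free_family.cstar_algebra_free[OF free_family_interval])

lemma free_family_tuple: "free_family {..<n::nat} (\<lambda>i. C_tuple R (r i))"
  by (rule free_family.intro) (rule cstar_algebra_C_tuple)

lemma cstar_algebra_C_all: "cstar_algebra (C_all R n r)"
  unfolding C_all_def by (rule free_family.cstar_algebra_free[OF free_family_tuple])

lemma tuple_incl_hom: "i < n \<Longrightarrow> star_hom (C_tuple R (r i)) (C_all R n r) (tuple_incl R n r i)"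
  unfolding C_all_def tuple_incl_def
  using free_family.free_incl_hom[OF free_family_tuple, of i n r] by simp

lemma interval_incl_hom:
  "j < k \<Longrightarrow> star_hom (C_interval R) (C_tuple R k) (free_incl {..<k} (\<lambda>j. C_interval R) j)"
  unfolding C_tuple_def using free_family.free_incl_hom[OF free_family_interval, of j k] by simp

lemma x_tuple_in: "j < k \<Longrightarrow> x_tuple R k j \<in> carrier (C_tuple R k)"
  unfolding x_tuple_def by (rule star_homD(1)[OF interval_incl_hom]) (auto intro: cid_in[OF R])

lemma x_tuple_star: assumes "j < k" shows "star (C_tuple R k) (x_tuple R k j) = x_tuple R k j"
proof -
  have "star (C_interval R) (restrict complex_of_real {-R..R}) = restrict complex_of_real {-R..R}"
    by (auto simp: C_interval_sel)
  then show ?thesis unfolding x_tuple_def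
    using star_homD(6)[OF interval_incl_hom[OF assms] cid_in[OF R]] by simp
qed

lemma x_all_in: "i < n \<Longrightarrow> j < r i \<Longrightarrow> x_all R n r i j \<in> carrier (C_all R n r)"
  unfolding x_all_def by (rule star_homD(1)[OF tuple_incl_hom]) (auto intro: x_tuple_in)

lemma x_all_star: "i < n \<Longrightarrow> j < r i \<Longrightarrow> star (C_all R n r) (x_all R n r i j) = x_all R n r i j"
  unfolding x_all_def
  using star_homD(6)[OF tuple_incl_hom x_tuple_in, of i n j r] x_tuple_star[of j "r i"] by simp

lemma tuple_dense: "nclosure (C_tuple R k) (gen_span (C_tuple R k) (x_tuple R k) {..<k}) = carrier (C_tuple R k)"
proof -
  interpret T: cstar_algebra "C_tuple R k" by (rule cstar_algebra_C_tuple)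
  interpret I: cstar_algebra "C_interval R" by (rule cstar_algebra_C_interval[OF R])
  let ?Q = "gen_span (C_tuple R k) (x_tuple R k) {..<k}"
  have Q: "?Q \<subseteq> carrier (C_tuple R k)" using T.gen_span_in[of "{..<k}" "x_tuple R k"] x_tuple_in by blast
  note F = free_family.free_dense[OF free_family_interval, folded C_tuple_def]
  show ?thesis
  proof (rule F[OF Q])
    fix j f assume j: "j \<in> {..<k}" and f: "f \<in> carrier (C_interval R)"
    let ?inc = "free_incl {..<k} (\<lambda>j. C_interval R) j"
    have h: "star_hom (C_interval R) (C_tuple R k) ?inc" using j by (intro interval_incl_hom) simp
    let ?P = "range (poly_ev (C_interval R) (restrict complex_of_real {-R..R}))"
    have P: "?P \<subseteq> carrier (C_interval R)" using I.poly_ev_in[OF cid_in[OF R]] by auto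
    have fP: "f \<in> nclosure (C_interval R) ?P"
      unfolding nclosure_def using f C_interval_poly_dense[OF R f] by auto
    show "?inc f \<in> nclosure (C_tuple R k) ?Q"
    proof (rule star_hom_nclosure[OF h I.star_algebra_axioms T.star_algebra_axioms P _ fP])
      fix y assume "y \<in> ?P"
      then obtain p where "y = poly_ev (C_interval R) (restrict complex_of_real {-R..R}) p" by auto
      then have "?inc y = poly_ev (C_tuple R k) (x_tuple R k j) p"
        using star_hom_poly_ev[OF h I.star_algebra_axioms T.star_algebra_axioms cid_in[OF R]]
        by (simp add: x_tuple_def)
      then show "?inc y \<in> ?Q"
        using gen_span_poly[OF R T.cstar_algebra_axioms j, of "x_tuple R k"] j x_tuple_in by auto
    qed
  qed (use T.gen_span_mult[of "{..<k}" "x_tuple R k"] x_tuple_in T.gen_span_one in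
        \<open>auto simp: gen_span_def intro: lin_span.add lin_span.smult\<close>)
qed

lemma nc_polys_gen_span:
  "nc_polys R n r = gen_span (C_all R n r) (\<lambda>(i, j). x_all R n r i j) (var_set n r)"
  by (simp add: nc_polys_def gen_span_def)

lemma nc_polys_in: "nc_polys R n r \<subseteq> carrier (C_all R n r)"
proof -
  interpret C: cstar_algebra "C_all R n r" by (rule cstar_algebra_C_all)
  show ?thesis unfolding nc_polys_gen_span
    using C.gen_span_in[of "var_set n r" "\<lambda>(i, j). x_all R n r i j"] x_all_in by (auto simp: var_set_def)
qed

lemma nc_polys_dense: "nclosure (C_all R n r) (nc_polys R n r) = carrier (C_all R n r)"
proof -
  interpret C: cstar_algebra "C_all R n r" by (rule cstar_algebra_C_all)
  let ?x = "\<lambda>(i, j). x_all R n r i j"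
  have x: "\<And>k. k \<in> var_set n r \<Longrightarrow> ?x k \<in> carrier (C_all R n r)" using x_all_in by (auto simp: var_set_def)
  note F = free_family.free_dense[OF free_family_tuple, folded C_all_def]
  show ?thesis
  proof (rule F[OF nc_polys_in])
    fix i f assume i: "i \<in> {..<n}" and f: "f \<in> carrier (C_tuple R (r i))"
    interpret T: cstar_algebra "C_tuple R (r i)" by (rule cstar_algebra_C_tuple)
    have h: "star_hom (C_tuple R (r i)) (C_all R n r) (tuple_incl R n r i)" using i by (intro tuple_incl_hom) simp
    let ?Q = "gen_span (C_tuple R (r i)) (x_tuple R (r i)) {..<r i}"
    have Q: "?Q \<subseteq> carrier (C_tuple R (r i))" using T.gen_span_in[of "{..<r i}" "x_tuple R (r i)"] x_tuple_in by blast
    have "tuple_incl R n r i f \<in> nclosure (C_all R n r) (nc_polys R n r)"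
    proof (rule star_hom_nclosure[OF h T.star_algebra_axioms C.star_algebra_axioms Q])
      show "f \<in> nclosure (C_tuple R (r i)) ?Q" using f tuple_dense by simp
      fix y assume "y \<in> ?Q"
      then have "tuple_incl R n r i y \<in> gen_span (C_all R n r) (\<lambda>j. x_all R n r i j) {..<r i}"
        using star_hom_gen_span[OF h T.cstar_algebra_axioms C.cstar_algebra_axioms, of "{..<r i}" "x_tuple R (r i)" y]
          x_tuple_in by (simp add: x_all_def)
      moreover have "gen_span (C_all R n r) (\<lambda>j. x_all R n r i j) {..<r i} \<subseteq> nc_polys R n r"
      proof
        fix z assume "z \<in> gen_span (C_all R n r) (\<lambda>j. x_all R n r i j) {..<r i}"
        then show "z \<in> nc_polys R n r" unfolding gen_span_def nc_polys_def
        proof induction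
          case (incl a)
          then obtain w where w: "w \<in> lists {..<r i}" "a = word_prod (C_all R n r) (\<lambda>j. x_all R n r i j) w" by auto
          have "word_prod (C_all R n r) ?x (map (Pair i) w) = a"
            unfolding w(2) by (simp add: word_prod_def foldr_map o_def)
          moreover have "map (Pair i) w \<in> lists (var_set n r)" using w(1) i by (auto simp: var_set_def)
          ultimately show ?case by (intro lin_span.incl) blast
        qed (auto intro: lin_span.intros)
      qed
      ultimately show "tuple_incl R n r i y \<in> nc_polys R n r" by auto
    qed
    then show "free_incl {..<n} (\<lambda>i. C_tuple R (r i)) i f \<in> nclosure (C_all R n r) (nc_polys R n r)"
      by (simp add: tuple_incl_def)
  next
    fix y z assume "y \<in> nc_polys R n r" "z \<in> nc_polys R n r"
    then show "y \<otimes>\<^bsub>C_all R n r\<^esub> z \<in> nc_polys R n r"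
      unfolding nc_polys_gen_span by (intro C.gen_span_mult x)
  qed (auto simp: nc_polys_def intro: lin_span.add lin_span.smult C.gen_span_one[unfolded gen_span_def])
qed

text \<open>Two applications of the universal property of free products, to the functional calculi of the single
  elements and then to the evaluations of the tuples.\<close>

theorem eval_at_star_hom:
  fixes D :: "'d cstar_alg"
  assumes D: "complete_cstar_algebra D" and Om: "positive_family D \<Omega> (nrm D)"
    and a: "\<And>i j. i < n \<Longrightarrow> j < r i \<Longrightarrow> a i j \<in> carrier D \<and> star D (a i j) = a i j \<and> nrm D (a i j) \<le> R"
  shows "star_hom (C_all R n r) D (eval_at R n r D a)"
    and "i < n \<Longrightarrow> j < r i \<Longrightarrow> eval_at R n r D a (x_all R n r i j) = a i j"
proof -
  have "\<exists>\<phi>. star_hom (C_interval R) D \<phi> \<and> \<phi> (restrict complex_of_real {-R..R}) = a i j" if "i < n" "j < r i" for i j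
    using functional_calculus[OF R D Om, of "a i j"] a[OF that] by metis
  then obtain \<phi> where \<phi>: "\<And>i j. i < n \<Longrightarrow> j < r i \<Longrightarrow> star_hom (C_interval R) D (\<phi> i j)"
    "\<And>i j. i < n \<Longrightarrow> j < r i \<Longrightarrow> \<phi> i j (restrict complex_of_real {-R..R}) = a i j" by metis
  have "\<exists>\<psi>. star_hom (C_tuple R (r i)) D \<psi> \<and> (\<forall>j<r i. \<psi> (x_tuple R (r i) j) = a i j)" if i: "i < n" for i
  proof -
    obtain \<psi> where \<psi>: "star_hom (C_tuple R (r i)) D \<psi>"
      "\<And>j f. j \<in> {..<r i} \<Longrightarrow> f \<in> carrier (C_interval R) \<Longrightarrow>
        \<psi> (free_incl {..<r i} (\<lambda>j. C_interval R) j f) = \<phi> i j f"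
      unfolding C_tuple_def
      using free_family.free_product_universal[OF free_family_interval D, of "r i" "\<phi> i"] \<phi>(1)[OF i] by auto
    have "\<psi> (x_tuple R (r i) j) = a i j" if "j < r i" for j
      unfolding x_tuple_def using \<psi>(2)[of j, OF _ cid_in[OF R]] \<phi>(2)[OF i that] that by simp
    with \<psi>(1) show ?thesis by blast
  qed
  then obtain \<psi> where \<psi>: "\<And>i. i < n \<Longrightarrow> star_hom (C_tuple R (r i)) D (\<psi> i)"
    "\<And>i j. i < n \<Longrightarrow> j < r i \<Longrightarrow> \<psi> i (x_tuple R (r i) j) = a i j" by metis
  obtain \<Phi> where \<Phi>: "star_hom (C_all R n r) D \<Phi>"
    "\<And>i f. i \<in> {..<n} \<Longrightarrow> f \<in> carrier (C_tuple R (r i)) \<Longrightarrow> \<Phi> (free_incl {..<n} (\<lambda>i. C_tuple R (r i)) i f) = \<psi> i f"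
    unfolding C_all_def
    using free_family.free_product_universal[OF free_family_tuple D, of n r \<psi>] \<psi>(1) by auto
  have "\<Phi> (x_all R n r i j) = a i j" if "i < n" "j < r i" for i j
    unfolding x_all_def tuple_incl_def using \<Phi>(2)[of i, OF _ x_tuple_in] \<psi>(2) that by simp
  with \<Phi>(1) have "\<exists>\<phi>. star_hom (C_all R n r) D \<phi> \<and> (\<forall>i<n. \<forall>j<r i. \<phi> (x_all R n r i j) = a i j)" by blast
  from someI_ex[OF this] show "star_hom (C_all R n r) D (eval_at R n r D a)"
    "i < n \<Longrightarrow> j < r i \<Longrightarrow> eval_at R n r D a (x_all R n r i j) = a i j"
    unfolding eval_at_def by auto
qed

end

section \<open>Positivity of product functionals\<close>

text \<open>The condition on the real part of the quadratic form does not force \<open>P\<close> to be Hermitian, so this is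
  required separately.\<close>

definition psd :: "'i set \<Rightarrow> ('i \<Rightarrow> 'i \<Rightarrow> complex) \<Rightarrow> bool" where
  "psd K P \<longleftrightarrow> (\<forall>u\<in>K. \<forall>v\<in>K. P v u = cnj (P u v)) \<and>
     (\<forall>c. 0 \<le> Re (\<Sum>u\<in>K. \<Sum>v\<in>K. cnj (c u) * c v * P u v))"

lemma psd_herm: "psd K P \<Longrightarrow> u \<in> K \<Longrightarrow> v \<in> K \<Longrightarrow> P v u = cnj (P u v)"
  unfolding psd_def by blast

lemma psd_ge0: assumes "psd K P" shows "0 \<le> Re (\<Sum>u\<in>K. \<Sum>v\<in>K. cnj (c u) * c v * P u v)"
  using conjunct2[OF assms[unfolded psd_def]] by (rule spec)

lemma psd_cong:
  assumes "psd K P" and eq: "\<And>u v. u \<in> K \<Longrightarrow> v \<in> K \<Longrightarrow> P u v = Q u v"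
  shows "psd K Q"
  unfolding psd_def
proof (intro conjI allI ballI)
  fix u v assume "u \<in> K" "v \<in> K"
  then show "Q v u = cnj (Q u v)" using psd_herm[OF assms(1), of u v] eq[of u v] eq[of v u] by simp
next
  fix c :: "'a \<Rightarrow> complex"
  have *: "(\<Sum>u\<in>K. \<Sum>v\<in>K. cnj (c u) * c v * P u v) = (\<Sum>u\<in>K. \<Sum>v\<in>K. cnj (c u) * c v * Q u v)"
    by (intro sum.cong refl) (simp add: eq)
  show "0 \<le> Re (\<Sum>u\<in>K. \<Sum>v\<in>K. cnj (c u) * c v * Q u v)"
    unfolding *[symmetric] by (rule psd_ge0[OF assms(1)])
qed

lemma psd_subset: assumes "psd K P" "K' \<subseteq> K" "finite K" shows "psd K' P"
  unfolding psd_def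
proof (intro conjI allI)
  show "\<forall>u\<in>K'. \<forall>v\<in>K'. P v u = cnj (P u v)" using psd_herm[OF assms(1)] assms(2) by blast
  fix c :: "'a \<Rightarrow> complex"
  define d where "d u = (if u \<in> K' then c u else 0)" for u
  have "(\<Sum>u\<in>K. \<Sum>v\<in>K. cnj (d u) * d v * P u v) = (\<Sum>u\<in>K'. \<Sum>v\<in>K. cnj (d u) * d v * P u v)"
    using assms by (intro sum.mono_neutral_right) (auto simp: d_def)
  also have "\<dots> = (\<Sum>u\<in>K'. \<Sum>v\<in>K'. cnj (d u) * d v * P u v)"
    using assms by (intro sum.cong refl sum.mono_neutral_right) (auto simp: d_def)
  also have "\<dots> = (\<Sum>u\<in>K'. \<Sum>v\<in>K'. cnj (c u) * c v * P u v)" by (simp add: d_def)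
  finally have eq: "(\<Sum>u\<in>K. \<Sum>v\<in>K. cnj (d u) * d v * P u v) = (\<Sum>u\<in>K'. \<Sum>v\<in>K'. cnj (c u) * c v * P u v)" .
  show "0 \<le> Re (\<Sum>u\<in>K'. \<Sum>v\<in>K'. cnj (c u) * c v * P u v)"
    unfolding eq[symmetric] by (rule psd_ge0[OF assms(1)])
qed

lemma psd_diag: assumes "psd K P" "k \<in> K" "finite K" shows "0 \<le> Re (P k k)" "Im (P k k) = 0"
proof -
  have "psd {k} P" by (rule psd_subset[OF assms(1) _ assms(3)]) (use assms in auto)
  from psd_ge0[OF this, of "\<lambda>_. 1"] show "0 \<le> Re (P k k)" by simp
  have "P k k = cnj (P k k)" by (rule psd_herm[OF assms(1,2,2)])
  then have "Im (P k k) = - Im (P k k)" by (metis cnj.sel(2))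
  then show "Im (P k k) = 0" by simp
qed

lemma psd_zero_row: assumes "psd K P" "finite K" "k \<in> K" "u \<in> K" "P k k = 0" shows "P k u = 0"
proof (cases "u = k")
  case False
  have sub: "psd {k, u} P" by (rule psd_subset[OF assms(1) _ assms(2)]) (use assms in auto)
  have Puk: "P u k = cnj (P k u)" by (rule psd_herm[OF assms(1,3,4)])
  show ?thesis
  proof (rule ccontr)
    assume nz: "P k u \<noteq> 0"
    define s where "s = (Re (P u u) + 1) / (2 * (cmod (P k u))\<^sup>2)"
    define c where "c = (\<lambda>v. if v = k then - of_real s * P k u else (1 :: complex))"
    have "0 \<le> Re (\<Sum>a\<in>{k, u}. \<Sum>b\<in>{k, u}. cnj (c a) * c b * P a b)"
      by (rule psd_ge0[OF sub])
    also have "(\<Sum>a\<in>{k, u}. \<Sum>b\<in>{k, u}. cnj (c a) * c b * P a b) =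
        P u u - 2 * of_real s * (P k u * cnj (P k u))"
      using False assms(5) by (simp add: c_def Puk algebra_simps)
    also have "P k u * cnj (P k u) = of_real ((cmod (P k u))\<^sup>2)" by (rule complex_norm_square[symmetric])
    also have "Re (P u u - 2 * of_real s * of_real ((cmod (P k u))\<^sup>2)) = Re (P u u) - 2 * s * (cmod (P k u))\<^sup>2"
      by (simp del: of_real_power)
    also have "2 * s * (cmod (P k u))\<^sup>2 = Re (P u u) + 1" using nz by (simp add: s_def)
    finally show False by simp
  qed
qed (use assms in simp)

text \<open>Schur's product theorem, by elimination of one index at a time: subtracting the rank one kernel
  through the pivot leaves a positive kernel that vanishes on the pivot row.\<close>

lemma psd_product:
  assumes "finite K" "psd K P" "psd K Q"
  shows "0 \<le> Re (\<Sum>u\<in>K. \<Sum>v\<in>K. P u v * Q u v)"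
  using assms
proof (induction K arbitrary: P rule: finite_induct)
  case (insert k K)
  let ?K = "insert k K"
  have fin: "finite ?K" using insert by simp
  have Q: "psd K Q" by (rule psd_subset[OF insert.prems(2) _ fin]) auto
  define p where "p = Re (P k k)"
  have p: "0 \<le> p" "P k k = of_real p"
    using psd_diag[OF insert.prems(1) _ fin, of k] by (auto simp: p_def complex_eq_iff)
  have herm: "P v u = cnj (P u v)" if "u \<in> ?K" "v \<in> ?K" for u v
    by (rule psd_herm[OF insert.prems(1) that])
  have split: "(\<Sum>u\<in>?K. \<Sum>v\<in>?K. f u v) =
      (\<Sum>u\<in>K. \<Sum>v\<in>K. f u v) + (\<Sum>v\<in>K. f k v) + (\<Sum>u\<in>K. f u k) + f k k" for f :: "_ \<Rightarrow> _ \<Rightarrow> complex"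
    using insert.hyps by (simp add: sum.distrib algebra_simps)
  show ?case
  proof (cases "p = 0")
    case True
    then have "P k k = 0" using p by simp
    then have z: "P k u = 0" "P u k = 0" if "u \<in> ?K" for u
      using psd_zero_row[OF insert.prems(1) fin _ that, of k] herm[of k u] that by auto
    have "psd K P" by (rule psd_subset[OF insert.prems(1) _ fin]) auto
    from insert.IH[OF this Q] show ?thesis unfolding split using z by simp
  next
    case False
    with p have pp: "p > 0" by simp
    define P' where "P' u v = P u v - P u k * P k v / of_real p" for u v
    have "psd K P'"
      unfolding psd_def
    proof (intro conjI allI ballI)
      fix u v assume "u \<in> K" "v \<in> K"
      then show "P' v u = cnj (P' u v)"
        using herm[of u v] herm[of k u] herm[of v k] insert.hyps by (simp add: P'_def)
    next
      fix c :: "'a \<Rightarrow> complex"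
      define t where "t = (\<Sum>v\<in>K. c v * P k v)"
      define d where "d = c(k := - t / of_real p)"
      have dK: "d u = c u" if "u \<in> K" for u using that insert.hyps by (auto simp: d_def)
      have tc: "(\<Sum>u\<in>K. cnj (c u) * P u k) = cnj t"
        unfolding t_def cnj_sum by (intro sum.cong refl) (simp add: herm[of k])
      have "(\<Sum>u\<in>?K. \<Sum>v\<in>?K. cnj (d u) * d v * P u v) =
          (\<Sum>u\<in>K. \<Sum>v\<in>K. cnj (c u) * c v * P u v) + cnj (d k) * t + d k * cnj t + cnj (d k) * d k * of_real p"
        unfolding split tc[symmetric] unfolding t_def sum_distrib_left
        using dK p by (simp add: mult_ac)
      also have "\<dots> = (\<Sum>u\<in>K. \<Sum>v\<in>K. cnj (c u) * c v * P u v) - cnj t * t / of_real p"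
        using pp by (simp add: d_def field_simps)
      also have "cnj t * t / of_real p = (\<Sum>u\<in>K. \<Sum>v\<in>K. cnj (c u) * c v * (P u k * P k v / of_real p))"
        unfolding tc[symmetric] unfolding t_def sum_product sum_divide_distrib
        by (intro sum.cong refl) (simp add: mult_ac)
      also have "(\<Sum>u\<in>K. \<Sum>v\<in>K. cnj (c u) * c v * P u v) - \<dots> = (\<Sum>u\<in>K. \<Sum>v\<in>K. cnj (c u) * c v * P' u v)"
        by (simp add: P'_def right_diff_distrib sum_subtractf)
      finally have eq: "(\<Sum>u\<in>?K. \<Sum>v\<in>?K. cnj (d u) * d v * P u v) =
        (\<Sum>u\<in>K. \<Sum>v\<in>K. cnj (c u) * c v * P' u v)" .
      show "0 \<le> Re (\<Sum>u\<in>K. \<Sum>v\<in>K. cnj (c u) * c v * P' u v)"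
        unfolding eq[symmetric] by (rule psd_ge0[OF insert.prems(1)])
    qed
    from insert.IH[OF this Q] have 1: "0 \<le> Re (\<Sum>u\<in>K. \<Sum>v\<in>K. P' u v * Q u v)" .
    have row: "P' k v = 0" "P' v k = 0" for v using pp p by (auto simp: P'_def)
    have "(\<Sum>u\<in>?K. \<Sum>v\<in>?K. P u v * Q u v) = (\<Sum>u\<in>?K. \<Sum>v\<in>?K. P' u v * Q u v)
        + (\<Sum>u\<in>?K. \<Sum>v\<in>?K. P u k * P k v / of_real p * Q u v)"
      unfolding sum.distrib[symmetric] by (intro sum.cong refl) (simp add: P'_def algebra_simps)
    also have "(\<Sum>u\<in>?K. \<Sum>v\<in>?K. P' u v * Q u v) = (\<Sum>u\<in>K. \<Sum>v\<in>K. P' u v * Q u v)"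
      unfolding split by (simp add: row)
    also have "(\<Sum>u\<in>?K. \<Sum>v\<in>?K. P u k * P k v / of_real p * Q u v) =
        (\<Sum>u\<in>?K. \<Sum>v\<in>?K. cnj (P k u) * P k v * Q u v) / of_real p"
      unfolding sum_divide_distrib by (intro sum.cong refl) (simp add: herm[of k])
    finally have "Re (\<Sum>u\<in>?K. \<Sum>v\<in>?K. P u v * Q u v) = Re (\<Sum>u\<in>K. \<Sum>v\<in>K. P' u v * Q u v)
        + Re (\<Sum>u\<in>?K. \<Sum>v\<in>?K. cnj (P k u) * P k v * Q u v) / p"
      by (simp only: plus_complex.sel Re_divide_of_real)
    moreover have "0 \<le> Re (\<Sum>u\<in>?K. \<Sum>v\<in>?K. cnj (P k u) * P k v * Q u v)"
      by (rule psd_ge0[OF insert.prems(2)])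
    ultimately show ?thesis using 1 pp by simp
  qed
qed simp

context positive_functional
begin

lemma psd_gram: assumes K: "finite K" and a: "\<And>u. u \<in> K \<Longrightarrow> a u \<in> carrier B"
  shows "psd K (\<lambda>u v. \<omega> (star B (a u) \<otimes> a v))"
  unfolding psd_def
proof (intro conjI allI ballI)
  fix u v assume "u \<in> K" "v \<in> K"
  then show "\<omega> (star B (a v) \<otimes> a u) = cnj (\<omega> (star B (a u) \<otimes> a v))" by (intro hermitian a)
next
  fix c :: "_ \<Rightarrow> complex"
  have "\<exists>x\<in>carrier B. \<forall>y\<in>carrier B. \<omega> (star B y \<otimes> x) = (\<Sum>u\<in>K. c u * \<omega> (star B y \<otimes> a u)) \<and>
      \<omega> (star B x \<otimes> y) = (\<Sum>u\<in>K. cnj (c u) * \<omega> (star B (a u) \<otimes> y))"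
    using K a
  proof (induction K)
    case empty
    show ?case using fun_smult[of \<zero> 0] by (intro bexI[of _ \<zero>]) auto
  next
    case (insert k K)
    then obtain x where x: "x \<in> carrier B" "\<And>y. y \<in> carrier B \<Longrightarrow> \<omega> (star B y \<otimes> x) = (\<Sum>u\<in>K. c u * \<omega> (star B y \<otimes> a u))"
      "\<And>y. y \<in> carrier B \<Longrightarrow> \<omega> (star B x \<otimes> y) = (\<Sum>u\<in>K. cnj (c u) * \<omega> (star B (a u) \<otimes> y))" by auto
    have ak: "a k \<in> carrier B" using insert by simp
    show ?case using x insert.hyps ak
      by (intro bexI[of _ "c k \<odot> a k \<oplus> x"]) (auto simp: distrib_left distrib_right fun_add fun_smult)
  qed
  then obtain x where x: "x \<in> carrier B" "\<And>y. y \<in> carrier B \<Longrightarrow> \<omega> (star B y \<otimes> x) = (\<Sum>u\<in>K. c u * \<omega> (star B y \<otimes> a u))"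
    "\<And>y. y \<in> carrier B \<Longrightarrow> \<omega> (star B x \<otimes> y) = (\<Sum>u\<in>K. cnj (c u) * \<omega> (star B (a u) \<otimes> y))" by auto
  have "\<omega> (star B x \<otimes> x) = (\<Sum>u\<in>K. cnj (c u) * \<omega> (star B (a u) \<otimes> x))" by (rule x(3)[OF x(1)])
  also have "\<dots> = (\<Sum>u\<in>K. \<Sum>v\<in>K. cnj (c u) * c v * \<omega> (star B (a u) \<otimes> a v))"
    by (intro sum.cong refl) (simp add: x(2)[OF a] sum_distrib_left mult.assoc)
  finally show "0 \<le> Re (\<Sum>u\<in>K. \<Sum>v\<in>K. cnj (c u) * c v * \<omega> (star B (a u) \<otimes> a v))"
    using q_ge0[OF x(1)] by (simp add: q_def)
qed

end

section \<open>The minimal tensor product\<close>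

definition complex_alg :: "complex cstar_alg" where
  "complex_alg = \<lparr> carrier = UNIV, mult = (*), one = 1, zero = 0, add = (+), smult = (*), star = cnj, nrm = cmod \<rparr>"

lemma complex_alg_sel [simp]:
  "carrier complex_alg = UNIV" "mult complex_alg = (*)" "one complex_alg = 1" "zero complex_alg = 0"
  "add complex_alg = (+)" "module.smult complex_alg = (*)" "star complex_alg = cnj" "nrm complex_alg = cmod"
  by (simp_all add: complex_alg_def)

lemma dst_complex [simp]: "dst complex_alg cmod x y = cmod (x - y)"
  by (simp add: dst_def)

lemma complete_cstar_algebra_complex: "complete_cstar_algebra complex_alg"
proof
  fix s :: "nat \<Rightarrow> complex"
  assume "\<And>e. e > 0 \<Longrightarrow> \<exists>K. \<forall>k\<ge>K. \<forall>l\<ge>K. dst complex_alg (nrm complex_alg) (s k) (s l) < e"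
  then have "Cauchy s" by (simp add: Cauchy_def dist_norm)
  then obtain x where "s \<longlonglongrightarrow> x" using Cauchy_convergent convergent_def by blast
  then have "(\<lambda>k. cmod (s k - x)) \<longlonglongrightarrow> 0" by (simp add: tendsto_norm_zero_iff LIM_zero_iff)
  then show "\<exists>x\<in>carrier complex_alg. (\<lambda>k. dst complex_alg (nrm complex_alg) (s k) x) \<longlonglongrightarrow> 0"
    by auto
qed (auto simp: algebra_simps norm_triangle_ineq norm_mult power2_eq_square)

lemma is_state_positive:
  assumes "star_algebra A" "is_state A \<phi>" shows "positive_functional A \<phi>"
  using assms by (auto simp: positive_functional_def positive_functional_axioms_def is_state_def)

text \<open>One state on each factor is needed for the set in the definition of \<open>min_norm\<close> to be nonempty.\<close>

locale tensor_pair = A: cstar_algebra A + B: cstar_algebra B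
  for A :: "'a cstar_alg" and B :: "'b cstar_alg" +
  fixes \<phi>\<^sub>0 \<psi>\<^sub>0
  assumes states_exist: "is_state A \<phi>\<^sub>0" "is_state B \<psi>\<^sub>0"
begin

abbreviation "W \<equiv> carrier A \<times> carrier B"
abbreviation "m \<equiv> \<lambda>(a, b) (a', b'). (a \<otimes>\<^bsub>A\<^esub> a', b \<otimes>\<^bsub>B\<^esub> b')"
abbreviation "s \<equiv> \<lambda>(a, b). (star A a, star B b)"
abbreviation "T \<equiv> pre_tensor A B"
abbreviation "MN \<equiv> min_norm A B"
abbreviation "C \<equiv> min_tensor A B"

lemma T_eq: "T = formal_alg W m (\<one>\<^bsub>A\<^esub>, \<one>\<^bsub>B\<^esub>) s"
  by (simp add: pre_tensor_def)

sublocale star_monoid W m "(\<one>\<^bsub>A\<^esub>, \<one>\<^bsub>B\<^esub>)" s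
  by unfold_locales (auto simp: A.mult_assoc B.mult_assoc)

sublocale T: star_algebra T
  unfolding T_eq by (rule star_algebra_formal)

lemma T_carrier: "p \<in> carrier T \<longleftrightarrow> Poly_Mapping.keys p \<subseteq> W"
  by (simp add: T_eq formal_alg_sel)

lemma T_add: "p \<oplus>\<^bsub>T\<^esub> q = p + q" and T_zero: "\<zero>\<^bsub>T\<^esub> = 0" and T_one: "\<one>\<^bsub>T\<^esub> = Poly_Mapping.single (\<one>\<^bsub>A\<^esub>, \<one>\<^bsub>B\<^esub>) 1"
  and T_smult: "c \<odot>\<^bsub>T\<^esub> p = Poly_Mapping.map ((*) c) p"
  by (simp_all add: T_eq formal_alg_sel)

lemma T_induct [consumes 1, case_names zero single add]:
  assumes "p \<in> carrier T" "P 0" "\<And>a b c. a \<in> carrier A \<Longrightarrow> b \<in> carrier B \<Longrightarrow> P (Poly_Mapping.single (a, b) c)"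
    "\<And>p q. p \<in> carrier T \<Longrightarrow> q \<in> carrier T \<Longrightarrow> P p \<Longrightarrow> P q \<Longrightarrow> P (p + q)"
  shows "P p"
  using assms(1) unfolding T_carrier
  by (induction p rule: formal_induct) (use assms(2-) in \<open>auto simp: T_carrier\<close>)

lemma single_in: "a \<in> carrier A \<Longrightarrow> b \<in> carrier B \<Longrightarrow> Poly_Mapping.single (a, b) c \<in> carrier T"
  by (auto simp: T_carrier)

lemma additive_pre_functional: "additive_family (\<lambda>(a, b) c. c * (\<phi> a * \<psi> b))"
  by (auto simp: additive_family_def algebra_simps)

lemma pre_functional_lin_ext: "pre_functional \<phi> \<psi> t = lin_ext (\<lambda>(a, b) c. c * (\<phi> a * \<psi> b)) t"
  by (auto simp: pre_functional_def lin_ext_def intro!: sum.cong)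

lemma pre_functional_add [simp]: "pre_functional \<phi> \<psi> (p + q) = pre_functional \<phi> \<psi> p + pre_functional \<phi> \<psi> q"
  and pre_functional_single [simp]: "pre_functional \<phi> \<psi> (Poly_Mapping.single (a, b) c) = c * (\<phi> a * \<psi> b)"
  and pre_functional_zero [simp]: "pre_functional \<phi> \<psi> 0 = 0"
  by (simp_all add: pre_functional_lin_ext lin_ext_add[OF additive_pre_functional] lin_ext_single[OF additive_pre_functional])

lemma pre_functional_smult: "pre_functional \<phi> \<psi> (Poly_Mapping.map ((*) c) p) = c * pre_functional \<phi> \<psi> p"
proof -
  have "Poly_Mapping.keys p \<subseteq> UNIV" by simp
  then show ?thesis by (induction p rule: formal_induct) (auto simp: distrib_left mult.assoc)
qed

lemma pre_functional_form:
  assumes "p \<in> carrier T" "q \<in> carrier T"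
  shows "pre_functional \<phi> \<psi> (star T p \<otimes>\<^bsub>T\<^esub> q) =
    lin_ext (\<lambda>(a, b) c. lin_ext (\<lambda>(a', b') d. cnj c * d * (\<phi> (star A a \<otimes>\<^bsub>A\<^esub> a') * \<psi> (star B b \<otimes>\<^bsub>B\<^esub> b'))) q) p"
proof -
  have add1: "additive_family (\<lambda>(a', b') d. cnj c * d * (\<phi> (star A a \<otimes>\<^bsub>A\<^esub> a') * \<psi> (star B b \<otimes>\<^bsub>B\<^esub> b')))" for a b c
    by (auto simp: additive_family_def algebra_simps)
  have add2: "additive_family (\<lambda>(a, b) c. lin_ext (\<lambda>(a', b') d. cnj c * d * (\<phi> (star A a \<otimes>\<^bsub>A\<^esub> a') * \<psi> (star B b \<otimes>\<^bsub>B\<^esub> b'))) q)"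
    by (auto simp: additive_family_def lin_ext_def distrib_right sum.distrib split_beta)
  show ?thesis
    using assms(1)
  proof (induction p rule: T_induct)
    case zero then show ?case by (simp add: T_eq)
  next
    case (add p p')
    then show ?case by (simp add: T_eq lin_ext_add[OF add2])
  next
    case (single a b c)
    note ab = this
    show ?case unfolding lin_ext_single[OF add2] prod.case
      using assms(2)
    proof (induction q rule: T_induct)
      case zero then show ?case by (simp add: T_eq)
    next
      case (add q q')
      then show ?case by (simp add: T_eq lin_ext_add[OF add1])
    next
      case (single a' b' d)
      then show ?case unfolding lin_ext_single[OF add1] prod.case by (simp add: T_eq)
    qed
  qed
qed

text \<open>For \<open>t = \<Sum> c\<^sub>u (a\<^sub>u \<otimes> b\<^sub>u)\<close> the value at \<open>t\<^sup>* t\<close> is the sum of the entries of a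
  Hadamard product of two Gram matrices.\<close>

lemma product_positive:
  assumes \<phi>: "is_state A \<phi>" and \<psi>: "is_state B \<psi>"
  shows "positive_functional T (pre_functional \<phi> \<psi>)"
proof
  interpret P: positive_functional A \<phi> by (rule is_state_positive[OF A.star_algebra_axioms \<phi>])
  interpret Q: positive_functional B \<psi> by (rule is_state_positive[OF B.star_algebra_axioms \<psi>])
  fix t assume t: "t \<in> carrier T"
  let ?K = "Poly_Mapping.keys t"
  have K: "fst u \<in> carrier A" "snd u \<in> carrier B" if "u \<in> ?K" for u
    using t that by (auto simp: T_carrier)
  define P where "P u v = \<phi> (star A (fst u) \<otimes>\<^bsub>A\<^esub> fst v)" for u v :: "'a \<times> 'b"
  define Q where "Q u v = cnj (Poly_Mapping.lookup t u) * Poly_Mapping.lookup t v * \<psi> (star B (snd u) \<otimes>\<^bsub>B\<^esub> snd v)" for u v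
  have psdP: "psd ?K P" unfolding P_def by (rule P.psd_gram) (use K in auto)
  have psdQ: "psd ?K Q"
  proof -
    let ?a = "\<lambda>u. Poly_Mapping.lookup t u \<odot>\<^bsub>B\<^esub> snd u"
    have "psd ?K (\<lambda>u v. \<psi> (star B (?a u) \<otimes>\<^bsub>B\<^esub> ?a v))" by (rule Q.psd_gram) (use K in auto)
    moreover have "\<psi> (star B (?a u) \<otimes>\<^bsub>B\<^esub> ?a v) = Q u v" if "u \<in> ?K" "v \<in> ?K" for u v
      using K that by (simp add: Q.fun_smult Q_def mult_ac)
    ultimately show ?thesis by (rule psd_cong)
  qed
  have eq: "pre_functional \<phi> \<psi> (star T t \<otimes>\<^bsub>T\<^esub> t) = (\<Sum>u\<in>?K. \<Sum>v\<in>?K. P u v * Q u v)"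
    unfolding pre_functional_form[OF t t] lin_ext_def P_def Q_def
    by (intro sum.cong refl) (auto simp: split_beta mult_ac intro!: sum.cong)
  have "0 \<le> Re (\<Sum>u\<in>?K. \<Sum>v\<in>?K. P u v * Q u v)" by (rule psd_product[OF _ psdP psdQ]) simp
  moreover have h: "cnj (P u v * Q u v) = P v u * Q v u" if "u \<in> ?K" "v \<in> ?K" for u v
    using psd_herm[OF psdP that] psd_herm[OF psdQ that] by simp
  have "cnj (\<Sum>u\<in>?K. \<Sum>v\<in>?K. P u v * Q u v) = (\<Sum>u\<in>?K. \<Sum>v\<in>?K. P v u * Q v u)"
    unfolding cnj_sum by (intro sum.cong refl h)
  then have "cnj (\<Sum>u\<in>?K. \<Sum>v\<in>?K. P u v * Q u v) = (\<Sum>u\<in>?K. \<Sum>v\<in>?K. P u v * Q u v)"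
    by (subst (asm) sum.swap)
  then have "- Im (\<Sum>u\<in>?K. \<Sum>v\<in>?K. P u v * Q u v) = Im (\<Sum>u\<in>?K. \<Sum>v\<in>?K. P u v * Q u v)"
    unfolding cnj.sel(2)[symmetric] by (rule arg_cong)
  then have "Im (\<Sum>u\<in>?K. \<Sum>v\<in>?K. P u v * Q u v) = 0" by simp
  ultimately show "pre_functional \<phi> \<psi> (star T t \<otimes>\<^bsub>T\<^esub> t) \<in> \<real>\<^sub>\<ge>\<^sub>0"
    unfolding eq complex_nonneg_Reals_iff by simp
qed (simp_all add: T_add T_smult pre_functional_smult)

text \<open>The projective norm of a formal tensor, as an a priori bound: it is submultiplicative and dominates all
  product functionals, so left multiplication is bounded in each of their seminorms and the supremum in
  \<open>min_norm\<close> is finite.\<close>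

definition L :: "('a \<times> 'b \<Rightarrow>\<^sub>0 complex) \<Rightarrow> real" where
  "L t = (\<Sum>u\<in>Poly_Mapping.keys t. cmod (Poly_Mapping.lookup t u) * (nrm A (fst u) * nrm B (snd u)))"

lemma L_ge0: "t \<in> carrier T \<Longrightarrow> 0 \<le> L t"
  unfolding L_def by (intro sum_nonneg mult_nonneg_nonneg) (auto simp: T_carrier)

lemma L_superset: "finite K \<Longrightarrow> Poly_Mapping.keys t \<subseteq> K \<Longrightarrow>
    L t = (\<Sum>u\<in>K. cmod (Poly_Mapping.lookup t u) * (nrm A (fst u) * nrm B (snd u)))"
  unfolding L_def by (intro sum.mono_neutral_left) (auto simp: in_keys_iff)

lemma L_add: assumes "p \<in> carrier T" "q \<in> carrier T" shows "L (p + q) \<le> L p + L q"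
proof -
  let ?K = "Poly_Mapping.keys p \<union> Poly_Mapping.keys q"
  have "L (p + q) = (\<Sum>u\<in>?K. cmod (Poly_Mapping.lookup (p + q) u) * (nrm A (fst u) * nrm B (snd u)))"
    by (rule L_superset) (use Poly_Mapping.keys_add[of p q] in auto)
  also have "\<dots> \<le> (\<Sum>u\<in>?K. cmod (Poly_Mapping.lookup p u) * (nrm A (fst u) * nrm B (snd u))
      + cmod (Poly_Mapping.lookup q u) * (nrm A (fst u) * nrm B (snd u)))"
    unfolding distrib_right[symmetric] lookup_add using assms
    by (intro sum_mono mult_right_mono norm_triangle_ineq mult_nonneg_nonneg) (auto simp: T_carrier)
  also have "\<dots> = L p + L q"
    unfolding sum.distrib by (subst (1 2) L_superset[of ?K]) auto
  finally show ?thesis .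
qed

lemma L_single [simp]: "L (Poly_Mapping.single (a, b) c) = cmod c * (nrm A a * nrm B b)"
  by (simp add: L_def)

lemma L_mult: assumes p: "p \<in> carrier T" and q: "q \<in> carrier T" shows "L (p \<otimes>\<^bsub>T\<^esub> q) \<le> L p * L q"
proof -
  have Lsum: "L (\<Sum>i\<in>I. f i) \<le> (\<Sum>i\<in>I. L (f i)) \<and> (\<Sum>i\<in>I. f i) \<in> carrier T"
    if "finite I" "\<And>i. i \<in> I \<Longrightarrow> f i \<in> carrier T" for I and f :: "'x \<Rightarrow> _"
    using that
  proof (induction I)
    case (insert i I)
    then have "L (f i + sum f I) \<le> L (f i) + L (sum f I)" by (intro L_add) auto
    moreover have "f i + sum f I \<in> carrier T" using insert T.add_in[of "f i" "sum f I"] by (simp add: T_add)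
    ultimately show ?case using insert by auto
  qed (simp add: L_def T_carrier)
  let ?Kp = "Poly_Mapping.keys p" and ?Kq = "Poly_Mapping.keys q"
  define f where "f u v = Poly_Mapping.single (m u v) (Poly_Mapping.lookup p u * Poly_Mapping.lookup q v)" for u v
  have inT: "f u v \<in> carrier T" if "u \<in> ?Kp" "v \<in> ?Kq" for u v
  proof -
    have "m u v \<in> W" using p q that by (intro m_in) (auto simp: T_carrier)
    then show ?thesis unfolding f_def T_carrier by simp
  qed
  have pq: "p \<otimes>\<^bsub>T\<^esub> q = (\<Sum>u\<in>?Kp. \<Sum>v\<in>?Kq. f u v)" by (simp add: T_eq formal_alg_sel f_def)
  have "L (p \<otimes>\<^bsub>T\<^esub> q) \<le> (\<Sum>u\<in>?Kp. L (\<Sum>v\<in>?Kq. f u v))"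
    unfolding pq using Lsum[of ?Kp] Lsum[of ?Kq] inT by simp
  also have "\<dots> \<le> (\<Sum>u\<in>?Kp. \<Sum>v\<in>?Kq. L (f u v))"
    using Lsum[of ?Kq] inT by (intro sum_mono) simp
  also have "\<dots> \<le> (\<Sum>u\<in>?Kp. \<Sum>v\<in>?Kq. (cmod (Poly_Mapping.lookup p u) * (nrm A (fst u) * nrm B (snd u)))
      * (cmod (Poly_Mapping.lookup q v) * (nrm A (fst v) * nrm B (snd v))))"
  proof (intro sum_mono)
    fix u v assume "u \<in> ?Kp" "v \<in> ?Kq"
    then have uv: "fst u \<in> carrier A" "snd u \<in> carrier B" "fst v \<in> carrier A" "snd v \<in> carrier B"
      using p q by (auto simp: T_carrier)
    have "L (f u v) = cmod (Poly_Mapping.lookup p u) * cmod (Poly_Mapping.lookup q v) *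
        (nrm A (fst u \<otimes>\<^bsub>A\<^esub> fst v) * nrm B (snd u \<otimes>\<^bsub>B\<^esub> snd v))"
      by (cases u; cases v) (simp add: f_def norm_mult)
    also have "\<dots> \<le> cmod (Poly_Mapping.lookup p u) * cmod (Poly_Mapping.lookup q v) *
        ((nrm A (fst u) * nrm A (fst v)) * (nrm B (snd u) * nrm B (snd v)))"
      using uv A.N_mult[OF uv(1,3)] B.N_mult[OF uv(2,4)] by (intro mult_left_mono mult_mono) auto
    finally show "L (f u v) \<le> (cmod (Poly_Mapping.lookup p u) * (nrm A (fst u) * nrm B (snd u)))
      * (cmod (Poly_Mapping.lookup q v) * (nrm A (fst v) * nrm B (snd v)))" by (simp add: mult_ac)
  qed
  also have "\<dots> = L p * L q" by (simp add: L_def sum_product)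
  finally show ?thesis .
qed

lemma pre_functional_le_L:
  assumes \<phi>: "is_state A \<phi>" and \<psi>: "is_state B \<psi>" and t: "t \<in> carrier T"
  shows "cmod (pre_functional \<phi> \<psi> t) \<le> L t"
  unfolding pre_functional_def L_def
proof (intro order_trans[OF norm_sum] sum_mono)
  fix u assume "u \<in> Poly_Mapping.keys t"
  then have u: "fst u \<in> carrier A" "snd u \<in> carrier B" using t by (auto simp: T_carrier)
  have "cmod (\<phi> (fst u)) \<le> nrm A (fst u)" "cmod (\<psi> (snd u)) \<le> nrm B (snd u)"
    using \<phi> \<psi> u by (auto simp: is_state_def)
  then show "cmod (case u of (a, b) \<Rightarrow> Poly_Mapping.lookup t (a, b) * (\<phi> a * \<psi> b))
      \<le> cmod (Poly_Mapping.lookup t u) * (nrm A (fst u) * nrm B (snd u))"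
    using u by (auto simp: split_beta norm_mult intro!: mult_left_mono mult_mono)
qed

text \<open>The positive functionals for which \<open>min_norm\<close> is the norm of a \<open>positive_family\<close>.\<close>

definition Om :: "(('a \<times> 'b \<Rightarrow>\<^sub>0 complex) \<Rightarrow> complex) set" where
  "Om = {\<lambda>t. pre_functional \<phi> \<psi> (star T r \<otimes>\<^bsub>T\<^esub> (t \<otimes>\<^bsub>T\<^esub> r)) | \<phi> \<psi> r.
     is_state A \<phi> \<and> is_state B \<psi> \<and> r \<in> carrier T}"

lemma action_bound:
  assumes "is_state A \<phi>" "is_state B \<psi>" "t \<in> carrier T" "r \<in> carrier T"
  shows "Re (pre_functional \<phi> \<psi> (star T (t \<otimes>\<^bsub>T\<^esub> r) \<otimes>\<^bsub>T\<^esub> (t \<otimes>\<^bsub>T\<^esub> r)))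
    \<le> L (star T t \<otimes>\<^bsub>T\<^esub> t) * Re (pre_functional \<phi> \<psi> (star T r \<otimes>\<^bsub>T\<^esub> r))"
proof -
  interpret P: positive_functional T "pre_functional \<phi> \<psi>" by (rule product_positive[OF assms(1,2)])
  have "star T (t \<otimes>\<^bsub>T\<^esub> r) \<otimes>\<^bsub>T\<^esub> (t \<otimes>\<^bsub>T\<^esub> r) = star T r \<otimes>\<^bsub>T\<^esub> ((star T t \<otimes>\<^bsub>T\<^esub> t) \<otimes>\<^bsub>T\<^esub> r)"
    using assms by (simp add: T.mult_assoc)
  moreover have "Re (pre_functional \<phi> \<psi> (star T r \<otimes>\<^bsub>T\<^esub> ((star T t \<otimes>\<^bsub>T\<^esub> t) \<otimes>\<^bsub>T\<^esub> r)))
    \<le> L (star T t \<otimes>\<^bsub>T\<^esub> t) * P.q r"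
    using assms by (intro P.bounded_action pre_functional_le_L L_ge0 L_mult) auto
  ultimately show ?thesis by (simp add: P.q_def)
qed

abbreviation "NS t \<equiv> {sqrt (Re (pre_functional \<phi> \<psi> (star T (t \<otimes>\<^bsub>T\<^esub> r) \<otimes>\<^bsub>T\<^esub> (t \<otimes>\<^bsub>T\<^esub> r)))) | \<phi> \<psi> r.
       is_state A \<phi> \<and> is_state B \<psi> \<and> r \<in> carrier T \<and>
       Re (pre_functional \<phi> \<psi> (star T r \<otimes>\<^bsub>T\<^esub> r)) \<le> 1}"

lemma min_norm_Sup: "MN t = Sup (NS t)"
  by (simp add: min_norm_def Let_def)

lemma NS_bdd: assumes t: "t \<in> carrier T" shows "bdd_above (NS t)"
proof (rule bdd_aboveI)
  fix x assume "x \<in> NS t"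
  then obtain \<phi> \<psi> r where *: "x = sqrt (Re (pre_functional \<phi> \<psi> (star T (t \<otimes>\<^bsub>T\<^esub> r) \<otimes>\<^bsub>T\<^esub> (t \<otimes>\<^bsub>T\<^esub> r))))"
    "is_state A \<phi>" "is_state B \<psi>" "r \<in> carrier T" "Re (pre_functional \<phi> \<psi> (star T r \<otimes>\<^bsub>T\<^esub> r)) \<le> 1" by blast
  have "L (star T t \<otimes>\<^bsub>T\<^esub> t) * Re (pre_functional \<phi> \<psi> (star T r \<otimes>\<^bsub>T\<^esub> r)) \<le> L (star T t \<otimes>\<^bsub>T\<^esub> t) * 1"
    using *(5) L_ge0 t by (intro mult_left_mono) auto
  then show "x \<le> sqrt (L (star T t \<otimes>\<^bsub>T\<^esub> t))"
    unfolding *(1) using action_bound[OF *(2,3) t *(4)] by (intro real_sqrt_le_mono) simp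
qed

lemma NS_zero: assumes "t \<in> carrier T" shows "0 \<in> NS t"
proof -
  have "t \<otimes>\<^bsub>T\<^esub> \<zero>\<^bsub>T\<^esub> = \<zero>\<^bsub>T\<^esub>" using assms by simp
  moreover have "pre_functional \<phi>\<^sub>0 \<psi>\<^sub>0 (star T \<zero>\<^bsub>T\<^esub> \<otimes>\<^bsub>T\<^esub> \<zero>\<^bsub>T\<^esub>) = 0"
    by (simp add: T_zero[symmetric] del: T_zero) (simp add: T_zero)
  ultimately show ?thesis using states_exist
    by (intro CollectI exI[of _ \<phi>\<^sub>0] exI[of _ \<psi>\<^sub>0] exI[of _ "\<zero>\<^bsub>T\<^esub>"]) simp
qed

sublocale PF: positive_family T Om MN
proof (intro positive_family.intro positive_family_axioms.intro)
  show "star_algebra T" by (rule T.star_algebra_axioms)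
next
  fix \<omega> assume "\<omega> \<in> Om"
  from \<open>\<omega> \<in> Om\<close> obtain \<phi> \<psi> r where *: "\<omega> = (\<lambda>t. pre_functional \<phi> \<psi> (star T r \<otimes>\<^bsub>T\<^esub> (t \<otimes>\<^bsub>T\<^esub> r)))"
    "is_state A \<phi>" "is_state B \<psi>" "r \<in> carrier T" by (auto simp: Om_def)
  interpret P: positive_functional T "pre_functional \<phi> \<psi>" by (rule product_positive[OF *(2,3)])
  show "positive_functional T \<omega>" unfolding * by (rule P.positive_conj[OF *(4)])
next
  fix \<omega> b assume "\<omega> \<in> Om" and b: "b \<in> carrier T"
  from \<open>\<omega> \<in> Om\<close> obtain \<phi> \<psi> r where *: "\<omega> = (\<lambda>t. pre_functional \<phi> \<psi> (star T r \<otimes>\<^bsub>T\<^esub> (t \<otimes>\<^bsub>T\<^esub> r)))"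
    "is_state A \<phi>" "is_state B \<psi>" "r \<in> carrier T" by (auto simp: Om_def)
  interpret P: positive_functional T "pre_functional \<phi> \<psi>" by (rule product_positive[OF *(2,3)])
  show "\<exists>\<omega>'\<in>Om. \<forall>a\<in>carrier T. \<omega>' a = \<omega> (star T b \<otimes>\<^bsub>T\<^esub> (a \<otimes>\<^bsub>T\<^esub> b))"
  proof (intro bexI ballI)
    let ?w = "\<lambda>t. pre_functional \<phi> \<psi> (star T (b \<otimes>\<^bsub>T\<^esub> r) \<otimes>\<^bsub>T\<^esub> (t \<otimes>\<^bsub>T\<^esub> (b \<otimes>\<^bsub>T\<^esub> r)))"
    show "?w \<in> Om" unfolding Om_def using * b by blast
    show "?w a = \<omega> (star T b \<otimes>\<^bsub>T\<^esub> (a \<otimes>\<^bsub>T\<^esub> b))" if "a \<in> carrier T" for a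
      using * b that by (simp add: T.mult_assoc)
  qed
next
  fix \<omega> a assume "\<omega> \<in> Om" and a: "a \<in> carrier T"
  from \<open>\<omega> \<in> Om\<close> obtain \<phi> \<psi> r where *: "\<omega> = (\<lambda>t. pre_functional \<phi> \<psi> (star T r \<otimes>\<^bsub>T\<^esub> (t \<otimes>\<^bsub>T\<^esub> r)))"
    "is_state A \<phi>" "is_state B \<psi>" "r \<in> carrier T" by (auto simp: Om_def)
  interpret P: positive_functional T "pre_functional \<phi> \<psi>" by (rule product_positive[OF *(2,3)])
  have eq: "\<omega> (star T a \<otimes>\<^bsub>T\<^esub> a) = pre_functional \<phi> \<psi> (star T (a \<otimes>\<^bsub>T\<^esub> r) \<otimes>\<^bsub>T\<^esub> (a \<otimes>\<^bsub>T\<^esub> r))"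
    using * a by (simp add: T.mult_assoc)
  have one: "\<omega> \<one>\<^bsub>T\<^esub> = pre_functional \<phi> \<psi> (star T r \<otimes>\<^bsub>T\<^esub> r)" using * by simp
  show "Re (\<omega> (star T a \<otimes>\<^bsub>T\<^esub> a)) \<le> (MN a)\<^sup>2 * Re (\<omega> \<one>\<^bsub>T\<^esub>)"
  proof (cases "P.q r = 0")
    case True
    then show ?thesis using action_bound[OF *(2,3) a *(4)] unfolding eq one by (simp add: P.q_def)
  next
    case False
    then have pos: "P.q r > 0" using P.q_ge0[OF *(4)] by linarith
    define c where "c = complex_of_real (1 / sqrt (P.q r))"
    have cc: "cnj c * c = of_real (1 / P.q r)" using pos by (simp add: c_def flip: of_real_mult)
    have scale: "pre_functional \<phi> \<psi> (star T (c \<odot>\<^bsub>T\<^esub> x) \<otimes>\<^bsub>T\<^esub> (c \<odot>\<^bsub>T\<^esub> x)) =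
        of_real (1 / P.q r) * pre_functional \<phi> \<psi> (star T x \<otimes>\<^bsub>T\<^esub> x)" if "x \<in> carrier T" for x
      using that cc by (simp add: P.fun_smult mult.assoc[symmetric] mult.commute[of c "cnj c"])
    have "Re (pre_functional \<phi> \<psi> (star T (c \<odot>\<^bsub>T\<^esub> r) \<otimes>\<^bsub>T\<^esub> (c \<odot>\<^bsub>T\<^esub> r))) = 1"
      unfolding scale[OF *(4)] using pos by (simp add: P.fun_star_self *(4))
    then have "sqrt (Re (pre_functional \<phi> \<psi> (star T (a \<otimes>\<^bsub>T\<^esub> (c \<odot>\<^bsub>T\<^esub> r)) \<otimes>\<^bsub>T\<^esub> (a \<otimes>\<^bsub>T\<^esub> (c \<odot>\<^bsub>T\<^esub> r))))) \<in> NS a"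
      using * by (intro CollectI exI[of _ \<phi>] exI[of _ \<psi>] exI[of _ "c \<odot>\<^bsub>T\<^esub> r"]) auto
    then have "sqrt (Re (pre_functional \<phi> \<psi> (star T (a \<otimes>\<^bsub>T\<^esub> (c \<odot>\<^bsub>T\<^esub> r)) \<otimes>\<^bsub>T\<^esub> (a \<otimes>\<^bsub>T\<^esub> (c \<odot>\<^bsub>T\<^esub> r))))) \<le> MN a"
      unfolding min_norm_Sup by (rule cSup_upper[OF _ NS_bdd[OF a]])
    also have "a \<otimes>\<^bsub>T\<^esub> (c \<odot>\<^bsub>T\<^esub> r) = c \<odot>\<^bsub>T\<^esub> (a \<otimes>\<^bsub>T\<^esub> r)" using a * by simp
    finally have "Re (pre_functional \<phi> \<psi> (star T (c \<odot>\<^bsub>T\<^esub> (a \<otimes>\<^bsub>T\<^esub> r)) \<otimes>\<^bsub>T\<^esub> (c \<odot>\<^bsub>T\<^esub> (a \<otimes>\<^bsub>T\<^esub> r)))) \<le> (MN a)\<^sup>2"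
      by (rule sqrt_le_D)
    then have "1 / P.q r * Re (\<omega> (star T a \<otimes>\<^bsub>T\<^esub> a)) \<le> (MN a)\<^sup>2"
      using scale[of "a \<otimes>\<^bsub>T\<^esub> r"] a * unfolding eq by simp
    then show ?thesis unfolding one using pos by (simp add: P.q_def field_simps)
  qed
next
  fix a assume a: "a \<in> carrier T"
  show "0 \<le> MN a" unfolding min_norm_Sup by (rule cSup_upper[OF NS_zero[OF a] NS_bdd[OF a]])
  fix c :: real assume c: "0 \<le> c" and le: "\<And>\<omega>. \<omega> \<in> Om \<Longrightarrow> Re (\<omega> (star T a \<otimes>\<^bsub>T\<^esub> a)) \<le> c\<^sup>2 * Re (\<omega> \<one>\<^bsub>T\<^esub>)"
  show "MN a \<le> c" unfolding min_norm_Sup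
  proof (rule cSup_least)
    show "NS a \<noteq> {}" using NS_zero[OF a] by blast
    fix x assume "x \<in> NS a"
    then obtain \<phi> \<psi> r where *: "x = sqrt (Re (pre_functional \<phi> \<psi> (star T (a \<otimes>\<^bsub>T\<^esub> r) \<otimes>\<^bsub>T\<^esub> (a \<otimes>\<^bsub>T\<^esub> r))))"
      "is_state A \<phi>" "is_state B \<psi>" "r \<in> carrier T" "Re (pre_functional \<phi> \<psi> (star T r \<otimes>\<^bsub>T\<^esub> r)) \<le> 1" by blast
    let ?w = "\<lambda>t. pre_functional \<phi> \<psi> (star T r \<otimes>\<^bsub>T\<^esub> (t \<otimes>\<^bsub>T\<^esub> r))"
    have "?w \<in> Om" unfolding Om_def using * by blast
    then have "Re (?w (star T a \<otimes>\<^bsub>T\<^esub> a)) \<le> c\<^sup>2 * Re (?w \<one>\<^bsub>T\<^esub>)" by (rule le)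
    also have "\<dots> \<le> c\<^sup>2 * 1" using * by (intro mult_left_mono) auto
    also have "star T r \<otimes>\<^bsub>T\<^esub> ((star T a \<otimes>\<^bsub>T\<^esub> a) \<otimes>\<^bsub>T\<^esub> r) = star T (a \<otimes>\<^bsub>T\<^esub> r) \<otimes>\<^bsub>T\<^esub> (a \<otimes>\<^bsub>T\<^esub> r)"
      using * a by (simp add: T.mult_assoc)
    finally show "x \<le> c" unfolding *(1) using c by (intro real_le_lsqrt) auto
  qed
qed

sublocale PC: pre_cstar_algebra T MN
  by unfold_locales

lemma cstar_algebra_tensor: "cstar_algebra C"
  unfolding min_tensor_def by (rule PC.cstar_algebra_completion)

end

context tensor_pair
begin

interpretation C: cstar_algebra C by (rule cstar_algebra_tensor)

lemma pre_functional_le_MN: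
  assumes \<phi>: "is_state A \<phi>" and \<psi>: "is_state B \<psi>" and t: "t \<in> carrier T"
  shows "cmod (pre_functional \<phi> \<psi> t) \<le> MN t"
proof -
  let ?w = "\<lambda>t. pre_functional \<phi> \<psi> (star T \<one>\<^bsub>T\<^esub> \<otimes>\<^bsub>T\<^esub> (t \<otimes>\<^bsub>T\<^esub> \<one>\<^bsub>T\<^esub>))"
  have w: "?w \<in> Om" unfolding Om_def using \<phi> \<psi> by blast
  have "?w \<one>\<^bsub>T\<^esub> = 1" using \<phi> \<psi> by (simp add: is_state_def) (simp add: T_one is_state_def)
  then show ?thesis using PF.Omega_le_norm[OF w t] t by simp
qed

lemma tensor_state_is_state:
  assumes \<phi>: "is_state A \<phi>" and \<psi>: "is_state B \<psi>"
  shows "is_state C (tensor_state A B \<phi> \<psi>)"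
    and "a \<in> carrier A \<Longrightarrow> b \<in> carrier B \<Longrightarrow> tensor_state A B \<phi> \<psi> (tensor_elem A B a b) = \<phi> a * \<psi> b"
proof -
  interpret D: complete_cstar_algebra complex_alg by (rule complete_cstar_algebra_complex)
  interpret P: positive_functional T "pre_functional \<phi> \<psi>" by (rule product_positive[OF \<phi> \<psi>])
  let ?e = "completion_embed T MN"
  let ?f = "pre_functional \<phi> \<psi>"
  interpret X: dense_extension C complex_alg "carrier T" ?e ?f
  proof
    fix p q assume pq: "p \<in> carrier T" "q \<in> carrier T"
    have "dst complex_alg (nrm complex_alg) (?f p) (?f q) = cmod (?f (p \<oplus>\<^bsub>T\<^esub> (-1) \<odot>\<^bsub>T\<^esub> q))"
      using pq by (simp add: P.fun_add P.fun_smult)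
    also have "\<dots> \<le> MN (p \<oplus>\<^bsub>T\<^esub> (-1) \<odot>\<^bsub>T\<^esub> q)" using pq by (intro pre_functional_le_MN[OF \<phi> \<psi>]) auto
    also have "\<dots> = dst C (nrm C) (?e p) (?e q)"
      unfolding min_tensor_def PC.embed_dst[OF pq] by (simp add: dst_def)
    finally show "dst complex_alg (nrm complex_alg) (?f p) (?f q) \<le> dst C (nrm C) (?e p) (?e q)" .
    show "\<exists>k\<in>carrier T. ?e k = ?e p \<oplus>\<^bsub>C\<^esub> ?e q \<and> ?f k = ?f p \<oplus>\<^bsub>complex_alg\<^esub> ?f q"
      using pq by (intro bexI[of _ "p \<oplus>\<^bsub>T\<^esub> q"]) (auto simp: P.fun_add min_tensor_def)
  next
    fix p c assume p: "p \<in> carrier T"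
    show "\<exists>k\<in>carrier T. ?e k = c \<odot>\<^bsub>C\<^esub> ?e p \<and> ?f k = c \<odot>\<^bsub>complex_alg\<^esub> ?f p"
      using p by (intro bexI[of _ "c \<odot>\<^bsub>T\<^esub> p"]) (auto simp: P.fun_smult min_tensor_def)
  qed (auto simp: min_tensor_def PC.embed_dense)
  have ext_one: "X.ext \<one>\<^bsub>C\<^esub> = 1"
  proof -
    have "X.ext (?e \<one>\<^bsub>T\<^esub>) = ?f \<one>\<^bsub>T\<^esub>" by (rule X.ext_i) simp
    also have "?f \<one>\<^bsub>T\<^esub> = 1" using \<phi> \<psi> by (simp add: T_one is_state_def)
    finally show ?thesis by (simp add: min_tensor_def)
  qed
  have ext_pos: "X.ext (star C x \<otimes>\<^bsub>C\<^esub> x) \<in> \<real>\<^sub>\<ge>\<^sub>0" if x: "x \<in> carrier C" for x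
  proof -
    have "\<exists>z\<in>\<real>\<^sub>\<ge>\<^sub>0. dist z (X.ext (star C x \<otimes>\<^bsub>C\<^esub> x)) < e" if e: "e > 0" for e
    proof -
      define M where "M = 2 * nrm C x + 1"
      have M: "M \<ge> 1" using x by (simp add: M_def)
      define e' where "e' = min 1 (e / M / 2)"
      have e': "e' > 0" "e' \<le> 1" "M * e' \<le> e / 2" using e M by (auto simp: e'_def min_def field_simps)
      obtain p where p: "p \<in> carrier T" "dst C (nrm C) x (?e p) < e'" using X.dense[OF x e'(1)] by blast
      have pC: "?e p \<in> carrier C" using p by simp
      have np: "nrm C (?e p) \<le> nrm C x + 1"
        using C.N_dst[of "?e p" x] C.dst_sym[OF x pC] p e' x pC by auto
      have "dst C (nrm C) (star C x \<otimes>\<^bsub>C\<^esub> x) (star C (?e p) \<otimes>\<^bsub>C\<^esub> ?e p)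
          \<le> nrm C (star C x) * dst C (nrm C) x (?e p) + dst C (nrm C) (star C x) (star C (?e p)) * nrm C (?e p)"
        using x pC by (intro C.dst_mult) auto
      also have "\<dots> = nrm C x * dst C (nrm C) x (?e p) + dst C (nrm C) x (?e p) * nrm C (?e p)" using x pC by simp
      also have "\<dots> \<le> nrm C x * e' + e' * (nrm C x + 1)" using p np x pC e' by (intro add_mono mult_mono) auto
      also have "\<dots> = M * e'" by (simp add: M_def algebra_simps)
      also have "\<dots> < e" using e' e by simp
      finally have "dst C (nrm C) (star C x \<otimes>\<^bsub>C\<^esub> x) (?e (star T p \<otimes>\<^bsub>T\<^esub> p)) < e"
        using p by (simp add: min_tensor_def)
      moreover have "star T p \<otimes>\<^bsub>T\<^esub> p \<in> carrier T" using p by simp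
      ultimately have "cmod (X.ext (star C x \<otimes>\<^bsub>C\<^esub> x) - ?f (star T p \<otimes>\<^bsub>T\<^esub> p)) < e"
        using X.ext_dst[of "star C x \<otimes>\<^bsub>C\<^esub> x" "star T p \<otimes>\<^bsub>T\<^esub> p"] x by simp
      moreover have "?f (star T p \<otimes>\<^bsub>T\<^esub> p) \<in> \<real>\<^sub>\<ge>\<^sub>0" using p by (intro P.fun_pos)
      ultimately show ?thesis by (intro bexI[of _ "?f (star T p \<otimes>\<^bsub>T\<^esub> p)"]) (simp_all add: dist_norm norm_minus_commute)
    qed
    then have "X.ext (star C x \<otimes>\<^bsub>C\<^esub> x) \<in> closure \<real>\<^sub>\<ge>\<^sub>0" unfolding closure_approachable by blast
    then show ?thesis by (simp add: closed_nonneg_Reals_complex)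
  qed
  have st: "is_state C X.ext"
    unfolding is_state_def using X.ext_add X.ext_smult X.ext_nrm ext_pos ext_one by auto
  have el: "X.ext (tensor_elem A B a b) = \<phi> a * \<psi> b" if "a \<in> carrier A" "b \<in> carrier B" for a b
    unfolding tensor_elem_def using single_in[OF that, of 1] by simp
  have "\<exists>\<omega>. is_state C \<omega> \<and> (\<forall>a\<in>carrier A. \<forall>b\<in>carrier B. \<omega> (tensor_elem A B a b) = \<phi> a * \<psi> b)"
    using st el by blast
  from someI_ex[OF this] show "is_state C (tensor_state A B \<phi> \<psi>)"
    "a \<in> carrier A \<Longrightarrow> b \<in> carrier B \<Longrightarrow> tensor_state A B \<phi> \<psi> (tensor_elem A B a b) = \<phi> a * \<psi> b"
    unfolding tensor_state_def by auto
qed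

lemma tensor_elem_in [simp]: "a \<in> carrier A \<Longrightarrow> b \<in> carrier B \<Longrightarrow> tensor_elem A B a b \<in> carrier C"
  unfolding tensor_elem_def min_tensor_def by (rule PC.embed_hom(1)) (rule single_in)

lemma tensor_elem_star:
  assumes "a \<in> carrier A" "b \<in> carrier B"
  shows "star C (tensor_elem A B a b) = tensor_elem A B (star A a) (star B b)"
  unfolding tensor_elem_def min_tensor_def
  using PC.embed_hom(6)[of "Poly_Mapping.single (a, b) 1"] assms
  by (simp add: single_in del: PC.embed_hom) (simp add: T_eq)

text \<open>The vectors \<open>s\<close> in \<open>min_norm\<close> are spanned by elementary tensors, so it suffices to test matrix
  coefficients between those.  The bilinearity of elementary tensors is a consequence.\<close>

lemma min_norm_null:
  assumes t: "t \<in> carrier T"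
    and z: "\<And>\<phi> \<psi> a b a' b'. is_state A \<phi> \<Longrightarrow> is_state B \<psi> \<Longrightarrow> a \<in> carrier A \<Longrightarrow> b \<in> carrier B \<Longrightarrow>
      a' \<in> carrier A \<Longrightarrow> b' \<in> carrier B \<Longrightarrow>
      pre_functional \<phi> \<psi> (Poly_Mapping.single (a, b) 1 \<otimes>\<^bsub>T\<^esub> (t \<otimes>\<^bsub>T\<^esub> Poly_Mapping.single (a', b') 1)) = 0"
  shows "MN t = 0"
proof -
  have s1: "Poly_Mapping.single u c = c \<odot>\<^bsub>T\<^esub> Poly_Mapping.single u 1" for u c
    by (simp add: T_smult)
  have null: "pre_functional \<phi> \<psi> (r \<otimes>\<^bsub>T\<^esub> (t \<otimes>\<^bsub>T\<^esub> r')) = 0"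
    if st: "is_state A \<phi>" "is_state B \<psi>" and r: "r \<in> carrier T" and r': "r' \<in> carrier T" for \<phi> \<psi> r r'
  proof -
    interpret P: positive_functional T "pre_functional \<phi> \<psi>" by (rule product_positive[OF st])
    show ?thesis
      using r
    proof (induction r rule: T_induct)
      case zero
      show ?case using t r' P.fun_smult[of "\<zero>\<^bsub>T\<^esub>" 0] by (simp flip: T_zero)
    next
      case (add p q)
      then show ?case using t r' by (simp flip: T_add add: T.distrib_right P.fun_add)
    next
      case (single a b c)
      note ab = this
      show ?case using r'
      proof (induction r' rule: T_induct)
        case zero
        show ?case using t ab P.fun_smult[of "\<zero>\<^bsub>T\<^esub>" 0] single_in by (simp flip: T_zero)
      next
        case (add p q)
        then show ?case using t ab single_in[OF ab] by (simp flip: T_add add: T.distrib_left P.fun_add)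
      next
        case (single a' b' d)
        have "Poly_Mapping.single (a, b) c \<otimes>\<^bsub>T\<^esub> (t \<otimes>\<^bsub>T\<^esub> Poly_Mapping.single (a', b') d) =
            (d * c) \<odot>\<^bsub>T\<^esub> (Poly_Mapping.single (a, b) 1 \<otimes>\<^bsub>T\<^esub> (t \<otimes>\<^bsub>T\<^esub> Poly_Mapping.single (a', b') 1))"
          unfolding s1[of _ c] s1[of _ d] using t single_in[OF ab, of 1] single_in[OF single, of 1]
          by (simp only: T.smult_mult_left T.smult_mult_right T.smult_smult T.mult_in T.smult_in)
        then show ?case using z[OF st ab single] t single_in[OF ab, of 1] single_in[OF single, of 1]
          by (simp only: P.fun_smult T.mult_in mult_zero_right)
      qed
    qed
  qed
  have "MN t \<le> 0"
  proof (rule PF.Omega_least[OF t order_refl])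
    fix \<omega> assume "\<omega> \<in> Om"
    then obtain \<phi> \<psi> r where *: "\<omega> = (\<lambda>t. pre_functional \<phi> \<psi> (star T r \<otimes>\<^bsub>T\<^esub> (t \<otimes>\<^bsub>T\<^esub> r)))"
      "is_state A \<phi>" "is_state B \<psi>" "r \<in> carrier T" by (auto simp: Om_def)
    have "star T r \<otimes>\<^bsub>T\<^esub> ((star T t \<otimes>\<^bsub>T\<^esub> t) \<otimes>\<^bsub>T\<^esub> r) = (star T r \<otimes>\<^bsub>T\<^esub> star T t) \<otimes>\<^bsub>T\<^esub> (t \<otimes>\<^bsub>T\<^esub> r)"
      using * t by (simp add: T.mult_assoc)
    then show "Re (\<omega> (star T t \<otimes>\<^bsub>T\<^esub> t)) \<le> 0\<^sup>2 * Re (\<omega> \<one>\<^bsub>T\<^esub>)" using null[OF *(2,3)] * t by simp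
  qed
  with PF.Omega_ge0[OF t] show ?thesis by simp
qed

lemma embed_eqI:
  assumes "p \<in> carrier T" "q \<in> carrier T" "MN (p \<oplus>\<^bsub>T\<^esub> (-1) \<odot>\<^bsub>T\<^esub> q) = 0"
  shows "completion_embed T MN p = completion_embed T MN q"
proof -
  have "dst PC.C (nrm PC.C) (completion_embed T MN p) (completion_embed T MN q) = 0"
    using PC.embed_dst[OF assms(1,2)] assms(3) by (simp add: dst_def[of T])
  then show ?thesis
    using C.dst_eq_zero[of "completion_embed T MN p" "completion_embed T MN q"] assms
    unfolding min_tensor_def by simp
qed

lemma tensor_elem_add_left:
  assumes ab: "a \<in> carrier A" "a' \<in> carrier A" "b \<in> carrier B"
  shows "tensor_elem A B (a \<oplus>\<^bsub>A\<^esub> a') b = tensor_elem A B a b \<oplus>\<^bsub>C\<^esub> tensor_elem A B a' b"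
proof -
  let ?s = "\<lambda>a b. Poly_Mapping.single (a, b) (1 :: complex)"
  have "completion_embed T MN (?s (a \<oplus>\<^bsub>A\<^esub> a') b) = completion_embed T MN (?s a b \<oplus>\<^bsub>T\<^esub> ?s a' b)"
  proof (rule embed_eqI)
    show "MN (?s (a \<oplus>\<^bsub>A\<^esub> a') b \<oplus>\<^bsub>T\<^esub> (-1) \<odot>\<^bsub>T\<^esub> (?s a b \<oplus>\<^bsub>T\<^esub> ?s a' b)) = 0"
    proof (rule min_norm_null)
      fix \<phi> \<psi> x y x' y' assume st: "is_state A \<phi>" "is_state B \<psi>"
        and xy: "x \<in> carrier A" "y \<in> carrier B" "x' \<in> carrier A" "y' \<in> carrier B"
      have "\<phi> (x \<otimes>\<^bsub>A\<^esub> ((a \<oplus>\<^bsub>A\<^esub> a') \<otimes>\<^bsub>A\<^esub> x')) = \<phi> (x \<otimes>\<^bsub>A\<^esub> (a \<otimes>\<^bsub>A\<^esub> x')) + \<phi> (x \<otimes>\<^bsub>A\<^esub> (a' \<otimes>\<^bsub>A\<^esub> x'))"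
        using st(1) ab xy by (simp add: A.distrib_left A.distrib_right is_state_def)
      then show "pre_functional \<phi> \<psi> (?s x y \<otimes>\<^bsub>T\<^esub> ((?s (a \<oplus>\<^bsub>A\<^esub> a') b \<oplus>\<^bsub>T\<^esub> (-1) \<odot>\<^bsub>T\<^esub> (?s a b \<oplus>\<^bsub>T\<^esub> ?s a' b)) \<otimes>\<^bsub>T\<^esub> ?s x' y')) = 0"
        by (simp add: T_add T_smult) (simp add: T_eq algebra_simps)
    qed (use ab single_in in auto)
  qed (use ab single_in in auto)
  then show ?thesis unfolding tensor_elem_def min_tensor_def using ab single_in by simp
qed

lemma tensor_elem_add_right:
  assumes ab: "a \<in> carrier A" "b \<in> carrier B" "b' \<in> carrier B"
  shows "tensor_elem A B a (b \<oplus>\<^bsub>B\<^esub> b') = tensor_elem A B a b \<oplus>\<^bsub>C\<^esub> tensor_elem A B a b'"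
proof -
  let ?s = "\<lambda>a b. Poly_Mapping.single (a, b) (1 :: complex)"
  have "completion_embed T MN (?s a (b \<oplus>\<^bsub>B\<^esub> b')) = completion_embed T MN (?s a b \<oplus>\<^bsub>T\<^esub> ?s a b')"
  proof (rule embed_eqI)
    show "MN (?s a (b \<oplus>\<^bsub>B\<^esub> b') \<oplus>\<^bsub>T\<^esub> (-1) \<odot>\<^bsub>T\<^esub> (?s a b \<oplus>\<^bsub>T\<^esub> ?s a b')) = 0"
    proof (rule min_norm_null)
      fix \<phi> \<psi> x y x' y' assume st: "is_state A \<phi>" "is_state B \<psi>"
        and xy: "x \<in> carrier A" "y \<in> carrier B" "x' \<in> carrier A" "y' \<in> carrier B"
      have "\<psi> (y \<otimes>\<^bsub>B\<^esub> ((b \<oplus>\<^bsub>B\<^esub> b') \<otimes>\<^bsub>B\<^esub> y')) = \<psi> (y \<otimes>\<^bsub>B\<^esub> (b \<otimes>\<^bsub>B\<^esub> y')) + \<psi> (y \<otimes>\<^bsub>B\<^esub> (b' \<otimes>\<^bsub>B\<^esub> y'))"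
        using st(2) ab xy by (simp add: B.distrib_left B.distrib_right is_state_def)
      then show "pre_functional \<phi> \<psi> (?s x y \<otimes>\<^bsub>T\<^esub> ((?s a (b \<oplus>\<^bsub>B\<^esub> b') \<oplus>\<^bsub>T\<^esub> (-1) \<odot>\<^bsub>T\<^esub> (?s a b \<oplus>\<^bsub>T\<^esub> ?s a b')) \<otimes>\<^bsub>T\<^esub> ?s x' y')) = 0"
        by (simp add: T_add T_smult) (simp add: T_eq algebra_simps)
    qed (use ab single_in in auto)
  qed (use ab single_in in auto)
  then show ?thesis unfolding tensor_elem_def min_tensor_def using ab single_in by simp
qed

lemma tensor_elem_smult:
  assumes ab: "a \<in> carrier A" "b \<in> carrier B"
  shows "tensor_elem A B (c \<odot>\<^bsub>A\<^esub> a) b = c \<odot>\<^bsub>C\<^esub> tensor_elem A B a b"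
    and "tensor_elem A B a (c \<odot>\<^bsub>B\<^esub> b) = c \<odot>\<^bsub>C\<^esub> tensor_elem A B a b"
proof -
  let ?s = "\<lambda>a b. Poly_Mapping.single (a, b) (1 :: complex)"
  have "completion_embed T MN (?s (c \<odot>\<^bsub>A\<^esub> a) b) = completion_embed T MN (c \<odot>\<^bsub>T\<^esub> ?s a b)"
  proof (rule embed_eqI)
    show "MN (?s (c \<odot>\<^bsub>A\<^esub> a) b \<oplus>\<^bsub>T\<^esub> (-1) \<odot>\<^bsub>T\<^esub> (c \<odot>\<^bsub>T\<^esub> ?s a b)) = 0"
    proof (rule min_norm_null)
      fix \<phi> \<psi> x y x' y' assume st: "is_state A \<phi>" "is_state B \<psi>"
        and xy: "x \<in> carrier A" "y \<in> carrier B" "x' \<in> carrier A" "y' \<in> carrier B"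
      have "\<phi> (x \<otimes>\<^bsub>A\<^esub> ((c \<odot>\<^bsub>A\<^esub> a) \<otimes>\<^bsub>A\<^esub> x')) = c * \<phi> (x \<otimes>\<^bsub>A\<^esub> (a \<otimes>\<^bsub>A\<^esub> x'))"
        using st(1) ab xy by (simp add: is_state_def)
      then show "pre_functional \<phi> \<psi> (?s x y \<otimes>\<^bsub>T\<^esub> ((?s (c \<odot>\<^bsub>A\<^esub> a) b \<oplus>\<^bsub>T\<^esub> (-1) \<odot>\<^bsub>T\<^esub> (c \<odot>\<^bsub>T\<^esub> ?s a b)) \<otimes>\<^bsub>T\<^esub> ?s x' y')) = 0"
        by (simp add: T_add T_smult) (simp add: T_eq algebra_simps)
    qed (use ab single_in in auto)
  qed (use ab single_in in auto)
  then show "tensor_elem A B (c \<odot>\<^bsub>A\<^esub> a) b = c \<odot>\<^bsub>C\<^esub> tensor_elem A B a b"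
    unfolding tensor_elem_def min_tensor_def using ab single_in PC.embed_hom(4)[OF single_in[OF ab], of c 1] by simp
  have "completion_embed T MN (?s a (c \<odot>\<^bsub>B\<^esub> b)) = completion_embed T MN (c \<odot>\<^bsub>T\<^esub> ?s a b)"
  proof (rule embed_eqI)
    show "MN (?s a (c \<odot>\<^bsub>B\<^esub> b) \<oplus>\<^bsub>T\<^esub> (-1) \<odot>\<^bsub>T\<^esub> (c \<odot>\<^bsub>T\<^esub> ?s a b)) = 0"
    proof (rule min_norm_null)
      fix \<phi> \<psi> x y x' y' assume st: "is_state A \<phi>" "is_state B \<psi>"
        and xy: "x \<in> carrier A" "y \<in> carrier B" "x' \<in> carrier A" "y' \<in> carrier B"
      have "\<psi> (y \<otimes>\<^bsub>B\<^esub> ((c \<odot>\<^bsub>B\<^esub> b) \<otimes>\<^bsub>B\<^esub> y')) = c * \<psi> (y \<otimes>\<^bsub>B\<^esub> (b \<otimes>\<^bsub>B\<^esub> y'))"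
        using st(2) ab xy by (simp add: is_state_def)
      then show "pre_functional \<phi> \<psi> (?s x y \<otimes>\<^bsub>T\<^esub> ((?s a (c \<odot>\<^bsub>B\<^esub> b) \<oplus>\<^bsub>T\<^esub> (-1) \<odot>\<^bsub>T\<^esub> (c \<odot>\<^bsub>T\<^esub> ?s a b)) \<otimes>\<^bsub>T\<^esub> ?s x' y')) = 0"
        by (simp add: T_add T_smult) (simp add: T_eq algebra_simps)
    qed (use ab single_in in auto)
  qed (use ab single_in in auto)
  then show "tensor_elem A B a (c \<odot>\<^bsub>B\<^esub> b) = c \<odot>\<^bsub>C\<^esub> tensor_elem A B a b"
    unfolding tensor_elem_def min_tensor_def using ab single_in PC.embed_hom(4)[OF single_in[OF ab], of c 1] by simp
qed

lemma tensor_elem_nrm: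
  assumes ab: "a \<in> carrier A" "b \<in> carrier B"
  shows "nrm C (tensor_elem A B a b) \<le> nrm A a * nrm B b"
proof -
  let ?t = "Poly_Mapping.single (a, b) (1 :: complex)"
  have t: "?t \<in> carrier T" by (rule single_in[OF ab])
  have "L (star T ?t \<otimes>\<^bsub>T\<^esub> ?t) = (nrm A a * nrm B b)\<^sup>2"
    using ab by (simp add: T_eq A.N_star_mult B.N_star_mult power_mult_distrib)
  note bound = action_bound[OF _ _ t, unfolded this]
  have "MN ?t \<le> nrm A a * nrm B b"
  proof (rule PF.Omega_least[OF t])
    fix \<omega> assume "\<omega> \<in> Om"
    then obtain \<phi> \<psi> r where *: "\<omega> = (\<lambda>t. pre_functional \<phi> \<psi> (star T r \<otimes>\<^bsub>T\<^esub> (t \<otimes>\<^bsub>T\<^esub> r)))"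
      "is_state A \<phi>" "is_state B \<psi>" "r \<in> carrier T" by (auto simp: Om_def)
    have "star T r \<otimes>\<^bsub>T\<^esub> ((star T ?t \<otimes>\<^bsub>T\<^esub> ?t) \<otimes>\<^bsub>T\<^esub> r) = star T (?t \<otimes>\<^bsub>T\<^esub> r) \<otimes>\<^bsub>T\<^esub> (?t \<otimes>\<^bsub>T\<^esub> r)"
      using * t by (simp add: T.mult_assoc)
    then show "Re (\<omega> (star T ?t \<otimes>\<^bsub>T\<^esub> ?t)) \<le> (nrm A a * nrm B b)\<^sup>2 * Re (\<omega> \<one>\<^bsub>T\<^esub>)"
      using bound[OF *(2-4)] * t by simp
  qed (use ab in auto)
  then show ?thesis unfolding tensor_elem_def min_tensor_def using t by simp
qed

text \<open>Replacing the legs of an elementary tensor one after the other is controlled by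
  \<open>tensor_elem_nrm\<close>; every element of the completion is close to a finite sum of elementary tensors.\<close>

lemma tensor_dense:
  assumes F': "F' \<subseteq> carrier A" "nclosure A F' = carrier A" and G': "G' \<subseteq> carrier B" "nclosure B G' = carrier B"
  shows "nclosure C (lin_span C {tensor_elem A B f g | f g. f \<in> F' \<and> g \<in> G'}) = carrier C"
proof
  let ?S = "{tensor_elem A B f g | f g. f \<in> F' \<and> g \<in> G'}"
  let ?Q = "lin_span C ?S"
  let ?e = "completion_embed T MN"
  have S: "?S \<subseteq> carrier C" using F'(1) G'(1) by (auto intro!: tensor_elem_in)
  then have Q: "?Q \<subseteq> carrier C" using C.lin_span_in by blast
  have elem: "tensor_elem A B a b \<in> nclosure C ?Q" if ab: "a \<in> carrier A" "b \<in> carrier B" for a b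
    unfolding nclosure_def
  proof (intro CollectI conjI allI impI)
    fix e :: real assume e: "e > 0"
    define M where "M = nrm A a + nrm B b + 1"
    have M: "M \<ge> 1" using ab by (simp add: M_def)
    define e' where "e' = min 1 (e / M / 2)"
    have e': "e' > 0" "e' \<le> 1" "M * e' \<le> e / 2" using e M by (auto simp: e'_def min_def field_simps)
    have "a \<in> nclosure A F'" "b \<in> nclosure B G'" using ab F' G' by auto
    then obtain f g where fg: "f \<in> F'" "dst A (nrm A) a f < e'" "g \<in> G'" "dst B (nrm B) b g < e'"
      using e'(1) unfolding nclosure_def by blast
    have fg': "f \<in> carrier A" "g \<in> carrier B" using fg F' G' by auto
    have gb: "nrm B g \<le> nrm B b + 1" using B.N_dst[of g b] B.dst_sym[of b g] fg fg' ab e' by auto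
    have 1: "dst C (nrm C) (tensor_elem A B a b) (tensor_elem A B a g) \<le> nrm A a * dst B (nrm B) b g"
    proof -
      have "tensor_elem A B a b \<oplus>\<^bsub>C\<^esub> (-1) \<odot>\<^bsub>C\<^esub> tensor_elem A B a g = tensor_elem A B a (b \<oplus>\<^bsub>B\<^esub> (-1) \<odot>\<^bsub>B\<^esub> g)"
        using ab fg' by (simp add: tensor_elem_add_right tensor_elem_smult(2))
      then show ?thesis unfolding dst_def using tensor_elem_nrm[of a "b \<oplus>\<^bsub>B\<^esub> (-1) \<odot>\<^bsub>B\<^esub> g"] ab fg' by simp
    qed
    have 2: "dst C (nrm C) (tensor_elem A B a g) (tensor_elem A B f g) \<le> dst A (nrm A) a f * nrm B g"
    proof -
      have "tensor_elem A B a g \<oplus>\<^bsub>C\<^esub> (-1) \<odot>\<^bsub>C\<^esub> tensor_elem A B f g = tensor_elem A B (a \<oplus>\<^bsub>A\<^esub> (-1) \<odot>\<^bsub>A\<^esub> f) g"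
        using ab fg' by (simp add: tensor_elem_add_left tensor_elem_smult(1))
      then show ?thesis unfolding dst_def using tensor_elem_nrm[of "a \<oplus>\<^bsub>A\<^esub> (-1) \<odot>\<^bsub>A\<^esub> f" g] ab fg' by simp
    qed
    have "dst C (nrm C) (tensor_elem A B a b) (tensor_elem A B f g) \<le> nrm A a * dst B (nrm B) b g + dst A (nrm A) a f * nrm B g"
      using C.dst_triangle[of "tensor_elem A B a b" "tensor_elem A B a g" "tensor_elem A B f g"] 1 2 ab fg' by simp
    also have "\<dots> \<le> nrm A a * e' + e' * (nrm B b + 1)" using fg fg' ab gb e' by (intro add_mono mult_mono) auto
    also have "\<dots> = M * e'" by (simp add: M_def algebra_simps)
    also have "\<dots> < e" using e' e by simp
    finally show "\<exists>y\<in>?Q. dst C (nrm C) (tensor_elem A B a b) y < e"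
      using fg by (intro bexI[of _ "tensor_elem A B f g"] lin_span.incl) auto
  qed (use ab in auto)
  have zero: "\<zero>\<^bsub>C\<^esub> \<in> nclosure C ?Q" using C.nclosure_incl[OF Q] lin_span.zero[of C ?S] by blast
  have e: "?e p \<in> nclosure C ?Q" if "p \<in> carrier T" for p
    using that
  proof (induction p rule: T_induct)
    case zero
    have "?e \<zero>\<^bsub>T\<^esub> = \<zero>\<^bsub>C\<^esub>"
      using PC.embed_hom(4)[of "\<zero>\<^bsub>T\<^esub>" 0] C.smult_zero_left[of "?e \<zero>\<^bsub>T\<^esub>"] PC.embed_hom(1)[of "\<zero>\<^bsub>T\<^esub>"]
      by (simp add: min_tensor_def del: PC.embed_hom)
    then show ?case using \<open>\<zero>\<^bsub>C\<^esub> \<in> nclosure C ?Q\<close> by (simp add: T_zero)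
  next
    case (single a b c)
    have "?e (Poly_Mapping.single (a, b) c) = c \<odot>\<^bsub>C\<^esub> tensor_elem A B a b"
      using PC.embed_hom(4)[OF single_in[OF single, of 1], of c]
      by (simp add: tensor_elem_def min_tensor_def T_smult)
    then show ?case using C.nclosure_smult[OF Q lin_span.smult elem[OF single]] by simp
  next
    case (add p q)
    have "?e (p + q) = ?e p \<oplus>\<^bsub>C\<^esub> ?e q"
      using PC.embed_hom(3)[OF add(1,2)] by (simp add: T_add min_tensor_def)
    then show ?case using C.nclosure_add[OF Q lin_span.add add(3,4)] by simp
  qed
  show "carrier C \<subseteq> nclosure C ?Q"
  proof
    fix x assume x: "x \<in> carrier C"
    have "\<exists>y\<in>nclosure C ?Q. dst C (nrm C) x y < \<epsilon>" if "\<epsilon> > 0" for \<epsilon>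
    proof -
      from PC.embed_dense[OF x[unfolded min_tensor_def] that]
      obtain p where p: "p \<in> carrier T" "dst C (nrm C) x (?e p) < \<epsilon>"
        unfolding min_tensor_def by (rule bexE)
      from p(2) e[OF p(1)] show ?thesis by (rule bexI)
    qed
    then have "x \<in> nclosure C (nclosure C ?Q)"
      unfolding nclosure_def[of C "nclosure C ?Q"] using x by simp
    then show "x \<in> nclosure C ?Q" by (rule C.nclosure_nclosure[OF Q])
  qed
qed (auto simp: nclosure_def)

text \<open>Evaluation of the minimal tensor product.  The hypothesis \<open>faithful\<close> says that a pair of states is,
  up to a constant, faithful on the image; then the operator norm on the image is recovered from the
  moments of \<open>t\<^sup>* t\<close> in that product state, and these are dominated by the minimal norm.\<close>

lemma tensor_universal:
  fixes D :: "'d cstar_alg" and g :: "'a \<times> 'b \<Rightarrow> 'd"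
  assumes D: "complete_cstar_algebra D"
    and g_in: "\<And>a b. a \<in> carrier A \<Longrightarrow> b \<in> carrier B \<Longrightarrow> g (a, b) \<in> carrier D"
    and g_mult: "\<And>a b a' b'. a \<in> carrier A \<Longrightarrow> b \<in> carrier B \<Longrightarrow> a' \<in> carrier A \<Longrightarrow> b' \<in> carrier B \<Longrightarrow>
      g (a \<otimes>\<^bsub>A\<^esub> a', b \<otimes>\<^bsub>B\<^esub> b') = g (a, b) \<otimes>\<^bsub>D\<^esub> g (a', b')"
    and g_star: "\<And>a b. a \<in> carrier A \<Longrightarrow> b \<in> carrier B \<Longrightarrow> g (star A a, star B b) = star D (g (a, b))"
    and g_one: "g (\<one>\<^bsub>A\<^esub>, \<one>\<^bsub>B\<^esub>) = \<one>\<^bsub>D\<^esub>"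
    and states: "is_state A \<phi>" "is_state B \<psi>"
    and tr_add: "\<And>x y. x \<in> carrier D \<Longrightarrow> y \<in> carrier D \<Longrightarrow> tr (x \<oplus>\<^bsub>D\<^esub> y) = tr x + tr y"
    and tr_smult: "\<And>x c. x \<in> carrier D \<Longrightarrow> tr (c \<odot>\<^bsub>D\<^esub> x) = c * tr x"
    and tr_g: "\<And>a b. a \<in> carrier A \<Longrightarrow> b \<in> carrier B \<Longrightarrow> tr (g (a, b)) = \<phi> a * \<psi> b"
    and faithful: "\<And>x. x \<in> carrier D \<Longrightarrow> (nrm D x)\<^sup>2 \<le> K * Re (tr (star D x \<otimes>\<^bsub>D\<^esub> x))"
  obtains \<Phi> where "star_hom C D \<Phi>"
    "\<And>a b. a \<in> carrier A \<Longrightarrow> b \<in> carrier B \<Longrightarrow> \<Phi> (tensor_elem A B a b) = g (a, b)"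
proof -
  interpret D: complete_cstar_algebra D by (rule D)
  interpret E: formal_evaluation W m "(\<one>\<^bsub>A\<^esub>, \<one>\<^bsub>B\<^esub>)" s D g
    by unfold_locales (auto simp: g_in)
  have ev: "E.evl p \<in> carrier D" if "p \<in> carrier T" for p using that by (simp add: T_carrier)
  have ev_mult: "E.evl (p \<otimes>\<^bsub>T\<^esub> q) = E.evl p \<otimes>\<^bsub>D\<^esub> E.evl q" if "p \<in> carrier T" "q \<in> carrier T" for p q
    unfolding T_eq using that by (intro E.ev_mult) (auto simp: T_carrier g_mult)
  have ev_star: "E.evl (star T p) = star D (E.evl p)" if "p \<in> carrier T" for p
    unfolding T_eq using that by (intro E.ev_star) (auto simp: T_carrier g_star)
  have ev_add: "E.evl (p \<oplus>\<^bsub>T\<^esub> q) = E.evl p \<oplus>\<^bsub>D\<^esub> E.evl q" if "p \<in> carrier T" "q \<in> carrier T" for p q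
    using that by (simp add: T_carrier T_add)
  have ev_smult: "E.evl (c \<odot>\<^bsub>T\<^esub> p) = c \<odot>\<^bsub>D\<^esub> E.evl p" if "p \<in> carrier T" for p c
    using that by (simp add: T_carrier T_smult)
  have ev_one: "E.evl \<one>\<^bsub>T\<^esub> = \<one>\<^bsub>D\<^esub>" unfolding T_one by (subst E.ev_single) (auto simp: g_one)
  have tr0: "tr \<zero>\<^bsub>D\<^esub> = 0" using tr_smult[of "\<zero>\<^bsub>D\<^esub>" 0] by simp
  have tr_ev: "tr (E.evl p) = pre_functional \<phi> \<psi> p" if "p \<in> carrier T" for p
    using that
  proof (induction p rule: T_induct)
    case (single a b c)
    then show ?case by (subst E.ev_single) (auto simp: tr_smult g_in tr_g)
  next
    case (add p q)
    then show ?case using ev_add[OF add(1,2)] ev by (simp add: T_add tr_add)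
  qed (simp add: tr0)
  have contr: "nrm D (E.evl t) \<le> MN t" if t: "t \<in> carrier T" for t
  proof -
    define h where "h = star T t \<otimes>\<^bsub>T\<^esub> t"
    have h: "h \<in> carrier T" "star T h = h" using t by (auto simp: h_def)
    define pw where "pw k = ((\<lambda>a. a \<otimes>\<^bsub>T\<^esub> a) ^^ k) h" for k :: nat
    have pw: "pw k \<in> carrier T \<and> star T (pw k) = pw k" for k
      by (induction k) (auto simp: pw_def h)
    have pwS: "pw (Suc k) = star T (pw k) \<otimes>\<^bsub>T\<^esub> pw k" for k using pw[of k] by (simp add: pw_def)
    have evS: "E.evl (pw (Suc k)) = star D (E.evl (pw k)) \<otimes>\<^bsub>D\<^esub> E.evl (pw k)" for k
    proof -
      have pk: "pw k \<in> carrier T" using pw by blast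
      show ?thesis unfolding pwS by (simp only: ev_mult ev_star pk T.star_in)
    qed
    have nev: "nrm D (E.evl (pw k)) = (nrm D (E.evl h)) ^ (2 ^ k)" for k
    proof (induction k)
      case (Suc k)
      have "nrm D (E.evl (pw (Suc k))) = (nrm D (E.evl (pw k)))\<^sup>2"
        unfolding evS by (rule D.N_star_mult, rule ev) (use pw in blast)
      then show ?case by (simp add: Suc power_mult[symmetric] mult.commute)
    qed (simp add: pw_def)
    have nMN: "MN (pw k) \<le> (MN h) ^ (2 ^ k)" for k
    proof (induction k)
      case (Suc k)
      have "MN (pw (Suc k)) = (MN (pw k))\<^sup>2" unfolding pwS using pw[of k] by (intro PF.N_cstar) simp
      also have "\<dots> \<le> ((MN h) ^ (2 ^ k))\<^sup>2" using Suc PF.Omega_ge0 pw[of k] by (intro power_mono) auto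
      finally show ?case by (simp add: power_mult[symmetric] mult.commute)
    qed (simp add: pw_def)
    have main: "(nrm D (E.evl h)) ^ (2 ^ Suc k) \<le> \<bar>K\<bar> * (MN h) ^ (2 ^ Suc k)" for k
    proof -
      have pk: "pw k \<in> carrier T" "pw (Suc k) \<in> carrier T" using pw by auto
      have "(nrm D (E.evl h)) ^ (2 ^ Suc k) = (nrm D (E.evl (pw k)))\<^sup>2"
        unfolding nev by (simp add: power_mult[symmetric] mult.commute)
      also have "\<dots> \<le> K * Re (tr (star D (E.evl (pw k)) \<otimes>\<^bsub>D\<^esub> E.evl (pw k)))" by (intro faithful ev pk)
      also have "star D (E.evl (pw k)) \<otimes>\<^bsub>D\<^esub> E.evl (pw k) = E.evl (pw (Suc k))" by (rule evS[symmetric])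
      also have "tr (E.evl (pw (Suc k))) = pre_functional \<phi> \<psi> (pw (Suc k))" by (rule tr_ev[OF pk(2)])
      also have "K * Re (pre_functional \<phi> \<psi> (pw (Suc k))) \<le> \<bar>K\<bar> * cmod (pre_functional \<phi> \<psi> (pw (Suc k)))"
        by (rule order_trans[OF abs_ge_self]) (simp add: abs_mult mult_left_mono abs_Re_le_cmod)
      also have "\<dots> \<le> \<bar>K\<bar> * (MN h) ^ (2 ^ Suc k)"
        using pre_functional_le_MN[OF states pk(2)] nMN[of "Suc k"] by (intro mult_left_mono) auto
      finally show ?thesis .
    qed
    have le: "nrm D (E.evl h) \<le> MN h"
    proof (rule ccontr)
      assume "\<not> nrm D (E.evl h) \<le> MN h"
      then have y: "MN h < nrm D (E.evl h)" by simp
      define \<rho> where "\<rho> = MN h / nrm D (E.evl h)"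
      have pos: "0 < nrm D (E.evl h)" using y PF.Omega_ge0[OF h(1)] by linarith
      have \<rho>: "0 \<le> \<rho>" "\<rho> < 1" using y pos PF.Omega_ge0[OF h(1)] by (auto simp: \<rho>_def)
      have "1 \<le> \<bar>K\<bar> * \<rho> ^ (2 ^ Suc k)" for k
        using main[of k] pos by (simp add: \<rho>_def power_divide pos_le_divide_eq del: power_Suc)
      moreover have "(\<lambda>k. \<bar>K\<bar> * \<rho> ^ (2 ^ Suc k)) \<longlonglongrightarrow> \<bar>K\<bar> * 0"
        using \<rho> by (intro tendsto_mult tendsto_const filterlim_compose[OF LIMSEQ_power_zero]
            filterlim_subseq) (auto simp: strict_mono_def)
      ultimately have "1 \<le> \<bar>K\<bar> * 0" by (intro LIMSEQ_le_const) auto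
      then show False by simp
    qed
    have "(nrm D (E.evl t))\<^sup>2 = nrm D (E.evl h)" unfolding h_def using t ev by (simp add: ev_mult ev_star D.N_star_mult)
    also have "\<dots> \<le> (MN t)\<^sup>2" using le PF.N_cstar[OF t] by (simp add: h_def)
    finally show ?thesis using PF.Omega_ge0[OF t] by (rule power2_le_imp_le)
  qed
  let ?e = "completion_embed T MN"
  interpret X: dense_extension C D "carrier T" ?e E.evl
  proof
    fix p q assume pq: "p \<in> carrier T" "q \<in> carrier T"
    have "dst D (nrm D) (E.evl p) (E.evl q) = nrm D (E.evl (p \<oplus>\<^bsub>T\<^esub> (-1) \<odot>\<^bsub>T\<^esub> q))"
      using pq by (simp add: ev_add ev_smult dst_def)
    also have "\<dots> \<le> MN (p \<oplus>\<^bsub>T\<^esub> (-1) \<odot>\<^bsub>T\<^esub> q)" using pq by (intro contr) auto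
    also have "\<dots> = dst C (nrm C) (?e p) (?e q)"
      unfolding min_tensor_def PC.embed_dst[OF pq] by (simp add: dst_def)
    finally show "dst D (nrm D) (E.evl p) (E.evl q) \<le> dst C (nrm C) (?e p) (?e q)" .
    show "\<exists>k\<in>carrier T. ?e k = ?e p \<oplus>\<^bsub>C\<^esub> ?e q \<and> E.evl k = E.evl p \<oplus>\<^bsub>D\<^esub> E.evl q"
      using pq by (intro bexI[of _ "p \<oplus>\<^bsub>T\<^esub> q"]) (auto simp: ev_add min_tensor_def)
  next
    fix p c assume p: "p \<in> carrier T"
    show "\<exists>k\<in>carrier T. ?e k = c \<odot>\<^bsub>C\<^esub> ?e p \<and> E.evl k = c \<odot>\<^bsub>D\<^esub> E.evl p"
      using p by (intro bexI[of _ "c \<odot>\<^bsub>T\<^esub> p"]) (auto simp: ev_smult min_tensor_def)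
  qed (auto simp: ev min_tensor_def PC.embed_dense)
  have "star_hom C D X.ext"
  proof (rule X.ext_star_hom)
    fix p q assume pq: "p \<in> carrier T" "q \<in> carrier T"
    show "\<exists>k\<in>carrier T. ?e k = ?e p \<otimes>\<^bsub>C\<^esub> ?e q \<and> E.evl k = E.evl p \<otimes>\<^bsub>D\<^esub> E.evl q"
      using pq by (intro bexI[of _ "p \<otimes>\<^bsub>T\<^esub> q"]) (auto simp: ev_mult min_tensor_def)
  next
    fix p assume p: "p \<in> carrier T"
    show "\<exists>k\<in>carrier T. ?e k = star C (?e p) \<and> E.evl k = star D (E.evl p)"
      using p by (intro bexI[of _ "star T p"]) (auto simp: ev_star min_tensor_def)
  qed (auto intro!: bexI[of _ "\<one>\<^bsub>T\<^esub>"] simp: ev_one min_tensor_def)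
  moreover have "X.ext (tensor_elem A B a b) = g (a, b)" if "a \<in> carrier A" "b \<in> carrier B" for a b
    unfolding tensor_elem_def X.ext_i[OF single_in[OF that]]
    using that g_in by (subst E.ev_single) auto
  ultimately show ?thesis using that by blast
qed

end

section \<open>Matrix algebras\<close>

lemma mat_alg_sel:
  "carrier (mat_alg N) = carrier_mat N N" "mult (mat_alg N) = (*)" "one (mat_alg N) = 1\<^sub>m N"
  "zero (mat_alg N) = 0\<^sub>m N N" "add (mat_alg N) = (+)" "module.smult (mat_alg N) = (\<cdot>\<^sub>m)"
  "star (mat_alg N) = mat_adjoint" "nrm (mat_alg N) = mat_norm"
  by (simp_all add: mat_alg_def ring_mat_def)

lemma mat_adjoint_index:
  "i < dim_col A \<Longrightarrow> j < dim_row A \<Longrightarrow> mat_adjoint A $$ (i, j) = cnj (A $$ (j, i))"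
  for A :: "complex mat"
  by (simp add: mat_adjoint_def mat_of_rows_index conjugate_complex_def)

lemma mat_adjoint_carrier: "A \<in> carrier_mat N M \<Longrightarrow> mat_adjoint A \<in> carrier_mat M N"
  for A :: "complex mat"
  using mat_of_rows_carrier(1)[of "dim_row A" "map conjugate (cols A)"] unfolding mat_adjoint_def by auto

lemma mat_mult_index:
  "A \<in> carrier_mat N K \<Longrightarrow> B \<in> carrier_mat K M \<Longrightarrow> i < N \<Longrightarrow> j < M \<Longrightarrow>
    (A * B) $$ (i, j) = (\<Sum>k<K. A $$ (i, k) * B $$ (k, j))"
  for A B :: "complex mat"
  by (auto simp: scalar_prod_def lessThan_atLeast0 intro!: sum.cong)

lemma star_algebra_mat: "star_algebra (mat_alg N)"
proof
  fix x y :: "complex mat" assume x: "x \<in> carrier (mat_alg N)"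
  then have x': "x \<in> carrier_mat N N" by (simp add: mat_alg_sel)
  have ax: "mat_adjoint x \<in> carrier_mat N N" by (rule mat_adjoint_carrier[OF x'])
  show "star (mat_alg N) x \<in> carrier (mat_alg N)" using ax by (simp add: mat_alg_sel)
  show "star (mat_alg N) (star (mat_alg N) x) = x"
    unfolding mat_alg_sel using x' ax mat_adjoint_carrier[OF ax] by (intro eq_matI) (auto simp: mat_adjoint_index)
  have cx: "c \<cdot>\<^sub>m x \<in> carrier_mat N N" for c using x' by simp
  show "star (mat_alg N) (c \<odot>\<^bsub>mat_alg N\<^esub> x) = cnj c \<odot>\<^bsub>mat_alg N\<^esub> star (mat_alg N) x" for c
    unfolding mat_alg_sel using x' ax mat_adjoint_carrier[OF cx[of c]] by (intro eq_matI) (auto simp: mat_adjoint_index)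
  assume y: "y \<in> carrier (mat_alg N)"
  then have y': "y \<in> carrier_mat N N" by (simp add: mat_alg_sel)
  have ay: "mat_adjoint y \<in> carrier_mat N N" by (rule mat_adjoint_carrier[OF y'])
  have xy: "x + y \<in> carrier_mat N N" "x * y \<in> carrier_mat N N" using x' y' by auto
  show "star (mat_alg N) (x \<oplus>\<^bsub>mat_alg N\<^esub> y) = star (mat_alg N) x \<oplus>\<^bsub>mat_alg N\<^esub> star (mat_alg N) y"
    unfolding mat_alg_sel using x' y' ax ay mat_adjoint_carrier[OF xy(1)] by (intro eq_matI) (auto simp: mat_adjoint_index)
  show "star (mat_alg N) (x \<otimes>\<^bsub>mat_alg N\<^esub> y) = star (mat_alg N) y \<otimes>\<^bsub>mat_alg N\<^esub> star (mat_alg N) x"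
  proof (unfold mat_alg_sel, rule eq_matI)
    fix i j assume ij: "i < dim_row (mat_adjoint y * mat_adjoint x)" "j < dim_col (mat_adjoint y * mat_adjoint x)"
    then have ij': "i < N" "j < N" using ax ay by auto
    have "mat_adjoint (x * y) $$ (i, j) = cnj (\<Sum>k<N. x $$ (j, k) * y $$ (k, i))"
      using mat_adjoint_index[of i "x * y" j] x' y' ij' mat_mult_index[OF x' y' ij'(2,1)] by simp
    also have "\<dots> = (\<Sum>k<N. mat_adjoint y $$ (i, k) * mat_adjoint x $$ (k, j))"
      using x' y' ij' by (auto simp: mat_adjoint_index intro!: sum.cong)
    also have "\<dots> = (mat_adjoint y * mat_adjoint x) $$ (i, j)" by (rule mat_mult_index[OF ay ax ij', symmetric])
    finally show "mat_adjoint (x * y) $$ (i, j) = (mat_adjoint y * mat_adjoint x) $$ (i, j)" .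
  qed (use mat_adjoint_carrier[OF xy(2)] ax ay in auto)
qed (auto simp: mat_alg_sel add_smult_distrib_right_mat add_smult_distrib_left_mat
      assoc_mult_mat[of _ N N _ N _ N] add_mult_distrib_mat[of _ N N] mult_add_distrib_mat[of _ N N] comm_add_mat
      intro!: eq_matI)

text \<open>The vector functional \<open>A \<mapsto> \<langle>v, A v\<rangle>\<close>.\<close>

definition vec_fun :: "nat \<Rightarrow> (nat \<Rightarrow> complex) \<Rightarrow> complex mat \<Rightarrow> complex" where
  "vec_fun N v A = (\<Sum>i<N. \<Sum>j<N. cnj (v i) * A $$ (i, j) * v j)"

definition mat_app :: "nat \<Rightarrow> complex mat \<Rightarrow> (nat \<Rightarrow> complex) \<Rightarrow> nat \<Rightarrow> complex" where
  "mat_app N A v i = (\<Sum>j<N. A $$ (i, j) * v j)"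

lemma vec_fun_sandwich:
  assumes "A \<in> carrier_mat N N" "B \<in> carrier_mat N N"
  shows "vec_fun N v (mat_adjoint B * (A * B)) = vec_fun N (mat_app N B v) A"
proof -
  have AB: "A * B \<in> carrier_mat N N" and aB: "mat_adjoint B \<in> carrier_mat N N"
    using assms mat_adjoint_carrier by auto
  have e: "(mat_adjoint B * (A * B)) $$ (i, j) = (\<Sum>k<N. \<Sum>l<N. cnj (B $$ (k, i)) * A $$ (k, l) * B $$ (l, j))"
    if "i < N" "j < N" for i j
    unfolding mat_mult_index[OF aB AB that]
    using assms that by (auto simp: mat_adjoint_index mat_mult_index[OF assms] sum_distrib_left mult.assoc simp del: index_mult_mat intro!: sum.cong)
  have "vec_fun N v (mat_adjoint B * (A * B)) =
      (\<Sum>i<N. \<Sum>j<N. \<Sum>k<N. \<Sum>l<N. cnj (B $$ (k, i) * v i) * A $$ (k, l) * (B $$ (l, j) * v j))"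
    unfolding vec_fun_def
    by (intro sum.cong refl) (simp add: e sum_distrib_left sum_distrib_right mult_ac del: index_mult_mat)
  also have "\<dots> = (\<Sum>i<N. \<Sum>k<N. \<Sum>j<N. \<Sum>l<N. cnj (B $$ (k, i) * v i) * A $$ (k, l) * (B $$ (l, j) * v j))"
    by (rule sum.cong[OF refl], rule sum.swap)
  also have "\<dots> = (\<Sum>k<N. \<Sum>i<N. \<Sum>j<N. \<Sum>l<N. cnj (B $$ (k, i) * v i) * A $$ (k, l) * (B $$ (l, j) * v j))"
    by (rule sum.swap)
  also have "\<dots> = (\<Sum>k<N. \<Sum>i<N. \<Sum>l<N. \<Sum>j<N. cnj (B $$ (k, i) * v i) * A $$ (k, l) * (B $$ (l, j) * v j))"
    by (rule sum.cong[OF refl], rule sum.cong[OF refl], rule sum.swap)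
  also have "\<dots> = (\<Sum>k<N. \<Sum>l<N. \<Sum>i<N. \<Sum>j<N. cnj (B $$ (k, i) * v i) * A $$ (k, l) * (B $$ (l, j) * v j))"
    by (rule sum.cong[OF refl], rule sum.swap)
  also have "\<dots> = vec_fun N (mat_app N B v) A"
    unfolding vec_fun_def mat_app_def cnj_sum
    by (intro sum.cong refl) (simp add: sum_distrib_left sum_distrib_right mult_ac)
  finally show ?thesis .
qed

lemma vec_fun_one: "vec_fun N v (1\<^sub>m N) = of_real (\<Sum>i<N. (cmod (v i))\<^sup>2)"
proof -
  have "vec_fun N v (1\<^sub>m N) = (\<Sum>i<N. \<Sum>j<N. if i = j then cnj (v i) * v j else 0)"
    unfolding vec_fun_def by (intro sum.cong refl) auto
  also have "\<dots> = (\<Sum>i<N. cnj (v i) * v i)" by (simp add: sum.delta)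
  also have "\<dots> = (\<Sum>i<N. of_real ((cmod (v i))\<^sup>2))"
    by (intro sum.cong refl) (metis complex_norm_square mult.commute)
  finally show ?thesis by simp
qed

lemma vec_fun_star_mult:
  assumes "A \<in> carrier_mat N N"
  shows "vec_fun N v (mat_adjoint A * A) = of_real (\<Sum>i<N. (cmod (mat_app N A v i))\<^sup>2)"
  using vec_fun_sandwich[of "1\<^sub>m N" N A v] assms by (simp add: vec_fun_one)

lemma vec_fun_positive: "positive_functional (mat_alg N) (vec_fun N v)"
proof -
  interpret star_algebra "mat_alg N" by (rule star_algebra_mat)
  show ?thesis
  proof
    fix A assume "A \<in> carrier (mat_alg N)"
    then show "vec_fun N v (star (mat_alg N) A \<otimes>\<^bsub>mat_alg N\<^esub> A) \<in> \<real>\<^sub>\<ge>\<^sub>0"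
      by (simp add: mat_alg_sel vec_fun_star_mult complex_nonneg_Reals_iff sum_nonneg)
  qed (auto simp: mat_alg_sel vec_fun_def algebra_simps sum.distrib sum_distrib_left intro!: sum.cong)
qed

definition frob :: "nat \<Rightarrow> complex mat \<Rightarrow> real" where
  "frob N A = (\<Sum>i<N. \<Sum>j<N. (cmod (A $$ (i, j)))\<^sup>2)"

lemma mat_app_bound:
  "(\<Sum>i<N. (cmod (mat_app N A v i))\<^sup>2) \<le> frob N A * (\<Sum>i<N. (cmod (v i))\<^sup>2)"
proof -
  have "(cmod (mat_app N A v i))\<^sup>2 \<le> (\<Sum>j<N. (cmod (A $$ (i, j)))\<^sup>2) * (\<Sum>j<N. (cmod (v j))\<^sup>2)" for i
  proof -
    have "cmod (mat_app N A v i) \<le> (\<Sum>j<N. cmod (A $$ (i, j)) * cmod (v j))"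
      unfolding mat_app_def by (rule order_trans[OF norm_sum]) (simp add: norm_mult)
    then have "(cmod (mat_app N A v i))\<^sup>2 \<le> (\<Sum>j<N. cmod (A $$ (i, j)) * cmod (v j))\<^sup>2"
      by (intro power_mono) auto
    also have "\<dots> \<le> (\<Sum>j<N. (cmod (A $$ (i, j)))\<^sup>2) * (\<Sum>j<N. (cmod (v j))\<^sup>2)"
      by (rule Cauchy_Schwarz_ineq_sum)
    finally show ?thesis .
  qed
  then show ?thesis unfolding frob_def sum_distrib_right by (intro sum_mono)
qed

lemma euclid_norm_fun: "euclid_norm (vec N f) = sqrt (\<Sum>i<N. (cmod (f i))\<^sup>2)"
  by (simp add: euclid_norm_def)

lemma euclid_norm_mat_app:
  assumes "A \<in> carrier_mat N N"
  shows "euclid_norm (A *\<^sub>v vec N f) = sqrt (\<Sum>i<N. (cmod (mat_app N A f i))\<^sup>2)"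
proof -
  have "(A *\<^sub>v vec N f) $ i = mat_app N A f i" if "i < N" for i
    using assms that by (auto simp: mat_app_def scalar_prod_def lessThan_atLeast0 intro!: sum.cong)
  then show ?thesis using assms by (simp add: euclid_norm_def)
qed

lemma mat_norm_Sup:
  assumes "A \<in> carrier_mat N N"
  shows "mat_norm A = Sup {sqrt (\<Sum>i<N. (cmod (mat_app N A f i))\<^sup>2) | f. (\<Sum>i<N. (cmod (f i))\<^sup>2) \<le> 1}"
proof -
  have "{euclid_norm (A *\<^sub>v v) | v. v \<in> carrier_vec (dim_col A) \<and> euclid_norm v \<le> 1} =
      {sqrt (\<Sum>i<N. (cmod (mat_app N A f i))\<^sup>2) | f. (\<Sum>i<N. (cmod (f i))\<^sup>2) \<le> 1}" (is "?L = ?R")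
  proof
    show "?L \<subseteq> ?R"
    proof
      fix x assume "x \<in> ?L"
      then obtain v where v: "v \<in> carrier_vec N" "euclid_norm v \<le> 1" "x = euclid_norm (A *\<^sub>v v)"
        using assms by auto
      have "v = vec N (\<lambda>i. v $ i)" using v by auto
      with v euclid_norm_mat_app[OF assms, of "\<lambda>i. v $ i"] euclid_norm_fun[of N "\<lambda>i. v $ i"]
      show "x \<in> ?R" by (intro CollectI exI[of _ "\<lambda>i. v $ i"]) simp
    qed
    show "?R \<subseteq> ?L"
    proof
      fix x assume "x \<in> ?R"
      then obtain f where f: "(\<Sum>i<N. (cmod (f i))\<^sup>2) \<le> 1" "x = sqrt (\<Sum>i<N. (cmod (mat_app N A f i))\<^sup>2)" by blast
      then show "x \<in> ?L" using assms
        by (intro CollectI exI[of _ "vec N f"]) (simp add: euclid_norm_mat_app[OF assms] euclid_norm_fun)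
    qed
  qed
  then show ?thesis by (simp add: mat_norm_def)
qed

lemma mat_norm_upper:
  assumes A: "A \<in> carrier_mat N N"
  shows "(\<Sum>i<N. (cmod (mat_app N A f i))\<^sup>2) \<le> (mat_norm A)\<^sup>2 * (\<Sum>i<N. (cmod (f i))\<^sup>2)"
    and "0 \<le> mat_norm A"
proof -
  let ?S = "{sqrt (\<Sum>i<N. (cmod (mat_app N A f i))\<^sup>2) | f. (\<Sum>i<N. (cmod (f i))\<^sup>2) \<le> 1}"
  have bdd: "bdd_above ?S"
  proof (rule bdd_aboveI)
    fix x assume "x \<in> ?S"
    then obtain f where f: "(\<Sum>i<N. (cmod (f i))\<^sup>2) \<le> 1" "x = sqrt (\<Sum>i<N. (cmod (mat_app N A f i))\<^sup>2)" by blast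
    have "frob N A * (\<Sum>i<N. (cmod (f i))\<^sup>2) \<le> frob N A * 1"
      using f by (intro mult_left_mono) (auto simp: frob_def intro!: sum_nonneg)
    then show "x \<le> sqrt (frob N A)" using mat_app_bound[where A = A and v = f and N = N] f by simp
  qed
  have up: "sqrt (\<Sum>i<N. (cmod (mat_app N A f i))\<^sup>2) \<le> mat_norm A" if "(\<Sum>i<N. (cmod (f i))\<^sup>2) \<le> 1" for f
    unfolding mat_norm_Sup[OF A] by (rule cSup_upper[OF _ bdd]) (use that in blast)
  from up[of "\<lambda>_. 0"] show ge0: "0 \<le> mat_norm A" by (simp add: mat_app_def)
  define u where "u = (\<Sum>i<N. (cmod (f i))\<^sup>2)"
  have u0: "0 \<le> u" by (simp add: u_def sum_nonneg)
  show "(\<Sum>i<N. (cmod (mat_app N A f i))\<^sup>2) \<le> (mat_norm A)\<^sup>2 * (\<Sum>i<N. (cmod (f i))\<^sup>2)"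
  proof (cases "u = 0")
    case True
    then show ?thesis using mat_app_bound[where A = A and v = f and N = N] by (simp add: u_def)
  next
    case False
    with u0 have up0: "u > 0" by simp
    define c where "c = complex_of_real (1 / sqrt u)"
    have cc: "(cmod c)\<^sup>2 = 1 / u" using up0 by (simp add: c_def norm_divide power_divide)
    have "(\<Sum>i<N. (cmod (c * f i))\<^sup>2) = 1 / u * u"
      unfolding u_def by (simp only: norm_mult power_mult_distrib cc[unfolded u_def] sum_distrib_left)
    then have "sqrt (\<Sum>i<N. (cmod (mat_app N A (\<lambda>i. c * f i) i))\<^sup>2) \<le> mat_norm A" using up0 by (intro up) simp
    then have "(\<Sum>i<N. (cmod (mat_app N A (\<lambda>i. c * f i) i))\<^sup>2) \<le> (mat_norm A)\<^sup>2" by (rule sqrt_le_D)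
    also have "(\<Sum>i<N. (cmod (mat_app N A (\<lambda>i. c * f i) i))\<^sup>2) = 1 / u * (\<Sum>i<N. (cmod (mat_app N A f i))\<^sup>2)"
    proof -
      have "mat_app N A (\<lambda>i. c * f i) i = c * mat_app N A f i" for i
        by (simp add: mat_app_def sum_distrib_left mult_ac)
      then show ?thesis by (simp only: norm_mult power_mult_distrib cc sum_distrib_left)
    qed
    finally show ?thesis using up0 by (simp add: u_def[symmetric] field_simps)
  qed
qed

lemma mat_norm_least:
  assumes A: "A \<in> carrier_mat N N" and c: "0 \<le> c"
    and le: "\<And>f. (\<Sum>i<N. (cmod (mat_app N A f i))\<^sup>2) \<le> c\<^sup>2 * (\<Sum>i<N. (cmod (f i))\<^sup>2)"
  shows "mat_norm A \<le> c"
  unfolding mat_norm_Sup[OF A]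
proof (rule cSup_least)
  show "{sqrt (\<Sum>i<N. (cmod (mat_app N A f i))\<^sup>2) | f. (\<Sum>i<N. (cmod (f i))\<^sup>2) \<le> 1} \<noteq> {}"
    by (auto intro!: exI[of _ "\<lambda>_. 0"])
  fix x assume "x \<in> {sqrt (\<Sum>i<N. (cmod (mat_app N A f i))\<^sup>2) | f. (\<Sum>i<N. (cmod (f i))\<^sup>2) \<le> 1}"
  then obtain f where f: "(\<Sum>i<N. (cmod (f i))\<^sup>2) \<le> 1" "x = sqrt (\<Sum>i<N. (cmod (mat_app N A f i))\<^sup>2)" by blast
  have "(\<Sum>i<N. (cmod (mat_app N A f i))\<^sup>2) \<le> c\<^sup>2 * 1" using le[of f] f by (meson mult_left_mono order_trans zero_le_power2)
  then show "x \<le> c" unfolding f(2) using c by (intro real_le_lsqrt) auto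
qed

lemma positive_family_mat: "positive_family (mat_alg N) (range (vec_fun N)) (nrm (mat_alg N))"
proof (intro positive_family.intro positive_family_axioms.intro star_algebra_mat)
  fix \<omega> assume "\<omega> \<in> range (vec_fun N)"
  then show "positive_functional (mat_alg N) \<omega>" using vec_fun_positive by auto
next
  fix \<omega> B assume "\<omega> \<in> range (vec_fun N)" and B: "B \<in> carrier (mat_alg N)"
  then obtain v where v: "\<omega> = vec_fun N v" by auto
  then show "\<exists>\<omega>'\<in>range (vec_fun N). \<forall>A\<in>carrier (mat_alg N).
      \<omega>' A = \<omega> (star (mat_alg N) B \<otimes>\<^bsub>mat_alg N\<^esub> (A \<otimes>\<^bsub>mat_alg N\<^esub> B))"
    using B by (intro bexI[of _ "vec_fun N (mat_app N B v)"]) (auto simp: mat_alg_sel vec_fun_sandwich)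
next
  fix A assume "A \<in> carrier (mat_alg N)"
  then have A: "A \<in> carrier_mat N N" by (simp add: mat_alg_sel)
  then show "0 \<le> nrm (mat_alg N) A" by (simp add: mat_alg_sel mat_norm_upper(2))
  show "Re (\<omega> (star (mat_alg N) A \<otimes>\<^bsub>mat_alg N\<^esub> A)) \<le> (nrm (mat_alg N) A)\<^sup>2 * Re (\<omega> \<one>\<^bsub>mat_alg N\<^esub>)"
    if "\<omega> \<in> range (vec_fun N)" for \<omega>
    using that mat_norm_upper(1)[OF A] by (auto simp: mat_alg_sel vec_fun_star_mult[OF A] vec_fun_one)
  fix c :: real assume c: "0 \<le> c"
    and le: "\<And>\<omega>. \<omega> \<in> range (vec_fun N) \<Longrightarrow>
      Re (\<omega> (star (mat_alg N) A \<otimes>\<^bsub>mat_alg N\<^esub> A)) \<le> c\<^sup>2 * Re (\<omega> \<one>\<^bsub>mat_alg N\<^esub>)"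
  show "nrm (mat_alg N) A \<le> c" unfolding mat_alg_sel
  proof (rule mat_norm_least[OF A c])
    fix f
    show "(\<Sum>i<N. (cmod (mat_app N A f i))\<^sup>2) \<le> c\<^sup>2 * (\<Sum>i<N. (cmod (f i))\<^sup>2)"
      using le[of "vec_fun N f"] by (simp add: mat_alg_sel vec_fun_star_mult[OF A] vec_fun_one)
  qed
qed

lemma mat_norm_le_frob: "A \<in> carrier_mat N N \<Longrightarrow> (mat_norm A)\<^sup>2 \<le> frob N A"
proof -
  assume A: "A \<in> carrier_mat N N"
  have f0: "0 \<le> frob N A" by (simp add: frob_def sum_nonneg)
  have "mat_norm A \<le> sqrt (frob N A)"
    by (rule mat_norm_least[OF A]) (use mat_app_bound f0 in auto)
  then have "(mat_norm A)\<^sup>2 \<le> (sqrt (frob N A))\<^sup>2" using mat_norm_upper(2)[OF A] by (intro power_mono)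
  then show ?thesis using f0 by simp
qed

lemma col_le_mat_norm:
  assumes A: "A \<in> carrier_mat N N" and j: "j < N"
  shows "(\<Sum>i<N. (cmod (A $$ (i, j)))\<^sup>2) \<le> (mat_norm A)\<^sup>2"
proof -
  let ?e = "\<lambda>k. if k = j then 1 else (0::complex)"
  have "mat_app N A ?e i = A $$ (i, j)" for i
    using j by (simp add: mat_app_def if_distrib[of "\<lambda>x. _ * x"] sum.delta' cong: if_cong)
  moreover have "(\<Sum>i<N. (cmod (?e i))\<^sup>2) = 1" using j by (simp add: if_distrib[of "\<lambda>x. (cmod x)\<^sup>2"] cong: if_cong)
  ultimately show ?thesis using mat_norm_upper(1)[OF A, of ?e] by simp
qed

lemma entry_le_mat_norm:
  assumes A: "A \<in> carrier_mat N N" and ij: "i < N" "j < N"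
  shows "cmod (A $$ (i, j)) \<le> mat_norm A"
proof -
  have "(cmod (A $$ (i, j)))\<^sup>2 \<le> (\<Sum>i<N. (cmod (A $$ (i, j)))\<^sup>2)" using ij by (intro member_le_sum) auto
  also have "\<dots> \<le> (mat_norm A)\<^sup>2" by (rule col_le_mat_norm[OF A ij(2)])
  finally show ?thesis using mat_norm_upper(2)[OF A] by (rule power2_le_imp_le)
qed

lemma complete_cstar_algebra_mat: "complete_cstar_algebra (mat_alg N)"
proof -
  interpret P: positive_family "mat_alg N" "range (vec_fun N)" "nrm (mat_alg N)" by (rule positive_family_mat)
  let ?d = "dst (mat_alg N) (nrm (mat_alg N))"
  have d: "?d A B = mat_norm (A + (-1) \<cdot>\<^sub>m B)" for A B by (simp add: dst_def mat_alg_sel)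
  show ?thesis
  proof
    fix A assume "A \<in> carrier (mat_alg N)" and z: "nrm (mat_alg N) A = 0"
    then have A: "A \<in> carrier_mat N N" by (simp add: mat_alg_sel)
    have "A $$ (i, j) = 0" if "i < N" "j < N" for i j
      using entry_le_mat_norm[OF A that] z by (simp add: mat_alg_sel)
    then show "A = \<zero>\<^bsub>mat_alg N\<^esub>" unfolding mat_alg_sel using A by (intro eq_matI) auto
  next
    fix s :: "nat \<Rightarrow> complex mat" assume s': "\<And>k. s k \<in> carrier (mat_alg N)"
      and cauchy: "\<And>e. e > 0 \<Longrightarrow> \<exists>K. \<forall>k\<ge>K. \<forall>l\<ge>K. ?d (s k) (s l) < e"
    have s: "s k \<in> carrier_mat N N" for k using s' by (simp add: mat_alg_sel)
    have diff: "s k + (-1) \<cdot>\<^sub>m B \<in> carrier_mat N N" if "B \<in> carrier_mat N N" for k B using s that by auto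
    have "\<exists>l. (\<lambda>k. s k $$ (i, j)) \<longlonglongrightarrow> l" if ij: "i < N" "j < N" for i j
    proof -
      have "Cauchy (\<lambda>k. s k $$ (i, j))"
        unfolding Cauchy_def
      proof (intro allI impI)
        fix e :: real assume "e > 0"
        then obtain K where K: "\<And>k l. k \<ge> K \<Longrightarrow> l \<ge> K \<Longrightarrow> ?d (s k) (s l) < e" using cauchy by metis
        show "\<exists>M. \<forall>m\<ge>M. \<forall>n\<ge>M. dist (s m $$ (i, j)) (s n $$ (i, j)) < e"
        proof (intro exI[of _ K] allI impI)
          fix k l assume "k \<ge> K" "l \<ge> K"
          then have "mat_norm (s k + (-1) \<cdot>\<^sub>m s l) < e" using K d by simp
          moreover have "(s k + (-1) \<cdot>\<^sub>m s l) $$ (i, j) = s k $$ (i, j) - s l $$ (i, j)"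
            using ij s[of k] s[of l] by simp
          ultimately show "dist (s k $$ (i, j)) (s l $$ (i, j)) < e"
            using entry_le_mat_norm[OF diff[OF s[of l], of k] ij] by (simp add: dist_norm)
        qed
      qed
      then show ?thesis using Cauchy_convergent convergent_def by blast
    qed
    then obtain l where l: "\<And>i j. i < N \<Longrightarrow> j < N \<Longrightarrow> (\<lambda>k. s k $$ (i, j)) \<longlonglongrightarrow> l i j" by metis
    define A where "A = mat N N (\<lambda>(i, j). l i j)"
    have A: "A \<in> carrier_mat N N" by (simp add: A_def)
    have "(\<lambda>k. frob N (s k + (-1) \<cdot>\<^sub>m A)) \<longlonglongrightarrow> (\<Sum>i<N. \<Sum>j<N. (cmod 0)\<^sup>2)"
      unfolding frob_def
    proof (intro tendsto_sum tendsto_power tendsto_norm)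
      fix i j assume ij: "i \<in> {..<N}" "j \<in> {..<N}"
      have "(s k + (-1) \<cdot>\<^sub>m A) $$ (i, j) = s k $$ (i, j) - l i j" for k
        using ij s[of k] by (simp add: A_def)
      then show "(\<lambda>k. (s k + (-1) \<cdot>\<^sub>m A) $$ (i, j)) \<longlonglongrightarrow> 0"
        using l[of i j] ij by (simp add: LIM_zero_iff)
    qed
    then have "(\<lambda>k. sqrt (frob N (s k + (-1) \<cdot>\<^sub>m A))) \<longlonglongrightarrow> sqrt 0" by (intro tendsto_real_sqrt) simp
    then have lim: "(\<lambda>k. sqrt (frob N (s k + (-1) \<cdot>\<^sub>m A))) \<longlonglongrightarrow> 0" by simp
    have "mat_norm (s k + (-1) \<cdot>\<^sub>m A) \<le> sqrt (frob N (s k + (-1) \<cdot>\<^sub>m A))" for k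
      using mat_norm_le_frob[OF diff[OF A]] by (rule real_le_rsqrt)
    then have "(\<lambda>k. ?d (s k) A) \<longlonglongrightarrow> 0"
      unfolding d using mat_norm_upper(2)[OF diff[OF A]]
      by (intro tendsto_sandwich[OF _ _ tendsto_const lim]) auto
    then show "\<exists>x\<in>carrier (mat_alg N). (\<lambda>k. ?d (s k) x) \<longlonglongrightarrow> 0" using A by (auto simp: mat_alg_sel)
  qed
qed

lemma trN_add: "A \<in> carrier_mat N N \<Longrightarrow> B \<in> carrier_mat N N \<Longrightarrow> trN N (A + B) = trN N A + trN N B"
  by (auto simp: trN_def sum.distrib add_divide_distrib[symmetric])

lemma trN_smult: "A \<in> carrier_mat N N \<Longrightarrow> trN N (c \<cdot>\<^sub>m A) = c * trN N A"
  by (auto simp: trN_def sum_distrib_left)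

lemma trN_comm: "A \<in> carrier_mat N N \<Longrightarrow> B \<in> carrier_mat N N \<Longrightarrow> trN N (A * B) = trN N (B * A)"
proof -
  assume AB: "A \<in> carrier_mat N N" "B \<in> carrier_mat N N"
  have "(\<Sum>i<N. (A * B) $$ (i, i)) = (\<Sum>i<N. \<Sum>k<N. A $$ (i, k) * B $$ (k, i))"
    by (intro sum.cong refl mat_mult_index[OF AB]) auto
  also have "\<dots> = (\<Sum>k<N. \<Sum>i<N. B $$ (k, i) * A $$ (i, k))"
    by (subst sum.swap) (simp add: mult.commute)
  also have "\<dots> = (\<Sum>i<N. (B * A) $$ (i, i))"
    by (intro sum.cong refl mat_mult_index[OF AB(2,1), symmetric]) auto
  finally show ?thesis by (simp add: trN_def)
qed

lemma trN_star_mult: "A \<in> carrier_mat N N \<Longrightarrow> trN N (mat_adjoint A * A) = of_real (frob N A / real N)"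
proof -
  assume A: "A \<in> carrier_mat N N"
  have "(\<Sum>i<N. (mat_adjoint A * A) $$ (i, i)) = (\<Sum>i<N. \<Sum>k<N. of_real ((cmod (A $$ (k, i)))\<^sup>2))"
  proof (intro sum.cong refl)
    fix i assume i: "i \<in> {..<N}"
    have "(mat_adjoint A * A) $$ (i, i) = (\<Sum>k<N. cnj (A $$ (k, i)) * A $$ (k, i))"
      using mat_mult_index[OF mat_adjoint_carrier[OF A] A, of i i] i A
      by (auto simp: mat_adjoint_index intro!: sum.cong)
    also have "\<dots> = (\<Sum>k<N. of_real ((cmod (A $$ (k, i)))\<^sup>2))"
      by (intro sum.cong refl) (metis complex_norm_square mult.commute)
    finally show "(mat_adjoint A * A) $$ (i, i) = (\<Sum>k<N. of_real ((cmod (A $$ (k, i)))\<^sup>2))" .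
  qed
  also have "\<dots> = of_real (frob N A)" unfolding frob_def by (subst sum.swap) simp
  finally show ?thesis by (simp add: trN_def)
qed

lemma trN_le_mat_norm:
  assumes A: "A \<in> carrier_mat N N" shows "cmod (trN N A) \<le> mat_norm A"
proof -
  have "cmod (\<Sum>i<N. A $$ (i, i)) \<le> (\<Sum>i<N. mat_norm A)"
    by (rule order_trans[OF norm_sum sum_mono]) (use entry_le_mat_norm[OF A] in auto)
  then show ?thesis using mat_norm_upper(2)[OF A]
    by (cases "N = 0") (auto simp: trN_def norm_divide field_simps)
qed

lemma trN_is_state: "N > 0 \<Longrightarrow> is_state (mat_alg N) (trN N)"
  unfolding is_state_def mat_alg_sel
  by (auto simp: trN_add trN_smult trN_star_mult trN_le_mat_norm complex_nonneg_Reals_iff frob_def sum_nonneg)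
     (simp add: trN_def)

lemma is_state_comp:
  assumes h: "star_hom A D \<phi>" and t: "is_state D \<tau>" and A: "star_algebra A"
  shows "is_state A (\<lambda>f. \<tau> (\<phi> f))"
proof -
  interpret star_algebra A by fact
  note hom = star_homD[OF h]
  have "\<tau> (\<phi> (star A a \<otimes>\<^bsub>A\<^esub> a)) \<in> \<real>\<^sub>\<ge>\<^sub>0" if "a \<in> carrier A" for a
    using that t hom(1)[OF that] by (simp add: hom is_state_def)
  moreover have "cmod (\<tau> (\<phi> a)) \<le> nrm A a" if "a \<in> carrier A" for a
  proof -
    have "cmod (\<tau> (\<phi> a)) \<le> nrm D (\<phi> a)" using t hom(1)[OF that] by (simp add: is_state_def)
    also have "\<dots> \<le> nrm A a" by (rule hom(7)[OF that])
    finally show ?thesis .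
  qed
  ultimately show ?thesis using t by (simp add: is_state_def hom)
qed

section \<open>Kronecker products and evaluation on the tensor square\<close>

lemma sum_div_mod: "(\<Sum>k<N * N. f (k div N) (k mod N)) = (\<Sum>a<N. \<Sum>b<N. f a b)"
  for f :: "nat \<Rightarrow> nat \<Rightarrow> complex"
proof -
  have "(\<Sum>(a, b)\<in>{..<N} \<times> {..<N}. f a b) = (\<Sum>k<N * N. f (k div N) (k mod N))"
  proof (rule sum.reindex_bij_witness[where i = "\<lambda>k. (k div N, k mod N)" and j = "\<lambda>(a, b). a * N + b"])
    fix k assume k: "k \<in> {..<N * N}"
    then show "(k div N, k mod N) \<in> {..<N} \<times> {..<N}"
      by (cases "N = 0") (auto simp: less_mult_imp_div_less)
  next
    fix p assume p: "p \<in> {..<N} \<times> {..<N}"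
    obtain a b where ab: "p = (a, b)" "a < N" "b < N" using p by auto
    have "a * N + b < Suc a * N" using ab by simp
    also have "\<dots> \<le> N * N" using ab by (intro mult_right_mono) auto
    finally show "(case p of (a, b) \<Rightarrow> a * N + b) \<in> {..<N * N}" using ab by simp
  qed auto
  then show ?thesis by (simp add: sum.cartesian_product)
qed

lemma kron_carrier [simp]: "kron N A B \<in> carrier_mat (N * N) (N * N)"
  by (simp add: kron_def)

lemma div_mod_less: "k < N * N \<Longrightarrow> k div N < N \<and> k mod N < N" for N :: nat
  by (cases "N = 0") (auto simp: less_mult_imp_div_less)

lemma kron_index: "k < N * N \<Longrightarrow> l < N * N \<Longrightarrow>
    kron N A B $$ (k, l) = A $$ (k div N, l div N) * B $$ (k mod N, l mod N)"
  by (simp add: kron_def)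

lemma kron_mult:
  assumes "A \<in> carrier_mat N N" "B \<in> carrier_mat N N" "A' \<in> carrier_mat N N" "B' \<in> carrier_mat N N"
  shows "kron N A B * kron N A' B' = kron N (A * A') (B * B')"
proof (rule eq_matI)
  fix k l assume "k < dim_row (kron N (A * A') (B * B'))" "l < dim_col (kron N (A * A') (B * B'))"
  then have kl: "k < N * N" "l < N * N" by (auto simp: kron_def)
  have "(kron N A B * kron N A' B') $$ (k, l) = (\<Sum>m<N * N. kron N A B $$ (k, m) * kron N A' B' $$ (m, l))"
    by (rule mat_mult_index[OF kron_carrier kron_carrier kl])
  also have "\<dots> = (\<Sum>m<N * N. (\<lambda>a b. A $$ (k div N, a) * A' $$ (a, l div N) * (B $$ (k mod N, b) * B' $$ (b, l mod N)))
      (m div N) (m mod N))"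
    using kl by (intro sum.cong refl) (simp add: kron_index mult_ac)
  also have "\<dots> = (\<Sum>a<N. \<Sum>b<N. A $$ (k div N, a) * A' $$ (a, l div N) * (B $$ (k mod N, b) * B' $$ (b, l mod N)))"
    by (rule sum_div_mod)
  also have "\<dots> = (A * A') $$ (k div N, l div N) * (B * B') $$ (k mod N, l mod N)"
    using div_mod_less[OF kl(1)] div_mod_less[OF kl(2)]
    by (simp add: mat_mult_index[OF assms(1,3)] mat_mult_index[OF assms(2,4)] sum_product del: index_mult_mat)
  also have "\<dots> = kron N (A * A') (B * B') $$ (k, l)" using kl by (simp add: kron_index del: index_mult_mat)
  finally show "(kron N A B * kron N A' B') $$ (k, l) = kron N (A * A') (B * B') $$ (k, l)" .
qed (auto simp: kron_def)

lemma kron_adjoint: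
  assumes "A \<in> carrier_mat N N" "B \<in> carrier_mat N N"
  shows "mat_adjoint (kron N A B) = kron N (mat_adjoint A) (mat_adjoint B)"
proof (rule eq_matI)
  fix k l assume "k < dim_row (kron N (mat_adjoint A) (mat_adjoint B))" "l < dim_col (kron N (mat_adjoint A) (mat_adjoint B))"
  then have kl: "k < N * N" "l < N * N" by (auto simp: kron_def)
  show "mat_adjoint (kron N A B) $$ (k, l) = kron N (mat_adjoint A) (mat_adjoint B) $$ (k, l)"
    using mat_adjoint_index[of k "kron N A B" l] kl assms div_mod_less[OF kl(1)] div_mod_less[OF kl(2)]
    by (simp add: kron_index mat_adjoint_index carrier_matD[OF kron_carrier])
qed (use mat_adjoint_carrier[OF kron_carrier[of N A B]] in \<open>auto simp: kron_def\<close>)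

lemma kron_one: "kron N (1\<^sub>m N) (1\<^sub>m N) = 1\<^sub>m (N * N)"
proof (rule eq_matI)
  fix k l assume "k < dim_row (1\<^sub>m (N * N))" "l < dim_col (1\<^sub>m (N * N) :: complex mat)"
  then have kl: "k < N * N" "l < N * N" by auto
  have "k = l \<longleftrightarrow> k div N = l div N \<and> k mod N = l mod N" by (metis div_mult_mod_eq)
  then show "kron N (1\<^sub>m N) (1\<^sub>m N) $$ (k, l) = 1\<^sub>m (N * N) $$ (k, l)"
    using kl div_mod_less[OF kl(1)] div_mod_less[OF kl(2)] by (auto simp: kron_index)
qed (auto simp: kron_def)

lemma trN_kron: "trN (N * N) (kron N A B) = trN N A * trN N B"
proof -
  have "(\<Sum>k<N * N. kron N A B $$ (k, k)) = (\<Sum>k<N * N. (\<lambda>a b. A $$ (a, a) * B $$ (b, b)) (k div N) (k mod N))"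
    by (intro sum.cong refl) (simp add: kron_index)
  also have "\<dots> = (\<Sum>a<N. \<Sum>b<N. A $$ (a, a) * B $$ (b, b))" by (rule sum_div_mod)
  also have "\<dots> = (\<Sum>a<N. A $$ (a, a)) * (\<Sum>b<N. B $$ (b, b))" by (simp add: sum_product)
  finally show ?thesis by (simp add: trN_def)
qed

text \<open>The constant \<open>N\<close> is crude, but \<open>tensor_universal\<close> needs only some constant.\<close>

lemma faithful_trace: "A \<in> carrier_mat N N \<Longrightarrow> (mat_norm A)\<^sup>2 \<le> real N * Re (trN N (mat_adjoint A * A))"
  using mat_norm_le_frob[of A N] mat_norm_upper(2)[of A N]
  by (cases "N = 0") (auto simp: trN_star_mult frob_def)

section \<open>Operator algebras\<close>

instance chilbert_space \<subseteq> banach ..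

lemma op_alg_sel:
  "carrier (op_alg M) = M" "mult (op_alg M) = (\<circ>)" "one (op_alg M) = id"
  "zero (op_alg M) = (\<lambda>x. 0)" "add (op_alg M) S T = (\<lambda>x. S x + T x)"
  "module.smult (op_alg M) c T = (\<lambda>x. scaleC c (T x))"
  "star (op_alg M) = op_adjoint" "nrm (op_alg M) = onorm"
  by (simp_all add: op_alg_def)

lemma scaleC_one [simp]: "scaleC 1 x = (x :: 'h::chilbert_space)"
  using scaleC_of_real[of 1 x] by simp

lemma scaleC_zero_left [simp]: "scaleC 0 x = (0 :: 'h::chilbert_space)"
  using scaleC_of_real[of 0 x] by simp

lemma scaleC_minus_one [simp]: "scaleC (- 1) x = - (x :: 'h::chilbert_space)"
  using scaleC_of_real[of "-1" x] by simp

lemma cinner_add_left: "cinner (x + y) z = cinner x z + cinner y (z :: 'h::chilbert_space)"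
  by (metis cinner_add_right cinner_commute complex_cnj_add)

lemma cinner_scaleC_left: "cinner (scaleC c x) y = cnj c * cinner x (y :: 'h::chilbert_space)"
  by (metis cinner_scaleC_right cinner_commute complex_cnj_mult)

lemma cinner_self: "cinner x x = of_real ((norm (x :: 'h::chilbert_space))\<^sup>2)"
proof -
  have "Im (cinner x x) = - Im (cinner x x)" using cinner_commute[of x x] by (metis cnj.sel(2))
  then show ?thesis by (simp add: complex_eq_iff Re_cinner power2_norm_eq_inner)
qed

lemma norm_scaleC: "norm (scaleC c x) = cmod c * norm (x :: 'h::chilbert_space)"
proof -
  have "cinner (scaleC c x) (scaleC c x) = (c * cnj c) * cinner x x"
    by (simp add: cinner_scaleC_left cinner_scaleC_right)
  also have "\<dots> = of_real ((cmod c * norm x)\<^sup>2)"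
    unfolding complex_norm_square[symmetric] cinner_self by (simp add: power_mult_distrib)
  finally have "(norm (scaleC c x))\<^sup>2 = (cmod c * norm x)\<^sup>2" unfolding cinner_self by (simp only: of_real_eq_iff)
  then show ?thesis by (simp add: power2_eq_iff_nonneg)
qed

lemma cinner_eqI: assumes "\<And>z. cinner z x = cinner z (y :: 'h::chilbert_space)" shows "x = y"
proof -
  have "inner (x - y) x = inner (x - y) y" using assms[of "x - y"] by (simp flip: Re_cinner)
  then have "inner (x - y) (x - y) = 0" by (simp add: inner_diff_right)
  then show ?thesis by simp
qed

lemma op_adjoint_eq: assumes "is_adjoint T S" shows "op_adjoint T = S"
  unfolding op_adjoint_def
proof (rule the_equality)
  fix S' assume S': "is_adjoint T S'"
  show "S' = S"
  proof
    fix y show "S' y = S y" by (rule cinner_eqI) (use assms S' in \<open>auto simp: is_adjoint_def\<close>)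
  qed
qed (rule assms)

lemma is_adjoint_sym: "is_adjoint T S \<Longrightarrow> is_adjoint S T"
  unfolding is_adjoint_def by (metis cinner_commute)

lemma scaleC_bounded_linear: "bounded_linear (scaleC c :: 'h::chilbert_space \<Rightarrow> 'h)"
proof
  show "scaleC c (r *\<^sub>R x) = r *\<^sub>R scaleC c (x :: 'h)" for r x
    using scaleC_scaleC[of c "of_real r" x] scaleC_scaleC[of "of_real r" c x]
    by (simp add: scaleC_of_real mult.commute)
qed (auto simp: scaleC_add_right norm_scaleC mult.commute intro!: exI[of _ "cmod c"])

lemma scaleC_scaleC_left: "scaleC c (scaleC d x) = scaleC d (scaleC c (x :: 'h::chilbert_space))"
  by (simp add: scaleC_scaleC mult.commute)

locale vn_algebra =
  fixes M :: "('h::chilbert_space \<Rightarrow> 'h) set"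
  assumes vn: "von_neumann_algebra M"
begin

definition "M' = commutant M"

lemma M_eq: "M = commutant M'"
  using vn by (simp add: von_neumann_algebra_def M'_def)

lemma M_iff: "T \<in> M \<longleftrightarrow> bounded_linear T \<and> (\<forall>c x. T (scaleC c x) = scaleC c (T x)) \<and> (\<forall>S\<in>M'. \<forall>x. T (S x) = S (T x))"
  by (subst M_eq) (auto simp: commutant_def bounded_ops_def fun_eq_iff)

lemma M'_bounded: "S \<in> M' \<Longrightarrow> bounded_linear S \<and> (\<forall>c x. S (scaleC c x) = scaleC c (S x))"
  by (simp add: M'_def commutant_def bounded_ops_def)

lemma M_bounded: "T \<in> M \<Longrightarrow> bounded_linear T" and M_scaleC: "T \<in> M \<Longrightarrow> T (scaleC c x) = scaleC c (T x)"
  by (simp_all add: M_iff)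

lemma M_add: assumes "S \<in> M" "T \<in> M" shows "(\<lambda>x. S x + T x) \<in> M"
  unfolding M_iff
proof (intro conjI allI ballI)
  show "bounded_linear (\<lambda>x. S x + T x)" using assms by (intro bounded_linear_add M_bounded)
  show "S (scaleC c x) + T (scaleC c x) = scaleC c (S x + T x)" for c x using assms by (simp add: M_scaleC scaleC_add_right)
  show "S (U x) + T (U x) = U (S x + T x)" if "U \<in> M'" for U x
    using assms that M'_bounded[OF that] by (simp add: M_iff linear_add[OF bounded_linear.linear])
qed

lemma M_mult: assumes "S \<in> M" "T \<in> M" shows "S \<circ> T \<in> M"
  using assms bounded_linear_compose[of S T] by (auto simp: M_iff o_def)

lemma M_smult: assumes "T \<in> M" shows "(\<lambda>x. scaleC c (T x)) \<in> M"
  using assms bounded_linear_compose[OF scaleC_bounded_linear, of T c] M'_bounded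
  by (auto simp: M_iff scaleC_scaleC_left[of c])

lemma M_id: "id \<in> M"
  using bounded_linear_ident by (auto simp: M_iff id_def)

lemma M_zero: "(\<lambda>x. 0) \<in> M"
  using M_smult[OF M_id, of 0] by simp

lemma M_adjoint: assumes "T \<in> M" shows "is_adjoint T (op_adjoint T)" "op_adjoint T \<in> M"
proof -
  obtain S where "S \<in> M" "is_adjoint T S" using assms vn unfolding von_neumann_algebra_def by blast
  with op_adjoint_eq[OF this(2)] show "is_adjoint T (op_adjoint T)" "op_adjoint T \<in> M" by auto
qed

lemma adj: "T \<in> M \<Longrightarrow> cinner (T x) y = cinner x (op_adjoint T y)"
  using M_adjoint(1)[of T] by (simp add: is_adjoint_def)

lemma star_algebra_op: "star_algebra (op_alg M)"
proof
  fix S T :: "'h \<Rightarrow> 'h" assume "S \<in> carrier (op_alg M)"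
  then have S: "S \<in> M" by (simp add: op_alg_sel)
  show "star (op_alg M) (star (op_alg M) S) = S"
    unfolding op_alg_sel by (rule op_adjoint_eq[OF is_adjoint_sym[OF M_adjoint(1)[OF S]]])
  show "star (op_alg M) (c \<odot>\<^bsub>op_alg M\<^esub> S) = cnj c \<odot>\<^bsub>op_alg M\<^esub> star (op_alg M) S" for c
    unfolding op_alg_sel
    by (rule op_adjoint_eq) (simp add: is_adjoint_def cinner_scaleC_left cinner_scaleC_right adj[OF S])
  assume "T \<in> carrier (op_alg M)"
  then have T: "T \<in> M" by (simp add: op_alg_sel)
  show "star (op_alg M) (S \<oplus>\<^bsub>op_alg M\<^esub> T) = star (op_alg M) S \<oplus>\<^bsub>op_alg M\<^esub> star (op_alg M) T"
    unfolding op_alg_sel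
    by (rule op_adjoint_eq) (simp add: is_adjoint_def cinner_add_left cinner_add_right adj[OF S] adj[OF T])
  show "star (op_alg M) (S \<otimes>\<^bsub>op_alg M\<^esub> T) = star (op_alg M) T \<otimes>\<^bsub>op_alg M\<^esub> star (op_alg M) S"
    unfolding op_alg_sel
    by (rule op_adjoint_eq) (simp add: is_adjoint_def adj[OF S] adj[OF T])
qed (auto simp: op_alg_sel M_add M_mult M_smult M_id M_zero M_adjoint scaleC_add_left scaleC_add_right scaleC_scaleC
       fun_eq_iff linear_add[OF bounded_linear.linear[OF M_bounded]] M_scaleC algebra_simps)

text \<open>The vector functionals; they compute the operator norm, and \<open>\<langle>x, b\<^sup>* a b x\<rangle> = \<langle>b x, a b x\<rangle>\<close> makes
  the family stable.\<close>

definition Omega :: "(('h \<Rightarrow> 'h) \<Rightarrow> complex) set" where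
  "Omega = range (\<lambda>x T. cinner x (T x))"

lemma vec_star_mult: "T \<in> M \<Longrightarrow> cinner x ((op_adjoint T \<circ> T) x) = of_real ((norm (T x))\<^sup>2)"
  by (simp add: adj[symmetric] cinner_self)

lemma positive_family_op: "positive_family (op_alg M) Omega (nrm (op_alg M))"
proof (intro positive_family.intro positive_family_axioms.intro star_algebra_op)
  interpret star_algebra "op_alg M" by (rule star_algebra_op)
  fix \<omega> assume "\<omega> \<in> Omega"
  then obtain x where w: "\<omega> = (\<lambda>T. cinner x (T x))" by (auto simp: Omega_def)
  show "positive_functional (op_alg M) \<omega>"
  proof
    fix T assume "T \<in> carrier (op_alg M)"
    then show "\<omega> (star (op_alg M) T \<otimes>\<^bsub>op_alg M\<^esub> T) \<in> \<real>\<^sub>\<ge>\<^sub>0"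
      unfolding w op_alg_sel by (simp add: vec_star_mult complex_nonneg_Reals_iff del: o_apply of_real_power)
  qed (auto simp: w op_alg_sel cinner_add_right cinner_scaleC_right)
  fix S assume "S \<in> carrier (op_alg M)"
  then have S: "S \<in> M" by (simp add: op_alg_sel)
  have "(\<lambda>T. cinner (S x) (T (S x))) \<in> Omega" unfolding Omega_def by (rule range_eqI[of _ _ "S x"]) simp
  then show "\<exists>\<omega>'\<in>Omega. \<forall>T\<in>carrier (op_alg M). \<omega>' T = \<omega> (star (op_alg M) S \<otimes>\<^bsub>op_alg M\<^esub> (T \<otimes>\<^bsub>op_alg M\<^esub> S))"
    unfolding w op_alg_sel by (rule bexI[rotated]) (auto simp: adj[OF S])
next
  fix T assume "T \<in> carrier (op_alg M)"
  then have T: "T \<in> M" by (simp add: op_alg_sel)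
  show "0 \<le> nrm (op_alg M) T" unfolding op_alg_sel by (rule onorm_pos_le[OF M_bounded[OF T]])
  show "Re (\<omega> (star (op_alg M) T \<otimes>\<^bsub>op_alg M\<^esub> T)) \<le> (nrm (op_alg M) T)\<^sup>2 * Re (\<omega> \<one>\<^bsub>op_alg M\<^esub>)" if w0: "\<omega> \<in> Omega" for \<omega>
  proof -
    obtain x where w: "\<omega> = (\<lambda>T. cinner x (T x))" using w0 unfolding Omega_def by (rule rangeE)
    have "(norm (T x))\<^sup>2 \<le> (onorm T * norm x)\<^sup>2" by (intro power_mono onorm[OF M_bounded[OF T]]) auto
    then show ?thesis unfolding w op_alg_sel
      by (simp add: vec_star_mult[OF T] cinner_self power_mult_distrib del: o_apply of_real_power)
  qed
  fix c :: real assume c: "0 \<le> c"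
    and le: "\<And>\<omega>. \<omega> \<in> Omega \<Longrightarrow> Re (\<omega> (star (op_alg M) T \<otimes>\<^bsub>op_alg M\<^esub> T)) \<le> c\<^sup>2 * Re (\<omega> \<one>\<^bsub>op_alg M\<^esub>)"
  show "nrm (op_alg M) T \<le> c" unfolding op_alg_sel
  proof (rule onorm_bound[OF c])
    fix x
    have "(norm (T x))\<^sup>2 \<le> c\<^sup>2 * (norm x)\<^sup>2"
      using le[of "\<lambda>T. cinner x (T x)"] unfolding op_alg_sel
      by (simp add: Omega_def vec_star_mult[OF T] cinner_self del: o_apply of_real_power)
    then have "(norm (T x))\<^sup>2 \<le> (c * norm x)\<^sup>2" by (simp add: power_mult_distrib)
    then show "norm (T x) \<le> c * norm x" using c by (intro power2_le_imp_le[of "norm (T x)"]) auto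
  qed
qed

text \<open>A pointwise limit of elements of \<open>M\<close> commutes with the commutant of \<open>M\<close>, hence lies in the bicommutant.\<close>

lemma complete_cstar_algebra_op: "complete_cstar_algebra (op_alg M)"
proof -
  interpret P: positive_family "op_alg M" Omega "nrm (op_alg M)" by (rule positive_family_op)
  have d: "dst (op_alg M) (nrm (op_alg M)) S T = onorm (\<lambda>x. S x - T x)" for S T
    by (simp add: dst_def op_alg_sel)
  show ?thesis
  proof
    fix T assume "T \<in> carrier (op_alg M)" "nrm (op_alg M) T = 0"
    then show "T = \<zero>\<^bsub>op_alg M\<^esub>" using onorm_eq_0[OF M_bounded, of T] by (auto simp: op_alg_sel fun_eq_iff)
  next
    fix s :: "nat \<Rightarrow> 'h \<Rightarrow> 'h" assume s': "\<And>k. s k \<in> carrier (op_alg M)"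
      and cauchy: "\<And>e. e > 0 \<Longrightarrow> \<exists>K. \<forall>k\<ge>K. \<forall>l\<ge>K. dst (op_alg M) (nrm (op_alg M)) (s k) (s l) < e"
    have s: "s k \<in> M" for k using s' by (simp add: op_alg_sel)
    define B where "B k = Blinfun (s k)" for k
    have B: "blinfun_apply (B k) = s k" for k unfolding B_def by (rule bounded_linear_Blinfun_apply[OF M_bounded[OF s]])
    have dB: "dist (B k) L = onorm (\<lambda>x. s k x - blinfun_apply L x)" for k L
      by (simp add: dist_norm norm_blinfun.rep_eq minus_blinfun.rep_eq B)
    have "Cauchy B"
      unfolding Cauchy_def
    proof (intro allI impI)
      fix e :: real assume "e > 0"
      from cauchy[OF this] obtain K where K: "\<forall>k\<ge>K. \<forall>l\<ge>K. onorm (\<lambda>x. s k x - s l x) < e" unfolding d by (rule exE)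
      show "\<exists>K. \<forall>k\<ge>K. \<forall>l\<ge>K. dist (B k) (B l) < e"
        unfolding dB B by (rule exI[of _ K]) (rule K)
    qed
    then obtain L where L: "B \<longlonglongrightarrow> L" using Cauchy_convergent convergent_def by blast
    have pt: "(\<lambda>k. s k x) \<longlonglongrightarrow> blinfun_apply L x" for x
      using bounded_bilinear.tendsto[OF bounded_bilinear_blinfun_apply L tendsto_const, of x] by (simp add: B)
    have "blinfun_apply L \<in> M"
      unfolding M_iff
    proof (intro conjI allI ballI)
      show "bounded_linear (blinfun_apply L)" by (rule blinfun.bounded_linear_right)
      show "blinfun_apply L (scaleC c x) = scaleC c (blinfun_apply L x)" for c x
      proof (rule LIMSEQ_unique[OF pt])
        show "(\<lambda>k. s k (scaleC c x)) \<longlonglongrightarrow> scaleC c (blinfun_apply L x)"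
          unfolding M_scaleC[OF s] by (rule bounded_linear.tendsto[OF scaleC_bounded_linear pt])
      qed
      fix S x assume S: "S \<in> M'"
      show "blinfun_apply L (S x) = S (blinfun_apply L x)"
      proof (rule LIMSEQ_unique[OF pt])
        have "s k (S x) = S (s k x)" for k using s[of k] S by (simp add: M_iff)
        then show "(\<lambda>k. s k (S x)) \<longlonglongrightarrow> S (blinfun_apply L x)"
          using bounded_linear.tendsto[OF conjunct1[OF M'_bounded[OF S]] pt] by simp
      qed
    qed
    moreover have "(\<lambda>k. dst (op_alg M) (nrm (op_alg M)) (s k) (blinfun_apply L)) \<longlonglongrightarrow> 0"
      unfolding d dB[symmetric] by (rule tendsto_dist_iff[THEN iffD1, OF L])
    ultimately show "\<exists>x\<in>carrier (op_alg M). (\<lambda>k. dst (op_alg M) (nrm (op_alg M)) (s k) x) \<longlonglongrightarrow> 0"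
      by (auto simp: op_alg_sel)
  qed
qed

end

section \<open>The evaluations used in the definitions\<close>

lemma Msa_iff: "A \<in> Msa N R \<longleftrightarrow> A \<in> carrier (mat_alg N) \<and> star (mat_alg N) A = A \<and> nrm (mat_alg N) A \<le> R"
  by (simp add: Msa_def mat_alg_sel)

lemma eval_mat:
  assumes "0 \<le> R" and "\<And>i j. i < n \<Longrightarrow> j < r i \<Longrightarrow> A i j \<in> Msa N R"
  shows "star_hom (C_all R n r) (mat_alg N) (eval_at R n r (mat_alg N) A)"
    and "i < n \<Longrightarrow> j < r i \<Longrightarrow> eval_at R n r (mat_alg N) A (x_all R n r i j) = A i j"
proof -
  have A: "\<And>i j. i < n \<Longrightarrow> j < r i \<Longrightarrow>
      A i j \<in> carrier (mat_alg N) \<and> star (mat_alg N) (A i j) = A i j \<and> nrm (mat_alg N) (A i j) \<le> R"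
    using assms(2) by (simp add: Msa_iff)
  note E = eval_at_star_hom[where D = "mat_alg N" and n = n and r = r and a = A, OF assms(1) complete_cstar_algebra_mat positive_family_mat A]
  show "star_hom (C_all R n r) (mat_alg N) (eval_at R n r (mat_alg N) A)" by (rule E(1))
  show "eval_at R n r (mat_alg N) A (x_all R n r i j) = A i j" if "i < n" "j < r i"
    by (rule E(2)) (use that in auto)
qed

lemma tensor_pair_C_all: assumes R: "0 \<le> R"
  obtains \<phi> where "tensor_pair (C_all R n r) (C_all R n r) \<phi> \<phi>"
proof -
  interpret C: cstar_algebra "C_all R n r" by (rule cstar_algebra_C_all[OF R])
  interpret D: complete_cstar_algebra "mat_alg 1" by (rule complete_cstar_algebra_mat)
  have "0\<^sub>m 1 1 \<in> Msa 1 R"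
    unfolding Msa_iff using D.star_zero D.N_zero D.zero_in R by (simp add: mat_alg_sel)
  then have "star_hom (C_all R n r) (mat_alg 1) (eval_at R n r (mat_alg 1) (\<lambda>_ _. 0\<^sub>m 1 1))"
    using eval_mat(1)[OF R, of n r "\<lambda>_ _. 0\<^sub>m 1 1" 1] by simp
  from is_state_comp[OF this trN_is_state C.star_algebra_axioms]
  have "tensor_pair (C_all R n r) (C_all R n r) (\<lambda>f. trN 1 (eval_at R n r (mat_alg 1) (\<lambda>_ _. 0\<^sub>m 1 1) f))
      (\<lambda>f. trN 1 (eval_at R n r (mat_alg 1) (\<lambda>_ _. 0\<^sub>m 1 1) f))"
    by (intro tensor_pair.intro tensor_pair_axioms.intro C.cstar_algebra_axioms) auto
  then show ?thesis by (rule that)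
qed

text \<open>The trace of \<open>M\<^sub>N \<otimes> M\<^sub>N\<close> is the product of the states \<open>tr f(A)\<close>, so \<open>tensor_universal\<close> applies.\<close>

lemma eval2_mat:
  assumes R: "0 \<le> R" and N: "N > 0" and A: "\<And>i j. i < n \<Longrightarrow> j < r i \<Longrightarrow> A i j \<in> Msa N R"
  shows "star_hom (C_all2 R n r) (mat_alg (N * N)) (eval2_at R n r N A)"
    and "f \<in> carrier (C_all R n r) \<Longrightarrow> g \<in> carrier (C_all R n r) \<Longrightarrow>
      eval2_at R n r N A (tensor_elem (C_all R n r) (C_all R n r) f g) =
      kron N (eval_at R n r (mat_alg N) A f) (eval_at R n r (mat_alg N) A g)"
proof -
  let ?C = "C_all R n r"
  let ?ev = "eval_at R n r (mat_alg N) A"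
  obtain \<phi> where "tensor_pair ?C ?C \<phi> \<phi>" using tensor_pair_C_all[OF R] by blast
  then interpret T: tensor_pair ?C ?C \<phi> \<phi> .
  have h: "star_hom ?C (mat_alg N) ?ev" by (rule eval_mat(1)[OF R A])
  note hom = star_homD[OF h, unfolded mat_alg_sel]
  have st: "is_state ?C (\<lambda>f. trN N (?ev f))"
    by (rule is_state_comp[OF h trN_is_state[OF N] T.A.star_algebra_axioms])
  obtain \<Phi> where "star_hom T.C (mat_alg (N * N)) \<Phi>"
    "\<And>a b. a \<in> carrier ?C \<Longrightarrow> b \<in> carrier ?C \<Longrightarrow> \<Phi> (tensor_elem ?C ?C a b) = (\<lambda>(f, g). kron N (?ev f) (?ev g)) (a, b)"
  proof (rule T.tensor_universal[where D = "mat_alg (N * N)" and g = "\<lambda>(f, g). kron N (?ev f) (?ev g)"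
        and tr = "trN (N * N)" and K = "real (N * N)", OF complete_cstar_algebra_mat _ _ _ _ st st])
    fix x assume "x \<in> carrier (mat_alg (N * N))"
    then show "(nrm (mat_alg (N * N)) x)\<^sup>2 \<le> real (N * N) *
        Re (trN (N * N) (star (mat_alg (N * N)) x \<otimes>\<^bsub>mat_alg (N * N)\<^esub> x))"
      unfolding mat_alg_sel by (rule faithful_trace)
  qed (auto simp: mat_alg_sel hom kron_mult kron_adjoint kron_one trN_add trN_smult trN_kron)
  then have "\<exists>\<Phi>. star_hom (C_all2 R n r) (mat_alg (N * N)) \<Phi> \<and>
     (\<forall>f\<in>carrier ?C. \<forall>g\<in>carrier ?C. \<Phi> (tensor_elem ?C ?C f g) = kron N (?ev f) (?ev g))"
    unfolding C_all2_def by auto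
  from someI_ex[OF this] show "star_hom (C_all2 R n r) (mat_alg (N * N)) (eval2_at R n r N A)"
    "f \<in> carrier ?C \<Longrightarrow> g \<in> carrier ?C \<Longrightarrow>
      eval2_at R n r N A (tensor_elem ?C ?C f g) = kron N (?ev f) (?ev g)"
    unfolding eval2_at_def by auto
qed

lemma nc_polys2_dense: assumes R: "0 \<le> R"
  shows "nclosure (C_all2 R n r) (nc_polys2 R n r) = carrier (C_all2 R n r)" and "nc_polys2 R n r \<subseteq> carrier (C_all2 R n r)"
    and "cstar_algebra (C_all2 R n r)"
proof -
  let ?C = "C_all R n r"
  obtain \<phi> where "tensor_pair ?C ?C \<phi> \<phi>" using tensor_pair_C_all[OF R] by blast
  then interpret T: tensor_pair ?C ?C \<phi> \<phi> .
  show C: "cstar_algebra (C_all2 R n r)" unfolding C_all2_def by (rule T.cstar_algebra_tensor)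
  note P = nc_polys_in[OF R, of n r] nc_polys_dense[OF R, of n r]
  show "nclosure (C_all2 R n r) (nc_polys2 R n r) = carrier (C_all2 R n r)"
    unfolding nc_polys2_def C_all2_def by (rule T.tensor_dense[OF P P])
  show "nc_polys2 R n r \<subseteq> carrier (C_all2 R n r)"
    unfolding nc_polys2_def
  proof
    fix x assume "x \<in> lin_span (C_all2 R n r) {tensor_elem ?C ?C f g | f g. f \<in> nc_polys R n r \<and> g \<in> nc_polys R n r}"
    moreover have "{tensor_elem ?C ?C f g | f g. f \<in> nc_polys R n r \<and> g \<in> nc_polys R n r} \<subseteq> carrier (C_all2 R n r)"
      using P(1) unfolding C_all2_def by (auto intro!: T.tensor_elem_in)
    ultimately show "x \<in> carrier (C_all2 R n r)" using cstar_algebra.lin_span_in[OF C] by blast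
  qed
qed

section \<open>Traces, words and unitary conjugation\<close>

context star_algebra
begin

lemma word_prod_conj:
  assumes u: "u \<in> carrier A" "star A u \<otimes> u = \<one>" "u \<otimes> star A u = \<one>"
    and a: "\<And>k. k \<in> set w \<Longrightarrow> a k \<in> carrier A"
  shows "word_prod A (\<lambda>k. u \<otimes> a k \<otimes> star A u) w = u \<otimes> word_prod A a w \<otimes> star A u"
  using a
proof (induction w)
  case (Cons k w)
  have W: "word_prod A a w \<in> carrier A" "a k \<in> carrier A" using Cons.prems by auto
  have c: "star A u \<otimes> (u \<otimes> x) = x" if "x \<in> carrier A" for x
    using u that mult_assoc[of "star A u" u x] by simp
  show ?case using Cons u W by (simp add: mult_assoc c)
qed (simp add: u)

lemma word_prod_cong: "(\<And>k. k \<in> set w \<Longrightarrow> a k = b k) \<Longrightarrow> word_prod A a w = word_prod A b w"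
  by (induction w) auto

end

context seminormed_star_algebra
begin

lemma N_one_le: "N \<one> \<le> 1"
proof -
  have "N \<one> = (N \<one>)\<^sup>2" using N_star_mult[of \<one>] by simp
  then show ?thesis by (auto simp: power2_eq_square)
qed

lemma N_isometry: assumes "u \<in> carrier A" "star A u \<otimes> u = \<one>" shows "N u \<le> 1"
proof -
  have "(N u)\<^sup>2 \<le> 1\<^sup>2" using N_star_mult[OF assms(1)] assms N_one_le by simp
  then show ?thesis by (rule power2_le_imp_le) simp
qed

lemma N_conj_le: assumes u: "u \<in> carrier A" "star A u \<otimes> u = \<one>" and x: "x \<in> carrier A"
  shows "N (u \<otimes> x \<otimes> star A u) \<le> N x"
proof -
  have "N (u \<otimes> x \<otimes> star A u) \<le> N u * N x * N u"
    using N_mult[of "u \<otimes> x" "star A u"] N_mult[of u x] u x mult_right_mono[of "N (u \<otimes> x)" "N u * N x" "N u"] by simp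
  also have "\<dots> \<le> 1 * N x * 1" using N_isometry[OF u] u x by (intro mult_mono) auto
  finally show ?thesis by simp
qed

lemma N_word_prod: assumes "\<And>k. k \<in> set w \<Longrightarrow> a k \<in> carrier A \<and> N (a k) \<le> K" "0 \<le> K"
  shows "N (word_prod A a w) \<le> K ^ length w"
  using assms(1)
proof (induction w)
  case (Cons k w)
  have W: "word_prod A a w \<in> carrier A" "a k \<in> carrier A" using Cons.prems by auto
  have "N (a k \<otimes> word_prod A a w) \<le> N (a k) * N (word_prod A a w)" using W by (intro N_mult)
  also have "\<dots> \<le> K * K ^ length w" using Cons W assms(2) by (intro mult_mono) auto
  finally show ?case by simp
qed (use N_one_le in simp)

end

locale tracial_state = cstar_algebra A for A :: "'a cstar_alg" (structure) +
  fixes \<tau> :: "'a \<Rightarrow> complex"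
  assumes state: "is_state A \<tau>"
    and trace: "x \<in> carrier A \<Longrightarrow> y \<in> carrier A \<Longrightarrow> \<tau> (x \<otimes> y) = \<tau> (y \<otimes> x)"
begin

sublocale PF: positive_functional A \<tau>
  by (rule is_state_positive[OF star_algebra_axioms state])

text \<open>The 2-norm of the trace, i.e. the normalized Hilbert--Schmidt norm for matrices.\<close>

definition "p x = sqrt (PF.q x)"

lemma p_ge0 [simp]: "x \<in> carrier A \<Longrightarrow> 0 \<le> p x" by (simp add: p_def)

lemma p_mult_left: assumes "x \<in> carrier A" "y \<in> carrier A" shows "p (x \<otimes> y) \<le> nrm A x * p y"
proof -
  have "PF.q (x \<otimes> y) = Re (\<tau> (star A y \<otimes> ((star A x \<otimes> x) \<otimes> y)))"
    using assms by (simp add: PF.q_def mult_assoc)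
  also have "\<dots> \<le> nrm A (star A x \<otimes> x) * PF.q y"
    using assms state by (intro PF.bounded_action) (auto simp: is_state_def N_mult)
  also have "\<dots> = (nrm A x)\<^sup>2 * PF.q y" using assms by (simp add: N_star_mult)
  finally have "p (x \<otimes> y) \<le> sqrt ((nrm A x)\<^sup>2 * PF.q y)" unfolding p_def by (rule real_sqrt_le_mono)
  then show ?thesis using assms by (simp add: p_def real_sqrt_mult)
qed

lemma q_star: "x \<in> carrier A \<Longrightarrow> PF.q (star A x) = PF.q x"
  using trace[of x "star A x"] by (simp add: PF.q_def)

lemma p_mult_right: assumes "x \<in> carrier A" "y \<in> carrier A" shows "p (x \<otimes> y) \<le> p x * nrm A y"
  using p_mult_left[of "star A y" "star A x"] q_star[of "x \<otimes> y"] q_star[of x] assms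
  by (simp add: p_def mult.commute)

lemma p_triangle: assumes "x \<in> carrier A" "y \<in> carrier A" shows "p (x \<oplus> y) \<le> p x + p y"
proof -
  have "complex_of_real (PF.q (x \<oplus> y)) = of_real (PF.q x) + \<tau> (star A x \<otimes> y) + cnj (\<tau> (star A x \<otimes> y)) + of_real (PF.q y)"
    using PF.expand[OF assms, of 1] PF.hermitian[OF assms] assms by simp
  then have "Re (complex_of_real (PF.q (x \<oplus> y))) = PF.q x + 2 * Re (\<tau> (star A x \<otimes> y)) + PF.q y" by simp
  moreover have "Re (\<tau> (star A x \<otimes> y)) \<le> p x * p y"
  proof -
    have "(cmod (\<tau> (star A x \<otimes> y)))\<^sup>2 \<le> (p x * p y)\<^sup>2"
      using PF.cauchy_schwarz[OF assms] assms by (simp add: p_def power_mult_distrib)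
    then have "cmod (\<tau> (star A x \<otimes> y)) \<le> p x * p y" by (rule power2_le_imp_le) (use assms in auto)
    then show ?thesis by (rule order_trans[OF complex_Re_le_cmod])
  qed
  ultimately have "PF.q (x \<oplus> y) \<le> (p x + p y)\<^sup>2"
    using assms by (simp add: p_def power2_sum)
  then show ?thesis unfolding p_def[of "x \<oplus> y"] using assms by (intro real_le_lsqrt) auto
qed

lemma trace_le_p: assumes "x \<in> carrier A" shows "cmod (\<tau> x) \<le> p x"
proof -
  have "(cmod (\<tau> x))\<^sup>2 \<le> (p x)\<^sup>2"
    using PF.fun_bound[OF assms] state assms by (simp add: PF.q_one is_state_def p_def)
  then show ?thesis by (rule power2_le_imp_le) (use assms in auto)
qed

text \<open>Replace one letter at a time; the 2-norm of a product is at most the 2-norm of one factor times the operator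
  norm of the other, on either side because the functional is a trace.\<close>

lemma word_prod_p_close:
  assumes ab: "\<And>k. k \<in> set w \<Longrightarrow> a k \<in> carrier A \<and> b k \<in> carrier A \<and> nrm A (a k) \<le> K \<and> nrm A (b k) \<le> K \<and>
      p (a k \<oplus> (-1) \<odot> b k) \<le> \<eta>" and K: "1 \<le> K" and \<eta>: "0 \<le> \<eta>"
  shows "p (word_prod A a w \<oplus> (-1) \<odot> word_prod A b w) \<le> real (length w) * K ^ length w * \<eta>"
  using ab
proof (induction w)
  case Nil
  show ?case by (simp add: p_def PF.q_def) (simp add: PF.fun_smult[of \<zero> 0, simplified])
next
  case (Cons k w)
  let ?W = "word_prod A a w" and ?V = "word_prod A b w"
  have c: "a k \<in> carrier A" "b k \<in> carrier A" "?W \<in> carrier A" "?V \<in> carrier A"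
    using Cons.prems by auto
  have "a k \<otimes> ?W \<oplus> (-1) \<odot> (b k \<otimes> ?V) = a k \<otimes> (?W \<oplus> (-1) \<odot> ?V) \<oplus> (a k \<oplus> (-1) \<odot> b k) \<otimes> ?V"
    using c by (simp add: distrib_left distrib_right add_assoc)
  then have "p (a k \<otimes> ?W \<oplus> (-1) \<odot> (b k \<otimes> ?V)) \<le> p (a k \<otimes> (?W \<oplus> (-1) \<odot> ?V)) + p ((a k \<oplus> (-1) \<odot> b k) \<otimes> ?V)"
    using c by (simp only: p_triangle add_in mult_in smult_in)
  also have "\<dots> \<le> nrm A (a k) * p (?W \<oplus> (-1) \<odot> ?V) + p (a k \<oplus> (-1) \<odot> b k) * nrm A ?V"
    using c by (intro add_mono p_mult_left p_mult_right) auto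
  also have "\<dots> \<le> K * (real (length w) * K ^ length w * \<eta>) + \<eta> * K ^ length w"
    using c Cons K \<eta> N_word_prod[of w b K] by (intro add_mono mult_mono) auto
  also have "\<dots> \<le> K * (real (length w) * K ^ length w * \<eta>) + K * (K ^ length w * \<eta>)"
    using mult_right_mono[of 1 K "K ^ length w * \<eta>"] K \<eta> by (simp add: mult.commute)
  also have "\<dots> = real (length (k # w)) * K ^ length (k # w) * \<eta>" by (simp add: algebra_simps)
  finally show ?case by simp
qed

lemma p_conj: assumes u: "u \<in> carrier A" "star A u \<otimes> u = \<one>" and x: "x \<in> carrier A"
  shows "p (u \<otimes> x \<otimes> star A u) \<le> p x"
proof -
  have "p (u \<otimes> x \<otimes> star A u) \<le> p (u \<otimes> x) * nrm A (star A u)" using u x by (intro p_mult_right) auto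
  also have "\<dots> \<le> p (u \<otimes> x) * 1" using N_isometry[OF u] u x by (intro mult_left_mono) auto
  also have "\<dots> \<le> nrm A u * p x" using p_mult_left[OF u(1) x] by simp
  also have "\<dots> \<le> 1 * p x" using N_isometry[OF u] u x by (intro mult_right_mono) auto
  finally show ?thesis by simp
qed

lemma trace_conj: assumes u: "u \<in> carrier A" "star A u \<otimes> u = \<one>" and x: "x \<in> carrier A"
  shows "\<tau> (u \<otimes> x \<otimes> star A u) = \<tau> x"
proof -
  have "\<tau> (u \<otimes> x \<otimes> star A u) = \<tau> (star A u \<otimes> (u \<otimes> x))" using u x by (intro trace) auto
  also have "star A u \<otimes> (u \<otimes> x) = x" using u x mult_assoc[of "star A u" u x] by simp
  finally show ?thesis .
qed

end

lemma tracial_state_mat: "N > 0 \<Longrightarrow> tracial_state (mat_alg N) (trN N)"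
proof (intro tracial_state.intro tracial_state_axioms.intro)
  show "cstar_algebra (mat_alg N)" using complete_cstar_algebra_mat by (rule complete_cstar_algebra.axioms(1))
qed (auto simp: trN_is_state mat_alg_sel trN_comm)

lemma unitary_group_iff:
  "U \<in> unitary_group N \<longleftrightarrow> U \<in> carrier (mat_alg N) \<and> star (mat_alg N) U \<otimes>\<^bsub>mat_alg N\<^esub> U = \<one>\<^bsub>mat_alg N\<^esub> \<and>
     U \<otimes>\<^bsub>mat_alg N\<^esub> star (mat_alg N) U = \<one>\<^bsub>mat_alg N\<^esub>"
  by (auto simp: unitary_group_def mat_alg_sel)

lemma conj_tuple_eq: "conj_tuple V A i j = V i \<otimes>\<^bsub>mat_alg N\<^esub> A i j \<otimes>\<^bsub>mat_alg N\<^esub> star (mat_alg N) (V i)"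
  by (simp add: conj_tuple_def mat_alg_sel)

lemma conj_tuple_Msa:
  assumes "A i j \<in> Msa N R" "V i \<in> unitary_group N" shows "conj_tuple V A i j \<in> Msa N R"
proof -
  interpret complete_cstar_algebra "mat_alg N" by (rule complete_cstar_algebra_mat)
  show ?thesis using assms N_conj_le[of "V i" "A i j"]
    unfolding Msa_iff unitary_group_iff conj_tuple_eq[of V A i j N] by (auto simp: mult_assoc)
qed

lemma Msa_mono: "A \<in> Msa N R \<Longrightarrow> R \<le> R' \<Longrightarrow> A \<in> Msa N R'"
  by (auto simp: Msa_def)

section \<open>Cutting off the spectrum\<close>

text \<open>Cutting a matrix \<open>A\<close> of norm at most \<open>S\<^sub>1\<close> off at \<open>S\<^sub>2\<close> by functional calculus changes it in the
  normalized Hilbert--Schmidt norm by an amount that is controlled by a single high moment, because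
  \<open>(t - cut t)\<^sup>2 \<le> \<eta>\<^sup>2 + S\<^sub>1\<^sup>2 (t / (S\<^sub>2 + \<eta>)) ^ (2 k)\<close> on \<open>[-S\<^sub>1, S\<^sub>1]\<close>.\<close>

lemma cut_off:
  assumes N: "N > 0" and A: "A \<in> Msa N S1" and S: "0 \<le> S2" "S2 \<le> S1" and \<eta>: "\<eta> > 0"
  obtains A' where "A' \<in> Msa N S2"
    "(tracial_state.p (mat_alg N) (trN N) (A \<oplus>\<^bsub>mat_alg N\<^esub> (-1) \<odot>\<^bsub>mat_alg N\<^esub> A'))\<^sup>2
      \<le> \<eta>\<^sup>2 + S1\<^sup>2 / (S2 + \<eta>) ^ (2 * k) * cmod (trN N (word_prod (mat_alg N) (\<lambda>_. A) (replicate (2 * k) z)))"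
proof -
  interpret tracial_state "mat_alg N" "trN N" by (rule tracial_state_mat[OF N])
  have S1: "0 \<le> S1" using S by simp
  interpret C: cstar_algebra "C_interval S1" by (rule cstar_algebra_C_interval[OF S1])
  let ?C = "C_interval S1" and ?M = "mat_alg N" and ?x = "restrict complex_of_real {-S1..S1}"
  have A': "A \<in> carrier ?M" "star ?M A = A" "nrm ?M A \<le> S1" using A by (auto simp: Msa_iff)
  obtain \<phi> where h: "star_hom ?C ?M \<phi>" and \<phi>x: "\<phi> ?x = A"
    using functional_calculus[OF S1 complete_cstar_algebra_mat positive_family_mat A'] by blast
  note hom = star_homD[OF h]
  have x: "?x \<in> carrier ?C" by (rule cid_in[OF S1])
  define cut where "cut t = max (- S2) (min S2 t)" for t :: real
  have contcut: "continuous_on T cut" for T unfolding cut_def by (intro continuous_intros)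
  define f where "f = restrict (\<lambda>t. complex_of_real (cut t)) {-S1..S1}"
  have f: "f \<in> carrier ?C" unfolding f_def by (intro restrict_in_C_interval continuous_on_of_real contcut)
  define c where "c = S1\<^sup>2 / (S2 + \<eta>) ^ (2 * k)"
  have c: "0 \<le> c" using S \<eta> by (simp add: c_def)
  have bound: "(t - cut t)\<^sup>2 \<le> \<eta>\<^sup>2 + c * t ^ (2 * k)" if t: "t \<in> {-S1..S1}" for t
  proof (cases "\<bar>t\<bar> \<le> S2 + \<eta>")
    case True
    then have "\<bar>t - cut t\<bar> \<le> \<bar>\<eta>\<bar>" using S \<eta> by (auto simp: cut_def max_def min_def abs_if split: if_splits)
    then have "(t - cut t)\<^sup>2 \<le> \<eta>\<^sup>2" by (rule power2_mono)
    moreover have "0 \<le> c * t ^ (2 * k)" using c by (simp add: zero_le_even_power)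
    ultimately show ?thesis by simp
  next
    case False
    have pos: "S2 + \<eta> > 0" using S \<eta> by simp
    have "\<bar>t - cut t\<bar> \<le> \<bar>S1\<bar>" using False t S by (auto simp: cut_def max_def min_def abs_if split: if_splits)
    then have 1: "(t - cut t)\<^sup>2 \<le> S1\<^sup>2" by (rule power2_mono)
    have "(S2 + \<eta>) ^ (2 * k) \<le> \<bar>t\<bar> ^ (2 * k)" using False pos by (intro power_mono) auto
    also have "\<bar>t\<bar> ^ (2 * k) = t ^ (2 * k)" by (simp add: power_even_abs)
    finally have "S1\<^sup>2 * (S2 + \<eta>) ^ (2 * k) \<le> S1\<^sup>2 * t ^ (2 * k)" by (intro mult_left_mono) auto
    then have "S1\<^sup>2 \<le> c * t ^ (2 * k)" using pos by (simp add: c_def field_simps)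
    with 1 show ?thesis using zero_le_power2[of \<eta>] by linarith
  qed
  define s where "s = restrict (\<lambda>t. complex_of_real (sqrt (\<eta>\<^sup>2 + c * t ^ (2 * k) - (t - cut t)\<^sup>2))) {-S1..S1}"
  have s: "s \<in> carrier ?C" unfolding s_def
    by (intro restrict_in_C_interval continuous_intros contcut)
  let ?X = "word_prod ?C (\<lambda>_. ?x) (replicate (2 * k) z)"
  have X: "?X \<in> carrier ?C" using x by simp
  have Xt: "?X = restrict (\<lambda>t. complex_of_real t ^ (2 * k)) {-S1..S1}"
  proof -
    have "word_prod ?C (\<lambda>_. ?x) (replicate m z) = restrict (\<lambda>t. complex_of_real t ^ m) {-S1..S1}" for m
      by (induction m) (auto simp: C_interval_sel fun_eq_iff)
    then show ?thesis .
  qed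
  let ?d = "?x \<oplus>\<^bsub>?C\<^esub> (-1) \<odot>\<^bsub>?C\<^esub> f"
  have eq: "of_real (\<eta>\<^sup>2) \<odot>\<^bsub>?C\<^esub> \<one>\<^bsub>?C\<^esub> \<oplus>\<^bsub>?C\<^esub> of_real c \<odot>\<^bsub>?C\<^esub> ?X
      = star ?C ?d \<otimes>\<^bsub>?C\<^esub> ?d \<oplus>\<^bsub>?C\<^esub> star ?C s \<otimes>\<^bsub>?C\<^esub> s"
  proof
    fix t
    show "(of_real (\<eta>\<^sup>2) \<odot>\<^bsub>?C\<^esub> \<one>\<^bsub>?C\<^esub> \<oplus>\<^bsub>?C\<^esub> of_real c \<odot>\<^bsub>?C\<^esub> ?X) t
      = (star ?C ?d \<otimes>\<^bsub>?C\<^esub> ?d \<oplus>\<^bsub>?C\<^esub> star ?C s \<otimes>\<^bsub>?C\<^esub> s) t"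
    proof (cases "t \<in> {-S1..S1}")
      case True
      let ?v = "\<eta>\<^sup>2 + c * t ^ (2 * k) - (t - cut t)\<^sup>2"
      have "sqrt ?v * sqrt ?v = ?v" using bound[OF True] by simp
      then have "complex_of_real (sqrt ?v) * of_real (sqrt ?v) = of_real ?v" by (simp only: of_real_mult[symmetric])
      moreover have "complex_of_real ?v = of_real (\<eta>\<^sup>2) + of_real c * of_real t ^ (2 * k) - (of_real t - of_real (cut t)) * (of_real t - of_real (cut t))"
        by (simp add: power2_eq_square)
      ultimately show ?thesis using True unfolding Xt by (simp add: C_interval_sel f_def s_def)
    next
      case False
      then show ?thesis by (simp only: C_interval_sel(5) restrict_apply if_False)
    qed
  qed
  have d: "?d \<in> carrier ?C" using x f by simp
  have \<phi>d: "\<phi> ?d = A \<oplus>\<^bsub>?M\<^esub> (-1) \<odot>\<^bsub>?M\<^esub> \<phi> f" using x f by (simp add: hom \<phi>x)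
  have \<phi>X: "\<phi> ?X = word_prod ?M (\<lambda>_. A) (replicate (2 * k) z)"
    using star_hom_word_prod[OF h C.star_algebra_axioms, of "replicate (2 * k) z" "\<lambda>_. ?x"] x by (simp add: \<phi>x)
  have "of_real (\<eta>\<^sup>2) \<odot>\<^bsub>?M\<^esub> \<one>\<^bsub>?M\<^esub> \<oplus>\<^bsub>?M\<^esub> of_real c \<odot>\<^bsub>?M\<^esub> \<phi> ?X
      = star ?M (\<phi> ?d) \<otimes>\<^bsub>?M\<^esub> \<phi> ?d \<oplus>\<^bsub>?M\<^esub> star ?M (\<phi> s) \<otimes>\<^bsub>?M\<^esub> \<phi> s"
    using arg_cong[OF eq, of \<phi>] d s X by (simp add: hom del: C.star_add C.star_smult C.word_prod_in)
  then have "trN N (of_real (\<eta>\<^sup>2) \<odot>\<^bsub>?M\<^esub> \<one>\<^bsub>?M\<^esub> \<oplus>\<^bsub>?M\<^esub> of_real c \<odot>\<^bsub>?M\<^esub> \<phi> ?X) = of_real (PF.q (\<phi> ?d)) + of_real (PF.q (\<phi> s))"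
    using hom(1)[OF d] hom(1)[OF s] by (simp only: PF.fun_add PF.fun_star_self mult_in star_in)
  then have "of_real (\<eta>\<^sup>2) + of_real c * trN N (\<phi> ?X) = of_real (PF.q (\<phi> ?d)) + of_real (PF.q (\<phi> s))"
    using hom(1)[OF X] state by (simp add: PF.fun_add PF.fun_smult is_state_def)
  then have "Re (of_real (\<eta>\<^sup>2) + of_real c * trN N (\<phi> ?X)) = Re (of_real (PF.q (\<phi> ?d)) + of_real (PF.q (\<phi> s)))" by (rule arg_cong)
  then have "\<eta>\<^sup>2 + c * Re (trN N (\<phi> ?X)) = PF.q (\<phi> ?d) + PF.q (\<phi> s)" by (simp del: of_real_power)
  moreover have "c * Re (trN N (\<phi> ?X)) \<le> c * cmod (trN N (\<phi> ?X))" using c by (intro mult_left_mono complex_Re_le_cmod)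
  ultimately have "PF.q (\<phi> ?d) \<le> \<eta>\<^sup>2 + c * cmod (trN N (\<phi> ?X))" using PF.q_ge0[OF hom(1)[OF s]] by linarith
  moreover have "(p (\<phi> ?d))\<^sup>2 = PF.q (\<phi> ?d)" using hom(1)[OF d] by (simp add: p_def)
  ultimately have 2: "(p (A \<oplus>\<^bsub>?M\<^esub> (-1) \<odot>\<^bsub>?M\<^esub> \<phi> f))\<^sup>2 \<le> \<eta>\<^sup>2 + c * cmod (trN N (word_prod ?M (\<lambda>_. A) (replicate (2 * k) z)))"
    by (simp only: \<phi>d \<phi>X)
  have "\<phi> f \<in> Msa N S2" unfolding Msa_iff
  proof (intro conjI)
    show "\<phi> f \<in> carrier ?M" by (rule hom(1)[OF f])
    have "star ?C f = f" by (auto simp: f_def C_interval_sel)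
    then show "star ?M (\<phi> f) = \<phi> f" using hom(6)[OF f] by simp
    have "nrm ?C f \<le> S2"
      by (rule C_interval_nrm_least[OF S1]) (use S in \<open>auto simp: f_def cut_def abs_if\<close>)
    then show "nrm ?M (\<phi> f) \<le> S2" using hom(7)[OF f] by simp
  qed
  from that[OF this 2[unfolded c_def]] show ?thesis .
qed

section \<open>Microstates and their measurability\<close>

locale orbital = vn_algebra M for M :: "('h::chilbert_space \<Rightarrow> 'h) set" +
  fixes \<tau> :: "('h \<Rightarrow> 'h) \<Rightarrow> complex" and n :: nat and r :: "nat \<Rightarrow> nat"
    and X :: "nat \<Rightarrow> nat \<Rightarrow> 'h \<Rightarrow> 'h" and \<gamma> :: "nat \<Rightarrow> complex mat measure"
  assumes tau: "is_state (op_alg M) \<tau>"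
    and haar: "\<And>N. N > 0 \<Longrightarrow> is_haar_prob N (\<gamma> N)"
    and X_sa: "\<And>i j. i < n \<Longrightarrow> j < r i \<Longrightarrow> X i j \<in> M \<and> op_sa (X i j)"
begin

abbreviation "G N \<equiv> (\<Pi>\<^sub>M i\<in>{..<n}. \<gamma> N)"
abbreviation "V \<equiv> var_set n r"
abbreviation "mom w \<equiv> \<tau> (word_prod (op_alg M) (\<lambda>(i, j). X i j) w)"
abbreviation "mat_word N A U w \<equiv> word_prod (mat_alg N) (\<lambda>(i, j). conj_tuple U A i j) w"
abbreviation "Mats N S \<equiv> {A. \<forall>i<n. \<forall>j<r i. A i j \<in> Msa N S}"
abbreviation "Gam A N m \<delta> \<equiv> Gamma_orb M \<tau> n r X A N m \<delta>"

sublocale O: complete_cstar_algebra "op_alg M" by (rule complete_cstar_algebra_op)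

lemma X_in: "i < n \<Longrightarrow> j < r i \<Longrightarrow> X i j \<in> carrier (op_alg M)"
  using X_sa by (simp add: op_alg_sel)

lemma X_star: "i < n \<Longrightarrow> j < r i \<Longrightarrow> star (op_alg M) (X i j) = X i j"
  using X_sa op_adjoint_eq[of "X i j" "X i j"] by (simp add: op_alg_sel op_sa_def)

lemma gamma_prob: "N > 0 \<Longrightarrow> prob_space (\<gamma> N)"
  using haar by (simp add: is_haar_prob_def)

lemma sets_gamma: "N > 0 \<Longrightarrow> sets (\<gamma> N) = sets (unitary_borel N)"
  using haar by (simp add: is_haar_prob_def)

lemma space_gamma: "N > 0 \<Longrightarrow> space (\<gamma> N) = unitary_group N"
  using sets_eq_imp_space_eq[OF sets_gamma] by (simp add: unitary_borel_def space_vimage_algebra)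

lemma prob_G: "N > 0 \<Longrightarrow> prob_space (G N)"
  by (intro prob_space_PiM gamma_prob)

lemma space_G: "N > 0 \<Longrightarrow> space (G N) = {..<n} \<rightarrow>\<^sub>E unitary_group N"
  by (simp add: space_PiM space_gamma)

text \<open>Entrywise measurability.  It is only asked for the entries with indices below \<open>N\<close>, since the entries of
  \<open>complex mat\<close> outside the dimension are unspecified.\<close>

definition mat_meas :: "nat \<Rightarrow> ((nat \<Rightarrow> complex mat) \<Rightarrow> complex mat) \<Rightarrow> bool" where
  "mat_meas N f \<longleftrightarrow> (\<forall>U\<in>space (G N). f U \<in> carrier_mat N N) \<and>
     (\<forall>k<N. \<forall>l<N. (\<lambda>U. f U $$ (k, l)) \<in> borel_measurable (G N))"

lemma unitary_entry_measurable:
  assumes N: "N > 0" and kl: "k < N" "l < N"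
  shows "(\<lambda>U. U $$ (k, l)) \<in> borel_measurable (\<gamma> N)"
proof -
  let ?f = "\<lambda>U. \<lambda>(k, l)\<in>{..<N} \<times> {..<N}. U $$ (k, l) :: complex"
  let ?P = "\<Pi>\<^sub>M kl\<in>{..<N} \<times> {..<N}. (borel :: complex measure)"
  have "?f \<in> measurable (unitary_borel N) ?P"
    unfolding unitary_borel_def by (rule measurable_vimage_algebra1) (auto simp: space_PiM)
  then have "(\<lambda>U. ?f U (k, l)) \<in> borel_measurable (unitary_borel N)"
    by (rule measurable_compose) (use kl in \<open>auto intro!: measurable_component_singleton\<close>)
  then have "(\<lambda>U. U $$ (k, l)) \<in> borel_measurable (unitary_borel N)" using kl by simp
  then show ?thesis using measurable_cong_sets[OF sets_gamma[OF N] refl] by blast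
qed

lemma mat_meas_component: assumes N: "N > 0" and i: "i < n" shows "mat_meas N (\<lambda>U. U i)"
  unfolding mat_meas_def
proof (intro conjI ballI allI impI)
  fix U assume "U \<in> space (G N)"
  then show "U i \<in> carrier_mat N N" using i by (auto simp: space_G[OF N] unitary_group_def PiE_def Pi_def)
next
  fix k l assume kl: "k < N" "l < N"
  show "(\<lambda>U. U i $$ (k, l)) \<in> borel_measurable (G N)"
    by (rule measurable_compose[OF measurable_component_singleton[of i "{..<n}"] unitary_entry_measurable[OF N kl]]) (use i in simp)
qed

lemma mat_meas_const: "A \<in> carrier_mat N N \<Longrightarrow> mat_meas N (\<lambda>_. A)"
  by (simp add: mat_meas_def)

lemma mat_meas_mult: assumes f: "mat_meas N f" and g: "mat_meas N g" shows "mat_meas N (\<lambda>U. f U * g U)"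
  unfolding mat_meas_def
proof (intro conjI ballI allI impI)
  fix k l assume kl: "k < N" "l < N"
  have "(\<lambda>U. \<Sum>m<N. f U $$ (k, m) * g U $$ (m, l)) \<in> borel_measurable (G N)"
    using f g kl by (intro borel_measurable_sum borel_measurable_times) (auto simp: mat_meas_def)
  moreover have "(f U * g U) $$ (k, l) = (\<Sum>m<N. f U $$ (k, m) * g U $$ (m, l))" if "U \<in> space (G N)" for U
    using f g kl that by (intro mat_mult_index) (auto simp: mat_meas_def)
  ultimately show "(\<lambda>U. (f U * g U) $$ (k, l)) \<in> borel_measurable (G N)" by (subst measurable_cong)
qed (use f g in \<open>auto simp: mat_meas_def\<close>)

lemma mat_meas_adjoint: assumes f: "mat_meas N f" shows "mat_meas N (\<lambda>U. mat_adjoint (f U))"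
  unfolding mat_meas_def
proof (intro conjI ballI allI impI)
  fix U assume "U \<in> space (G N)"
  then show "mat_adjoint (f U) \<in> carrier_mat N N" using f by (intro mat_adjoint_carrier) (simp add: mat_meas_def)
next
  fix k l assume kl: "k < N" "l < N"
  have "(\<lambda>U. cnj (f U $$ (l, k))) \<in> borel_measurable (G N)"
    using f kl by (intro borel_measurable_continuous_on[of cnj] continuous_intros) (auto simp: mat_meas_def)
  moreover have "mat_adjoint (f U) $$ (k, l) = cnj (f U $$ (l, k))" if "U \<in> space (G N)" for U
    using f that kl by (intro mat_adjoint_index) (auto simp: mat_meas_def)
  ultimately show "(\<lambda>U. mat_adjoint (f U) $$ (k, l)) \<in> borel_measurable (G N)" by (subst measurable_cong)
qed

lemma mat_meas_word:
  assumes N: "N > 0" and A: "A \<in> Mats N S" and w: "w \<in> lists V"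
  shows "mat_meas N (\<lambda>U. mat_word N A U w)"
  using w
proof (induction w)
  case Nil
  show ?case by (simp add: word_prod_def mat_alg_sel mat_meas_const)
next
  case (Cons x w)
  obtain i j where x: "x = (i, j)" "i < n" "j < r i" using Cons.hyps by (auto simp: var_set_def)
  have "A i j \<in> carrier_mat N N" using A x by (auto simp: Msa_def)
  then have "mat_meas N (\<lambda>U. conj_tuple U A i j)"
    unfolding conj_tuple_def
    by (intro mat_meas_mult mat_meas_component[OF N] mat_meas_const mat_meas_adjoint x)
  from mat_meas_mult[OF this Cons.IH] show ?case
    by (simp add: word_prod_def mat_alg_sel x)
qed

lemma trN_measurable: "mat_meas N f \<Longrightarrow> (\<lambda>U. trN N (f U)) \<in> borel_measurable (G N)"
  unfolding trN_def by (intro borel_measurable_divide borel_measurable_sum) (auto simp: mat_meas_def)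

lemma Gam_eq: "N > 0 \<Longrightarrow> Gam A N m \<delta> = {U \<in> space (G N). \<forall>w\<in>{w\<in>lists V. 1 \<le> length w \<and> length w \<le> m}.
    cmod (trN N (mat_word N A U w) - mom w) < \<delta>}"
  by (auto simp: Gamma_orb_def space_G)

lemma finite_words: "finite {w\<in>lists V. length w \<le> m}"
proof -
  have "finite V" by (simp add: var_set_def)
  from finite_lists_length_le[OF this, of m] show ?thesis
    by (rule rev_finite_subset) (auto simp: in_lists_conv_set)
qed

lemma Gam_sets: assumes N: "N > 0" and A: "A \<in> Mats N S" shows "Gam A N m \<delta> \<in> sets (G N)"
  unfolding Gam_eq[OF N]
proof (rule sets.sets_Collect_finite_All)
  show "finite {w\<in>lists V. 1 \<le> length w \<and> length w \<le> m}"
    by (rule rev_finite_subset[OF finite_words[of m]]) auto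
  fix w assume "w \<in> {w\<in>lists V. 1 \<le> length w \<and> length w \<le> m}"
  then have "(\<lambda>U. trN N (mat_word N A U w)) \<in> borel_measurable (G N)"
    by (intro trN_measurable mat_meas_word[OF N A]) auto
  then have "(\<lambda>U. cmod (trN N (mat_word N A U w) - mom w)) \<in> borel_measurable (G N)"
    by (intro borel_measurable_continuous_on[of "\<lambda>z. cmod (z - mom w)"] continuous_intros)
  from borel_measurable_less[OF this borel_measurable_const]
  show "{U \<in> space (G N). cmod (trN N (mat_word N A U w) - mom w) < \<delta>} \<in> sets (G N)" .
qed

section \<open>The orbital free entropy as an infimum\<close>

definition rate :: "real \<Rightarrow> nat \<Rightarrow> real \<Rightarrow> ereal" where
  "rate S m \<delta> = limsup (\<lambda>N. ereal (1 / real N ^ 2) *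
     (SUP A\<in>Mats N S. log_ereal (measure (G N) (Gam A N m \<delta>))))"

lemma log_ereal_mono: "0 \<le> x \<Longrightarrow> x \<le> y \<Longrightarrow> log_ereal x \<le> log_ereal y"
  by (auto simp: log_ereal_def)

text \<open>Only the microstate spaces need to be compared, one matrix tuple at a time and with a possibly different tuple
  on the right; this form serves both monotonicity and the change of the cut-off constant.\<close>

lemma rate_compare:
  assumes "\<And>N A. N > 0 \<Longrightarrow> A \<in> Mats N S \<Longrightarrow> \<exists>A'\<in>Mats N S'. Gam A N m \<delta> \<subseteq> Gam A' N m' \<delta>'"
  shows "rate S m \<delta> \<le> rate S' m' \<delta>'"
  unfolding rate_def
proof (rule Limsup_mono, rule eventually_mono[OF eventually_gt_at_top[of 0]])
  fix N :: nat assume N: "0 < N"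
  interpret prob_space "G N" by (rule prob_G[OF N])
  have "(SUP A\<in>Mats N S. log_ereal (measure (G N) (Gam A N m \<delta>))) \<le>
        (SUP A\<in>Mats N S'. log_ereal (measure (G N) (Gam A N m' \<delta>')))"
  proof (rule SUP_mono)
    fix A assume "A \<in> Mats N S"
    then obtain A' where A': "A' \<in> Mats N S'" "Gam A N m \<delta> \<subseteq> Gam A' N m' \<delta>'" using assms[OF N] by blast
    show "\<exists>A'\<in>Mats N S'. log_ereal (measure (G N) (Gam A N m \<delta>)) \<le> log_ereal (measure (G N) (Gam A' N m' \<delta>'))"
      using A' by (intro bexI[of _ A'] log_ereal_mono finite_measure_mono Gam_sets[OF N]) auto
  qed
  then show "ereal (1 / real N ^ 2) * (SUP A\<in>Mats N S. log_ereal (measure (G N) (Gam A N m \<delta>))) \<le>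
        ereal (1 / real N ^ 2) * (SUP A\<in>Mats N S'. log_ereal (measure (G N) (Gam A N m' \<delta>')))"
    by (rule ereal_mult_left_mono) simp
qed

lemma Gam_mono: "m' \<le> m \<Longrightarrow> \<delta> \<le> \<delta>' \<Longrightarrow> Gam A N m \<delta> \<subseteq> Gam A N m' \<delta>'"
  unfolding Gamma_orb_def by force

lemma rate_mono: "m' \<le> m \<Longrightarrow> \<delta> \<le> \<delta>' \<Longrightarrow> rate S m \<delta> \<le> rate S m' \<delta>'"
  using Gam_mono by (intro rate_compare) blast

text \<open>The rate decreases as \<open>m\<close> grows and \<open>\<delta>\<close> shrinks, so the limit exists and is the infimum.\<close>

lemma chi_orb_eq: "chi_orb \<gamma> S M \<tau> n r X = (INF (m, \<delta>)\<in>UNIV \<times> {0<..}. rate S m \<delta>)"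
proof -
  let ?I = "INF (m, \<delta>)\<in>UNIV \<times> {0<..}. rate S m \<delta>"
  let ?F = "sequentially \<times>\<^sub>F at_right (0::real)"
  have "((\<lambda>(m, \<delta>). rate S m \<delta>) \<longlongrightarrow> ?I) ?F"
  proof (rule order_tendstoI)
    fix y assume y: "y < ?I"
    have "eventually (\<lambda>(m, \<delta>). y < rate S m \<delta>) ?F"
      unfolding eventually_prod_filter
    proof (intro exI conjI allI impI)
      show "eventually (\<lambda>m::nat. True) sequentially" by simp
      show "eventually (\<lambda>\<delta>::real. 0 < \<delta>) (at_right 0)" by (simp add: eventually_at_right_less)
      fix m :: nat and \<delta> :: real assume "0 < \<delta>"
      then have "?I \<le> rate S m \<delta>" by (intro INF_lower2[of "(m, \<delta>)"]) auto
      with y show "case (m, \<delta>) of (m, \<delta>) \<Rightarrow> y < rate S m \<delta>" by simp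
    qed
    then show "eventually (\<lambda>x. y < (case x of (m, \<delta>) \<Rightarrow> rate S m \<delta>)) ?F" by (rule eventually_mono) auto
  next
    fix y assume "?I < y"
    then obtain m0 \<delta>0 where 0: "0 < \<delta>0" "rate S m0 \<delta>0 < y" unfolding INF_less_iff by auto
    have "eventually (\<lambda>(m, \<delta>). rate S m \<delta> < y) ?F"
      unfolding eventually_prod_filter
    proof (intro exI conjI allI impI)
      show "eventually (\<lambda>m. m0 \<le> m) sequentially" by (rule eventually_ge_at_top)
      show "eventually (\<lambda>\<delta>. \<delta> < \<delta>0) (at_right 0)"
        using 0(1) by (auto simp: eventually_at_right_field intro!: exI[of _ \<delta>0])
      fix m \<delta> assume "m0 \<le> m" "\<delta> < \<delta>0"
      then have "rate S m \<delta> \<le> rate S m0 \<delta>0" by (intro rate_mono) auto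
      with 0 show "case (m, \<delta>) of (m, \<delta>) \<Rightarrow> rate S m \<delta> < y" by simp
    qed
    then show "eventually (\<lambda>x. (case x of (m, \<delta>) \<Rightarrow> rate S m \<delta>) < y) ?F" by (rule eventually_mono) auto
  qed
  moreover have "\<not> trivial_limit ?F" by (simp add: prod_filter_eq_bot)
  ultimately have "Lim ?F (\<lambda>(m, \<delta>). rate S m \<delta>) = ?I" by (intro tendsto_Lim)
  then show ?thesis unfolding chi_orb_def rate_def .
qed

section \<open>Independence of the cut-off constant\<close>

lemma mom_le:
  assumes "\<And>i j. i < n \<Longrightarrow> j < r i \<Longrightarrow> onorm (X i j) \<le> K" "0 \<le> K" "w \<in> lists V"
  shows "cmod (mom w) \<le> K ^ length w"
proof -
  have x: "(case k of (i, j) \<Rightarrow> X i j) \<in> carrier (op_alg M) \<and> nrm (op_alg M) (case k of (i, j) \<Rightarrow> X i j) \<le> K"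
    if "k \<in> set w" for k
    using that assms(1,3) X_in by (auto simp: var_set_def op_alg_sel(8))
  then have "word_prod (op_alg M) (\<lambda>(i, j). X i j) w \<in> carrier (op_alg M)" by (intro O.word_prod_in) auto
  then have "cmod (mom w) \<le> nrm (op_alg M) (word_prod (op_alg M) (\<lambda>(i, j). X i j) w)" using tau by (simp add: is_state_def)
  also have "\<dots> \<le> K ^ length w" using x assms(2) by (intro O.N_word_prod) auto
  finally show ?thesis .
qed

lemma mat_word_replicate:
  assumes N: "N > 0" and A: "A i j \<in> carrier (mat_alg N)" and U: "U i \<in> unitary_group N"
  shows "trN N (mat_word N A U (replicate l (i, j))) = trN N (word_prod (mat_alg N) (\<lambda>_. A i j) (replicate l (i, j)))"
proof -
  interpret tracial_state "mat_alg N" "trN N" by (rule tracial_state_mat[OF N])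
  have U': "U i \<in> carrier (mat_alg N)" "star (mat_alg N) (U i) \<otimes>\<^bsub>mat_alg N\<^esub> U i = \<one>\<^bsub>mat_alg N\<^esub>"
    "U i \<otimes>\<^bsub>mat_alg N\<^esub> star (mat_alg N) (U i) = \<one>\<^bsub>mat_alg N\<^esub>" using U by (auto simp: unitary_group_iff)
  have "mat_word N A U (replicate l (i, j)) = word_prod (mat_alg N)
      (\<lambda>_. U i \<otimes>\<^bsub>mat_alg N\<^esub> A i j \<otimes>\<^bsub>mat_alg N\<^esub> star (mat_alg N) (U i)) (replicate l (i, j))"
    by (rule word_prod_cong) (auto simp: conj_tuple_eq[of U A i j N])
  also have "\<dots> = U i \<otimes>\<^bsub>mat_alg N\<^esub> word_prod (mat_alg N) (\<lambda>_. A i j) (replicate l (i, j)) \<otimes>\<^bsub>mat_alg N\<^esub> star (mat_alg N) (U i)"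
    by (rule word_prod_conj[OF U']) (rule A)
  finally show ?thesis using trace_conj[OF U'(1,2), of "word_prod (mat_alg N) (\<lambda>_. A i j) (replicate l (i, j))"] A by simp
qed

text \<open>If \<open>A\<close> has any microstate, then the moment of order \<open>2 k\<close> of each \<open>A i j\<close> is at most
  \<open>S2 ^ (2 k) + \<delta>'\<close>, so \<open>cut_off\<close> replaces \<open>A i j\<close> by a matrix of norm at most \<open>S2\<close> at small
  2-distance.  The new tuple does not depend on the unitaries.\<close>

lemma microstates_cut_off:
  assumes S: "\<And>i j. i < n \<Longrightarrow> j < r i \<Longrightarrow> onorm (X i j) \<le> S2" "0 \<le> S2" "S2 \<le> S1" and \<delta>: "\<delta> > 0"
  obtains m' \<delta>' where "\<delta>' > 0"
    "\<And>N A. N > 0 \<Longrightarrow> A \<in> Mats N S1 \<Longrightarrow> \<exists>A'\<in>Mats N S2. Gam A N m' \<delta>' \<subseteq> Gam A' N m \<delta>"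
proof -
  \<comment> \<open>\<open>K\<close> bounds the letters, and is at least \<open>1\<close> so that its powers increase; then words change by at most \<open>L * \<eta>\<close>\<close>
  define K where "K = max S1 1"
  have K: "1 \<le> K" "S1 \<le> K" "S2 \<le> K" using S by (auto simp: K_def)
  define L where "L = (real m + 1) * K ^ m"
  have L: "L > 0" using K by (simp add: L_def)
  define \<eta> where "\<eta> = \<delta> / (2 * L)"
  have \<eta>: "\<eta> > 0" "L * \<eta> = \<delta> / 2" using L \<delta> by (auto simp: \<eta>_def)
  define \<eta>1 where "\<eta>1 = \<eta> / 2"
  have \<eta>1: "\<eta>1 > 0" "\<eta>1\<^sup>2 = \<eta>\<^sup>2 / 4" using \<eta> by (auto simp: \<eta>1_def power_divide)
  define \<rho> where "\<rho> = S2 / (S2 + \<eta>1)"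
  have \<rho>: "0 \<le> \<rho>" "\<rho> < 1" using S \<eta>1 by (auto simp: \<rho>_def)
  have "(\<lambda>k. S1\<^sup>2 * \<rho> ^ (2 * k)) \<longlonglongrightarrow> S1\<^sup>2 * 0"
    using \<rho> by (intro tendsto_mult tendsto_const filterlim_compose[OF LIMSEQ_power_zero]
          filterlim_subseq) (auto simp: strict_mono_def)
  then have "\<forall>\<^sub>F k in sequentially. S1\<^sup>2 * \<rho> ^ (2 * k) < \<eta>\<^sup>2 / 4"
    using \<eta> by (intro order_tendstoD(2)) auto
  then have "\<forall>\<^sub>F k in sequentially. S1\<^sup>2 * \<rho> ^ (2 * k) < \<eta>\<^sup>2 / 4 \<and> 1 \<le> k"
    using eventually_ge_at_top[of 1] by (rule eventually_conj)
  then obtain k where k: "S1\<^sup>2 * \<rho> ^ (2 * k) < \<eta>\<^sup>2 / 4" "1 \<le> k"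
    using eventually_happens'[OF sequentially_bot] by blast
  define c where "c = S1\<^sup>2 / (S2 + \<eta>1) ^ (2 * k)"
  have c: "0 \<le> c" using S \<eta>1 by (simp add: c_def)
  have cS: "c * S2 ^ (2 * k) = S1\<^sup>2 * \<rho> ^ (2 * k)" by (simp add: c_def \<rho>_def power_divide)
  define \<delta>' where "\<delta>' = min (\<delta> / 2) (\<eta>\<^sup>2 / 4 / (c + 1))"
  have c\<delta>: "\<delta>' > 0" "\<delta>' \<le> \<delta> / 2" "c * \<delta>' \<le> \<eta>\<^sup>2 / 4"
  proof -
    show "\<delta>' > 0" using \<delta> \<eta> c by (simp add: \<delta>'_def add_nonneg_pos)
    show "\<delta>' \<le> \<delta> / 2" unfolding \<delta>'_def by (rule min.cobounded1)
    have "c * \<delta>' \<le> (c + 1) * \<delta>'" using \<open>\<delta>' > 0\<close> by simp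
    also have "\<dots> \<le> (c + 1) * (\<eta>\<^sup>2 / 4 / (c + 1))" using c by (intro mult_left_mono) (auto simp: \<delta>'_def)
    also have "\<dots> = \<eta>\<^sup>2 / 4"
      by (rule trans[OF times_divide_eq_right nonzero_mult_div_cancel_left]) (use c in simp)
    finally show "c * \<delta>' \<le> \<eta>\<^sup>2 / 4" .
  qed
  define m' where "m' = max m (2 * k)"
  have "\<exists>A'\<in>Mats N S2. Gam A N m' \<delta>' \<subseteq> Gam A' N m \<delta>" if N: "N > 0" and A: "A \<in> Mats N S1" for N A
  proof (cases "Gam A N m' \<delta>' = {}")
    case True
    interpret complete_cstar_algebra "mat_alg N" by (rule complete_cstar_algebra_mat)
    have "\<zero>\<^bsub>mat_alg N\<^esub> \<in> Msa N S2" unfolding Msa_iff using S by simp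
    then show ?thesis using True by (intro bexI[of _ "\<lambda>_ _. \<zero>\<^bsub>mat_alg N\<^esub>"]) auto
  next
    case False
    interpret tracial_state "mat_alg N" "trN N" by (rule tracial_state_mat[OF N])
    obtain U where U: "U \<in> Gam A N m' \<delta>'" using False by blast
    have Un: "U i \<in> unitary_group N" if "U \<in> Gam A N m' \<delta>'" "i < n" for U i
      using that by (auto simp: Gamma_orb_def)
    have "\<exists>B\<in>Msa N S2. p (A i j \<oplus>\<^bsub>mat_alg N\<^esub> (-1) \<odot>\<^bsub>mat_alg N\<^esub> B) \<le> \<eta>" if ij: "i < n" "j < r i" for i j
    proof -
      let ?w = "replicate (2 * k) (i, j)"
      have AM: "A i j \<in> Msa N S1" using A ij by simp
      then have Ac: "A i j \<in> carrier (mat_alg N)" by (simp add: Msa_iff)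
      have w: "?w \<in> lists V" "1 \<le> length ?w" "length ?w \<le> m'" using ij k by (auto simp: var_set_def m'_def)
      then have "cmod (trN N (mat_word N A U ?w) - mom ?w) < \<delta>'" using U unfolding Gamma_orb_def by blast
      then have "cmod (trN N (word_prod (mat_alg N) (\<lambda>_. A i j) ?w) - mom ?w) < \<delta>'"
        using mat_word_replicate[where A = A and i = i and j = j and U = U, OF N Ac Un[OF U ij(1)]] by simp
      moreover have "cmod (mom ?w) \<le> S2 ^ (2 * k)" using mom_le[OF S(1,2) w(1)] by simp
      ultimately have tr: "cmod (trN N (word_prod (mat_alg N) (\<lambda>_. A i j) ?w)) \<le> S2 ^ (2 * k) + \<delta>'"
        using norm_triangle_ineq2[of "trN N (word_prod (mat_alg N) (\<lambda>_. A i j) ?w)" "mom ?w"] by linarith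
      obtain B where B: "B \<in> Msa N S2"
        "(p (A i j \<oplus>\<^bsub>mat_alg N\<^esub> (-1) \<odot>\<^bsub>mat_alg N\<^esub> B))\<^sup>2 \<le> \<eta>1\<^sup>2 + c * cmod (trN N (word_prod (mat_alg N) (\<lambda>_. A i j) ?w))"
        using cut_off[OF N AM S(2,3) \<eta>1(1), of k "(i, j)"] unfolding c_def by blast
      have Bc: "B \<in> carrier (mat_alg N)" using B by (simp add: Msa_iff)
      have "c * cmod (trN N (word_prod (mat_alg N) (\<lambda>_. A i j) ?w)) \<le> c * (S2 ^ (2 * k) + \<delta>')"
        using tr c by (rule mult_left_mono)
      then have "(p (A i j \<oplus>\<^bsub>mat_alg N\<^esub> (-1) \<odot>\<^bsub>mat_alg N\<^esub> B))\<^sup>2 \<le> \<eta>\<^sup>2 / 4 + (c * S2 ^ (2 * k) + c * \<delta>')"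
        using B(2) \<eta>1(2) by (simp add: ring_distribs)
      also have "\<dots> \<le> \<eta>\<^sup>2" using k(1) cS c\<delta>(3) zero_le_power2[of \<eta>] by linarith
      finally have "p (A i j \<oplus>\<^bsub>mat_alg N\<^esub> (-1) \<odot>\<^bsub>mat_alg N\<^esub> B) \<le> \<eta>" by (rule power2_le_imp_le) (use \<eta> in simp)
      with B(1) show ?thesis by blast
    qed
    note close = this
    define A' where "A' i j = (SOME B. B \<in> Msa N S2 \<and> p (A i j \<oplus>\<^bsub>mat_alg N\<^esub> (-1) \<odot>\<^bsub>mat_alg N\<^esub> B) \<le> \<eta>)" for i j
    have A': "A' i j \<in> Msa N S2" "p (A i j \<oplus>\<^bsub>mat_alg N\<^esub> (-1) \<odot>\<^bsub>mat_alg N\<^esub> A' i j) \<le> \<eta>"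
      if "i < n" "j < r i" for i j
      using someI_ex[OF close[OF that, unfolded Bex_def]] unfolding A'_def by auto
    have "Gam A N m' \<delta>' \<subseteq> Gam A' N m \<delta>"
    proof
      fix U assume U: "U \<in> Gam A N m' \<delta>'"
      have "cmod (trN N (mat_word N A' U w) - mom w) < \<delta>" if w: "w \<in> lists V" "1 \<le> length w" "length w \<le> m" for w
      proof -
        have old: "cmod (trN N (mat_word N A U w) - mom w) < \<delta>'"
          using U w unfolding Gamma_orb_def m'_def by simp
        have step: "(case k of (i, j) \<Rightarrow> conj_tuple U A i j) \<in> carrier (mat_alg N) \<and>
            (case k of (i, j) \<Rightarrow> conj_tuple U A' i j) \<in> carrier (mat_alg N) \<and>
            nrm (mat_alg N) (case k of (i, j) \<Rightarrow> conj_tuple U A i j) \<le> K \<and>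
            nrm (mat_alg N) (case k of (i, j) \<Rightarrow> conj_tuple U A' i j) \<le> K \<and>
            p ((case k of (i, j) \<Rightarrow> conj_tuple U A i j) \<oplus>\<^bsub>mat_alg N\<^esub>
               (-1) \<odot>\<^bsub>mat_alg N\<^esub> (case k of (i, j) \<Rightarrow> conj_tuple U A' i j)) \<le> \<eta>"
          if kw: "k \<in> set w" for k
        proof -
          obtain i j where k: "k = (i, j)" "i < n" "j < r i" using w(1) kw by (auto simp: var_set_def)
          note Ui = Un[OF U k(2)]
          have Ui': "U i \<in> carrier (mat_alg N)" "star (mat_alg N) (U i) \<otimes>\<^bsub>mat_alg N\<^esub> U i = \<one>\<^bsub>mat_alg N\<^esub>"
            using Ui by (auto simp: unitary_group_iff)
          have AM: "A i j \<in> Msa N S1" "A' i j \<in> Msa N S2" using A A' k by auto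
          then have Ac: "A i j \<in> carrier (mat_alg N)" "A' i j \<in> carrier (mat_alg N)" by (auto simp: Msa_iff)
          have 1: "conj_tuple U A i j \<in> Msa N K" "conj_tuple U A' i j \<in> Msa N K"
            using conj_tuple_Msa[where A = A and i = i and j = j and V = U, OF AM(1)]
              conj_tuple_Msa[where A = A' and i = i and j = j and V = U, OF AM(2)] Ui K(2,3) by (auto intro: Msa_mono)
          have "conj_tuple U A i j \<oplus>\<^bsub>mat_alg N\<^esub> (-1) \<odot>\<^bsub>mat_alg N\<^esub> conj_tuple U A' i j
             = U i \<otimes>\<^bsub>mat_alg N\<^esub> (A i j \<oplus>\<^bsub>mat_alg N\<^esub> (-1) \<odot>\<^bsub>mat_alg N\<^esub> A' i j) \<otimes>\<^bsub>mat_alg N\<^esub> star (mat_alg N) (U i)"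
            using Ui'(1) Ac by (simp add: conj_tuple_eq[of _ _ _ _ N] distrib_left distrib_right)
          then have "p (conj_tuple U A i j \<oplus>\<^bsub>mat_alg N\<^esub> (-1) \<odot>\<^bsub>mat_alg N\<^esub> conj_tuple U A' i j) \<le> \<eta>"
            using p_conj[OF Ui', of "A i j \<oplus>\<^bsub>mat_alg N\<^esub> (-1) \<odot>\<^bsub>mat_alg N\<^esub> A' i j"] A'(2)[OF k(2,3)] Ac by simp
          then show ?thesis using 1 by (simp add: Msa_iff k)
        qed
        have wc: "mat_word N A U w \<in> carrier (mat_alg N)" "mat_word N A' U w \<in> carrier (mat_alg N)"
          by (rule word_prod_in, use step in simp)+
        have "cmod (trN N (mat_word N A U w) - trN N (mat_word N A' U w)) =
            cmod (trN N (mat_word N A U w \<oplus>\<^bsub>mat_alg N\<^esub> (-1) \<odot>\<^bsub>mat_alg N\<^esub> mat_word N A' U w))"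
          using wc by (simp add: PF.fun_add PF.fun_smult)
        also have "\<dots> \<le> p (mat_word N A U w \<oplus>\<^bsub>mat_alg N\<^esub> (-1) \<odot>\<^bsub>mat_alg N\<^esub> mat_word N A' U w)"
          using wc by (intro trace_le_p) auto
        also have "\<dots> \<le> real (length w) * K ^ length w * \<eta>"
          by (rule word_prod_p_close[OF step K(1)]) (use \<eta> in auto)
        also have "\<dots> \<le> L * \<eta>" unfolding L_def using w(3) K \<eta>
          by (intro mult_right_mono mult_mono power_increasing) auto
        finally have "cmod (trN N (mat_word N A U w) - trN N (mat_word N A' U w)) \<le> \<delta> / 2" using \<eta> by simp
        moreover have "cmod (trN N (mat_word N A' U w) - mom w) \<le>
            cmod (trN N (mat_word N A U w) - trN N (mat_word N A' U w)) + cmod (trN N (mat_word N A U w) - mom w)"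
          using norm_triangle_ineq[of "trN N (mat_word N A' U w) - trN N (mat_word N A U w)" "trN N (mat_word N A U w) - mom w"]
          by (simp add: norm_minus_commute)
        ultimately show ?thesis using old c\<delta>(2) by linarith
      qed
      then show "U \<in> Gam A' N m \<delta>" using U unfolding Gamma_orb_def by auto
    qed
    then show ?thesis using A'(1) by (intro bexI[of _ A']) auto
  qed
  from that[OF c\<delta>(1) this] show ?thesis .
qed

text \<open>The case distinction covers \<open>S2 < 0\<close>, which the hypothesis permits when there are no variables at all.\<close>

lemma chi_orb_cut_off_le:
  assumes S: "\<And>i j. i < n \<Longrightarrow> j < r i \<Longrightarrow> onorm (X i j) \<le> S2"
  shows "chi_orb \<gamma> S1 M \<tau> n r X \<le> chi_orb \<gamma> S2 M \<tau> n r X"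
  unfolding chi_orb_eq
proof (rule INF_greatest, clarify)
  fix m :: nat and \<delta> :: real assume \<delta>: "0 < \<delta>"
  have "\<exists>m' \<delta>'. \<delta>' > 0 \<and> rate S1 m' \<delta>' \<le> rate S2 m \<delta>"
  proof (cases "S2 \<le> S1 \<and> V \<noteq> {}")
    case True
    then obtain i j where "i < n" "j < r i" by (auto simp: var_set_def)
    then have S2: "0 \<le> S2" using order_trans[OF onorm_pos_le[OF M_bounded] S] X_sa by auto
    have S12: "S2 \<le> S1" using True by simp
    show ?thesis
    proof (rule microstates_cut_off[OF S S2 S12 \<delta>])
      fix m' \<delta>'
      assume "\<delta>' > 0" and sub: "\<And>N A. N > 0 \<Longrightarrow> A \<in> Mats N S1 \<Longrightarrow> \<exists>A'\<in>Mats N S2. Gam A N m' \<delta>' \<subseteq> Gam A' N m \<delta>"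
      have "rate S1 m' \<delta>' \<le> rate S2 m \<delta>" by (rule rate_compare) (rule sub)
      with \<open>\<delta>' > 0\<close> show ?thesis by (intro exI conjI)
    qed
  next
    case False
    have "Mats N S1 \<subseteq> Mats N S2" for N
    proof (cases "V = {}")
      case True
      then have "\<not> (i < n \<and> j < r i)" for i j by (auto simp: var_set_def)
      then show ?thesis by blast
    next
      case V: False
      with False have "S1 \<le> S2" by simp
      then show ?thesis using Msa_mono by blast
    qed
    then have "rate S1 m \<delta> \<le> rate S2 m \<delta>" by (intro rate_compare) blast
    with \<delta> show ?thesis by blast
  qed
  then obtain m' \<delta>' where "\<delta>' > 0" "rate S1 m' \<delta>' \<le> rate S2 m \<delta>" by blast
  then show "(INF (m, \<delta>)\<in>UNIV \<times> {0<..}. rate S1 m \<delta>) \<le> rate S2 m \<delta>"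
    by (intro INF_lower2[of "(m', \<delta>')"]) auto
qed

end

section \<open>The states on the universal algebra given by microstates\<close>

lemma state_diff_le:
  assumes A: "star_algebra A" and s: "is_state A \<sigma>" and xy: "x \<in> carrier A" "y \<in> carrier A"
  shows "cmod (\<sigma> x - \<sigma> y) \<le> dst A (nrm A) x y"
proof -
  interpret star_algebra A by (rule A)
  have "\<sigma> (x \<oplus>\<^bsub>A\<^esub> (-1) \<odot>\<^bsub>A\<^esub> y) = \<sigma> x + \<sigma> ((-1) \<odot>\<^bsub>A\<^esub> y)" using s xy by (simp add: is_state_def)
  also have "\<dots> = \<sigma> x - \<sigma> y" using s xy by (simp add: is_state_def)
  finally have e: "\<sigma> x - \<sigma> y = \<sigma> (x \<oplus>\<^bsub>A\<^esub> (-1) \<odot>\<^bsub>A\<^esub> y)" by simp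
  have "x \<oplus>\<^bsub>A\<^esub> (-1) \<odot>\<^bsub>A\<^esub> y \<in> carrier A" using xy by simp
  then have "cmod (\<sigma> (x \<oplus>\<^bsub>A\<^esub> (-1) \<odot>\<^bsub>A\<^esub> y)) \<le> nrm A (x \<oplus>\<^bsub>A\<^esub> (-1) \<odot>\<^bsub>A\<^esub> y)"
    using s unfolding is_state_def by blast
  then show ?thesis unfolding e dst_def .
qed

lemma state_star:
  assumes A: "star_algebra A" and s: "is_state A \<sigma>" and x: "x \<in> carrier A"
  shows "\<sigma> (star A x) = cnj (\<sigma> x)"
proof -
  interpret positive_functional A \<sigma> by (rule is_state_positive[OF A s])
  show ?thesis using hermitian[of "\<one>\<^bsub>A\<^esub>" x] x by simp
qed

lemma word_prod_map: "word_prod A a (map f w) = word_prod A (\<lambda>k. a (f k)) w"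
  by (induction w) (auto simp: word_prod_def)

locale orbital_cut_off = orbital M \<tau> n r X \<gamma>
  for M :: "('h::chilbert_space \<Rightarrow> 'h) set" and \<tau> n r X \<gamma> +
  fixes R :: real
  assumes R: "0 < R" and X_norm: "\<And>i j. i < n \<Longrightarrow> j < r i \<Longrightarrow> onorm (X i j) \<le> R"
begin

abbreviation "C \<equiv> C_all R n r"
abbreviation "C2 \<equiv> C_all2 R n r"
abbreviation "te f g \<equiv> tensor_elem C C f g"
abbreviation "x \<equiv> \<lambda>(i, j). x_all R n r i j"
abbreviation "\<tau>1 \<equiv> tau_all M \<tau> R n r X"
abbreviation "\<tau>2 \<equiv> tensor_state C C \<tau>1 \<tau>1"
abbreviation "tr1 N A U f \<equiv> trN N (eval_at R n r (mat_alg N) (conj_tuple U A) f)"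
abbreviation "tr2 N A U h \<equiv> trN (N * N) (eval2_at R n r N (conj_tuple U A) h)"

lemma R0: "0 \<le> R" using R by simp

sublocale C: cstar_algebra C by (rule cstar_algebra_C_all[OF R0])
sublocale C2: cstar_algebra C2 by (rule nc_polys2_dense(3)[OF R0])

lemma x_in: "k \<in> V \<Longrightarrow> x k \<in> carrier C" and x_star: "k \<in> V \<Longrightarrow> star C (x k) = x k"
  using x_all_in[OF R0] x_all_star[OF R0] by (auto simp: var_set_def)

lemma word_in: "w \<in> lists V \<Longrightarrow> word_prod C x w \<in> carrier C"
  by (rule C.word_prod_in) (use x_in in auto)

lemma word_poly: "w \<in> lists V \<Longrightarrow> word_prod C x w \<in> nc_polys R n r"
  unfolding nc_polys_def by (rule lin_span.incl) blast

lemma eval_X: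
  shows eval_X_hom: "star_hom C (op_alg M) (eval_at R n r (op_alg M) X)"
    and eval_X_x: "i < n \<Longrightarrow> j < r i \<Longrightarrow> eval_at R n r (op_alg M) X (x_all R n r i j) = X i j"
proof -
  have X: "\<And>i j. i < n \<Longrightarrow> j < r i \<Longrightarrow>
      X i j \<in> carrier (op_alg M) \<and> star (op_alg M) (X i j) = X i j \<and> nrm (op_alg M) (X i j) \<le> R"
    using X_in X_star X_norm by (simp add: op_alg_sel)
  note E = eval_at_star_hom[where D = "op_alg M" and n = n and r = r and a = X, OF R0
      complete_cstar_algebra_op positive_family_op X]
  show "star_hom C (op_alg M) (eval_at R n r (op_alg M) X)" by (rule E(1))
  show "eval_at R n r (op_alg M) X (x_all R n r i j) = X i j" if "i < n" "j < r i"
    by (rule E(2)) (use that in auto)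
qed

lemma \<tau>1_eq: "\<tau>1 = (\<lambda>f. \<tau> (eval_at R n r (op_alg M) X f))"
  by (rule ext) (simp add: tau_all_def)

lemma \<tau>1_state: "is_state C \<tau>1"
  unfolding \<tau>1_eq by (rule is_state_comp[OF eval_X_hom tau C.star_algebra_axioms])

lemma \<tau>1_word: assumes w: "w \<in> lists V" shows "\<tau>1 (word_prod C x w) = mom w"
proof -
  have "eval_at R n r (op_alg M) X (word_prod C x w) =
      word_prod (op_alg M) (\<lambda>k. eval_at R n r (op_alg M) X (x k)) w"
    by (rule star_hom_word_prod[OF eval_X_hom C.star_algebra_axioms]) (use w x_in in auto)
  also have "\<dots> = word_prod (op_alg M) (\<lambda>(i, j). X i j) w"
    by (rule O.word_prod_cong) (use w eval_X_x in \<open>auto simp: var_set_def\<close>)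
  finally show ?thesis by (simp add: tau_all_def)
qed

lemma tau_tuple_word: assumes i: "i < n" and w: "w \<in> lists {..<r i}"
  shows "tau_tuple M \<tau> R n r X i (word_prod (C_tuple R (r i)) (x_tuple R (r i)) w) = mom (map (Pair i) w)"
proof -
  interpret Ci: cstar_algebra "C_tuple R (r i)" by (rule cstar_algebra_C_tuple[OF R0])
  have "tuple_incl R n r i (word_prod (C_tuple R (r i)) (x_tuple R (r i)) w) =
      word_prod C (\<lambda>j. tuple_incl R n r i (x_tuple R (r i) j)) w"
    by (rule star_hom_word_prod[OF tuple_incl_hom[where r = r, OF R0 i] Ci.star_algebra_axioms]) (use w x_tuple_in[OF R0] in auto)
  also have "\<dots> = word_prod C x (map (Pair i) w)" by (simp add: word_prod_map x_all_def)
  finally show ?thesis using i w by (simp add: tau_tuple_def \<tau>1_word var_set_def in_lists_conv_set)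
qed

lemma tensor_pair_C: "tensor_pair C C \<tau>1 \<tau>1"
  by (intro tensor_pair.intro tensor_pair_axioms.intro C.cstar_algebra_axioms \<tau>1_state)

lemma te_in: "f \<in> carrier C \<Longrightarrow> g \<in> carrier C \<Longrightarrow> te f g \<in> carrier C2"
  unfolding C_all2_def by (rule tensor_pair.tensor_elem_in[OF tensor_pair_C])

lemma te_star: "f \<in> carrier C \<Longrightarrow> g \<in> carrier C \<Longrightarrow> star C2 (te f g) = te (star C f) (star C g)"
  unfolding C_all2_def by (rule tensor_pair.tensor_elem_star[OF tensor_pair_C])

text \<open>States on \<open>C \<otimes>\<^sub>m\<^sub>i\<^sub>n C\<close> that are the square of a state on \<open>C\<close>.  Both \<open>\<tau>\<^sub>X\<close> and
  every microstate give such a pair, which is why the two can be treated alike.\<close>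

definition square_state :: "(C_all_elem \<Rightarrow> complex) \<Rightarrow> ((C_all_elem, C_all_elem) tensor \<Rightarrow> complex) \<Rightarrow> bool" where
  "square_state \<sigma> \<sigma>2 \<longleftrightarrow> is_state C \<sigma> \<and> is_state C2 \<sigma>2 \<and>
     (\<forall>f\<in>carrier C. \<forall>g\<in>carrier C. \<sigma>2 (te f g) = \<sigma> f * \<sigma> g)"

lemma square_state_\<tau>: "square_state \<tau>1 \<tau>2"
  unfolding square_state_def C_all2_def
  using \<tau>1_state tensor_pair.tensor_state_is_state[OF tensor_pair_C \<tau>1_state \<tau>1_state] by blast

lemma conj_in:
  assumes "N > 0" "A \<in> Mats N R" "U \<in> space (G N)" "i < n" "j < r i" shows "conj_tuple U A i j \<in> Msa N R"
  using conj_tuple_Msa[where A = A and i = i and j = j and V = U and N = N and R = R] assms by (auto simp: space_G)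

lemma square_state_tr: assumes N: "N > 0" and A: "A \<in> Mats N R" and U: "U \<in> space (G N)"
  shows "square_state (tr1 N A U) (tr2 N A U)"
  unfolding square_state_def
proof (intro conjI ballI)
  note c = conj_in[OF N A U]
  show "is_state C (tr1 N A U)"
    by (rule is_state_comp[OF eval_mat(1)[OF R0 c] trN_is_state[OF N] C.star_algebra_axioms])
  show "is_state C2 (tr2 N A U)"
    by (rule is_state_comp[OF eval2_mat(1)[OF R0 N c] trN_is_state C2.star_algebra_axioms]) (use N in auto)
  fix f g assume "f \<in> carrier C" "g \<in> carrier C"
  then show "tr2 N A U (te f g) = tr1 N A U f * tr1 N A U g"
    using eval2_mat(2)[OF R0 N c] by (simp add: trN_kron)
qed

lemma tr1_word: assumes N: "N > 0" and A: "A \<in> Mats N R" and U: "U \<in> space (G N)" and w: "w \<in> lists V"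
  shows "tr1 N A U (word_prod C x w) = trN N (mat_word N A U w)"
proof -
  note c = conj_in[OF N A U]
  have "eval_at R n r (mat_alg N) (conj_tuple U A) (word_prod C x w) =
      word_prod (mat_alg N) (\<lambda>k. eval_at R n r (mat_alg N) (conj_tuple U A) (x k)) w"
    by (rule star_hom_word_prod[OF eval_mat(1)[OF R0 c] C.star_algebra_axioms]) (use w x_in in auto)
  also have "\<dots> = mat_word N A U w"
    by (rule star_algebra.word_prod_cong[OF star_algebra_mat]) (use w eval_mat(2)[OF R0 c] in \<open>auto simp: var_set_def\<close>)
  finally show ?thesis by simp
qed

text \<open>Whatever holds for the values at words and passes to sums, products and uniform limits holds for the values at
  every element of the tensor square.  It is applied to measurability and to convergence.\<close>

lemma square_state_induct:
  fixes \<sigma> :: "'w \<Rightarrow> C_all_elem \<Rightarrow> complex" and \<FF> :: "('w \<Rightarrow> complex) \<Rightarrow> bool"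
  assumes sq: "\<And>\<omega>. \<omega> \<in> \<Omega> \<Longrightarrow> square_state (\<sigma> \<omega>) (\<sigma>2 \<omega>)"
    and zero: "\<FF> (\<lambda>_. 0)"
    and add: "\<And>F H. \<FF> F \<Longrightarrow> \<FF> H \<Longrightarrow> \<FF> (\<lambda>\<omega>. F \<omega> + H \<omega>)"
    and smult: "\<And>F c. \<FF> F \<Longrightarrow> \<FF> (\<lambda>\<omega>. c * F \<omega>)"
    and mult: "\<And>F H. \<FF> F \<Longrightarrow> \<FF> H \<Longrightarrow> \<FF> (\<lambda>\<omega>. F \<omega> * H \<omega>)"
    and lim: "\<And>F. (\<And>e. e > 0 \<Longrightarrow> \<exists>H. \<FF> H \<and> (\<forall>\<omega>\<in>\<Omega>. cmod (F \<omega> - H \<omega>) < e)) \<Longrightarrow> \<FF> F"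
    and words: "\<And>w. w \<in> lists V \<Longrightarrow> \<FF> (\<lambda>\<omega>. \<sigma> \<omega> (word_prod C x w))"
    and h: "h \<in> carrier C2"
  shows "\<FF> (\<lambda>\<omega>. \<sigma>2 \<omega> h)"
proof -
  have cong: "\<FF> F" if "\<FF> H" "\<And>\<omega>. \<omega> \<in> \<Omega> \<Longrightarrow> F \<omega> = H \<omega>" for F H
    by (rule lim, rule exI[of _ H]) (use that in simp)
  have span: "\<FF> (\<lambda>\<omega>. s \<omega> y)"
    if s: "\<And>\<omega>. \<omega> \<in> \<Omega> \<Longrightarrow> is_state B (s \<omega>)" and B: "cstar_algebra B"
      and gens: "\<And>y. y \<in> S \<Longrightarrow> y \<in> carrier B \<and> \<FF> (\<lambda>\<omega>. s \<omega> y)" and y: "y \<in> lin_span B S"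
    for B :: "'c cstar_alg" and s :: "'w \<Rightarrow> 'c \<Rightarrow> complex" and S y
  proof -
    interpret B: cstar_algebra B by (rule B)
    from y have "y \<in> carrier B \<and> \<FF> (\<lambda>\<omega>. s \<omega> y)"
    proof induction
      case zero
      have "s \<omega> \<zero>\<^bsub>B\<^esub> = 0" if "\<omega> \<in> \<Omega>" for \<omega>
      proof -
        have "\<And>c a. a \<in> carrier B \<Longrightarrow> s \<omega> (c \<odot>\<^bsub>B\<^esub> a) = c * s \<omega> a"
          using s[OF that] unfolding is_state_def by blast
        from this[OF B.zero_in, of 0] show ?thesis by simp
      qed
      then show ?case using cong[OF \<open>\<FF> (\<lambda>_. 0)\<close>, of "\<lambda>\<omega>. s \<omega> \<zero>\<^bsub>B\<^esub>"] by simp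
    next
      case (incl a) then show ?case by (rule gens)
    next
      case (add a b)
      have "\<FF> (\<lambda>\<omega>. s \<omega> (a \<oplus>\<^bsub>B\<^esub> b))"
        by (rule cong[OF assms(3)[of "\<lambda>\<omega>. s \<omega> a" "\<lambda>\<omega>. s \<omega> b"]]) (use add s in \<open>auto simp: is_state_def\<close>)
      then show ?case using add by simp
    next
      case (smult a c)
      have "\<FF> (\<lambda>\<omega>. s \<omega> (c \<odot>\<^bsub>B\<^esub> a))"
        by (rule cong[OF assms(4)[of "\<lambda>\<omega>. s \<omega> a" c]]) (use smult s in \<open>auto simp: is_state_def\<close>)
      then show ?case using smult by simp
    qed
    then show ?thesis ..
  qed
  have poly: "\<FF> (\<lambda>\<omega>. \<sigma> \<omega> f)" if "f \<in> nc_polys R n r" for f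
  proof (rule span[OF _ C.cstar_algebra_axioms _ that[unfolded nc_polys_def]])
    show "is_state C (\<sigma> \<omega>)" if "\<omega> \<in> \<Omega>" for \<omega> using sq[OF that] by (simp add: square_state_def)
    fix y assume "y \<in> {word_prod C x w |w. w \<in> lists V}"
    then obtain w where "y = word_prod C x w" "w \<in> lists V" by blast
    then show "y \<in> carrier C \<and> \<FF> (\<lambda>\<omega>. \<sigma> \<omega> y)" using words word_in by blast
  qed
  have poly2: "\<FF> (\<lambda>\<omega>. \<sigma>2 \<omega> p)" if "p \<in> nc_polys2 R n r" for p
  proof (rule span[OF _ C2.cstar_algebra_axioms _ that[unfolded nc_polys2_def]])
    show "is_state C2 (\<sigma>2 \<omega>)" if "\<omega> \<in> \<Omega>" for \<omega> using sq[OF that] by (simp add: square_state_def)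
    fix y assume "y \<in> {te f g |f g. f \<in> nc_polys R n r \<and> g \<in> nc_polys R n r}"
    then obtain f g where y: "y = te f g" and fg: "f \<in> nc_polys R n r" "g \<in> nc_polys R n r" by blast
    then have c: "f \<in> carrier C" "g \<in> carrier C" using nc_polys_in[OF R0] by auto
    have "\<FF> (\<lambda>\<omega>. \<sigma>2 \<omega> (te f g))"
      by (rule cong[OF mult[OF poly[OF fg(1)] poly[OF fg(2)]]]) (use sq c in \<open>auto simp: square_state_def\<close>)
    then show "y \<in> carrier C2 \<and> \<FF> (\<lambda>\<omega>. \<sigma>2 \<omega> y)" using te_in c y by simp
  qed
  show ?thesis
  proof (rule lim)
    fix e :: real assume "e > 0"
    have "h \<in> nclosure C2 (nc_polys2 R n r)" using h nc_polys2_dense(1)[OF R0] by simp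
    then obtain p where p: "p \<in> nc_polys2 R n r" "dst C2 (nrm C2) h p < e"
      using \<open>e > 0\<close> unfolding nclosure_def by blast
    have pc: "p \<in> carrier C2" using p(1) nc_polys2_dense(2)[OF R0] by blast
    have "cmod (\<sigma>2 \<omega> h - \<sigma>2 \<omega> p) < e" if "\<omega> \<in> \<Omega>" for \<omega>
    proof -
      have "is_state C2 (\<sigma>2 \<omega>)" using sq[OF that] by (simp add: square_state_def)
      from state_diff_le[OF C2.star_algebra_axioms this h pc] p(2) show ?thesis by linarith
    qed
    then show "\<exists>H. \<FF> H \<and> (\<forall>\<omega>\<in>\<Omega>. cmod (\<sigma>2 \<omega> h - H \<omega>) < e)" using poly2[OF p(1)] by blast
  qed
qed

lemma tr2_measurable:
  assumes N: "N > 0" and A: "A \<in> Mats N R" and h: "h \<in> carrier C2"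
  shows "(\<lambda>U. tr2 N A U h) \<in> borel_measurable (G N)"
proof (rule square_state_induct[where \<Omega> = "space (G N)" and \<sigma> = "tr1 N A" and ?\<sigma>2.0 = "tr2 N A"
      and \<FF> = "\<lambda>F. F \<in> borel_measurable (G N)"])
  show "square_state (tr1 N A U) (tr2 N A U)" if "U \<in> space (G N)" for U by (rule square_state_tr[OF N A that])
  show "(\<lambda>U. tr1 N A U (word_prod C x w)) \<in> borel_measurable (G N)" if "w \<in> lists V" for w
    using trN_measurable[OF mat_meas_word[OF N A that]]
    by (subst measurable_cong[OF tr1_word[OF N A _ that]]) auto
next
  fix F assume F: "\<And>e. e > 0 \<Longrightarrow> \<exists>H. H \<in> borel_measurable (G N) \<and> (\<forall>U\<in>space (G N). cmod (F U - H U) < e)"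
  have "\<forall>k. \<exists>H. H \<in> borel_measurable (G N) \<and> (\<forall>U\<in>space (G N). cmod (F U - H U) < inverse (real (Suc k)))"
    by (rule allI) (rule F, simp)
  from choice[OF this] obtain H where H: "\<And>k. H k \<in> borel_measurable (G N)"
    "\<And>k U. U \<in> space (G N) \<Longrightarrow> cmod (F U - H k U) < inverse (real (Suc k))" by blast
  show "F \<in> borel_measurable (G N)"
  proof (rule borel_measurable_LIMSEQ_metric[OF H(1)])
    fix U assume U: "U \<in> space (G N)"
    have "(\<lambda>k. H k U - F U) \<longlonglongrightarrow> 0"
      by (rule Lim_null_comparison[OF _ LIMSEQ_inverse_real_of_nat])
         (use H(2)[OF U] in \<open>auto simp: norm_minus_commute less_imp_le\<close>)
    then show "(\<lambda>k. H k U) \<longlonglongrightarrow> F U" by (simp add: LIM_zero_iff)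
  qed
qed (use h in \<open>auto intro: borel_measurable_add borel_measurable_times\<close>)

lemma tr2_bounded: assumes N: "N > 0" and A: "A \<in> Mats N R" and U: "U \<in> space (G N)" and h: "h \<in> carrier C2"
  shows "\<bar>Re (tr2 N A U h)\<bar> \<le> nrm C2 h"
proof -
  have "cmod (tr2 N A U h) \<le> nrm C2 h"
    using square_state_tr[OF N A U] h by (simp add: square_state_def is_state_def)
  then show ?thesis using abs_Re_le_cmod[of "tr2 N A U h"] by linarith
qed

abbreviation "weight h N A U \<equiv> exp (- (real N ^ 2) * Re (tr2 N A U h))"

lemma weight_integrable: assumes N: "N > 0" and A: "A \<in> Mats N R" and h: "h \<in> carrier C2"
  shows "integrable (G N) (weight h N A)"
proof -
  interpret prob_space "G N" by (rule prob_G[OF N])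
  have "(\<lambda>U. Re (tr2 N A U h)) \<in> borel_measurable (G N)"
    by (rule measurable_compose[OF tr2_measurable[OF N A h] borel_measurable_Re])
  then have m: "weight h N A \<in> borel_measurable (G N)" 
    by (rule measurable_compose) (intro borel_measurable_continuous_onI continuous_intros)
  show ?thesis
  proof (rule integrable_const_bound[OF _ m])
    show "AE U in G N. norm (weight h N A U) \<le> exp (real N ^ 2 * nrm C2 h)"
    proof (rule AE_I2)
      fix U assume U: "U \<in> space (G N)"
      have "real N ^ 2 * (- Re (tr2 N A U h)) \<le> real N ^ 2 * nrm C2 h"
        using tr2_bounded[OF N A U h] by (intro mult_left_mono) auto
      then show "norm (weight h N A U) \<le> exp (real N ^ 2 * nrm C2 h)" by simp
    qed
  qed
qed

section \<open>Values of the tensor square on good microstates\<close>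

text \<open>By \<open>square_state_induct\<close>, with convergence along the filter of microstates as the class of functions.\<close>

lemma tr2_close:
  assumes h: "h \<in> carrier C2" and e: "e > 0"
  obtains m \<delta> where "\<delta> > 0"
    "\<And>N A U. N > 0 \<Longrightarrow> A \<in> Mats N R \<Longrightarrow> U \<in> Gam A N m \<delta> \<Longrightarrow> cmod (tr2 N A U h - \<tau>2 h) < e"
proof -
  define S where "S m \<delta> = {(N, A, U). N > 0 \<and> A \<in> Mats N R \<and> U \<in> Gam A N m \<delta>}" for m \<delta>
  define FIL where "FIL = (INF (m, \<delta>)\<in>UNIV \<times> {0<..}. principal (S m \<delta>))"
  have ev: "eventually P FIL \<longleftrightarrow> (\<exists>m \<delta>. \<delta> > 0 \<and> (\<forall>\<omega>\<in>S m \<delta>. P \<omega>))" for P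
  proof -
    have "eventually P FIL \<longleftrightarrow> (\<exists>b\<in>UNIV \<times> {0<..}. eventually P (case b of (m, \<delta>) \<Rightarrow> principal (S m \<delta>)))"
      unfolding FIL_def
    proof (rule eventually_INF_base)
      fix a b :: "nat \<times> real" assume ab: "a \<in> UNIV \<times> {0<..}" "b \<in> UNIV \<times> {0::real<..}"
      obtain m \<delta> m' \<delta>' where [simp]: "a = (m, \<delta>)" "b = (m', \<delta>')" by (cases a, cases b) auto
      have "S (max m m') (min \<delta> \<delta>') \<subseteq> S m \<delta> \<inter> S m' \<delta>'"
      proof -
        have "Gam A N (max m m') (min \<delta> \<delta>') \<subseteq> Gam A N m \<delta> \<inter> Gam A N m' \<delta>'" for A N
          by (intro Int_greatest Gam_mono) auto
        then show ?thesis unfolding S_def by blast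
      qed
      then show "\<exists>c\<in>UNIV \<times> {0<..}. (case c of (m, \<delta>) \<Rightarrow> principal (S m \<delta>)) \<le>
          inf (case a of (m, \<delta>) \<Rightarrow> principal (S m \<delta>)) (case b of (m, \<delta>) \<Rightarrow> principal (S m \<delta>))"
        using ab by (intro bexI[of _ "(max m m', min \<delta> \<delta>')"]) auto
    qed (auto intro!: exI[of _ 1])
    then show ?thesis by (auto simp: eventually_principal)
  qed
  \<comment> \<open>the extra point \<open>None\<close> carries the limit state, so that one family of states contains both sides\<close>
  define \<sigma> where "\<sigma> \<omega> = (case \<omega> of None \<Rightarrow> \<tau>1 | Some (N, A, U) \<Rightarrow> tr1 N A U)" for \<omega>
  define \<sigma>2 where "\<sigma>2 \<omega> = (case \<omega> of None \<Rightarrow> \<tau>2 | Some (N, A, U) \<Rightarrow> tr2 N A U)" for \<omega>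
  define \<Omega> where "\<Omega> = insert None (Some ` {(N, A, U). N > 0 \<and> A \<in> Mats N R \<and> U \<in> space (G N)})"
  have S\<Omega>: "Some \<omega> \<in> \<Omega>" if "\<omega> \<in> S m \<delta>" for \<omega> m \<delta>
    using that unfolding S_def \<Omega>_def by (auto simp: Gam_eq)
  have "((\<lambda>\<omega>. \<sigma>2 (Some \<omega>) h) \<longlongrightarrow> \<sigma>2 None h) FIL"
  proof (rule square_state_induct[where \<Omega> = \<Omega> and \<sigma> = \<sigma> and ?\<sigma>2.0 = \<sigma>2 and \<FF> = "\<lambda>F. ((\<lambda>\<omega>. F (Some \<omega>)) \<longlongrightarrow> F None) FIL"])
    show "square_state (\<sigma> \<omega>) (\<sigma>2 \<omega>)" if "\<omega> \<in> \<Omega>" for \<omega>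
      using that square_state_\<tau> square_state_tr by (auto simp: \<Omega>_def \<sigma>_def \<sigma>2_def)
  next
    fix w assume w: "w \<in> lists V"
    show "((\<lambda>\<omega>. \<sigma> (Some \<omega>) (word_prod C x w)) \<longlongrightarrow> \<sigma> None (word_prod C x w)) FIL"
    proof (rule tendstoI)
      fix e :: real assume "e > 0"
      have "dist (\<sigma> (Some \<omega>) (word_prod C x w)) (\<sigma> None (word_prod C x w)) < e" if \<omega>S: "\<omega> \<in> S (length w) e" for \<omega>
      proof -
        obtain N A U where \<omega>: "\<omega> = (N, A, U)" "N > 0" "A \<in> Mats N R" "U \<in> Gam A N (length w) e"
          using \<omega>S unfolding S_def by blast
        have U: "U \<in> space (G N)" using \<omega> by (auto simp: Gam_eq)
        show ?thesis
        proof (cases "w = []")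
          case True
          have "is_state C (tr1 N A U)" using square_state_tr[OF \<omega>(2,3) U] by (simp add: square_state_def)
          then show ?thesis using \<tau>1_state \<open>e > 0\<close> by (simp add: True \<sigma>_def \<omega>(1) is_state_def)
        next
          case False
          then have "1 \<le> length w" by (cases w) auto
          then have "cmod (trN N (mat_word N A U w) - mom w) < e" using \<omega>(4) w unfolding Gamma_orb_def by blast
          then show ?thesis by (simp add: \<sigma>_def \<omega>(1) \<tau>1_word[OF w] tr1_word[OF \<omega>(2,3) U w] dist_norm)
        qed
      qed
      then show "\<forall>\<^sub>F \<omega> in FIL. dist (\<sigma> (Some \<omega>) (word_prod C x w)) (\<sigma> None (word_prod C x w)) < e"
        unfolding ev using \<open>e > 0\<close> by blast
    qed
  next
    fix F :: "(nat \<times> (nat \<Rightarrow> nat \<Rightarrow> complex mat) \<times> (nat \<Rightarrow> complex mat)) option \<Rightarrow> complex"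
    assume F: "\<And>e. e > 0 \<Longrightarrow> \<exists>H. ((\<lambda>\<omega>. H (Some \<omega>)) \<longlongrightarrow> H None) FIL \<and> (\<forall>\<omega>\<in>\<Omega>. cmod (F \<omega> - H \<omega>) < e)"
    show "((\<lambda>\<omega>. F (Some \<omega>)) \<longlongrightarrow> F None) FIL"
    proof (rule tendstoI)
      fix e :: real assume e: "e > 0"
      then obtain H where H: "((\<lambda>\<omega>. H (Some \<omega>)) \<longlongrightarrow> H None) FIL" "\<forall>\<omega>\<in>\<Omega>. cmod (F \<omega> - H \<omega>) < e/3"
        using F[of "e/3"] by auto
      obtain m \<delta> where \<delta>: "\<delta> > 0" and close: "\<forall>\<omega>\<in>S m \<delta>. dist (H (Some \<omega>)) (H None) < e/3"
        using tendstoD[OF H(1), of "e/3"] e unfolding ev by auto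
      have "dist (F (Some \<omega>)) (F None) < e" if "\<omega> \<in> S m \<delta>" for \<omega>
      proof -
        have 1: "dist (F (Some \<omega>)) (H (Some \<omega>)) < e/3" using H(2) S\<Omega>[OF that] by (simp add: dist_norm)
        have 2: "dist (F None) (H None) < e/3" using H(2) by (simp add: dist_norm \<Omega>_def)
        have 3: "dist (H (Some \<omega>)) (H None) < e/3" using close that by blast
        show ?thesis using 1 2 3 dist_triangle[of "F (Some \<omega>)" "F None" "H (Some \<omega>)"]
            dist_triangle[of "H (Some \<omega>)" "F None" "H None"] dist_commute[of "H None" "F None"] by linarith
      qed
      then show "\<forall>\<^sub>F \<omega> in FIL. dist (F (Some \<omega>)) (F None) < e" unfolding ev using \<delta> by blast
    qed
  qed (use h in \<open>auto intro: tendsto_add tendsto_mult\<close>)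
  from tendstoD[OF this e] obtain m \<delta> where \<delta>: "\<delta> > 0" and "\<forall>\<omega>\<in>S m \<delta>. dist (\<sigma>2 (Some \<omega>) h) (\<sigma>2 None h) < e"
    unfolding ev by blast
  then have "\<And>N A U. N > 0 \<Longrightarrow> A \<in> Mats N R \<Longrightarrow> U \<in> Gam A N m \<delta> \<Longrightarrow> cmod (tr2 N A U h - \<tau>2 h) < e"
    by (auto simp: S_def \<sigma>2_def dist_norm)
  with \<delta> show ?thesis by (rule that)
qed

end

section \<open>The two inequalities\<close>

context orbital_cut_off
begin

abbreviation "\<sigma>s \<equiv> tau_tuple M \<tau> R n r X"

definition prate :: "(C_all_elem, C_all_elem) tensor \<Rightarrow> nat \<Rightarrow> real \<Rightarrow> ereal" where
  "prate h m \<delta> = limsup (\<lambda>N. ereal (1 / real N ^ 2) * pressure_fin \<gamma> R n r h \<sigma>s N m \<delta>)"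

lemma pressure_eq: "pressure \<gamma> R n r h \<sigma>s = (INF (m, \<delta>)\<in>UNIV \<times> {0<..}. prate h m \<delta>)"
  by (simp add: pressure_def prate_def)

text \<open>A word in the variables of one tuple is conjugated as a whole, which the trace does not see.\<close>

lemma Gamma_R_of_Gam:
  assumes N: "N > 0" and A: "A \<in> Mats N R" and U: "U \<in> Gam A N m \<delta>" and i: "i < n"
  shows "A i \<in> Gamma_R R (r i) (\<sigma>s i) N m \<delta>"
  unfolding Gamma_R_def
proof (intro CollectI conjI ballI allI impI)
  show "A i j \<in> Msa N R" if "j < r i" for j using A i that by simp
  fix w assume w: "w \<in> lists {..<r i}" and l: "1 \<le> length w \<and> length w \<le> m"
  interpret tracial_state "mat_alg N" "trN N" by (rule tracial_state_mat[OF N])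
  have "U i \<in> unitary_group N" using U i by (auto simp: Gamma_orb_def)
  then have Ui: "U i \<in> carrier (mat_alg N)" "star (mat_alg N) (U i) \<otimes>\<^bsub>mat_alg N\<^esub> U i = \<one>\<^bsub>mat_alg N\<^esub>"
    "U i \<otimes>\<^bsub>mat_alg N\<^esub> star (mat_alg N) (U i) = \<one>\<^bsub>mat_alg N\<^esub>" by (auto simp: unitary_group_iff)
  have Ac: "A i j \<in> carrier (mat_alg N)" if "j \<in> set w" for j using A i w that by (auto simp: Msa_iff)
  have "mat_word N A U (map (Pair i) w) = word_prod (mat_alg N)
      (\<lambda>j. U i \<otimes>\<^bsub>mat_alg N\<^esub> A i j \<otimes>\<^bsub>mat_alg N\<^esub> star (mat_alg N) (U i)) w"
    unfolding word_prod_map by (rule word_prod_cong) (simp add: conj_tuple_eq[where N = N])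
  also have "\<dots> = U i \<otimes>\<^bsub>mat_alg N\<^esub> word_prod (mat_alg N) (A i) w \<otimes>\<^bsub>mat_alg N\<^esub> star (mat_alg N) (U i)"
    by (rule word_prod_conj[OF Ui Ac])
  finally have "trN N (mat_word N A U (map (Pair i) w)) = trN N (word_prod (mat_alg N) (A i) w)"
    using trace_conj[OF Ui(1,2) word_prod_in[OF Ac]] by simp
  moreover have "cmod (trN N (mat_word N A U (map (Pair i) w)) - mom (map (Pair i) w)) < \<delta>"
  proof -
    have "map (Pair i) w \<in> lists V" "1 \<le> length (map (Pair i) w) \<and> length (map (Pair i) w) \<le> m"
      using w i l by (auto simp: var_set_def)
    then show ?thesis using U unfolding Gamma_orb_def by blast
  qed
  ultimately show "cmod (trN N (word_prod (mat_alg N) (A i) w) -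
      \<sigma>s i (word_prod (C_tuple R (r i)) (x_tuple R (r i)) w)) < \<delta>"
    unfolding tau_tuple_word[OF i w] by simp
qed

lemma Gamma_R_mono: "m' \<le> m \<Longrightarrow> \<delta> \<le> \<delta>' \<Longrightarrow> Gamma_R R k \<sigma> N m \<delta> \<subseteq> Gamma_R R k \<sigma> N m' \<delta>'"
  unfolding Gamma_R_def by force

lemma weight_integral_ge:
  assumes N: "N > 0" and A: "A \<in> Mats N R" and h: "h \<in> carrier C2"
    and c: "\<And>U. U \<in> Gam A N m \<delta> \<Longrightarrow> Re (tr2 N A U h) \<le> c"
  shows "exp (- (real N ^ 2) * c) * measure (G N) (Gam A N m \<delta>) \<le> (\<integral>U. weight h N A U \<partial>G N)"
proof -
  interpret prob_space "G N" by (rule prob_G[OF N])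
  have "exp (- (real N ^ 2) * c) * measure (G N) (Gam A N m \<delta>) =
      (\<integral>U. exp (- (real N ^ 2) * c) * indicator (Gam A N m \<delta>) U \<partial>G N)"
    using Gam_sets[OF N A] by simp
  also have "\<dots> \<le> (\<integral>U. weight h N A U \<partial>G N)"
  proof (rule integral_mono[OF _ weight_integrable[OF N A h]])
    show "integrable (G N) (\<lambda>U. exp (- (real N ^ 2) * c) * indicator (Gam A N m \<delta>) U)"
      using Gam_sets[OF N A] by (intro integrable_mult_right integrable_real_indicator) (auto simp: emeasure_eq_measure)
    fix U show "exp (- (real N ^ 2) * c) * indicator (Gam A N m \<delta>) U \<le> weight h N A U"
      using c[of U] by (auto simp: indicator_def mult_left_mono)
  qed
  finally show ?thesis .
qed

text \<open>The integral in the pressure is bounded below by its part over the orbital microstates.  The hypotheses on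
  \<open>m0\<close>, \<open>\<delta>0\<close> (of the pressure) and \<open>m1\<close>, \<open>\<delta>1\<close> (of \<open>tr2_close\<close>) are met together by taking the maximum and the minimum.\<close>

lemma chi_orb_le_pressure: assumes h: "h \<in> carrier C2"
  shows "chi_orb \<gamma> R M \<tau> n r X \<le> shifted_pressure \<gamma> M \<tau> R n r X h"
proof -
  let ?\<chi> = "chi_orb \<gamma> R M \<tau> n r X" and ?t = "Re (\<tau>2 h)"
  have main: "?\<chi> \<le> prate h m0 \<delta>0 + ereal (?t + \<epsilon>)" if \<delta>0: "\<delta>0 > 0" and \<epsilon>: "\<epsilon> > 0" for m0 \<delta>0 \<epsilon>
  proof -
    obtain m1 \<delta>1 where \<delta>1: "\<delta>1 > 0" and close:
      "\<And>N A U. N > 0 \<Longrightarrow> A \<in> Mats N R \<Longrightarrow> U \<in> Gam A N m1 \<delta>1 \<Longrightarrow> cmod (tr2 N A U h - \<tau>2 h) < \<epsilon>"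
      by (rule tr2_close[OF h \<epsilon>], rule that)
    define m where "m = max m0 m1"
    define \<delta> where "\<delta> = min \<delta>0 \<delta>1"
    define c where "c = ?t + \<epsilon>"
    let ?S = "\<lambda>N. SUP A\<in>Mats N R. log_ereal (measure (G N) (Gam A N m \<delta>))"
    let ?P = "\<lambda>N. pressure_fin \<gamma> R n r h \<sigma>s N m0 \<delta>0"
    have \<delta>: "\<delta> > 0" using \<delta>0 \<delta>1 by (simp add: \<delta>_def)
    have fin: "?S N \<le> ?P N + ereal (real N ^ 2 * c)" if N: "N > 0" for N
    proof (rule SUP_least)
      fix A assume A: "A \<in> Mats N R"
      show "log_ereal (measure (G N) (Gam A N m \<delta>)) \<le> ?P N + ereal (real N ^ 2 * c)"
      proof (cases "measure (G N) (Gam A N m \<delta>) = 0")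
        case True then show ?thesis by (simp add: log_ereal_def)
      next
        case False
        then have pos: "measure (G N) (Gam A N m \<delta>) > 0" using measure_nonneg[of "G N" "Gam A N m \<delta>"] by linarith
        have "Gam A N m \<delta> \<noteq> {}" using False by auto
        then obtain U where U: "U \<in> Gam A N m \<delta>" by blast
        have "A i \<in> Gamma_R R (r i) (\<sigma>s i) N m0 \<delta>0" if "i < n" for i
          by (rule subsetD[OF Gamma_R_mono Gamma_R_of_Gam[OF N A U that]]) (auto simp: m_def \<delta>_def)
        then have up: "log_ereal (\<integral>U. weight h N A U \<partial>G N) \<le> ?P N"
          unfolding pressure_fin_def by (intro SUP_upper) auto
        have le: "exp (- (real N ^ 2) * c) * measure (G N) (Gam A N m \<delta>) \<le> (\<integral>U. weight h N A U \<partial>G N)"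
        proof (rule weight_integral_ge[OF N A h])
          fix U assume U: "U \<in> Gam A N m \<delta>"
          have "U \<in> Gam A N m1 \<delta>1" by (rule subsetD[OF Gam_mono U]) (auto simp: m_def \<delta>_def)
          from close[OF N A this] have "Re (tr2 N A U h - \<tau>2 h) < \<epsilon>"
            using complex_Re_le_cmod[of "tr2 N A U h - \<tau>2 h"] by linarith
          then show "Re (tr2 N A U h) \<le> c" by (simp add: c_def)
        qed
        have "ln (exp (- (real N ^ 2) * c) * measure (G N) (Gam A N m \<delta>)) =
            ln (measure (G N) (Gam A N m \<delta>)) - real N ^ 2 * c"
          using pos by (simp add: ln_mult)
        then have "ereal (ln (measure (G N) (Gam A N m \<delta>)) - real N ^ 2 * c) =
            log_ereal (exp (- (real N ^ 2) * c) * measure (G N) (Gam A N m \<delta>))"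
          using pos by (simp add: log_ereal_def)
        also have "\<dots> \<le> log_ereal (\<integral>U. weight h N A U \<partial>G N)"
          by (rule log_ereal_mono[OF _ le]) simp
        also note up
        finally have "ereal (ln (measure (G N) (Gam A N m \<delta>)) - real N ^ 2 * c) + ereal (real N ^ 2 * c)
            \<le> ?P N + ereal (real N ^ 2 * c)" by (rule add_right_mono)
        then show ?thesis using False by (simp add: log_ereal_def)
      qed
    qed
    have "rate R m \<delta> \<le> limsup (\<lambda>N. ereal (1 / real N ^ 2) * ?P N + ereal c)"
      unfolding rate_def
    proof (rule Limsup_mono, rule eventually_mono[OF eventually_gt_at_top[of 0]])
      fix N :: nat assume N: "0 < N"
      have "ereal (1 / real N ^ 2) * ?S N \<le> ereal (1 / real N ^ 2) * (?P N + ereal (real N ^ 2 * c))"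
        by (rule ereal_mult_left_mono[OF fin[OF N]]) simp
      also have "\<dots> = ereal (1 / real N ^ 2) * ?P N + ereal (1 / real N ^ 2) * ereal (real N ^ 2 * c)"
        using distrib_left_ereal_nn[of "1 / real N ^ 2" "?P N" "ereal (real N ^ 2 * c)"]
        by (simp add: mult.commute)
      also have "ereal (1 / real N ^ 2) * ereal (real N ^ 2 * c) = ereal c" using N by simp
      finally show "ereal (1 / real N ^ 2) * ?S N \<le> ereal (1 / real N ^ 2) * ?P N + ereal c" .
    qed
    also have "\<dots> = prate h m0 \<delta>0 + ereal c" unfolding prate_def by (rule Limsup_add_ereal_right) auto
    finally have "rate R m \<delta> \<le> prate h m0 \<delta>0 + ereal c" .
    moreover have "?\<chi> \<le> rate R m \<delta>" unfolding chi_orb_eq using \<delta> by (intro INF_lower2[of "(m, \<delta>)"]) auto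
    ultimately show ?thesis unfolding c_def by (rule order_trans[rotated])
  qed
  have "?\<chi> \<le> ereal ?t + prate h m0 \<delta>0" if "\<delta>0 > 0" for m0 \<delta>0
  proof (rule ereal_le_epsilon2)
    fix e :: real assume "0 < e"
    from main[OF \<open>\<delta>0 > 0\<close> this, of m0] show "?\<chi> \<le> ereal ?t + prate h m0 \<delta>0 + ereal e"
      by (simp add: ac_simps plus_ereal.simps(1)[symmetric] del: plus_ereal.simps)
  qed
  note low = this
  have "?\<chi> - ereal ?t \<le> pressure \<gamma> R n r h \<sigma>s"
    unfolding pressure_eq
  proof (rule INF_greatest, clarify)
    fix m :: nat and \<delta> :: real assume "0 < \<delta>"
    from low[OF this, of m] show "?\<chi> - ereal ?t \<le> prate h m \<delta>" by (simp add: ereal_minus_le_iff add.commute)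
  qed
  then show ?thesis unfolding shifted_pressure_def by (simp add: ereal_minus_le_iff add.commute)
qed

text \<open>With \<open>u = w - \<tau>(w)\<close>, the summand of \<open>w\<close> is \<open>\<beta>/2 (u \<otimes> u\<^sup>* + u\<^sup>* \<otimes> u)\<close>; the flip is added to make it
  selfadjoint.\<close>

lemma square_penalty:
  assumes W: "finite W" "W \<subseteq> lists V" and \<beta>: "\<beta> > 0"
  shows "\<exists>p\<in>nc_polys2 R n r. star C2 p = p \<and> (\<forall>\<sigma> \<sigma>2. square_state \<sigma> \<sigma>2 \<longrightarrow>
      Re (\<sigma>2 p) = \<beta> * (\<Sum>w\<in>W. (cmod (\<sigma> (word_prod C x w) - mom w))\<^sup>2))"
  using W
proof (induction W rule: finite_induct)
  case empty
  have "Re (\<sigma>2 \<zero>\<^bsub>C2\<^esub>) = 0" if "square_state \<sigma> \<sigma>2" for \<sigma> \<sigma>2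
  proof -
    have "\<And>c a. a \<in> carrier C2 \<Longrightarrow> \<sigma>2 (c \<odot>\<^bsub>C2\<^esub> a) = c * \<sigma>2 a" using that unfolding square_state_def is_state_def by blast
    from this[OF C2.zero_in, of 0] show ?thesis by simp
  qed
  then show ?case by (intro bexI[of _ "\<zero>\<^bsub>C2\<^esub>"]) (auto simp: nc_polys2_def lin_span.zero C2.star_zero)
next
  case (insert w W)
  then obtain p where p: "p \<in> nc_polys2 R n r" "star C2 p = p"
    "\<And>\<sigma> \<sigma>2. square_state \<sigma> \<sigma>2 \<Longrightarrow> Re (\<sigma>2 p) = \<beta> * (\<Sum>w\<in>W. (cmod (\<sigma> (word_prod C x w) - mom w))\<^sup>2)" by auto
  have w: "w \<in> lists V" using insert.prems by simp
  define u where "u = word_prod C x w \<oplus>\<^bsub>C\<^esub> (- mom w) \<odot>\<^bsub>C\<^esub> word_prod C x []"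
  define v where "v = word_prod C x (rev w) \<oplus>\<^bsub>C\<^esub> (- cnj (mom w)) \<odot>\<^bsub>C\<^esub> word_prod C x []"
  have wc: "word_prod C x w \<in> carrier C" "word_prod C x (rev w) \<in> carrier C" "word_prod C x [] \<in> carrier C"
    using w by (auto intro!: word_in)
  have sw: "star C (word_prod C x w) = word_prod C x (rev w)"
    by (rule C.star_word_prod) (use w x_in x_star in auto)
  have uv: "u \<in> carrier C" "v \<in> carrier C" "star C u = v" "star C v = u"
    using wc sw C.star_star[OF wc(1)] unfolding u_def v_def by simp_all
  have uvp: "u \<in> nc_polys R n r" "v \<in> nc_polys R n r"
    unfolding u_def v_def nc_polys_def
    by (intro lin_span.add lin_span.smult word_poly[unfolded nc_polys_def]; use w in auto)+
  define d where "d = of_real (\<beta> / 2) \<odot>\<^bsub>C2\<^esub> (te u v \<oplus>\<^bsub>C2\<^esub> te v u)"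
  have tc: "te u v \<in> carrier C2" "te v u \<in> carrier C2" using te_in uv by auto
  have pc: "p \<in> carrier C2" using p(1) nc_polys2_dense(2)[OF R0] by blast
  have dc: "d \<in> carrier C2" unfolding d_def using tc by simp
  have dp: "d \<in> nc_polys2 R n r" unfolding d_def nc_polys2_def using uvp
    by (intro lin_span.smult lin_span.add lin_span.incl) auto
  have dstar: "star C2 d = d" unfolding d_def using tc uv by (simp add: te_star C2.add_comm[OF tc])
  have dval: "Re (\<sigma>2 d) = \<beta> * (cmod (\<sigma> (word_prod C x w) - mom w))\<^sup>2" if sq: "square_state \<sigma> \<sigma>2" for \<sigma> \<sigma>2
  proof -
    have st: "is_state C \<sigma>" "is_state C2 \<sigma>2" "\<sigma>2 (te u v) = \<sigma> u * \<sigma> v" "\<sigma>2 (te v u) = \<sigma> v * \<sigma> u"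
      using sq uv unfolding square_state_def by auto
    have su: "\<sigma> u = \<sigma> (word_prod C x w) - mom w"
    proof -
      have "\<sigma> u = \<sigma> (word_prod C x w) + \<sigma> ((- mom w) \<odot>\<^bsub>C\<^esub> word_prod C x [])"
        unfolding u_def using st(1) wc C.smult_in[OF wc(3)] unfolding is_state_def by blast
      moreover have "\<sigma> ((- mom w) \<odot>\<^bsub>C\<^esub> word_prod C x []) = - mom w * \<sigma> (word_prod C x [])"
        using st(1) wc unfolding is_state_def by blast
      moreover have "\<sigma> (word_prod C x []) = 1" using st(1) by (simp add: is_state_def)
      ultimately show ?thesis by simp
    qed
    have sv: "\<sigma> v = cnj (\<sigma> u)" using state_star[OF C.star_algebra_axioms st(1) uv(1)] uv(3) by simp
    have "\<sigma>2 d = of_real (\<beta> / 2) * \<sigma>2 (te u v \<oplus>\<^bsub>C2\<^esub> te v u)"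
      unfolding d_def using st(2) C2.add_in[OF tc] unfolding is_state_def by blast
    also have "\<sigma>2 (te u v \<oplus>\<^bsub>C2\<^esub> te v u) = \<sigma>2 (te u v) + \<sigma>2 (te v u)"
      using st(2) tc unfolding is_state_def by blast
    also have "\<dots> = of_real (2 * (cmod (\<sigma> u))\<^sup>2)" using complex_norm_square[of "\<sigma> u"] by (simp add: st sv)
    also have "of_real (\<beta> / 2) * of_real (2 * (cmod (\<sigma> u))\<^sup>2) = complex_of_real (\<beta> * (cmod (\<sigma> u))\<^sup>2)"
      unfolding of_real_mult[symmetric] by (rule arg_cong[of _ _ complex_of_real]) simp
    finally show ?thesis unfolding su[symmetric] by (simp only: Re_complex_of_real)
  qed
  show ?case
  proof (intro bexI conjI allI impI)
    show "d \<oplus>\<^bsub>C2\<^esub> p \<in> nc_polys2 R n r" using dp p(1) unfolding nc_polys2_def by (rule lin_span.add)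
    show "star C2 (d \<oplus>\<^bsub>C2\<^esub> p) = d \<oplus>\<^bsub>C2\<^esub> p" using dc pc dstar p(2) by simp
    fix \<sigma> \<sigma>2 assume sq: "square_state \<sigma> \<sigma>2"
    have "\<sigma>2 (d \<oplus>\<^bsub>C2\<^esub> p) = \<sigma>2 d + \<sigma>2 p" using sq dc pc unfolding square_state_def is_state_def by blast
    then show "Re (\<sigma>2 (d \<oplus>\<^bsub>C2\<^esub> p)) = \<beta> * (\<Sum>w\<in>insert w W. (cmod (\<sigma> (word_prod C x w) - mom w))\<^sup>2)"
      using insert.hyps by (simp add: dval[OF sq] p(3)[OF sq] ring_class.ring_distribs(1))
  qed
qed

text \<open>The integral of the weight of the penalty is at most \<open>\<gamma>(\<Gamma>\<^sub>o\<^sub>r\<^sub>b) + exp (- N\<^sup>2 \<beta> \<delta>\<^sup>2)\<close>.  This holds for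
  every tuple of matrices of norm at most \<open>R\<close>, so it bounds already the term \<open>m = 0\<close>, \<open>\<delta> = 1\<close> of the
  infimum that defines the pressure.\<close>

lemma inf_poly_le_rate: assumes \<delta>: "\<delta> > 0" and \<beta>: "\<beta> > 0"
  shows "inf_poly \<gamma> M \<tau> R n r X \<le> max (rate R m \<delta>) (ereal (- (\<beta> * \<delta>\<^sup>2)))"
proof -
  let ?W = "{w\<in>lists V. length w \<le> m}"
  obtain p where p: "p \<in> nc_polys2 R n r" "star C2 p = p"
    "\<And>\<sigma> \<sigma>2. square_state \<sigma> \<sigma>2 \<Longrightarrow> Re (\<sigma>2 p) = \<beta> * (\<Sum>w\<in>?W. (cmod (\<sigma> (word_prod C x w) - mom w))\<^sup>2)"
    using square_penalty[OF finite_words _ \<beta>, of m] by auto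
  have pc: "p \<in> carrier C2" using p(1) nc_polys2_dense(2)[OF R0] by blast
  define b where "b = \<beta> * \<delta>\<^sup>2"
  have p0: "Re (\<tau>2 p) = 0" using p(3)[OF square_state_\<tau>] by (simp add: \<tau>1_word)
  let ?S = "\<lambda>N. SUP A\<in>Mats N R. log_ereal (measure (G N) (Gam A N m \<delta>))"
  let ?P = "\<lambda>N. pressure_fin \<gamma> R n r p \<sigma>s N 0 1"
  have fin: "?P N \<le> ereal (ln 2) + max (?S N) (ereal (- (real N ^ 2 * b)))" if N: "N > 0" for N
    unfolding pressure_fin_def
  proof (rule SUP_least)
    interpret prob_space "G N" by (rule prob_G[OF N])
    fix A assume "A \<in> {A. \<forall>i<n. A i \<in> Gamma_R R (r i) (\<sigma>s i) N 0 1}"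
    then have A: "A \<in> Mats N R" by (auto simp: Gamma_R_def)
    define a where "a = measure (G N) (Gam A N m \<delta>)"
    define e where "e = exp (- (real N ^ 2 * b))"
    have e: "e > 0" by (simp add: e_def)
    have a: "a \<ge> 0" by (simp add: a_def)
    have nonneg: "0 \<le> Re (tr2 N A U p)" if "U \<in> space (G N)" for U
      unfolding p(3)[OF square_state_tr[OF N A that]] using \<beta> by (intro mult_nonneg_nonneg sum_nonneg) auto
    have far: "b \<le> Re (tr2 N A U p)" if U: "U \<in> space (G N)" and nU: "U \<notin> Gam A N m \<delta>" for U
    proof -
      obtain w where w: "w \<in> ?W" "\<delta> \<le> cmod (trN N (mat_word N A U w) - mom w)"
        using U nU unfolding Gam_eq[OF N] by (auto simp: not_less)
      have "\<delta>\<^sup>2 \<le> (cmod (tr1 N A U (word_prod C x w) - mom w))\<^sup>2"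
        using w \<delta> tr1_word[OF N A U] by (intro power_mono) auto
      also have "\<dots> \<le> (\<Sum>w\<in>?W. (cmod (tr1 N A U (word_prod C x w) - mom w))\<^sup>2)"
        by (rule member_le_sum[OF w(1) _ finite_words]) auto
      finally show ?thesis
        unfolding p(3)[OF square_state_tr[OF N A U]] b_def using \<beta> by (intro mult_left_mono) auto
    qed
    have "(\<integral>U. weight p N A U \<partial>G N) \<le> (\<integral>U. indicator (Gam A N m \<delta>) U + e \<partial>G N)"
    proof (rule integral_mono[OF weight_integrable[OF N A pc]])
      show "integrable (G N) (\<lambda>U. indicator (Gam A N m \<delta>) U + e)"
      proof (rule Bochner_Integration.integrable_add[OF _ integrable_const])
        show "integrable (G N) (indicat_real (Gam A N m \<delta>))"
          using Gam_sets[OF N A] by (intro integrable_real_indicator) (auto simp: emeasure_eq_measure)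
      qed
      fix U assume U: "U \<in> space (G N)"
      show "weight p N A U \<le> indicator (Gam A N m \<delta>) U + e"
      proof (cases "U \<in> Gam A N m \<delta>")
        case True
        have "0 \<le> real N ^ 2 * Re (tr2 N A U p)" using nonneg[OF U] by simp
        then have "weight p N A U \<le> 1" by simp
        then have "weight p N A U \<le> 1 + e" using e by linarith
        then show ?thesis using True by simp
      next
        case False
        have "real N ^ 2 * b \<le> real N ^ 2 * Re (tr2 N A U p)" using far[OF U False] by (intro mult_left_mono) auto
        then show ?thesis using False by (simp add: e_def)
      qed
    qed
    also have "\<dots> = a + e" using Gam_sets[OF N A] by (simp add: a_def emeasure_eq_measure prob_space)
    \<comment> \<open>the factor \<open>2\<close> disappears at speed \<open>N\<^sup>2\<close>\<close>
    also have "\<dots> \<le> 2 * max a e" by simp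
    finally have le: "(\<integral>U. weight p N A U \<partial>G N) \<le> 2 * max a e" .
    have "log_ereal (\<integral>U. weight p N A U \<partial>G N) \<le> log_ereal (2 * max a e)"
      by (rule log_ereal_mono[OF _ le]) (rule Bochner_Integration.integral_nonneg, simp)
    also have "\<dots> = ereal (ln 2) + log_ereal (max a e)"
      using e by (simp add: log_ereal_def ln_mult max_def)
    also have "log_ereal (max a e) \<le> max (log_ereal a) (ereal (- (real N ^ 2 * b)))"
    proof (cases "a \<le> e")
      case True then show ?thesis using e by (simp add: log_ereal_def max_def e_def)
    next
      case False then show ?thesis by (simp add: max_def)
    qed
    also have "\<dots> \<le> max (?S N) (ereal (- (real N ^ 2 * b)))"
      unfolding a_def by (intro max.mono SUP_upper A order_refl)
    finally show "log_ereal (\<integral>U. weight p N A U \<partial>G N) \<le> ereal (ln 2) + max (?S N) (ereal (- (real N ^ 2 * b)))"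
      by (simp add: add_left_mono)
  qed
  let ?s = "\<lambda>N. ereal (1 / real N ^ 2) * ?S N"
  have "prate p 0 1 \<le> limsup (\<lambda>N. ereal (ln 2 / real N ^ 2) + max (?s N) (ereal (- b)))"
    unfolding prate_def
  proof (rule Limsup_mono, rule eventually_mono[OF eventually_gt_at_top[of 0]])
    fix N :: nat assume N: "0 < N"
    let ?B = "ereal (- (real N ^ 2 * b))"
    have c: "ereal (1 / real N ^ 2) * ?B = ereal (- b)" using N by simp
    have "ereal (1 / real N ^ 2) * ?P N \<le> ereal (1 / real N ^ 2) * (ereal (ln 2) + max (?S N) ?B)"
      by (rule ereal_mult_left_mono[OF fin[OF N]]) simp
    also have "\<dots> = ereal (ln 2 / real N ^ 2) + ereal (1 / real N ^ 2) * max (?S N) ?B"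
      using distrib_left_ereal_nn[of "1 / real N ^ 2" "ereal (ln 2)" "max (?S N) ?B"] by (simp add: mult.commute)
    also have "ereal (1 / real N ^ 2) * max (?S N) ?B \<le> max (?s N) (ereal (- b))"
      using c by (cases "?S N \<le> ?B") (auto simp: max_def)
    finally show "ereal (1 / real N ^ 2) * ?P N \<le> ereal (ln 2 / real N ^ 2) + max (?s N) (ereal (- b))"
      by (simp add: add_left_mono)
  qed
  also have "\<dots> \<le> limsup (\<lambda>N. ereal (ln 2 / real N ^ 2)) + limsup (\<lambda>N. max (?s N) (ereal (- b)))"
    by (rule ereal_limsup_add_mono)
  also have "limsup (\<lambda>N. ereal (ln 2 / real N ^ 2)) = ereal 0"
  proof (rule lim_imp_Limsup)
    have "(\<lambda>N. ln 2 * (inverse (real N) * inverse (real N))) \<longlonglongrightarrow> ln 2 * (0 * 0)"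
      by (intro tendsto_mult tendsto_const lim_inverse_n)
    then have "(\<lambda>N. ln 2 / real N ^ 2) \<longlonglongrightarrow> 0" by (simp add: power2_eq_square field_simps)
    then show "(\<lambda>N. ereal (ln 2 / real N ^ 2)) \<longlonglongrightarrow> ereal 0" by (rule tendsto_ereal)
  qed simp
  also have "limsup (\<lambda>N. max (?s N) (ereal (- b))) \<le> max (rate R m \<delta>) (ereal (- b))"
    unfolding Limsup_le_iff
  proof (intro allI impI)
    fix y assume y: "max (rate R m \<delta>) (ereal (- b)) < y"
    then have "limsup ?s < y" by (simp add: rate_def)
    from Limsup_lessD[OF this] show "\<forall>\<^sub>F N in sequentially. max (?s N) (ereal (- b)) < y"
      by (rule eventually_mono) (use y in simp)
  qed
  finally have "prate p 0 1 \<le> max (rate R m \<delta>) (ereal (- b))" by (simp add: zero_ereal_def[symmetric] add_left_mono)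
  moreover have "pressure \<gamma> R n r p \<sigma>s \<le> prate p 0 1"
    unfolding pressure_eq by (rule INF_lower2[of "(0, 1)"]) auto
  moreover have "inf_poly \<gamma> M \<tau> R n r X \<le> shifted_pressure \<gamma> M \<tau> R n r X p"
    unfolding inf_poly_def using p by (intro INF_lower) auto
  ultimately show ?thesis
    unfolding shifted_pressure_def p0 b_def by (simp add: zero_ereal_def[symmetric])
qed

theorem chi_orb_eq_inf:
  "inf_all \<gamma> M \<tau> R n r X = chi_orb \<gamma> R M \<tau> n r X" "inf_poly \<gamma> M \<tau> R n r X = chi_orb \<gamma> R M \<tau> n r X"
proof -
  let ?\<chi> = "chi_orb \<gamma> R M \<tau> n r X" and ?p = "inf_poly \<gamma> M \<tau> R n r X"
  have 1: "?\<chi> \<le> inf_all \<gamma> M \<tau> R n r X"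
    unfolding inf_all_def by (rule INF_greatest) (auto intro: chi_orb_le_pressure)
  have 2: "inf_all \<gamma> M \<tau> R n r X \<le> ?p"
    unfolding inf_all_def inf_poly_def
    by (rule INF_superset_mono) (use nc_polys2_dense(2)[OF R0, of n r] in auto)
  have "?p \<le> rate R m \<delta>" if \<delta>: "\<delta> > 0" for m \<delta>
  proof (rule ccontr)
    assume n: "\<not> ?p \<le> rate R m \<delta>"
    then have small: "?p \<le> ereal (- (\<beta> * \<delta>\<^sup>2))" if "\<beta> > 0" for \<beta>
      using inf_poly_le_rate[OF \<delta> that, of m] by (auto simp: max_def split: if_splits)
    show False
    proof (cases ?p)
      case (real q)
      have "(\<bar>q\<bar> + 1) / \<delta>\<^sup>2 > 0" using \<delta> by simp
      from small[OF this] show False using \<delta> by (simp add: real)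
    next
      case PInf then show False using small[of 1] by simp
    next
      case MInf then show False using n by simp
    qed
  qed
  then have 3: "?p \<le> ?\<chi>" unfolding chi_orb_eq by (auto intro!: INF_greatest)
  show "inf_all \<gamma> M \<tau> R n r X = ?\<chi>" using 1 2 3 by (meson order_antisym order_trans)
  show "?p = ?\<chi>" using 1 2 3 by (meson order_antisym order_trans)
qed

end

theorem proposition6p1:
  fixes M :: "('h::chilbert_space \<Rightarrow> 'h) set"
    and \<tau> :: "('h \<Rightarrow> 'h) \<Rightarrow> complex"
    and n :: nat and r :: "nat \<Rightarrow> nat"
    and X :: "nat \<Rightarrow> nat \<Rightarrow> 'h \<Rightarrow> 'h"
    and R :: real
    and \<gamma> :: "nat \<Rightarrow> complex mat measure"
  assumes "tracial_Wstar_prob_space M \<tau>"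
    and "\<And>N. N > 0 \<Longrightarrow> is_haar_prob N (\<gamma> N)"
    and "R > 0"
    and "\<And>i j. i < n \<Longrightarrow> j < r i \<Longrightarrow> X i j \<in> M \<and> op_sa (X i j) \<and> onorm (X i j) \<le> R"
  shows "(\<forall>S. (\<forall>i<n. \<forall>j<r i. onorm (X i j) \<le> S) \<longrightarrow>
            chi_orb \<gamma> S M \<tau> n r X = inf_all \<gamma> M \<tau> R n r X \<and>
            chi_orb \<gamma> S M \<tau> n r X = inf_poly \<gamma> M \<tau> R n r X) \<and>
         (\<forall>R'>0. (\<forall>i<n. \<forall>j<r i. onorm (X i j) \<le> R') \<longrightarrow>
            inf_all \<gamma> M \<tau> R' n r X = inf_all \<gamma> M \<tau> R n r X \<and>
            inf_poly \<gamma> M \<tau> R' n r X = inf_poly \<gamma> M \<tau> R n r X)"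
proof -
  have "vn_algebra M" "is_state (op_alg M) \<tau>"
    using assms(1) by (simp_all add: vn_algebra_def tracial_Wstar_prob_space_def)
  then interpret orbital M \<tau> n r X \<gamma>
    by (intro orbital.intro orbital_axioms.intro assms(2)) (use assms(4) in auto)
  have cut_off: "orbital_cut_off M \<tau> n r X \<gamma> S" if "0 < S" "\<forall>i<n. \<forall>j<r i. onorm (X i j) \<le> S" for S
    using that by (intro orbital_cut_off.intro orbital_axioms orbital_cut_off_axioms.intro) auto
  have XR: "\<forall>i<n. \<forall>j<r i. onorm (X i j) \<le> R" using assms(4) by blast
  have same: "chi_orb \<gamma> S M \<tau> n r X = chi_orb \<gamma> R M \<tau> n r X" if "\<forall>i<n. \<forall>j<r i. onorm (X i j) \<le> S" for S
    using that XR by (intro order_antisym chi_orb_cut_off_le) auto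
  note eqR = orbital_cut_off.chi_orb_eq_inf[OF cut_off[OF assms(3) XR]]
  show ?thesis
  proof (intro conjI allI impI)
    fix R' :: real assume R': "R' > 0" "\<forall>i<n. \<forall>j<r i. onorm (X i j) \<le> R'"
    note eqR' = orbital_cut_off.chi_orb_eq_inf[OF cut_off[OF R']]
    show "inf_all \<gamma> M \<tau> R' n r X = inf_all \<gamma> M \<tau> R n r X"
      "inf_poly \<gamma> M \<tau> R' n r X = inf_poly \<gamma> M \<tau> R n r X"
      using eqR eqR' same[OF R'(2)] by simp_all
  qed (simp_all only: eqR same)
qed

end
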